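(* Let $\mathcal{M}$ be a finite-dimensional von Neumann algebra and $\sigma\in\mathcal{D}_+(\mathcal{M})$ a full-rank state. For any given $\sigma$-GNS detailed balanced quantum Markov semigroup $\exp(t\mathcal{L}_O)$ on $\mathcal{M}$, there exist second-order lifts of $\exp(t\mathcal{L}_O)$ in the sense defined in the context.
   Context: A finite-dimensional von Neumann algebra is a von Neumann subalgebra of $\mathcal{B}(\mathfrak{H})$, $\dim\mathfrak{H}<\infty$; $\mathcal{D}_+$ denotes its full-rank density operators. A quantum Markov semigroup (QMS) is a semigroup $\exp(t\mathcal{L})$ of completely positive unital maps. For a full-rank state $\rho$, the GNS inner product is $\langle X,Y\rangle_{\rho,1}=\mathrm{tr}(\rho X^*Y)$ and the KMS inner product is $\langle X,Y\rangle_{\rho,1/2}=\mathrm{tr}(\rho^{1/2}X^*\rho^{1/2}Y)$; a QMS is $\rho$-GNS (resp. $\rho$-KMS) detailed balanced if its generator is self-adjoint for $\langle\cdot,\cdot\rangle_{\rho,1}$ (resp. $\langle\cdot,\cdot\rangle_{\rho,1/2}$). $\Phi^\star$ is the adjoint for the KMS inner product. $\mathcal{F}(\mathcal{L})=\ker\mathcal{L}$. Second-order lift. Let $\hat{\mathcal{M}}$ be a finite-dimensional von Neumann algebra and $\mathcal{L}_\gamma=\mathcal{L}_A+\gamma\mathcal{L}_S$, $\gamma>0$, a family of QMS generators on $\hat{\mathcal{M}}$, with $\mathcal{L}_A,\mathcal{L}_S$ independent of $\gamma$. Let $\hat\sigma\in\mathcal{D}_+(\hat{\mathcal{M}})$ be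 the state of (A), $E_S$ the conditional expectation with respect to $\hat\sigma$ (the $\hat\sigma$-KMS-orthogonal projection) from $\hat{\mathcal{M}}$ onto $\mathcal{F}(\mathcal{L}_S)$, and define on $\mathcal{F}(\mathcal{L}_S)$ the operator $\mathcal{L}_{\rm col}:=-(\mathcal{L}_AE_S)^\star(-\mathcal{L}_S)^{-1}\mathcal{L}_AE_S$ (pseudoinverse of $-\mathcal{L}_S$). $\exp(t\mathcal{L}_\gamma)$ is a second-order lift of $\exp(t\mathcal{L}_{\rm col})$ if: (A) for some $\hat\sigma\in\mathcal{D}_+(\hat{\mathcal{M}})$, $\mathcal{L}_S=\mathcal{L}_S^\star$ and $\mathcal{L}_A=-\mathcal{L}_A^\star$ for the $\hat\sigma$-KMS inner product; (B) $\dim\mathcal{F}(\mathcal{L}_S)>\dim\mathcal{F}(\mathcal{L}_\gamma)$; (C) $E_S\mathcal{L}_AE_S=0$; (D) $\mathcal{L}_{\rm col}$ generates a QMS on the von Neumann algebra $\mathcal{F}(\mathcal{L}_S)$ that is $\sigma_o$-KMS detailed balanced for some full-rank invariant state $\sigma_o\in\mathcal{D}_+(\mathcal{F}(\mathcal{L}_S))$, with $\langle X,\mathcal{L}_{\rm col}Y\rangle_{\hat\sigma,1/2}=\langle X,\mathcal{L}_{\rm col}Y\rangle_{\sigma_o,1/2}$ for all $X,Y\in\mathcal{F}(\mathcal{L}_S)$. It is a second-order lift of the given $\exp(t\mathcal{L}_O)$ on $\mathcal{M}$ if moreover, under a $*$-isomorphism $\mathcal{F}(\mathcal{L}_S)\cong\mathcal{M}$,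 one has $\mathcal{L}_{\rm col}=\mathcal{L}_O$.
   Formalization: The given semigroup is assumed nontrivial (L_O is not identically zero on M); for L_O = 0 no second-order lift exists, since conditions (A) and (C) then force F(L_S) to lie in F(L_γ), contradicting (B). *)

theory Defs
  imports
    "Jordan_Normal_Form.Schur_Decomposition"
    "Jordan_Normal_Form.DL_Rank"
begin

text \<open>
  The Hilbert space is \<open>\<complex>\<^sup>n\<close>, and \<open>\<B>(\<complex>\<^sup>n)\<close> is \<open>carrier_mat n n\<close>. The dimension is a number rather
  than a type because the lift lives on a space whose dimension is existentially quantified.
  Superoperators on an algebra \<open>M\<close> are functions on matrices of which only the values on \<open>M\<close>
  matter.
\<close>

subsection \<open>Matrices\<close>

definition mtrace :: "complex mat \<Rightarrow> complex" where
  "mtrace A = (\<Sum>i<dim_row A. A $$ (i, i))"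

text \<open>
  The order on \<open>complex\<close> is the one with \<open>0 \<le> z\<close> iff \<open>z\<close> is real and nonnegative, so
  hermiticity is implied.
\<close>

definition psd :: "nat \<Rightarrow> complex mat \<Rightarrow> bool" where
  "psd n A \<longleftrightarrow> A \<in> carrier_mat n n \<and> (\<forall>v \<in> carrier_vec n. 0 \<le> (A *\<^sub>v v) \<bullet>c v)"

definition msqrt :: "nat \<Rightarrow> complex mat \<Rightarrow> complex mat" where
  "msqrt n A = (THE B. psd n B \<and> B * B = A)"

subsection \<open>Finite-dimensional von Neumann algebras and states\<close>

text \<open>Closedness in the weak operator topology is automatic for subspaces of \<open>\<B>(\<complex>\<^sup>n)\<close>.\<close>

definition von_neumann_algebra :: "nat \<Rightarrow> complex mat set \<Rightarrow> bool" where
  "von_neumann_algebra n M \<longleftrightarrow>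
     M \<subseteq> carrier_mat n n \<and> 1\<^sub>m n \<in> M \<and>
     (\<forall>X\<in>M. \<forall>Y\<in>M. X + Y \<in> M) \<and>
     (\<forall>c. \<forall>X\<in>M. c \<cdot>\<^sub>m X \<in> M) \<and>
     (\<forall>X\<in>M. \<forall>Y\<in>M. X * Y \<in> M) \<and>
     (\<forall>X\<in>M. mat_adjoint X \<in> M)"

definition full_rank_states :: "nat \<Rightarrow> complex mat set \<Rightarrow> complex mat set" where
  "full_rank_states n M = {\<rho> \<in> M. psd n \<rho> \<and> mtrace \<rho> = 1 \<and> vec_space.rank n \<rho> = n}"

definition star_isomorphism ::
  "nat \<Rightarrow> complex mat set \<Rightarrow> nat \<Rightarrow> complex mat set \<Rightarrow> (complex mat \<Rightarrow> complex mat) \<Rightarrow> bool" where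
  "star_isomorphism m N n M \<iota> \<longleftrightarrow>
     bij_betw \<iota> N M \<and> \<iota> (1\<^sub>m m) = 1\<^sub>m n \<and>
     (\<forall>X\<in>N. \<forall>Y\<in>N. \<iota> (X + Y) = \<iota> X + \<iota> Y) \<and>
     (\<forall>c. \<forall>X\<in>N. \<iota> (c \<cdot>\<^sub>m X) = c \<cdot>\<^sub>m \<iota> X) \<and>
     (\<forall>X\<in>N. \<forall>Y\<in>N. \<iota> (X * Y) = \<iota> X * \<iota> Y) \<and>
     (\<forall>X\<in>N. \<iota> (mat_adjoint X) = mat_adjoint (\<iota> X))"

subsection \<open>Quantum Markov semigroups\<close>

definition linear_on :: "complex mat set \<Rightarrow> (complex mat \<Rightarrow> complex mat) \<Rightarrow> bool" where
  "linear_on M L \<longleftrightarrow>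
     (\<forall>X\<in>M. L X \<in> M) \<and>
     (\<forall>X\<in>M. \<forall>Y\<in>M. L (X + Y) = L X + L Y) \<and>
     (\<forall>c. \<forall>X\<in>M. L (c \<cdot>\<^sub>m X) = c \<cdot>\<^sub>m L X)"

text \<open>
  \<open>exp (t L)\<close> as an entrywise power series. For \<open>L\<close> linear on a subspace \<open>M\<close> it converges on \<open>M\<close>,
  and maps \<open>M\<close> linearly into itself.
\<close>

definition semigroup_exp ::
  "nat \<Rightarrow> (complex mat \<Rightarrow> complex mat) \<Rightarrow> real \<Rightarrow> complex mat \<Rightarrow> complex mat" where
  "semigroup_exp n L t X =
     mat n n (\<lambda>ij. \<Sum>k. (of_real t ^ k / fact k) * (((L ^^ k) X) $$ ij))"

text \<open>
  An element of \<open>M\<^sub>k(M)\<close> is a \<open>k * n\<close> by \<open>k * n\<close> matrix all of whose \<open>n\<close> by \<open>n\<close> blocks lie in \<open>M\<close>;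
  the amplification \<open>id\<^sub>k \<otimes> \<Phi>\<close> applies \<open>\<Phi>\<close> to every block.
\<close>

definition block :: "nat \<Rightarrow> complex mat \<Rightarrow> nat \<Rightarrow> nat \<Rightarrow> complex mat" where
  "block n X i j = mat n n (\<lambda>(a, b). X $$ (i * n + a, j * n + b))"

definition block_matrices :: "nat \<Rightarrow> nat \<Rightarrow> complex mat set \<Rightarrow> complex mat set" where
  "block_matrices k n M =
     {X \<in> carrier_mat (k * n) (k * n). \<forall>i<k. \<forall>j<k. block n X i j \<in> M}"

definition amplification ::
  "nat \<Rightarrow> nat \<Rightarrow> (complex mat \<Rightarrow> complex mat) \<Rightarrow> complex mat \<Rightarrow> complex mat" where
  "amplification k n \<Phi> X =
     mat (k * n) (k * n) (\<lambda>(p, q). \<Phi> (block n X (p div n) (q div n)) $$ (p mod n, q mod n))"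

definition completely_positive ::
  "nat \<Rightarrow> complex mat set \<Rightarrow> (complex mat \<Rightarrow> complex mat) \<Rightarrow> bool" where
  "completely_positive n M \<Phi> \<longleftrightarrow>
     (\<forall>k. \<forall>X \<in> block_matrices k n M. psd (k * n) X \<longrightarrow> psd (k * n) (amplification k n \<Phi> X))"

definition qms_generator ::
  "nat \<Rightarrow> complex mat set \<Rightarrow> (complex mat \<Rightarrow> complex mat) \<Rightarrow> bool" where
  "qms_generator n M L \<longleftrightarrow>
     linear_on M L \<and>
     (\<forall>t\<ge>0. completely_positive n M (semigroup_exp n L t) \<and>
             semigroup_exp n L t (1\<^sub>m n) = 1\<^sub>m n)"

definition fixed_space :: "nat \<Rightarrow> complex mat set \<Rightarrow> (complex mat \<Rightarrow> complex mat) \<Rightarrow> complex mat set"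
  where "fixed_space n M L = {X \<in> M. L X = 0\<^sub>m n n}"

definition mat_dim :: "nat \<Rightarrow> complex mat set \<Rightarrow> nat" where
  "mat_dim n V =
     vectorspace.dim (class_ring :: complex ring) ((module_mat TYPE(complex) n n)\<lparr>carrier := V\<rparr>)"

subsection \<open>Detailed balance\<close>

definition gns_inner :: "complex mat \<Rightarrow> complex mat \<Rightarrow> complex mat \<Rightarrow> complex" where
  "gns_inner \<rho> X Y = mtrace (\<rho> * mat_adjoint X * Y)"

definition kms_inner :: "nat \<Rightarrow> complex mat \<Rightarrow> complex mat \<Rightarrow> complex mat \<Rightarrow> complex" where
  "kms_inner n \<rho> X Y = mtrace (msqrt n \<rho> * mat_adjoint X * msqrt n \<rho> * Y)"

definition gns_detailed_balanced ::
  "complex mat set \<Rightarrow> complex mat \<Rightarrow> (complex mat \<Rightarrow> complex mat) \<Rightarrow> bool" where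
  "gns_detailed_balanced M \<rho> L \<longleftrightarrow>
     (\<forall>X\<in>M. \<forall>Y\<in>M. gns_inner \<rho> (L X) Y = gns_inner \<rho> X (L Y))"

definition kms_detailed_balanced ::
  "nat \<Rightarrow> complex mat set \<Rightarrow> complex mat \<Rightarrow> (complex mat \<Rightarrow> complex mat) \<Rightarrow> bool" where
  "kms_detailed_balanced n M \<rho> L \<longleftrightarrow>
     (\<forall>X\<in>M. \<forall>Y\<in>M. kms_inner n \<rho> (L X) Y = kms_inner n \<rho> X (L Y))"

subsection \<open>Operators on an algebra with the KMS inner product of a full-rank state\<close>

text \<open>
  Each description below has a unique solution when \<open>M\<close> is an algebra, \<open>\<rho>\<close> a full-rank state of
  \<open>M\<close>, \<open>V\<close> a subspace of \<open>M\<close>, and \<open>\<Phi>\<close>, \<open>T\<close> are linear on \<open>M\<close>.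
\<close>

definition kms_adjoint ::
  "nat \<Rightarrow> complex mat set \<Rightarrow> complex mat \<Rightarrow> (complex mat \<Rightarrow> complex mat) \<Rightarrow> complex mat \<Rightarrow> complex mat"
  where
  "kms_adjoint n M \<rho> \<Phi> Y =
     (THE W. W \<in> M \<and> (\<forall>X\<in>M. kms_inner n \<rho> (\<Phi> X) Y = kms_inner n \<rho> X W))"

definition kms_projection ::
  "nat \<Rightarrow> complex mat \<Rightarrow> complex mat set \<Rightarrow> complex mat \<Rightarrow> complex mat" where
  "kms_projection n \<rho> V X =
     (THE Y. Y \<in> V \<and> (\<forall>Z\<in>V. kms_inner n \<rho> Z (X - Y) = 0))"

text \<open>
  Moore-Penrose pseudoinverse: \<open>Y\<close> is orthogonal to the kernel of \<open>T\<close>, and \<open>T Y\<close> is the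
  orthogonal projection of \<open>X\<close> onto the range of \<open>T\<close>.
\<close>

definition kms_pseudoinverse ::
  "nat \<Rightarrow> complex mat set \<Rightarrow> complex mat \<Rightarrow> (complex mat \<Rightarrow> complex mat) \<Rightarrow> complex mat \<Rightarrow> complex mat"
  where
  "kms_pseudoinverse n M \<rho> T X =
     (THE Y. Y \<in> M \<and> (\<forall>Z \<in> fixed_space n M T. kms_inner n \<rho> Z Y = 0) \<and>
             (\<forall>Z\<in>M. kms_inner n \<rho> (T Z) (X - T Y) = 0))"

subsection \<open>Second-order lifts\<close>

definition lift_generator ::
  "(complex mat \<Rightarrow> complex mat) \<Rightarrow> (complex mat \<Rightarrow> complex mat) \<Rightarrow> real \<Rightarrow> complex mat \<Rightarrow> complex mat"
  where
  "lift_generator LA LS \<gamma> X = LA X + of_real \<gamma> \<cdot>\<^sub>m LS X"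

definition cond_exp ::
  "nat \<Rightarrow> complex mat set \<Rightarrow> complex mat \<Rightarrow> (complex mat \<Rightarrow> complex mat) \<Rightarrow> complex mat \<Rightarrow> complex mat"
  where
  "cond_exp n M \<rho> LS = kms_projection n \<rho> (fixed_space n M LS)"

definition L_col ::
  "nat \<Rightarrow> complex mat set \<Rightarrow> complex mat \<Rightarrow> (complex mat \<Rightarrow> complex mat) \<Rightarrow>
   (complex mat \<Rightarrow> complex mat) \<Rightarrow> complex mat \<Rightarrow> complex mat"
  where
  "L_col n M \<rho> LA LS X =
     (let LE = LA \<circ> cond_exp n M \<rho> LS
      in - kms_adjoint n M \<rho> LE (kms_pseudoinverse n M \<rho> (\<lambda>Z. - LS Z) (LE X)))"

text \<open>
  The family \<open>LA + \<gamma> LS\<close> on \<open>M\<close> is a second-order lift of the semigroup generated by \<open>L_col\<close>, with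
  \<open>\<rho>\<close> the state for which \<open>LS\<close> is self-adjoint and \<open>LA\<close> anti-self-adjoint.
\<close>

definition second_order_lift_wrt ::
  "nat \<Rightarrow> complex mat set \<Rightarrow> complex mat \<Rightarrow> (complex mat \<Rightarrow> complex mat) \<Rightarrow>
   (complex mat \<Rightarrow> complex mat) \<Rightarrow> bool"
  where
  "second_order_lift_wrt n M \<rho> LA LS \<longleftrightarrow>
     von_neumann_algebra n M \<and> \<rho> \<in> full_rank_states n M \<and>
     linear_on M LA \<and> linear_on M LS \<and>
     (\<forall>\<gamma>>0. qms_generator n M (lift_generator LA LS \<gamma>)) \<and>
     (\<forall>X\<in>M. LS X = kms_adjoint n M \<rho> LS X) \<and>
     (\<forall>X\<in>M. LA X = - kms_adjoint n M \<rho> LA X) \<and>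
     (\<forall>\<gamma>>0. mat_dim n (fixed_space n M LS) >
              mat_dim n (fixed_space n M (lift_generator LA LS \<gamma>))) \<and>
     (\<forall>X\<in>M. cond_exp n M \<rho> LS (LA (cond_exp n M \<rho> LS X)) = 0\<^sub>m n n) \<and>
     (let F = fixed_space n M LS; Lc = L_col n M \<rho> LA LS in
        von_neumann_algebra n F \<and> qms_generator n F Lc \<and>
        (\<exists>\<rho>o \<in> full_rank_states n F.
           (\<forall>t\<ge>0. \<forall>X\<in>F. mtrace (\<rho>o * semigroup_exp n Lc t X) = mtrace (\<rho>o * X)) \<and>
           kms_detailed_balanced n F \<rho>o Lc \<and>
           (\<forall>X\<in>F. \<forall>Y\<in>F. kms_inner n \<rho> X (Lc Y) = kms_inner n \<rho>o X (Lc Y))))"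

definition second_order_lift_of ::
  "nat \<Rightarrow> complex mat set \<Rightarrow> (complex mat \<Rightarrow> complex mat) \<Rightarrow> (complex mat \<Rightarrow> complex mat) \<Rightarrow>
   nat \<Rightarrow> complex mat set \<Rightarrow> (complex mat \<Rightarrow> complex mat) \<Rightarrow> bool"
  where
  "second_order_lift_of m Mh LA LS n M LO \<longleftrightarrow>
     (\<exists>\<rho>. second_order_lift_wrt m Mh \<rho> LA LS \<and>
          (\<exists>\<iota>. star_isomorphism m (fixed_space m Mh LS) n M \<iota> \<and>
               (\<forall>X \<in> fixed_space m Mh LS. \<iota> (L_col m Mh \<rho> LA LS X) = LO (\<iota> X))))"

end

theory Submission
  imports Defs "HOL-Computational_Algebra.Fundamental_Theorem_Algebra"
begin

text \<open>
  Write \<open>\<sigma>\<close> for the state and \<open>L\<close> for the generator. The lift is a Hamiltonian coupling of \<open>\<complex>\<^sup>n\<close> to a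
  finite number of further copies of \<open>\<complex>\<^sup>n\<close>, together with a relaxation onto \<open>M\<close>; it exists because
  GNS symmetry forces \<open>L\<close> into a form without Hamiltonian part and with Kraus operators that are
  eigenvectors of the modular automorphism \<open>X \<mapsto> \<sigma> X \<sigma>\<inverse>\<close>.

  \<^bold>\<open>The form of the generator.\<close> Differentiating complete positivity of \<open>exp (t L)\<close> at \<open>t = 0\<close> shows
  that \<open>\<Sum> \<xi>\<^sub>i\<^sup>\<dagger> L(V\<^sub>i\<^sup>\<dagger> V\<^sub>j) \<xi>\<^sub>j \<ge> 0\<close> whenever \<open>\<Sum> V\<^sub>i \<xi>\<^sub>i = 0\<close>. Using the Casimir element of \<open>M\<close>, which is
  central and invertible, every tuple can be completed to one satisfying the constraint; this gives
  \<open>L X = \<Psi>(X) + k X + X k\<^sup>\<dagger> - R X\<close> with \<open>\<Psi>\<close> completely positive, \<open>R\<close> central, and \<open>k\<close> given by a canonical formula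
  (\<open>Psi_cp\<close>). GNS symmetry makes \<open>L\<close> commute with the modular automorphism, and the canonical choice
  passes this on to \<open>\<Psi>\<close> and \<open>k\<close> (\<open>Psi_modular\<close>). Hence \<open>\<Psi>(X) = \<Sum> V\<^sub>q\<^sup>\<dagger> X V\<^sub>q\<close> with \<open>\<sigma> V\<^sub>q = r\<^sub>q V\<^sub>q \<sigma>\<close> (\<open>kraus\<close>).
  Averaging this expression for \<open>L\<close> with the one obtained from its GNS adjoint, and using \<open>L 1 = 0\<close>,
  one arrives at
    \<open>2 L X = \<Phi>(X) - 1/2 (\<Phi>(1) X + X \<Phi>(1))\<close> with
    \<open>\<Phi>(X) = P (\<Sum> V\<^sub>q\<^sup>\<dagger> X V\<^sub>q + r\<^sub>q\<inverse> V\<^sub>q X V\<^sub>q\<^sup>\<dagger>)\<close>,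
  where \<open>P\<close> is the trace-preserving conditional expectation onto \<open>M\<close> (\<open>symmetric_form\<close>).

  \<^bold>\<open>The lift.\<close> For \<open>N\<close> Kraus operators, let the matrices on \<open>\<complex>\<^bsup>N+1\<^esup> \<otimes> \<complex>\<^sup>n\<close> carry the state
  \<open>diag (t\<^sub>0, \<dots>, t\<^sub>N) \<otimes> \<sigma>\<close> with \<open>t\<^sub>q\<^sub>+\<^sub>1 = r\<^sub>q t\<^sub>0\<close>, and let \<open>H\<close> be the hermitian matrix whose only nonzero blocks
  are multiples of \<open>V\<^sub>q\<close> and \<open>V\<^sub>q\<^sup>\<dagger>\<close>, between the blocks \<open>0\<close> and \<open>q + 1\<close>. The weights are such that \<open>H\<close> commutes with
  the state. Let \<open>E\<close> be the conditional expectation onto \<open>1 \<otimes> M\<close> that averages the diagonal blocks with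
  weights \<open>t\<^sub>q\<close> and applies \<open>P\<close>. The lift is \<open>L\<^sub>A Z = \<i> [H, Z]\<close> and \<open>L\<^sub>S = E - id\<close>.

  The kernel of \<open>L\<^sub>S\<close> is \<open>1 \<otimes> M\<close>, a copy of \<open>M\<close>. As \<open>H\<close> commutes with the state, \<open>L\<^sub>A\<close> is antisymmetric, and as
  its diagonal blocks vanish, \<open>E L\<^sub>A E = 0\<close>. Since \<open>- L\<^sub>S\<close> is a projection, its pseudoinverse acts trivially on
  the range of \<open>L\<^sub>A E\<close>, so that the collapsed generator is
    \<open>E L\<^sub>A\<^sup>2 E = E (2 H X H - H\<^sup>2 X - X H\<^sup>2)\<close> for \<open>X \<in> 1 \<otimes> M\<close>.
  With the right size of the blocks of \<open>H\<close> this is \<open>L\<close> (\<open>red_LA_LA_emb\<close>). The lifted semigroups are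
  completely positive because, up to multiples of \<open>Z\<close> and a small term \<open>\<epsilon> H Z H\<close>, their generators are
  sums of \<open>\<gamma> E Z\<close> and a positive multiple of \<open>(1 + \<i> \<epsilon> H) Z (1 + \<i> \<epsilon> H)\<^sup>\<dagger>\<close> (\<open>lift_cp\<close>). Finally, whatever \<open>L\<^sub>A + \<gamma> L\<^sub>S\<close> annihilates is
  annihilated by both parts; since \<open>L\<close> is not zero, \<open>L\<^sub>A\<close> does not vanish on the kernel of \<open>L\<^sub>S\<close>, and
  the kernel drops in dimension (\<open>dimension_drop\<close>).
\<close>

section \<open>Finitely supported matrices\<close>

text \<open>
  Square matrices of all sizes share one type: the finitely supported matrices over
  \<open>\<nat> \<times> \<nat>\<close>. They form a ring, without a unit, and the \<open>n\<close> by \<open>n\<close> matrices are the corner of this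
  ring cut out by the projection \<open>idm n\<close>. Matrices, vectors (as single columns) and the block
  embeddings between spaces of different dimension can then be multiplied without carrying sizes
  along.
\<close>

typedef fmat = "{A :: nat \<Rightarrow> nat \<Rightarrow> complex. \<exists>n. \<forall>i j. n \<le> i \<or> n \<le> j \<longrightarrow> A i j = 0}"
  morphisms entry Abs_fmat
  by (rule exI[of _ "\<lambda>_ _. 0"]) auto

setup_lifting type_definition_fmat

lemma fmat_eqI: "(\<And>i j. entry A i j = entry B i j) \<Longrightarrow> A = B"
  by (metis entry_inject ext)

definition corner :: "nat \<Rightarrow> fmat set" where
  "corner n = {A. \<forall>i j. n \<le> i \<or> n \<le> j \<longrightarrow> entry A i j = 0}"

lemma corner_entry: "A \<in> corner n \<Longrightarrow> n \<le> i \<or> n \<le> j \<Longrightarrow> entry A i j = 0"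
  by (auto simp: corner_def)

lemma cornerI: "(\<And>i j. n \<le> i \<or> n \<le> j \<Longrightarrow> entry A i j = 0) \<Longrightarrow> A \<in> corner n"
  by (auto simp: corner_def)

lemma corner_mono: "A \<in> corner m \<Longrightarrow> m \<le> n \<Longrightarrow> A \<in> corner n"
  by (auto simp: corner_def)

lemma ex_corner: "\<exists>n. A \<in> corner n"
  using entry[of A] by (auto simp: corner_def)

lemma ex_corner2: obtains n where "A \<in> corner n" "B \<in> corner n"
  by (metis corner_mono ex_corner max.cobounded1 max.cobounded2)

lemma ex_corner3: obtains n where "A \<in> corner n" "B \<in> corner n" "C \<in> corner n"
  by (metis corner_mono ex_corner ex_corner2 max.cobounded1 max.cobounded2)

instantiation fmat :: ab_group_add
begin
lift_definition zero_fmat :: fmat is "\<lambda>_ _. 0" by auto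
lift_definition plus_fmat :: "fmat \<Rightarrow> fmat \<Rightarrow> fmat" is "\<lambda>A B i j. A i j + B i j"
proof -
  fix A B :: "nat \<Rightarrow> nat \<Rightarrow> complex"
  assume "\<exists>n. \<forall>i j. n \<le> i \<or> n \<le> j \<longrightarrow> A i j = 0" "\<exists>n. \<forall>i j. n \<le> i \<or> n \<le> j \<longrightarrow> B i j = 0"
  then obtain n m where "\<forall>i j. n \<le> i \<or> n \<le> j \<longrightarrow> A i j = 0" "\<forall>i j. m \<le> i \<or> m \<le> j \<longrightarrow> B i j = 0"
    by auto
  then show "\<exists>n. \<forall>i j. n \<le> i \<or> n \<le> j \<longrightarrow> A i j + B i j = 0"
    by (intro exI[of _ "n + m"]) auto
qed
lift_definition minus_fmat :: "fmat \<Rightarrow> fmat \<Rightarrow> fmat" is "\<lambda>A B i j. A i j - B i j"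
proof -
  fix A B :: "nat \<Rightarrow> nat \<Rightarrow> complex"
  assume "\<exists>n. \<forall>i j. n \<le> i \<or> n \<le> j \<longrightarrow> A i j = 0" "\<exists>n. \<forall>i j. n \<le> i \<or> n \<le> j \<longrightarrow> B i j = 0"
  then obtain n m where "\<forall>i j. n \<le> i \<or> n \<le> j \<longrightarrow> A i j = 0" "\<forall>i j. m \<le> i \<or> m \<le> j \<longrightarrow> B i j = 0"
    by auto
  then show "\<exists>n. \<forall>i j. n \<le> i \<or> n \<le> j \<longrightarrow> A i j - B i j = 0"
    by (intro exI[of _ "n + m"]) auto
qed
lift_definition uminus_fmat :: "fmat \<Rightarrow> fmat" is "\<lambda>A i j. - A i j" by auto
instance by standard (transfer; auto simp: fun_eq_iff)+
end

lift_definition cscale :: "complex \<Rightarrow> fmat \<Rightarrow> fmat" (infixr "*\<^sub>C" 75) is "\<lambda>c A i j. c * A i j"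
  by (metis mult_zero_right)
lift_definition adj :: "fmat \<Rightarrow> fmat" ("_\<^sup>\<dagger>" [1000] 1000) is "\<lambda>A i j. cnj (A j i)"
  by (metis complex_cnj_zero)
lift_definition idm :: "nat \<Rightarrow> fmat" is "\<lambda>n i j. if i = j \<and> i < n then 1 else 0"
  by (metis linorder_not_less)
lift_definition munit :: "nat \<Rightarrow> nat \<Rightarrow> fmat" is "\<lambda>a b i j. if i = a \<and> j = b then 1 else 0"
proof -
  fix a b :: nat
  show "\<exists>n. \<forall>i j. n \<le> i \<or> n \<le> j \<longrightarrow> (if i = a \<and> j = b then 1 else 0) = (0::complex)"
    by (intro exI[of _ "Suc (a + b)"]) auto
qed

lemma entry_simps [simp]:
  "entry 0 i j = 0" "entry (A + B) i j = entry A i j + entry B i j"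
  "entry (A - B) i j = entry A i j - entry B i j" "entry (- A) i j = - entry A i j"
  "entry (c *\<^sub>C A) i j = c * entry A i j" "entry (A\<^sup>\<dagger>) i j = cnj (entry A j i)"
  by (transfer, simp)+

lemma entry_idm: "entry (idm n) i j = (if i = j \<and> i < n then 1 else 0)"
  by transfer simp
lemma entry_munit: "entry (munit a b) i j = (if i = a \<and> j = b then 1 else 0)"
  by transfer simp

lemma entry_sum [simp]: "entry (sum f S) i j = (\<Sum>x\<in>S. entry (f x) i j)"
  by (induction S rule: infinite_finite_induct) auto

instantiation fmat :: ring
begin
lift_definition times_fmat :: "fmat \<Rightarrow> fmat \<Rightarrow> fmat" is "\<lambda>A B i j. \<Sum>k | A i k \<noteq> 0. A i k * B k j"
proof -
  fix A B :: "nat \<Rightarrow> nat \<Rightarrow> complex"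
  assume "\<exists>n. \<forall>i j. n \<le> i \<or> n \<le> j \<longrightarrow> A i j = 0" "\<exists>n. \<forall>i j. n \<le> i \<or> n \<le> j \<longrightarrow> B i j = 0"
  then obtain n m where "\<forall>i j. n \<le> i \<or> n \<le> j \<longrightarrow> A i j = 0" "\<forall>i j. m \<le> i \<or> m \<le> j \<longrightarrow> B i j = 0"
    by auto
  then show "\<exists>n. \<forall>i j. n \<le> i \<or> n \<le> j \<longrightarrow> (\<Sum>k | A i k \<noteq> 0. A i k * B k j) = 0"
    by (intro exI[of _ "n + m"]) auto
qed

lemma entry_times:
  assumes "A \<in> corner N \<or> B \<in> corner N"
  shows "entry (A * B) i j = (\<Sum>k<N. entry A i k * entry B k j)"
proof -
  obtain n where n: "A \<in> corner n" using ex_corner by blast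
  have "{k. entry A i k \<noteq> 0} \<subseteq> {..<n}"
    using corner_entry[OF n] by (metis (mono_tags, lifting) lessThan_iff linorder_not_less mem_Collect_eq subsetI)
  then have f: "finite {k. entry A i k \<noteq> 0}" using finite_subset by blast
  have "entry (A * B) i j = (\<Sum>k | entry A i k \<noteq> 0. entry A i k * entry B k j)"
    by transfer simp
  also have "\<dots> = (\<Sum>k\<in>{k. entry A i k \<noteq> 0} \<union> {..<N}. entry A i k * entry B k j)"
    by (rule sum.mono_neutral_left) (use f in auto)
  also have "\<dots> = (\<Sum>k<N. entry A i k * entry B k j)"
  proof (rule sum.mono_neutral_right)
    show "\<forall>k\<in>{k. entry A i k \<noteq> 0} \<union> {..<N} - {..<N}. entry A i k * entry B k j = 0"
      using assms corner_entry[of A N] corner_entry[of B N] by (metis Diff_iff lessThan_iff linorder_not_less mult_eq_0_iff)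
  qed (use f in auto)
  finally show ?thesis .
qed

instance
proof
  fix A B C :: fmat
  obtain n where n: "A \<in> corner n" "B \<in> corner n" "C \<in> corner n" by (rule ex_corner3)
  show "A * B * C = A * (B * C)"
    by (rule fmat_eqI)
      (simp add: entry_times[where N = n] n sum_distrib_left sum_distrib_right mult.assoc, rule sum.swap)
  show "(A + B) * C = A * C + B * C" "A * (B + C) = A * B + A * C"
    by (rule fmat_eqI; simp add: entry_times[where N = n] n algebra_simps sum.distrib)+
qed
end

lemma cscale_simps [simp]:
  "c *\<^sub>C (A + B) = c *\<^sub>C A + c *\<^sub>C B" "c *\<^sub>C (A - B) = c *\<^sub>C A - c *\<^sub>C B" "c *\<^sub>C (- A) = - (c *\<^sub>C A)"
  "c *\<^sub>C (0::fmat) = 0" "0 *\<^sub>C A = 0" "1 *\<^sub>C A = A" "(-1) *\<^sub>C A = - A" "c *\<^sub>C d *\<^sub>C A = (c * d) *\<^sub>C A"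
  by (rule fmat_eqI; simp add: algebra_simps)+

lemma cscale_add_left: "(c + d) *\<^sub>C A = c *\<^sub>C A + d *\<^sub>C A"
  and cscale_diff_left: "(c - d) *\<^sub>C A = c *\<^sub>C A - d *\<^sub>C A"
  and cscale_minus_left: "(- c) *\<^sub>C A = - (c *\<^sub>C A)"
  by (rule fmat_eqI; simp add: algebra_simps)+

lemma cscale_mult [simp]: "(c *\<^sub>C A) * B = c *\<^sub>C (A * B)" "A * (c *\<^sub>C B) = c *\<^sub>C (A * B)"
proof -
  obtain n where n: "A \<in> corner n" "B \<in> corner n" by (rule ex_corner2)
  show "(c *\<^sub>C A) * B = c *\<^sub>C (A * B)" "A * (c *\<^sub>C B) = c *\<^sub>C (A * B)"
    by (rule fmat_eqI; simp add: entry_times[where N = n] n sum_distrib_left algebra_simps)+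
qed

lemma cscale_sum: "c *\<^sub>C (\<Sum>x\<in>S. f x) = (\<Sum>x\<in>S. c *\<^sub>C f x)"
  by (rule fmat_eqI) (simp add: sum_distrib_left)

lemma cscale_sum_left: "(\<Sum>x\<in>S. c x) *\<^sub>C A = (\<Sum>x\<in>S. c x *\<^sub>C A)"
  by (rule fmat_eqI) (simp add: sum_distrib_right)

global_interpretation fmat: vector_space cscale
  by standard (auto simp: cscale_add_left)

lemma adj_simps [simp]:
  "(A + B)\<^sup>\<dagger> = A\<^sup>\<dagger> + B\<^sup>\<dagger>" "(A - B)\<^sup>\<dagger> = A\<^sup>\<dagger> - B\<^sup>\<dagger>" "(- A)\<^sup>\<dagger> = - A\<^sup>\<dagger>" "0\<^sup>\<dagger> = 0"
  "(c *\<^sub>C A)\<^sup>\<dagger> = cnj c *\<^sub>C A\<^sup>\<dagger>" "A\<^sup>\<dagger>\<^sup>\<dagger> = A"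
  by (rule fmat_eqI; simp)+

lemma adj_corner: "A \<in> corner n \<Longrightarrow> A\<^sup>\<dagger> \<in> corner n"
  by (auto simp: corner_def)

lemma adj_times [simp]: "(A * B)\<^sup>\<dagger> = B\<^sup>\<dagger> * A\<^sup>\<dagger>"
proof -
  obtain n where n: "A \<in> corner n" "B \<in> corner n" by (rule ex_corner2)
  show ?thesis
    by (rule fmat_eqI) (simp add: entry_times[where N = n] n adj_corner mult.commute)
qed

lemma adj_sum [simp]: "(\<Sum>x\<in>S. f x)\<^sup>\<dagger> = (\<Sum>x\<in>S. (f x)\<^sup>\<dagger>)"
  by (rule fmat_eqI) simp

lemma adj_idm [simp]: "(idm n)\<^sup>\<dagger> = idm n"
  by (rule fmat_eqI) (auto simp: entry_idm)

lemma adj_munit [simp]: "(munit a b)\<^sup>\<dagger> = munit b a"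
  by (rule fmat_eqI) (auto simp: entry_munit)

subsection \<open>Corners\<close>

lemma idm_corner [simp]: "idm n \<in> corner n"
  by (auto simp: corner_def entry_idm)

lemma munit_corner [simp]: "a < n \<Longrightarrow> b < n \<Longrightarrow> munit a b \<in> corner n"
  by (auto simp: corner_def entry_munit)

lemma idm_times: "A \<in> corner n \<Longrightarrow> idm n * A = A"
  and times_idm: "A \<in> corner n \<Longrightarrow> A * idm n = A"
proof -
  assume A: "A \<in> corner n"
  have "entry (idm n * A) i j = entry A i j" for i j
    using corner_entry[OF A, of i j]
    by (cases "i < n"; simp add: entry_times[where N = n] A entry_idm if_distrib[of "\<lambda>x. x * _"] cong: if_cong)
  then show "idm n * A = A" by (rule fmat_eqI)
  have "entry (A * idm n) i j = entry A i j" for i j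
    using corner_entry[OF A, of i j]
    by (cases "j < n"; simp add: entry_times[where N = n] A entry_idm if_distrib[of "\<lambda>x. _ * x"] cong: if_cong conj_cong)
  then show "A * idm n = A" by (rule fmat_eqI)
qed

lemma corner_zero [simp]: "0 \<in> corner n"
  and corner_add: "A \<in> corner n \<Longrightarrow> B \<in> corner n \<Longrightarrow> A + B \<in> corner n"
  and corner_diff: "A \<in> corner n \<Longrightarrow> B \<in> corner n \<Longrightarrow> A - B \<in> corner n"
  and corner_uminus: "A \<in> corner n \<Longrightarrow> - A \<in> corner n"
  and corner_cscale: "A \<in> corner n \<Longrightarrow> c *\<^sub>C A \<in> corner n"
  by (auto simp: corner_def)

lemma corner_sum: "(\<And>x. x \<in> S \<Longrightarrow> f x \<in> corner n) \<Longrightarrow> sum f S \<in> corner n"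
  by (auto simp: corner_def)

lemma corner_times: "A \<in> corner n \<Longrightarrow> B \<in> corner n \<Longrightarrow> A * B \<in> corner n"
  by (rule cornerI) (auto simp: entry_times[where N = n] corner_entry)

lemma corner_compress: "idm n * A * idm n \<in> corner n"
proof -
  obtain m where m: "A \<in> corner m" "idm n \<in> corner m" by (rule ex_corner2)
  show ?thesis
    by (rule cornerI) (auto simp: entry_times[where N = m] m corner_times entry_idm intro!: sum.neutral)
qed

lemma corner_iff: "A \<in> corner n \<longleftrightarrow> idm n * A * idm n = A"
  using corner_compress idm_times times_idm by metis

lemma corner_sandwich:
  assumes "A \<in> corner n" "C \<in> corner n" shows "A * B * C \<in> corner n"
proof -
  have "A * B * C = (idm n * A) * B * (C * idm n)" using assms by (simp only: idm_times times_idm)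
  also have "\<dots> = idm n * (A * B * C) * idm n" by (simp only: mult.assoc)
  finally show ?thesis using corner_compress by metis
qed

lemmas corner_intros = corner_add corner_diff corner_uminus corner_cscale corner_sum corner_times
  corner_zero idm_corner adj_corner

lemma munit_times [simp]: "munit a b * munit c d = (if b = c then munit a d else 0)"
proof -
  define N where "N = Suc (max (max a b) (max c d))"
  have N: "munit a b \<in> corner N" by (auto simp: N_def)
  have b: "b < N" by (auto simp: N_def)
  show ?thesis
    by (rule fmat_eqI) (use b in \<open>auto simp: entry_times[where N = N] N entry_munit if_distrib[of "\<lambda>x. x * _"]
        if_distrib[of "\<lambda>x. _ * x"] cong: if_cong\<close>)
qed

lemma munit_expand: "A \<in> corner n \<Longrightarrow> A = (\<Sum>i<n. \<Sum>j<n. entry A i j *\<^sub>C munit i j)"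
proof (rule fmat_eqI)
  fix i j assume A: "A \<in> corner n"
  have e: "entry A a b * (if i = a \<and> j = b then 1 else 0) = (if b = j then (if a = i then entry A a b else 0) else 0)"
    for a b by auto
  have "entry (\<Sum>a<n. \<Sum>b<n. entry A a b *\<^sub>C munit a b) i j = (if i < n \<and> j < n then entry A i j else 0)"
    by (cases "j < n") (simp_all add: entry_munit e)
  then show "entry A i j = entry (\<Sum>i<n. \<Sum>j<n. entry A i j *\<^sub>C munit i j) i j"
    using corner_entry[OF A, of i j] by auto
qed

lemma idm_eq: "idm n = (\<Sum>i<n. munit i i)"
  by (rule fmat_eqI) (auto simp: entry_idm entry_munit)

subsection \<open>Trace\<close>

definition tr :: "fmat \<Rightarrow> complex" where "tr A = (\<Sum>i | entry A i i \<noteq> 0. entry A i i)"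

lemma tr_eq: assumes "A \<in> corner N" shows "tr A = (\<Sum>i<N. entry A i i)"
proof -
  have "{k. entry A k k \<noteq> 0} \<subseteq> {..<N}"
    using corner_entry[OF assms] by (metis (mono_tags, lifting) lessThan_iff linorder_not_less mem_Collect_eq subsetI)
  then show ?thesis unfolding tr_def by (intro sum.mono_neutral_left) auto
qed

lemma tr_simps [simp]:
  "tr (A + B) = tr A + tr B" "tr (A - B) = tr A - tr B" "tr (- A) = - tr A" "tr 0 = 0"
  "tr (c *\<^sub>C A) = c * tr A" "tr (A\<^sup>\<dagger>) = cnj (tr A)"
proof -
  obtain n where n: "A \<in> corner n" "B \<in> corner n" by (rule ex_corner2)
  show "tr (A + B) = tr A + tr B" "tr (A - B) = tr A - tr B" "tr (- A) = - tr A" "tr 0 = 0"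
  "tr (c *\<^sub>C A) = c * tr A" "tr (A\<^sup>\<dagger>) = cnj (tr A)"
    by (auto simp: tr_eq[where N = n] n corner_intros sum.distrib sum_subtractf sum_negf sum_distrib_left)
qed

lemma tr_sum [simp]: "tr (sum f S) = (\<Sum>x\<in>S. tr (f x))"
  by (induction S rule: infinite_finite_induct) auto

lemma tr_comm: "tr (A * B) = tr (B * A)"
proof -
  obtain n where n: "A \<in> corner n" "B \<in> corner n" by (rule ex_corner2)
  show ?thesis
    by (simp add: tr_eq[where N = n] n corner_times entry_times[where N = n])
      (subst sum.swap, simp add: mult.commute)
qed

lemma tr_rotate: "tr (A * B * C) = tr (C * A * B)"
  by (metis mult.assoc tr_comm)

lemma tr_idm: "tr (idm n) = of_nat n"
  by (simp add: tr_eq[where N = n] entry_idm)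

lemma tr_munit: "tr (munit a b) = (if a = b then 1 else 0)"
proof -
  define N where "N = Suc (max a b)"
  have N: "munit a b \<in> corner N" "a < N" by (auto simp: N_def)
  have "tr (munit a b) = (\<Sum>i<N. if i = a then (if a = b then 1 else 0) else 0)"
    unfolding tr_eq[OF N(1)] entry_munit by (intro sum.cong) auto
  then show ?thesis using N by simp
qed

lemma tr_adj_self: "A \<in> corner n \<Longrightarrow> tr (A\<^sup>\<dagger> * A) = of_real (\<Sum>i<n. \<Sum>k<n. (cmod (entry A k i))\<^sup>2)"
  by (simp add: tr_eq[where N = n] corner_intros entry_times[where N = n]
      complex_norm_square mult.commute del: of_real_power)

lemma tr_adj_self_nonneg: "0 \<le> tr (A\<^sup>\<dagger> * A)"
proof -
  obtain n where "A \<in> corner n" using ex_corner by blast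
  then show ?thesis by (simp add: tr_adj_self less_eq_complex_def sum_nonneg)
qed

lemma tr_adj_self_eq_0 [simp]: "tr (A\<^sup>\<dagger> * A) = 0 \<longleftrightarrow> A = 0"
proof
  assume t: "tr (A\<^sup>\<dagger> * A) = 0"
  obtain n where n: "A \<in> corner n" using ex_corner by blast
  then have "(\<Sum>i<n. \<Sum>k<n. (cmod (entry A k i))\<^sup>2) = 0" using t by (simp only: tr_adj_self of_real_eq_0_iff)
  then have "\<forall>i<n. \<forall>k<n. entry A k i = 0"
    by (simp add: sum_nonneg_eq_0_iff sum_nonneg)
  then show "A = 0" using corner_entry[OF n] by (intro fmat_eqI) (metis entry_simps(1) linorder_not_less)
qed simp

subsection \<open>Positive matrices\<close>

text \<open>
  The columns of \<open>B\<close> are the test vectors, and the trace adds up their quadratic forms.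
\<close>

definition pos :: "fmat \<Rightarrow> bool" where "pos A \<longleftrightarrow> (\<forall>B. 0 \<le> tr (B\<^sup>\<dagger> * A * B))"

lemma posD: "pos A \<Longrightarrow> 0 \<le> tr (B\<^sup>\<dagger> * A * B)"
  by (auto simp: pos_def)

lemma pos_0 [simp]: "pos 0" by (simp add: pos_def)

lemma pos_add: "pos A \<Longrightarrow> pos B \<Longrightarrow> pos (A + B)"
  by (simp add: pos_def algebra_simps add_nonneg_nonneg)

lemma pos_sum: "(\<And>x. x \<in> S \<Longrightarrow> pos (f x)) \<Longrightarrow> pos (sum f S)"
  by (induction S rule: infinite_finite_induct) (auto intro: pos_add)

lemma pos_cscale: "pos A \<Longrightarrow> 0 \<le> c \<Longrightarrow> pos (c *\<^sub>C A)"
  by (simp add: pos_def mult_nonneg_nonneg)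

lemma pos_conj: "pos A \<Longrightarrow> pos (C\<^sup>\<dagger> * A * C)"
  unfolding pos_def
proof
  fix B assume "\<forall>B. 0 \<le> tr (B\<^sup>\<dagger> * A * B)"
  then have "0 \<le> tr ((C * B)\<^sup>\<dagger> * A * (C * B))" by blast
  then show "0 \<le> tr (B\<^sup>\<dagger> * (C\<^sup>\<dagger> * A * C) * B)" by (simp add: mult.assoc)
qed

lemma pos_adj_self: "pos (A\<^sup>\<dagger> * A)"
  unfolding pos_def
proof
  fix B
  have "0 \<le> tr ((A * B)\<^sup>\<dagger> * (A * B))" by (rule tr_adj_self_nonneg)
  then show "0 \<le> tr (B\<^sup>\<dagger> * (A\<^sup>\<dagger> * A) * B)" by (simp add: mult.assoc)
qed

lemma pos_conj': "pos A \<Longrightarrow> pos (C * A * C\<^sup>\<dagger>)"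
  using pos_conj[of A "C\<^sup>\<dagger>"] by simp

section \<open>Orthogonal projections and spectral theory\<close>

text \<open>
  The orthogonal projection onto \<open>V\<close> for the Hilbert--Schmidt inner product \<open>tr (X\<^sup>\<dagger> * Y)\<close>.
\<close>

definition hs_proj :: "fmat set \<Rightarrow> fmat \<Rightarrow> fmat" where
  "hs_proj V X = (SOME Y. Y \<in> V \<and> (\<forall>Z\<in>V. tr (Z\<^sup>\<dagger> * (X - Y)) = 0))"

lemma corner_span: "corner n \<subseteq> fmat.span ((\<lambda>(i, j). munit i j) ` ({..<n} \<times> {..<n}))"
proof
  fix A assume "A \<in> corner n"
  then have "A = (\<Sum>i<n. \<Sum>j<n. entry A i j *\<^sub>C munit i j)" by (rule munit_expand)
  also have "\<dots> \<in> fmat.span ((\<lambda>(i, j). munit i j) ` ({..<n} \<times> {..<n}))"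
    by (intro fmat.span_sum fmat.span_scale fmat.span_base) auto
  finally show "A \<in> fmat.span ((\<lambda>(i, j). munit i j) ` ({..<n} \<times> {..<n}))" .
qed

lemma corner_independent:
  assumes "fmat.independent S" "S \<subseteq> corner n"
  shows "finite S" "card S \<le> n * n"
proof -
  let ?M = "(\<lambda>(i, j). munit i j) ` ({..<n} \<times> {..<n})"
  have "finite S \<and> card S \<le> card ?M"
    by (rule fmat.independent_span_bound) (use assms corner_span in auto)
  moreover have "card ?M \<le> card ({..<n} \<times> {..<n})" by (rule card_image_le) auto
  ultimately show "finite S" "card S \<le> n * n" by auto
qed

text \<open>
  Gram--Schmidt: a further spanning vector \<open>b\<close> enters through its component \<open>b'\<close> orthogonal to the
  span of the others.
\<close>

lemma finite_span_proj:
  assumes "finite B"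
  shows "\<exists>Y\<in>fmat.span B. \<forall>Z\<in>fmat.span B. tr (Z\<^sup>\<dagger> * (X - Y)) = 0"
  using assms
proof (induction B arbitrary: X)
  case empty
  show ?case by (auto simp: fmat.span_empty)
next
  case (insert b B)
  obtain Yb where Yb: "Yb \<in> fmat.span B" "\<And>Z. Z \<in> fmat.span B \<Longrightarrow> tr (Z\<^sup>\<dagger> * (b - Yb)) = 0"
    using insert.IH[of b] by blast
  obtain Y where Y: "Y \<in> fmat.span B" "\<And>Z. Z \<in> fmat.span B \<Longrightarrow> tr (Z\<^sup>\<dagger> * (X - Y)) = 0"
    using insert.IH[of X] by blast
  define b' where "b' = b - Yb"
  have orth: "tr (Z\<^sup>\<dagger> * b') = 0" if "Z \<in> fmat.span B" for Z using Yb(2)[OF that] by (simp add: b'_def)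
  have orth': "tr (b'\<^sup>\<dagger> * Z) = 0" if "Z \<in> fmat.span B" for Z
  proof -
    have "tr (b'\<^sup>\<dagger> * Z) = cnj (tr (Z\<^sup>\<dagger> * b'))" by (metis adj_simps(6) adj_times tr_simps(6))
    then show ?thesis by (simp add: orth[OF that])
  qed
  (* If b' = 0, the quotient is 0, and the correction term vanishes as it must. *)
  define c where "c = tr (b'\<^sup>\<dagger> * X) / tr (b'\<^sup>\<dagger> * b')"
  have sub: "fmat.span B \<subseteq> fmat.span (insert b B)" by (rule fmat.span_mono) auto
  have bin: "b \<in> fmat.span (insert b B)" by (rule fmat.span_base) simp
  show ?case
  proof (intro bexI ballI)
    show "Y + c *\<^sub>C b' \<in> fmat.span (insert b B)"
      unfolding b'_def
      by (intro fmat.span_add fmat.span_scale fmat.span_diff) (use sub Y(1) Yb(1) bin in auto)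
    fix Z assume "Z \<in> fmat.span (insert b B)"
    then obtain k where k: "Z - k *\<^sub>C b \<in> fmat.span B" using fmat.span_breakdown_eq by blast
    define Z1 where "Z1 = (Z - k *\<^sub>C b) + k *\<^sub>C Yb"
    have Z1: "Z1 \<in> fmat.span B" unfolding Z1_def by (intro fmat.span_add fmat.span_scale k Yb(1))
    have Z: "Z = Z1 + k *\<^sub>C b'" by (simp add: Z1_def b'_def)
    have 1: "tr (Z1\<^sup>\<dagger> * (X - (Y + c *\<^sub>C b'))) = 0"
      using Y(2)[OF Z1] orth[OF Z1] by (simp add: algebra_simps)
    have 2: "tr (b'\<^sup>\<dagger> * (X - (Y + c *\<^sub>C b'))) = 0"
      using orth'[OF Y(1)] by (cases "b' = 0") (simp_all add: algebra_simps c_def)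
    show "tr (Z\<^sup>\<dagger> * (X - (Y + c *\<^sub>C b'))) = 0"
      using 1 2 by (simp add: Z distrib_right)
  qed
qed

lemma hs_proj_exists:
  assumes "fmat.subspace V" "V \<subseteq> corner n"
  shows "hs_proj V X \<in> V" "\<And>Z. Z \<in> V \<Longrightarrow> tr (Z\<^sup>\<dagger> * (X - hs_proj V X)) = 0"
proof -
  obtain B where B: "B \<subseteq> V" "fmat.independent B" "V \<subseteq> fmat.span B"
    using fmat.maximal_independent_subset[of V] by blast
  have "fmat.span B = V" using B assms(1) by (metis fmat.span_subspace)
  moreover have "finite B" using corner_independent[of B n] B assms(2) by auto
  ultimately have "\<exists>Y. Y \<in> V \<and> (\<forall>Z\<in>V. tr (Z\<^sup>\<dagger> * (X - Y)) = 0)" using finite_span_proj[of B X] by auto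
  then have "hs_proj V X \<in> V \<and> (\<forall>Z\<in>V. tr (Z\<^sup>\<dagger> * (X - hs_proj V X)) = 0)"
    unfolding hs_proj_def by (rule someI_ex)
  then show "hs_proj V X \<in> V" "\<And>Z. Z \<in> V \<Longrightarrow> tr (Z\<^sup>\<dagger> * (X - hs_proj V X)) = 0" by auto
qed

lemma hs_proj_eqI:
  assumes V: "fmat.subspace V" "V \<subseteq> corner n" and Y: "Y \<in> V" "\<And>Z. Z \<in> V \<Longrightarrow> tr (Z\<^sup>\<dagger> * (X - Y)) = 0"
  shows "hs_proj V X = Y"
proof -
  define D where "D = hs_proj V X - Y"
  have "D \<in> V" unfolding D_def using hs_proj_exists(1)[OF V] Y(1) V(1) by (simp add: fmat.subspace_diff)
  then have "tr (D\<^sup>\<dagger> * (X - Y)) = 0" "tr (D\<^sup>\<dagger> * (X - hs_proj V X)) = 0"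
    using Y(2) hs_proj_exists(2)[OF V] by auto
  moreover have "D\<^sup>\<dagger> * D = D\<^sup>\<dagger> * (X - Y) - D\<^sup>\<dagger> * (X - hs_proj V X)"
    unfolding right_diff_distrib[symmetric] by (simp add: D_def)
  ultimately have "tr (D\<^sup>\<dagger> * D) = 0" by simp
  then have "D = 0" by (simp only: tr_adj_self_eq_0)
  then show ?thesis by (simp add: D_def)
qed

context
  fixes V n assumes V: "fmat.subspace V" "V \<subseteq> corner n"
begin

lemma hs_proj_id: "X \<in> V \<Longrightarrow> hs_proj V X = X"
  by (rule hs_proj_eqI[OF V]) auto

lemma hs_proj_add: "hs_proj V (X + Y) = hs_proj V X + hs_proj V Y"
proof (rule hs_proj_eqI[OF V])
  fix Z assume "Z \<in> V"
  then show "tr (Z\<^sup>\<dagger> * (X + Y - (hs_proj V X + hs_proj V Y))) = 0"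
    using hs_proj_exists(2)[OF V, of Z X] hs_proj_exists(2)[OF V, of Z Y] by (simp add: algebra_simps)
qed (intro fmat.subspace_add V hs_proj_exists(1)[OF V])

lemma hs_proj_cscale: "hs_proj V (c *\<^sub>C X) = c *\<^sub>C hs_proj V X"
proof (rule hs_proj_eqI[OF V])
  fix Z assume "Z \<in> V"
  then show "tr (Z\<^sup>\<dagger> * (c *\<^sub>C X - c *\<^sub>C hs_proj V X)) = 0"
    using hs_proj_exists(2)[OF V, of Z X] by (simp add: algebra_simps)
qed (intro fmat.subspace_scale V hs_proj_exists(1)[OF V])

lemma hs_proj_tr: "Z \<in> V \<Longrightarrow> tr (Z\<^sup>\<dagger> * hs_proj V X) = tr (Z\<^sup>\<dagger> * X)"
  using hs_proj_exists(2)[OF V, of Z X] by (simp add: algebra_simps)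

lemma hs_proj_sym: "tr ((hs_proj V X)\<^sup>\<dagger> * Y) = tr (X\<^sup>\<dagger> * hs_proj V Y)"
proof -
  have "tr ((hs_proj V X)\<^sup>\<dagger> * Y) = tr ((hs_proj V X)\<^sup>\<dagger> * hs_proj V Y)"
    by (simp add: hs_proj_tr hs_proj_exists(1)[OF V])
  also have "\<dots> = cnj (tr ((hs_proj V Y)\<^sup>\<dagger> * hs_proj V X))" by (metis adj_simps(6) adj_times tr_simps(6))
  also have "\<dots> = cnj (tr ((hs_proj V Y)\<^sup>\<dagger> * X))"
    by (simp add: hs_proj_tr hs_proj_exists(1)[OF V])
  also have "\<dots> = tr (X\<^sup>\<dagger> * hs_proj V Y)" by (metis adj_simps(6) adj_times tr_simps(6))
  finally show ?thesis .
qed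

end

subsection \<open>Eigenvectors\<close>

text \<open>
  The vectors \<open>(T ^^ k) x\<close> cannot all be independent, so some nonzero polynomial in \<open>T\<close> annihilates
  \<open>x\<close>. Take one of least degree; it is not constant, hence has a root \<open>\<mu>\<close>. Its cofactor at \<open>\<mu>\<close> does
  not annihilate \<open>x\<close>, by minimality, and sends \<open>x\<close> to an eigenvector for \<open>\<mu>\<close>.
\<close>

lemma eigenvector_exists:
  fixes T :: "fmat \<Rightarrow> fmat"
  assumes V: "fmat.subspace V" "V \<subseteq> corner n" and x: "x \<in> V" "x \<noteq> 0"
    and T: "\<And>y. y \<in> V \<Longrightarrow> T y \<in> V" "\<And>y z. y \<in> V \<Longrightarrow> z \<in> V \<Longrightarrow> T (y + z) = T y + T z"
      "\<And>c y. y \<in> V \<Longrightarrow> T (c *\<^sub>C y) = c *\<^sub>C T y"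
  shows "\<exists>y \<mu>. y \<in> V \<and> y \<noteq> 0 \<and> T y = \<mu> *\<^sub>C y"
proof -
  have it: "(T ^^ k) x \<in> V" for k by (induction k) (auto intro: x T)
  have Tsum: "T (\<Sum>k\<in>S. c k *\<^sub>C (T ^^ k) x) = (\<Sum>k\<in>S. c k *\<^sub>C (T ^^ Suc k) x)" if "finite S" for S c
    using that
  proof (induction S)
    case empty
    have "T (0 *\<^sub>C x) = 0 *\<^sub>C T x" by (rule T(3)) (rule x)
    then show ?case by simp
  next
    case (insert a S)
    then show ?case
      by (simp add: T it V(1) fmat.subspace_sum fmat.subspace_scale)
  qed
  define ev where "ev p = (\<Sum>k\<le>degree p. coeff p k *\<^sub>C (T ^^ k) x)" for p
  have ev_N: "ev p = (\<Sum>k\<le>N. coeff p k *\<^sub>C (T ^^ k) x)" if "degree p \<le> N" for p N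
    unfolding ev_def by (rule sum.mono_neutral_left) (use that in \<open>auto simp: coeff_eq_0\<close>)
  have ev_in: "ev p \<in> V" for p
    unfolding ev_def by (intro fmat.subspace_sum V fmat.subspace_scale it)
  have "\<exists>p. p \<noteq> 0 \<and> ev p = 0"
  proof (cases "inj_on (\<lambda>k. (T ^^ k) x) {..n * n}")
    case False
    then obtain i j where ij: "i \<noteq> j" "(T ^^ i) x = (T ^^ j) x" "i \<le> n * n" "j \<le> n * n" by (auto simp: inj_on_def)
    let ?p = "monom 1 i - monom 1 j :: complex poly"
    have "coeff ?p i = 1" using ij by simp
    then have "?p \<noteq> 0" by (metis coeff_0 zero_neq_one)
    moreover have "degree ?p \<le> n * n"
      by (rule degree_diff_le) (use ij in \<open>auto simp: degree_monom_eq\<close>)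
    then have "ev ?p = (\<Sum>k\<le>n*n. (if k = i then (T ^^ k) x else 0) - (if k = j then (T ^^ k) x else 0))"
      unfolding ev_N[OF \<open>degree ?p \<le> n * n\<close>] by (intro sum.cong refl) (auto simp: coeff_monom)
    then have "ev ?p = 0" using ij by (simp add: sum_subtractf)
    ultimately show ?thesis by blast
  next
    case True
    let ?f = "\<lambda>k. (T ^^ k) x" let ?S = "?f ` {..n * n}"
    have c: "card ?S = Suc (n * n)" using card_image[OF True] by simp
    have "\<not> fmat.independent ?S" using corner_independent(2)[of ?S n] c it V(2) by fastforce
    then obtain S u v where S: "finite S" "S \<subseteq> ?S" "v \<in> S" "u v \<noteq> 0" "(\<Sum>v\<in>S. u v *\<^sub>C v) = 0"
      unfolding fmat.dependent_explicit by blast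
    define J where "J = {k. k \<le> n * n \<and> ?f k \<in> S}"
    have JS: "?f ` J = S" using S(2) unfolding J_def by auto
    have inj: "inj_on ?f J" using True by (rule inj_on_subset) (auto simp: J_def)
    define p where "p = (\<Sum>k\<in>J. monom (u (?f k)) k)"
    have fin: "finite J" by (simp add: J_def)
    have cp: "coeff p k = (if k \<in> J then u (?f k) else 0)" for k
      unfolding p_def coeff_sum coeff_monom using fin by simp
    obtain k where k: "k \<in> J" "?f k = v" using S(3) JS by auto
    then have "coeff p k \<noteq> 0" using S(4) by (simp add: cp)
    then have "p \<noteq> 0" by auto
    have "degree p \<le> n * n" by (rule degree_le) (auto simp: cp J_def)
    then have "ev p = (\<Sum>k\<le>n*n. (if k \<in> J then u (?f k) *\<^sub>C ?f k else 0))"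
      by (subst ev_N) (auto simp: cp intro!: sum.cong)
    also have "\<dots> = (\<Sum>k\<in>J. u (?f k) *\<^sub>C ?f k)"
      by (subst sum.inter_restrict[symmetric]) (auto simp: J_def intro!: sum.cong)
    also have "\<dots> = (\<Sum>v\<in>S. u v *\<^sub>C v)" unfolding JS[symmetric] by (simp add: sum.reindex[OF inj])
    finally show ?thesis using S(5) \<open>p \<noteq> 0\<close> by auto
  qed
  then obtain p0 where p0: "p0 \<noteq> 0 \<and> ev p0 = 0" by blast
  define p where "p = (ARG_MIN degree p. p \<noteq> 0 \<and> ev p = 0)"
  have p: "p \<noteq> 0" "ev p = 0" and pmin: "\<And>q. q \<noteq> 0 \<Longrightarrow> ev q = 0 \<Longrightarrow> degree p \<le> degree q"
    using arg_min_natI[of "\<lambda>p. p \<noteq> 0 \<and> ev p = 0", OF p0, of degree]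
      arg_min_nat_le[of "\<lambda>p. p \<noteq> 0 \<and> ev p = 0" _ degree] unfolding p_def by auto
  have "degree p \<noteq> 0"
  proof
    assume d: "degree p = 0"
    then have "coeff p 0 *\<^sub>C x = 0" using p(2) by (simp add: ev_def)
    moreover have "coeff p 0 \<noteq> 0" using d p(1) by (metis leading_coeff_0_iff)
    ultimately show False using x(2) by simp
  qed
  then have "\<not> constant (poly p)" by (simp add: constant_degree)
  then obtain \<mu> where "poly p \<mu> = 0" using fundamental_theorem_of_algebra by blast
  then obtain q where q: "p = [:- \<mu>, 1:] * q" unfolding poly_eq_0_iff_dvd by (elim dvdE)
  have q0: "q \<noteq> 0" using p(1) q by auto
  have dq: "degree p = Suc (degree q)" unfolding q using q0 by (subst degree_mult_eq) auto
  have evq: "ev q \<noteq> 0" using pmin[OF q0] dq by auto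
  have pq: "p = pCons 0 q - smult \<mu> q" unfolding q by simp
  have "ev p = (\<Sum>k\<le>Suc (degree q). coeff (pCons 0 q) k *\<^sub>C (T ^^ k) x) - (\<Sum>k\<le>Suc (degree q). (\<mu> * coeff q k) *\<^sub>C (T ^^ k) x)"
    by (subst ev_N[of _ "Suc (degree q)"]) (auto simp: dq pq cscale_diff_left sum_subtractf simp flip: dq)
  also have "(\<Sum>k\<le>Suc (degree q). coeff (pCons 0 q) k *\<^sub>C (T ^^ k) x) = (\<Sum>k\<le>degree q. coeff q k *\<^sub>C (T ^^ Suc k) x)"
    by (subst sum.atMost_Suc_shift) simp
  also have "\<dots> = T (ev q)" unfolding ev_def by (simp add: Tsum)
  also have "(\<Sum>k\<le>Suc (degree q). (\<mu> * coeff q k) *\<^sub>C (T ^^ k) x) = \<mu> *\<^sub>C ev q"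
    by (subst ev_N[of _ "Suc (degree q)"]) (auto simp: cscale_sum)
  finally have "T (ev q) = \<mu> *\<^sub>C ev q" using p(2) by simp
  then show ?thesis using evq ev_in by blast
qed

lemma munit00_sandwich: "munit 0 0 * Z * munit 0 0 = entry Z 0 0 *\<^sub>C munit 0 0"
proof -
  obtain n where n: "munit 0 0 \<in> corner n" "Z \<in> corner n" by (rule ex_corner2)
  then have "0 < n" by (metis corner_entry entry_munit gr0I le0 zero_neq_one)
  show ?thesis
    by (rule fmat_eqI) (use \<open>0 < n\<close> in \<open>auto simp: entry_times[where N = n] n corner_times entry_munit
        if_distrib[of "\<lambda>x. x * _"] if_distrib[of "\<lambda>x. _ * x"] cong: if_cong\<close>)
qed

text \<open>
  A vector is a matrix \<open>x\<close> with \<open>x * munit 0 0 = x\<close>, that is, with no entries outside its column 0;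
  inner products of vectors are then multiples of \<open>munit 0 0\<close>.
\<close>

lemma column_inner:
  assumes "x * munit 0 0 = x" "y * munit 0 0 = y"
  shows "x\<^sup>\<dagger> * y = tr (x\<^sup>\<dagger> * y) *\<^sub>C munit 0 0"
proof -
  have "x\<^sup>\<dagger> = munit 0 0 * x\<^sup>\<dagger>" using assms(1) by (metis adj_munit adj_times)
  then have "x\<^sup>\<dagger> * y = munit 0 0 * (x\<^sup>\<dagger> * y) * munit 0 0" using assms(2) by (metis mult.assoc)
  then have e: "x\<^sup>\<dagger> * y = entry (x\<^sup>\<dagger> * y) 0 0 *\<^sub>C munit 0 0" by (metis munit00_sandwich)
  then have "tr (x\<^sup>\<dagger> * y) = entry (x\<^sup>\<dagger> * y) 0 0 * tr (munit 0 0)" by (metis tr_simps(5))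
  then show ?thesis using e by (simp add: tr_munit)
qed

lemma herm_eigenvalue_real:
  assumes "A\<^sup>\<dagger> = A" "A * y = \<mu> *\<^sub>C y" "y \<noteq> 0"
  shows "\<mu> = of_real (Re \<mu>)"
proof -
  have "(y\<^sup>\<dagger> * A * y)\<^sup>\<dagger> = y\<^sup>\<dagger> * A * y" using assms(1) by (simp add: mult.assoc)
  then have "cnj (tr (y\<^sup>\<dagger> * A * y)) = tr (y\<^sup>\<dagger> * A * y)" by (metis tr_simps(6))
  moreover have "tr (y\<^sup>\<dagger> * A * y) = \<mu> * tr (y\<^sup>\<dagger> * y)" by (simp add: mult.assoc assms(2))
  moreover have "cnj (tr (y\<^sup>\<dagger> * y)) = tr (y\<^sup>\<dagger> * y)" by (metis adj_simps(6) adj_times tr_simps(6))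
  ultimately have "cnj \<mu> = \<mu>" using assms(3) by simp
  then show ?thesis by (metis Reals_cnj_iff of_real_Re)
qed

text \<open>
  Eigenvectors are collected one at a time. The projection \<open>q\<close> onto the orthogonal complement of
  the first \<open>k\<close> of them commutes with \<open>A\<close> and has trace \<open>n - k\<close>; for \<open>k < n\<close> its range is therefore a
  nonzero invariant subspace, which contains a further eigenvector, and for \<open>k = n\<close> it is zero.
\<close>

lemma herm_eigenbasis:
  assumes A: "A \<in> corner n" "A\<^sup>\<dagger> = A"
  obtains w :: "nat \<Rightarrow> fmat" and l :: "nat \<Rightarrow> real"
  where "\<And>i. i < n \<Longrightarrow> w i \<in> corner n" "\<And>i. i < n \<Longrightarrow> w i * munit 0 0 = w i"
    "\<And>i. i < n \<Longrightarrow> A * w i = of_real (l i) *\<^sub>C w i"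
    "\<And>i j. i < n \<Longrightarrow> j < n \<Longrightarrow> (w i)\<^sup>\<dagger> * w j = (if i = j then munit 0 0 else 0)"
    "(\<Sum>i<n. w i * (w i)\<^sup>\<dagger>) = idm n"
proof -
  let ?Q = "\<lambda>k w l. (\<forall>i<k. w i \<in> corner n \<and> w i * munit 0 0 = w i \<and> A * w i = complex_of_real (l i) *\<^sub>C w i) \<and>
    (\<forall>i<k. \<forall>j<k. (w i)\<^sup>\<dagger> * w j = (if i = j then munit 0 0 else 0))"
  have props: "\<And>j. j < k \<Longrightarrow> (idm n - (\<Sum>i<k. w i * (w i)\<^sup>\<dagger>)) * w j = 0" "tr (idm n - (\<Sum>i<k. w i * (w i)\<^sup>\<dagger>)) = of_nat n - of_nat k"
    "(idm n - (\<Sum>i<k. w i * (w i)\<^sup>\<dagger>)) * (idm n - (\<Sum>i<k. w i * (w i)\<^sup>\<dagger>)) = idm n - (\<Sum>i<k. w i * (w i)\<^sup>\<dagger>)"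
    if Q: "?Q k w l" for w k and l :: "nat \<Rightarrow> real"
  proof -
    have wi: "(\<Sum>i<k. w i * ((w i)\<^sup>\<dagger> * w j)) = w j" if "j < k" for j
    proof -
      have "(\<Sum>i<k. w i * ((w i)\<^sup>\<dagger> * w j)) = (\<Sum>i<k. if i = j then w j else 0)"
        by (intro sum.cong refl) (use Q that in auto)
      then show ?thesis using that by simp
    qed
    show z: "(idm n - (\<Sum>i<k. w i * (w i)\<^sup>\<dagger>)) * w j = 0" if "j < k" for j
      unfolding left_diff_distrib sum_distrib_right mult.assoc wi[OF that] using Q that by (simp add: idm_times)
    have "tr (w i * (w i)\<^sup>\<dagger>) = 1" if "i < k" for i
      using Q that by (subst tr_comm) (simp add: tr_munit)
    then show "tr (idm n - (\<Sum>i<k. w i * (w i)\<^sup>\<dagger>)) = of_nat n - of_nat k"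
      by (simp add: tr_idm)
    have "(idm n - (\<Sum>i<k. w i * (w i)\<^sup>\<dagger>)) * (\<Sum>i<k. w i * (w i)\<^sup>\<dagger>) = 0"
      by (simp add: sum_distrib_left z flip: mult.assoc)
    then show "(idm n - (\<Sum>i<k. w i * (w i)\<^sup>\<dagger>)) * (idm n - (\<Sum>i<k. w i * (w i)\<^sup>\<dagger>)) = idm n - (\<Sum>i<k. w i * (w i)\<^sup>\<dagger>)"
      using times_idm[of "idm n - (\<Sum>i<k. w i * (w i)\<^sup>\<dagger>)" n] Q
      by (subst right_diff_distrib) (auto intro!: corner_intros)
  qed
  have "\<exists>w l. ?Q k w l" if "k \<le> n" for k
    using that
  proof (induction k)
    case 0
    then show ?case by simp
  next
    case (Suc k)
    then obtain w l where Q: "?Q k w l" by auto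
    define q where "q = idm n - (\<Sum>i<k. w i * (w i)\<^sup>\<dagger>)"
    have qc: "q \<in> corner n" using Q by (auto simp: q_def intro!: corner_intros)
    have qw: "q * w j = 0" if "j < k" for j using props(1)[OF Q] that by (simp add: q_def)
    have qq: "q * q = q" using props(3)[OF Q] by (auto simp: q_def)
    have qh: "q\<^sup>\<dagger> = q" by (simp add: q_def)
    have "tr q \<noteq> 0" using props(2)[OF Q] Suc.prems by (auto simp: q_def)
    then have q0: "q \<noteq> 0" by auto
    have wwA: "w i * (w i)\<^sup>\<dagger> * A = of_real (l i) *\<^sub>C (w i * (w i)\<^sup>\<dagger>)" if "i < k" for i
    proof -
      have "(w i * (w i)\<^sup>\<dagger> * A) = (A * w i * (w i)\<^sup>\<dagger>)\<^sup>\<dagger>" using A(2) by (simp add: mult.assoc)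
      also have "\<dots> = of_real (l i) *\<^sub>C (w i * (w i)\<^sup>\<dagger>)" using Q that by simp
      finally show ?thesis .
    qed
    have qA: "q * A = A * q"
      using Q by (simp add: q_def left_diff_distrib right_diff_distrib idm_times times_idm A(1) sum_distrib_left
          sum_distrib_right wwA) (simp flip: mult.assoc)
    define V where "V = {X \<in> corner n. X * munit 0 0 = X \<and> q * X = X}"
    have Vs: "fmat.subspace V"
      by (auto simp: V_def fmat.subspace_def corner_intros distrib_left distrib_right)
    have "\<exists>j<n. q * munit j 0 \<noteq> 0"
    proof (rule ccontr)
      assume "\<not> (\<exists>j<n. q * munit j 0 \<noteq> 0)"
      then have "q * munit j 0 * munit 0 j = 0" if "j < n" for j using that by simp
      then have "q * idm n = 0" by (simp add: idm_eq sum_distrib_left mult.assoc)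
      then show False using q0 qc by (simp add: times_idm)
    qed
    then obtain j where j: "j < n" "q * munit j 0 \<noteq> 0" by blast
    have jV: "q * munit j 0 \<in> V" using j qc qq by (auto simp: V_def corner_intros mult.assoc simp flip: mult.assoc[of q q])
    have "\<exists>y \<mu>. y \<in> V \<and> y \<noteq> 0 \<and> A * y = \<mu> *\<^sub>C y"
    proof (rule eigenvector_exists[OF Vs _ jV j(2)])
      show "V \<subseteq> corner n" by (auto simp: V_def)
      fix y assume "y \<in> V"
      moreover have "q * (A * y) = A * (q * y)" by (metis mult.assoc qA)
      ultimately show "A * y \<in> V" using A(1) by (auto simp: V_def corner_intros mult.assoc)
    qed (auto simp: distrib_left)
    then obtain y \<mu> where y: "y \<in> V" "y \<noteq> 0" "A * y = \<mu> *\<^sub>C y" by blast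
    have mu: "\<mu> = of_real (Re \<mu>)" using herm_eigenvalue_real[OF A(2) y(3) y(2)] .
    define r where "r = Re (tr (y\<^sup>\<dagger> * y))"
    have "0 \<le> tr (y\<^sup>\<dagger> * y)" "tr (y\<^sup>\<dagger> * y) \<noteq> 0" using y(2) by (simp_all add: tr_adj_self_nonneg)
    then have r: "tr (y\<^sup>\<dagger> * y) = of_real r" "r > 0"
      by (auto simp: r_def less_eq_complex_def complex_eq_iff)
    define z where "z = complex_of_real (1 / sqrt r) *\<^sub>C y"
    have zc: "z \<in> corner n" "z * munit 0 0 = z" "q * z = z" "A * z = of_real (Re \<mu>) *\<^sub>C z"
      using y mu by (auto simp: z_def V_def corner_intros)
    have sq: "complex_of_real (sqrt r) * complex_of_real (sqrt r) = of_real r"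
      using r(2) by (simp flip: of_real_mult)
    have zz: "z\<^sup>\<dagger> * z = munit 0 0"
      by (subst column_inner[OF zc(2) zc(2)]) (use r sq in \<open>simp add: z_def field_simps\<close>)
    have zw: "z\<^sup>\<dagger> * w j = 0" if "j < k" for j
    proof -
      have "z\<^sup>\<dagger> * w j = z\<^sup>\<dagger> * q * w j" using zc(3) qh by (metis adj_times)
      then show ?thesis using qw[OF that] by (simp add: mult.assoc)
    qed
    have wz: "(w j)\<^sup>\<dagger> * z = 0" if "j < k" for j
      using zw[OF that] by (metis adj_simps(4,6) adj_times)
    have "?Q (Suc k) (w(k := z)) (l(k := Re \<mu>))"
      using Q zc zz zw wz by (auto simp: less_Suc_eq)
    then show ?case by blast
  qed
  then obtain w l where Q: "?Q n w l" by blast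
  define q where "q = idm n - (\<Sum>i<n. w i * (w i)\<^sup>\<dagger>)"
  have qq: "q * q = q" using props(3)[OF Q] by (auto simp: q_def)
  have qh: "q\<^sup>\<dagger> = q" by (simp add: q_def)
  have "tr q = 0" using props(2)[OF Q] by (auto simp: q_def)
  then have "tr (q\<^sup>\<dagger> * q) = 0" using qq qh by simp
  then have "q = 0" by (simp only: tr_adj_self_eq_0)
  then show thesis using that[of w l] Q by (auto simp: q_def)
qed

subsection \<open>Star algebras\<close>

definition star_alg :: "nat \<Rightarrow> fmat set \<Rightarrow> bool" where
  "star_alg n N \<longleftrightarrow> N \<subseteq> corner n \<and> idm n \<in> N \<and> (\<forall>X\<in>N. \<forall>Y\<in>N. X + Y \<in> N) \<and>
     (\<forall>c. \<forall>X\<in>N. c *\<^sub>C X \<in> N) \<and> (\<forall>X\<in>N. \<forall>Y\<in>N. X * Y \<in> N) \<and> (\<forall>X\<in>N. X\<^sup>\<dagger> \<in> N)"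

text \<open>
  Proofs below select from this list by position; facts 11 and 1 are what projections and
  exponentials need to know of an algebra.
\<close>

lemma star_algD:
  assumes "star_alg n N"
  shows "N \<subseteq> corner n" "idm n \<in> N" "\<And>X Y. X \<in> N \<Longrightarrow> Y \<in> N \<Longrightarrow> X + Y \<in> N"
    "\<And>c X. X \<in> N \<Longrightarrow> c *\<^sub>C X \<in> N" "\<And>X Y. X \<in> N \<Longrightarrow> Y \<in> N \<Longrightarrow> X * Y \<in> N"
    "\<And>X. X \<in> N \<Longrightarrow> X\<^sup>\<dagger> \<in> N" "0 \<in> N" "\<And>X. X \<in> N \<Longrightarrow> - X \<in> N" "\<And>X Y. X \<in> N \<Longrightarrow> Y \<in> N \<Longrightarrow> X - Y \<in> N"
    "\<And>f S. (\<And>x. x \<in> S \<Longrightarrow> f x \<in> N) \<Longrightarrow> sum f S \<in> N" "fmat.subspace N"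
    "\<And>X. X \<in> N \<Longrightarrow> X \<in> corner n"
proof -
  show 1: "N \<subseteq> corner n" "idm n \<in> N" "\<And>X Y. X \<in> N \<Longrightarrow> Y \<in> N \<Longrightarrow> X + Y \<in> N"
    "\<And>c X. X \<in> N \<Longrightarrow> c *\<^sub>C X \<in> N" "\<And>X Y. X \<in> N \<Longrightarrow> Y \<in> N \<Longrightarrow> X * Y \<in> N"
    "\<And>X. X \<in> N \<Longrightarrow> X\<^sup>\<dagger> \<in> N"
    using assms by (auto simp: star_alg_def)
  have "0 *\<^sub>C idm n \<in> N" using 1 by blast
  then show 0: "0 \<in> N" by simp
  show s: "fmat.subspace N" using 1 0 by (auto simp: fmat.subspace_def)
  show "\<And>X. X \<in> N \<Longrightarrow> - X \<in> N" "\<And>X Y. X \<in> N \<Longrightarrow> Y \<in> N \<Longrightarrow> X - Y \<in> N"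
    "\<And>f S. (\<And>x. x \<in> S \<Longrightarrow> f x \<in> N) \<Longrightarrow> sum f S \<in> N"
    using s by (auto intro: fmat.subspace_neg fmat.subspace_diff fmat.subspace_sum)
  show "\<And>X. X \<in> N \<Longrightarrow> X \<in> corner n" using 1 by auto
qed

lemma star_alg_corner: "star_alg n (corner n)"
  by (auto simp: star_alg_def intro: corner_intros)

lemma star_alg_commutant:
  assumes "\<And>Y. Y \<in> S \<Longrightarrow> Y\<^sup>\<dagger> \<in> S" "S \<subseteq> corner n"
  shows "star_alg n {X \<in> corner n. \<forall>Y\<in>S. X * Y = Y * X}"
  unfolding star_alg_def
proof (intro conjI ballI allI)
  fix X Y assume "X \<in> {X \<in> corner n. \<forall>Y\<in>S. X * Y = Y * X}" "Y \<in> {X \<in> corner n. \<forall>Y\<in>S. X * Y = Y * X}"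
  then show "X * Y \<in> {X \<in> corner n. \<forall>Y\<in>S. X * Y = Y * X}"
    by (auto simp: corner_intros) (metis mult.assoc)
next
  fix X assume X: "X \<in> {X \<in> corner n. \<forall>Y\<in>S. X * Y = Y * X}"
  have "X\<^sup>\<dagger> * Y = Y * X\<^sup>\<dagger>" if "Y \<in> S" for Y
  proof -
    have "X * Y\<^sup>\<dagger> = Y\<^sup>\<dagger> * X" using X assms(1)[OF that] by auto
    then have "(X * Y\<^sup>\<dagger>)\<^sup>\<dagger> = (Y\<^sup>\<dagger> * X)\<^sup>\<dagger>" by simp
    then show ?thesis by simp
  qed
  then show "X\<^sup>\<dagger> \<in> {X \<in> corner n. \<forall>Y\<in>S. X * Y = Y * X}" using X by (auto simp: corner_intros)
qed (use assms(2) in \<open>auto simp: corner_intros algebra_simps idm_times times_idm subset_iff\<close>)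

text \<open>
  Polarization within \<open>N\<close>: it is enough to test with elements of \<open>N\<close>, because \<open>A\<^sup>\<dagger> - A\<close> is one of them.
\<close>

lemma herm_by_star_alg:
  assumes N: "star_alg n N" "A \<in> N" and re: "\<And>Y. Y \<in> N \<Longrightarrow> tr (Y\<^sup>\<dagger> * A * Y) \<in> \<real>"
  shows "A\<^sup>\<dagger> = A"
proof -
  note Nd = star_algD[OF N(1)]
  define D where "D = A\<^sup>\<dagger> - A"
  have DN: "D \<in> N" unfolding D_def by (intro Nd N(2))
  have z: "tr (B\<^sup>\<dagger> * D * B) = 0" if "B \<in> N" for B
  proof -
    have "tr (B\<^sup>\<dagger> * A\<^sup>\<dagger> * B) = tr ((B\<^sup>\<dagger> * A * B)\<^sup>\<dagger>)" by (simp add: mult.assoc)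
    also have "\<dots> = tr (B\<^sup>\<dagger> * A * B)" using re[OF that] by (simp only: tr_simps Reals_cnj_iff)
    finally show ?thesis by (simp add: D_def algebra_simps)
  qed
  have pol: "tr (B\<^sup>\<dagger> * D * C) = 0" if BC: "B \<in> N" "C \<in> N" for B C
  proof -
    have "tr (B\<^sup>\<dagger> * D * C) + tr (C\<^sup>\<dagger> * D * B) = 0"
      using z[OF Nd(3)[OF BC]] z[OF BC(1)] z[OF BC(2)] by (simp add: algebra_simps)
    moreover have "\<i> * tr (B\<^sup>\<dagger> * D * C) - \<i> * tr (C\<^sup>\<dagger> * D * B) = 0"
      using z[OF Nd(3)[OF BC(1) Nd(4)[OF BC(2), of \<i>]]] z[OF BC(1)] z[OF BC(2)] by (simp add: algebra_simps)
    then have "\<i> * (tr (B\<^sup>\<dagger> * D * C) - tr (C\<^sup>\<dagger> * D * B)) = 0" by (simp add: algebra_simps)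
    then have "tr (B\<^sup>\<dagger> * D * C) - tr (C\<^sup>\<dagger> * D * B) = 0" by (metis complex_i_not_zero mult_eq_0_iff)
    ultimately show ?thesis by simp
  qed
  have "tr (D\<^sup>\<dagger> * D) = 0" using pol[OF DN Nd(2)] Nd(12)[OF DN] by (simp add: mult.assoc times_idm)
  then have "D = 0" by (simp only: tr_adj_self_eq_0)
  then show ?thesis by (simp add: D_def)
qed

lemma nonneg_real: "0 \<le> z \<Longrightarrow> z \<in> \<real>" for z :: complex
  by (simp add: less_eq_complex_def complex_is_Real_iff)

lemma pos_herm: "pos A \<Longrightarrow> A\<^sup>\<dagger> = A"
  using ex_corner[of A] herm_by_star_alg[OF star_alg_corner] posD nonneg_real by metis

definition spectral_family :: "nat \<Rightarrow> fmat set \<Rightarrow> fmat \<Rightarrow> real set \<Rightarrow> (real \<Rightarrow> fmat) \<Rightarrow> bool" where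
  "spectral_family n N A L E \<longleftrightarrow> finite L \<and> (\<forall>l\<in>L. E l \<in> N \<and> (E l)\<^sup>\<dagger> = E l \<and> E l \<noteq> 0 \<and>
     A * E l = of_real l *\<^sub>C E l) \<and> (\<forall>l\<in>L. \<forall>m\<in>L. E l * E m = (if l = m then E l else 0)) \<and>
     (\<Sum>l\<in>L. E l) = idm n"

lemma spectral_familyD:
  assumes "spectral_family n N A L E"
  shows "finite L" "\<And>l. l \<in> L \<Longrightarrow> E l \<in> N" "\<And>l. l \<in> L \<Longrightarrow> (E l)\<^sup>\<dagger> = E l" "\<And>l. l \<in> L \<Longrightarrow> E l \<noteq> 0"
    "\<And>l. l \<in> L \<Longrightarrow> A * E l = of_real l *\<^sub>C E l"
    "\<And>l m. l \<in> L \<Longrightarrow> m \<in> L \<Longrightarrow> E l * E m = (if l = m then E l else 0)"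
    "(\<Sum>l\<in>L. E l) = idm n"
  using assms by (auto simp: spectral_family_def)

text \<open>
  The spectral projections of \<open>A\<close> lie in \<open>N\<close>. The set \<open>J x\<close> of all \<open>X \<in> N\<close> with \<open>A * X = x *\<^sub>C X\<close> is a
  right ideal of \<open>N\<close>, so the projection onto it is left multiplication by an element \<open>E x\<close>, which has
  to be a hermitian idempotent. If the \<open>E x\<close> did not add up to \<open>idm n\<close>, the set of all \<open>X \<in> N\<close> fixed by
  the complementary projection \<open>f\<close> would contain an eigenvector of \<open>A\<close>, which some \<open>E x\<close> fixes as well.
\<close>

lemma spectral_resolution:
  assumes N: "star_alg n N" and A: "A \<in> N" "A\<^sup>\<dagger> = A"
  shows "\<exists>L E. spectral_family n N A L E"
proof -
  note Nd = star_algD[OF N]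
  have Ac: "A \<in> corner n" using A(1) Nd(1) by auto
  obtain w :: "nat \<Rightarrow> fmat" and l :: "nat \<Rightarrow> real" where w: "\<And>i. i < n \<Longrightarrow> A * w i = of_real (l i) *\<^sub>C w i"
    "(\<Sum>i<n. w i * (w i)\<^sup>\<dagger>) = idm n"
    using herm_eigenbasis[OF Ac A(2)] by metis
  define J where "J x = {X \<in> N. A * X = complex_of_real x *\<^sub>C X}" for x
  define E where "E x = hs_proj (J x) (idm n)" for x
  have Jc: "J x \<subseteq> corner n" for x using Nd(1) by (auto simp: J_def)
  have Js: "fmat.subspace (J x)" for x
    by (auto simp: J_def fmat.subspace_def Nd distrib_left mult.commute)
  have JX: "Y * X \<in> J x" if "Y \<in> J x" "X \<in> N" for X Y x
    using that by (auto simp: J_def Nd simp flip: mult.assoc)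
  have EJ: "E x \<in> J x" for x unfolding E_def by (rule hs_proj_exists(1)[OF Js Jc])
  then have EN: "E x \<in> N" and AE: "A * E x = complex_of_real x *\<^sub>C E x" for x by (auto simp: J_def)
  have projE: "hs_proj (J x) X = E x * X" if X: "X \<in> N" for x X
  proof (rule hs_proj_eqI[OF Js Jc JX[OF EJ X]])
    fix Z assume "Z \<in> J x"
    then have "Z * X\<^sup>\<dagger> \<in> J x" using JX Nd(6) X by blast
    then have "tr ((Z * X\<^sup>\<dagger>)\<^sup>\<dagger> * (idm n - E x)) = 0"
      unfolding E_def by (rule hs_proj_exists(2)[OF Js Jc])
    then have "tr (X * (Z\<^sup>\<dagger> * (idm n - E x))) = 0" by (simp add: mult.assoc)
    then have "tr (Z\<^sup>\<dagger> * (idm n - E x) * X) = 0" by (simp add: tr_comm[of X])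
    moreover have "idm n * X = X" using X Nd(1) idm_times by auto
    then have "Z\<^sup>\<dagger> * (idm n - E x) * X = Z\<^sup>\<dagger> * (X - E x * X)" by (simp only: mult.assoc left_diff_distrib)
    ultimately show "tr (Z\<^sup>\<dagger> * (X - E x * X)) = 0" by simp
  qed
  have EX: "E x * X = X" if "X \<in> J x" for x X
    using projE[of X x] hs_proj_id[OF Js Jc that] that by (auto simp: J_def)
  have Eh: "(E x)\<^sup>\<dagger> = E x" for x
  proof -
    define D where "D = (E x)\<^sup>\<dagger> - E x"
    have D: "D \<in> N" using EN Nd by (auto simp: D_def)
    have "tr ((E x * D)\<^sup>\<dagger> * idm n) = tr (D\<^sup>\<dagger> * (E x * idm n))"
      using hs_proj_sym[OF Js Jc, of x D "idm n"] projE D Nd(2) by simp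
    then have "tr (D\<^sup>\<dagger> * (E x)\<^sup>\<dagger> * idm n) = tr (D\<^sup>\<dagger> * (E x * idm n))" by simp
    moreover have "(E x)\<^sup>\<dagger> * idm n = (E x)\<^sup>\<dagger>" "E x * idm n = E x" using EN Nd(1,6) times_idm by blast+
    ultimately have "tr (D\<^sup>\<dagger> * ((E x)\<^sup>\<dagger> - E x)) = 0" by (simp only: mult.assoc right_diff_distrib tr_simps) simp
    then have "tr (D\<^sup>\<dagger> * D) = 0" by (simp only: D_def[symmetric])
    then have "D = 0" by (simp only: tr_adj_self_eq_0)
    then show ?thesis by (simp add: D_def)
  qed
  have EA: "E x * A = complex_of_real x *\<^sub>C E x" for x
    using arg_cong[OF AE[of x], of adj] by (simp add: Eh A(2))
  have EE: "E x * E y = (if x = y then E x else 0)" for x y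
  proof (cases "x = y")
    case True then show ?thesis using EX[OF EJ] by simp
  next
    case False
    have "complex_of_real x *\<^sub>C (E x * E y) = (E x * A) * E y" by (simp add: EA)
    also have "\<dots> = complex_of_real y *\<^sub>C (E x * E y)" by (simp add: mult.assoc AE)
    finally have "(complex_of_real x - complex_of_real y) *\<^sub>C (E x * E y) = 0" by (simp add: cscale_diff_left)
    then show ?thesis using False by simp
  qed
  (* All eigenvalues occur in the eigenbasis w, so there are finitely many of them. *)
  have ev: "x \<in> l ` {..<n}" if X: "A * X = complex_of_real x *\<^sub>C X" "X \<noteq> 0" "X \<in> corner n" for X x
  proof (rule ccontr)
    assume x: "x \<notin> l ` {..<n}"
    have "(w i)\<^sup>\<dagger> * X = 0" if i: "i < n" for i
    proof -
      have "(w i)\<^sup>\<dagger> * A = complex_of_real (l i) *\<^sub>C (w i)\<^sup>\<dagger>"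
        using arg_cong[OF w(1)[OF i], of adj] by (simp add: A(2))
      then have "complex_of_real (l i) *\<^sub>C ((w i)\<^sup>\<dagger> * X) = (w i)\<^sup>\<dagger> * (A * X)" by (simp flip: mult.assoc)
      also have "\<dots> = complex_of_real x *\<^sub>C ((w i)\<^sup>\<dagger> * X)" by (simp add: X(1))
      finally have "(complex_of_real (l i) - complex_of_real x) *\<^sub>C ((w i)\<^sup>\<dagger> * X) = 0" by (simp add: cscale_diff_left)
      then show ?thesis using x i by auto
    qed
    then have "idm n * X = 0" by (simp add: w(2)[symmetric] sum_distrib_right mult.assoc)
    then show False using X(2,3) by (simp add: idm_times)
  qed
  define L where "L = {x \<in> l ` {..<n}. E x \<noteq> 0}"
  have fL: "finite L" by (simp add: L_def)
  define f where "f = idm n - sum E L"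
  have fN: "f \<in> N" by (auto simp: f_def intro!: Nd EN)
  have fE: "f * E x = 0" if "x \<in> L" for x
  proof -
    have "sum E L * E x = (\<Sum>y\<in>L. if y = x then E x else 0)" by (auto simp: sum_distrib_right EE intro!: sum.cong)
    then show ?thesis using that fL EN[of x] Nd(1) by (auto simp: f_def left_diff_distrib idm_times)
  qed
  have "f = 0"
  proof (rule ccontr)
    assume f0: "f \<noteq> 0"
    have ff: "f * f = f"
    proof -
      have "f * f = f * idm n - (\<Sum>x\<in>L. f * E x)" by (simp add: f_def right_diff_distrib sum_distrib_left)
      then show ?thesis using fE fN Nd(1) by (auto simp: times_idm)
    qed
    have fA: "f * A = A * f"
      using Ac by (simp add: f_def left_diff_distrib right_diff_distrib sum_distrib_left sum_distrib_right AE EA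
          idm_times times_idm)
    define V where "V = {X \<in> N. f * X = X}"
    have "\<exists>y \<mu>. y \<in> V \<and> y \<noteq> 0 \<and> A * y = \<mu> *\<^sub>C y"
    proof (rule eigenvector_exists[of V n f])
      show "fmat.subspace V" by (auto simp: V_def fmat.subspace_def Nd distrib_left)
      show "V \<subseteq> corner n" using Nd(1) by (auto simp: V_def)
      show "f \<in> V" using fN ff by (simp add: V_def)
      fix y assume "y \<in> V"
      moreover have "f * (A * y) = A * (f * y)" by (metis mult.assoc fA)
      ultimately show "A * y \<in> V" unfolding V_def using A(1) Nd(5) by auto
    qed (auto simp: distrib_left f0)
    then obtain y \<mu> where y: "y \<in> N" "f * y = y" "y \<noteq> 0" "A * y = \<mu> *\<^sub>C y" by (auto simp: V_def)
    define x where "x = Re \<mu>"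
    have mu: "\<mu> = of_real x" unfolding x_def using herm_eigenvalue_real[OF A(2) y(4) y(3)] .
    have "y \<in> J x" using y mu by (simp add: J_def)
    then have Ey: "E x * y = y" by (rule EX)
    then have "E x \<noteq> 0" using y(3) by auto
    moreover have "x \<in> l ` {..<n}" using ev[of y x] y mu Nd(1) by auto
    ultimately have "x \<in> L" by (simp add: L_def)
    then have "f * (E x * y) = 0" using fE by (simp flip: mult.assoc)
    then show False using Ey y by simp
  qed
  then have "(\<Sum>x\<in>L. E x) = idm n" by (simp add: f_def)
  then have "spectral_family n N A L E" using fL EN Eh AE EE by (auto simp: spectral_family_def L_def)
  then show ?thesis by blast
qed

text \<open>
  Positivity is tested with elements of \<open>N\<close> only; this decides the signs of the eigenvalues because
  the spectral projections are in \<open>N\<close>.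
\<close>

lemma sqrt_in_star_alg:
  assumes N: "star_alg n N" and AN: "A \<in> N" and nn: "\<And>Y. Y \<in> N \<Longrightarrow> 0 \<le> tr (Y\<^sup>\<dagger> * A * Y)"
  obtains R where "R \<in> N" "pos R" "R * R = A"
proof -
  note Nd = star_algD[OF N]
  have A: "A \<in> N" "A\<^sup>\<dagger> = A" using AN herm_by_star_alg[OF N AN] nn nonneg_real by blast+
  obtain L E where LE: "spectral_family n N A L E"
    using spectral_resolution[OF N A] by blast
  note E = spectral_familyD[OF LE]
  have l0: "0 \<le> l" if "l \<in> L" for l
  proof -
    have "tr ((E l)\<^sup>\<dagger> * A * E l) = of_real l * tr ((E l)\<^sup>\<dagger> * E l)" using E(5)[OF that] by (simp add: mult.assoc)
    then have "0 \<le> of_real l * tr ((E l)\<^sup>\<dagger> * E l)" using nn[OF E(2)[OF that]] by simp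
    moreover have "0 \<le> tr ((E l)\<^sup>\<dagger> * E l)" "tr ((E l)\<^sup>\<dagger> * E l) \<noteq> 0" using E(4)[OF that] by (simp_all add: tr_adj_self_nonneg)
    ultimately show ?thesis by (auto simp: less_eq_complex_def complex_eq_iff zero_le_mult_iff)
  qed
  define R where "R = (\<Sum>l\<in>L. complex_of_real (sqrt l) *\<^sub>C E l)"
  have "R \<in> N" unfolding R_def by (intro Nd E)
  moreover have "pos R"
    unfolding R_def
  proof (rule pos_sum, rule pos_cscale)
    fix l assume l: "l \<in> L"
    have "pos ((E l)\<^sup>\<dagger> * E l)" by (rule pos_adj_self)
    then show "pos (E l)" using E(3,6) l by simp
    show "0 \<le> complex_of_real (sqrt l)" using l0[OF l] by (simp add: less_eq_complex_def)
  qed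
  moreover have "R * R = A"
  proof -
    have "R * R = (\<Sum>l\<in>L. \<Sum>m\<in>L. (complex_of_real (sqrt l) *\<^sub>C E l) * (complex_of_real (sqrt m) *\<^sub>C E m))"
      unfolding R_def by (rule sum_product)
    also have "\<dots> = (\<Sum>l\<in>L. \<Sum>m\<in>L. if m = l then of_real l *\<^sub>C E l else 0)"
    proof (intro sum.cong refl)
      fix l m assume lm: "l \<in> L" "m \<in> L"
      have "complex_of_real (sqrt l) * complex_of_real (sqrt l) = of_real l"
        using l0[OF lm(1)] by (metis abs_of_nonneg of_real_mult real_sqrt_mult_self)
      then show "(complex_of_real (sqrt l) *\<^sub>C E l) * (complex_of_real (sqrt m) *\<^sub>C E m) =
          (if m = l then of_real l *\<^sub>C E l else 0)"
        using E(6)[OF lm] by simp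
    qed
    also have "\<dots> = (\<Sum>l\<in>L. A * E l)" using E(1,5) by simp
    also have "\<dots> = A * idm n" by (simp add: E(7) flip: sum_distrib_left)
    finally show ?thesis using A(1) Nd(1) by (auto simp: times_idm)
  qed
  ultimately show thesis by (rule that)
qed

text \<open>
  Injectivity on \<open>N\<close> excludes the eigenvalue 0, whose spectral projection would be in \<open>N\<close>.
\<close>

lemma inverse_in_star_alg:
  assumes N: "star_alg n N" and A: "A \<in> N" "A\<^sup>\<dagger> = A" and inj: "\<And>X. X \<in> N \<Longrightarrow> A * X = 0 \<Longrightarrow> X = 0"
  obtains B where "B \<in> N" "B * A = idm n" "A * B = idm n" "B\<^sup>\<dagger> = B"
proof -
  note Nd = star_algD[OF N]
  obtain L E where LE: "spectral_family n N A L E"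
    using spectral_resolution[OF N A] by blast
  note E = spectral_familyD[OF LE]
  have l0: "l \<noteq> 0" if "l \<in> L" for l using inj[OF E(2)[OF that]] E(4,5)[OF that] by auto
  define B where "B = (\<Sum>l\<in>L. complex_of_real (1 / l) *\<^sub>C E l)"
  have B: "B \<in> N" unfolding B_def by (intro Nd E)
  have Bh: "B\<^sup>\<dagger> = B" by (simp add: B_def E(3))
  have AB: "A * B = idm n" using l0 by (simp add: B_def sum_distrib_left E(5,7))
  have "B * A = (A * B)\<^sup>\<dagger>" using A(2) Bh by simp
  then have "B * A = idm n" by (simp add: AB)
  then show thesis using that B AB Bh by blast
qed

lemma pos_mult_eq_0:
  assumes "pos A" "tr (D\<^sup>\<dagger> * A * D) = 0"
  shows "A * D = 0"
proof -
  obtain n where n: "A \<in> corner n" using ex_corner by blast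
  obtain R where R: "pos R" "R * R = A"
    using sqrt_in_star_alg[OF star_alg_corner n] posD[OF assms(1)] by metis
  have "(R * D)\<^sup>\<dagger> * (R * D) = D\<^sup>\<dagger> * (R * R) * D" by (simp add: pos_herm[OF R(1)] mult.assoc)
  then have "tr ((R * D)\<^sup>\<dagger> * (R * D)) = 0" using assms(2) R(2) by simp
  then have "R * D = 0" by (simp only: tr_adj_self_eq_0)
  then show ?thesis using R(2) by (metis mult.assoc mult_zero_right)
qed

text \<open>
  For \<open>D = B - S\<close> the equation \<open>B\<^sup>2 = S\<^sup>2\<close> says \<open>D (B + S) + (B + S) D = 0\<close>. Multiplying by \<open>D\<close> and taking
  the trace gives \<open>tr (D B D) + tr (D S D) = 0\<close>, so \<open>B D\<close>, \<open>S D\<close> and finally \<open>D\<^sup>2\<close> vanish.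
\<close>

lemma pos_sqrt_unique:
  assumes B: "pos B" "pos S" "B * B = S * S"
  shows "B = S"
proof -
  define D where "D = B - S"
  have Dh: "D\<^sup>\<dagger> = D" using B by (simp add: D_def pos_herm)
  have "D * (B + S) + (B + S) * D = 0" using B(3) by (simp add: D_def algebra_simps)
  then have "tr (D * (D * (B + S)) + D * ((B + S) * D)) = 0" by (simp flip: distrib_left)
  then have "tr (D * (D * (B + S))) + tr (D * ((B + S) * D)) = 0" by simp
  moreover have "tr (D * (D * (B + S))) = tr (D * ((B + S) * D))" by (metis mult.assoc tr_comm)
  ultimately have "tr (D * ((B + S) * D)) = 0" by simp
  then have "tr (D\<^sup>\<dagger> * B * D) + tr (D\<^sup>\<dagger> * S * D) = 0" by (simp add: Dh algebra_simps)
  moreover have "0 \<le> tr (D\<^sup>\<dagger> * B * D)" "0 \<le> tr (D\<^sup>\<dagger> * S * D)" using B posD by auto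
  ultimately have "tr (D\<^sup>\<dagger> * B * D) = 0" "tr (D\<^sup>\<dagger> * S * D) = 0" by (auto simp: less_eq_complex_def complex_eq_iff)
  then have "B * D = 0" "S * D = 0" using B pos_mult_eq_0 by auto
  then have "D * D = 0" by (simp add: D_def left_diff_distrib)
  then have "tr (D\<^sup>\<dagger> * D) = 0" by (simp add: Dh)
  then have "D = 0" by (simp only: tr_adj_self_eq_0)
  then show ?thesis by (simp add: D_def)
qed

section \<open>Block decompositions\<close>

text \<open>
  The isometry of \<open>\<complex>\<^sup>n\<close> onto the \<open>i\<close>-th block of \<open>\<complex>\<^sup>k \<otimes> \<complex>\<^sup>n\<close>. It is independent of \<open>k\<close>, which enters only
  through the relation \<open>sum_blk\<close>.
\<close>

definition blk :: "nat \<Rightarrow> nat \<Rightarrow> fmat" where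
  "blk n i = (\<Sum>a<n. munit (i * n + a) a)"

lemma block_index_eq_iff: "a < n \<Longrightarrow> b < n \<Longrightarrow> i * n + a = j * n + b \<longleftrightarrow> i = j \<and> a = (b::nat)"
  by (metis div_mult_self3 div_less add.commute add_cancel_right_left mod_less mod_mult_self3 not_less_zero)

lemma blk_adj_blk: "(blk n i)\<^sup>\<dagger> * blk n j = (if i = j then idm n else 0)"
proof -
  have "(blk n i)\<^sup>\<dagger> * blk n j = (\<Sum>a<n. \<Sum>b<n. if i = j \<and> a = b then munit a b else 0)"
    unfolding blk_def adj_sum sum_product by (intro sum.cong refl) (auto simp: block_index_eq_iff)
  also have "\<dots> = (\<Sum>a<n. if i = j then munit a a else 0)"
    by (intro sum.cong refl) (auto simp: sum.delta)
  finally show ?thesis by (simp add: idm_eq)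
qed

lemma sum_blk: "(\<Sum>i<k. blk n i * (blk n i)\<^sup>\<dagger>) = idm (k * n)"
proof -
  have "blk n i * (blk n i)\<^sup>\<dagger> = sum (\<lambda>p. munit p p) {i * n..<i * n + n}" for i
  proof -
    have "blk n i * (blk n i)\<^sup>\<dagger> = (\<Sum>a<n. \<Sum>b<n. if b = a then munit (i * n + a) (i * n + a) else 0)"
      unfolding blk_def adj_sum sum_product by (intro sum.cong refl) auto
    also have "\<dots> = (\<Sum>a<n. munit (a + i * n) (a + i * n))" by (simp add: add.commute)
    also have "\<dots> = sum (\<lambda>p. munit p p) {0 + i * n..<n + i * n}"
      by (subst sum.shift_bounds_nat_ivl) (simp add: lessThan_atLeast0)
    finally show ?thesis by (simp add: add.commute)
  qed
  then show ?thesis unfolding idm_eq by (simp add: sum.nat_group)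
qed

lemma blk_idm: "blk n i * idm n = blk n i"
  unfolding blk_def sum_distrib_right by (intro sum.cong refl) (simp add: idm_eq sum_distrib_left)

lemma idm_blk_adj: "idm n * (blk n i)\<^sup>\<dagger> = (blk n i)\<^sup>\<dagger>"
  using arg_cong[OF blk_idm[of n i], of adj] by simp

lemma blk_corner: "i < k \<Longrightarrow> blk n i \<in> corner (k * n)"
  unfolding blk_def
proof (intro corner_sum munit_corner)
  fix a assume a: "i < k" "a \<in> {..<n}"
  then have "Suc i * n \<le> k * n" by (intro mult_le_mono1) auto
  then show "i * n + a < k * n" using a by auto
  have "1 * n \<le> k * n" using a(1) by (intro mult_le_mono1) linarith
  then show "a < k * n" using a(2) by (simp add: less_le_trans)
qed

lemma blk_compress_corner: "(blk n i)\<^sup>\<dagger> * Z * blk n j \<in> corner n"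
  unfolding corner_iff by (metis blk_idm idm_blk_adj mult.assoc)

lemma blk_expand_corner: "i < k \<Longrightarrow> j < k \<Longrightarrow> blk n i * X * (blk n j)\<^sup>\<dagger> \<in> corner (k * n)"
  by (intro corner_sandwich adj_corner blk_corner)

lemma array_corner: "(\<Sum>i<k. \<Sum>j<k. blk n i * Y i j * (blk n j)\<^sup>\<dagger>) \<in> corner (k * n)"
  by (intro corner_sum blk_expand_corner) auto

lemma compress_array:
  assumes "\<And>i j. i < k \<Longrightarrow> j < k \<Longrightarrow> Y i j \<in> corner n" "i < k" "j < k"
  shows "(blk n i)\<^sup>\<dagger> * (\<Sum>i<k. \<Sum>j<k. blk n i * Y i j * (blk n j)\<^sup>\<dagger>) * blk n j = Y i j"
proof -
  have "(blk n i)\<^sup>\<dagger> * (\<Sum>i<k. \<Sum>j<k. blk n i * Y i j * (blk n j)\<^sup>\<dagger>) * blk n j =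
      (\<Sum>a<k. \<Sum>b<k. ((blk n i)\<^sup>\<dagger> * blk n a) * Y a b * ((blk n b)\<^sup>\<dagger> * blk n j))"
    by (simp add: sum_distrib_left sum_distrib_right mult.assoc)
  also have "\<dots> = (\<Sum>a<k. \<Sum>b<k. if b = j then (if a = i then Y i j else 0) else 0)"
    by (intro sum.cong refl) (use assms(1) in \<open>auto simp: blk_adj_blk idm_times times_idm\<close>)
  finally show ?thesis using assms by simp
qed

lemma blk_decompose:
  assumes "Z \<in> corner (k * n)"
  shows "Z = (\<Sum>i<k. \<Sum>j<k. blk n i * ((blk n i)\<^sup>\<dagger> * Z * blk n j) * (blk n j)\<^sup>\<dagger>)"
proof -
  have "Z = idm (k * n) * Z * idm (k * n)" using assms corner_iff by simp
  also have "\<dots> = (\<Sum>i<k. blk n i * (blk n i)\<^sup>\<dagger> * Z) * (\<Sum>j<k. blk n j * (blk n j)\<^sup>\<dagger>)"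
    unfolding sum_blk[symmetric] by (simp only: sum_distrib_right)
  finally show ?thesis by (simp add: sum_product mult.assoc)
qed

lemma blk_product:
  assumes "X \<in> corner (k * n)"
  shows "(blk n i)\<^sup>\<dagger> * (X * Y) * blk n j = (\<Sum>l<k. ((blk n i)\<^sup>\<dagger> * X * blk n l) * ((blk n l)\<^sup>\<dagger> * Y * blk n j))"
proof -
  have "X * Y = X * idm (k * n) * Y" using assms times_idm by simp
  also have "\<dots> = (\<Sum>l<k. X * blk n l * (blk n l)\<^sup>\<dagger> * Y)"
    unfolding sum_blk[symmetric] by (simp add: sum_distrib_left sum_distrib_right mult.assoc)
  finally show ?thesis by (simp add: sum_distrib_left sum_distrib_right mult.assoc)
qed

text \<open>
  The algebra \<open>M\<^sub>k(M)\<close> of \<open>k\<close> by \<open>k\<close> matrices over \<open>M\<close>.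
\<close>

definition block_alg :: "nat \<Rightarrow> nat \<Rightarrow> fmat set \<Rightarrow> fmat set" where
  "block_alg k n M = {Z \<in> corner (k * n). \<forall>i<k. \<forall>j<k. (blk n i)\<^sup>\<dagger> * Z * blk n j \<in> M}"

lemma star_alg_block_alg:
  assumes M: "star_alg n M"
  shows "star_alg (k * n) (block_alg k n M)"
  unfolding star_alg_def
proof (intro conjI ballI allI)
  note Md = star_algD[OF M]
  show "idm (k * n) \<in> block_alg k n M"
  proof -
    have "(blk n i)\<^sup>\<dagger> * idm (k * n) * blk n j \<in> M" if "i < k" "j < k" for i j
      using idm_times[OF blk_corner[OF that(2)], of n] by (simp add: mult.assoc blk_adj_blk Md)
    then show ?thesis by (auto simp: block_alg_def)
  qed
  fix X assume X: "X \<in> block_alg k n M"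
  have e: "(blk n i)\<^sup>\<dagger> * X\<^sup>\<dagger> * blk n j = ((blk n j)\<^sup>\<dagger> * X * blk n i)\<^sup>\<dagger>" for i j by (simp add: mult.assoc)
  then show "X\<^sup>\<dagger> \<in> block_alg k n M" using X by (auto simp only: block_alg_def adj_corner e mem_Collect_eq intro!: Md(6))
  fix Y assume Y: "Y \<in> block_alg k n M"
  show "X * Y \<in> block_alg k n M"
  proof -
    have "(blk n i)\<^sup>\<dagger> * (X * Y) * blk n j \<in> M" if "i < k" "j < k" for i j
    proof -
      have "((blk n i)\<^sup>\<dagger> * X * blk n l) * ((blk n l)\<^sup>\<dagger> * Y * blk n j) \<in> M" if "l < k" for l
        by (rule Md(5)) (use X Y \<open>i < k\<close> \<open>j < k\<close> that in \<open>auto simp: block_alg_def\<close>)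
      moreover have "X \<in> corner (k * n)" using X by (simp add: block_alg_def)
      ultimately show ?thesis by (simp only: blk_product) (intro Md(10), simp)
    qed
    then show ?thesis using X Y by (simp add: block_alg_def corner_times)
  qed
qed (use star_algD[OF M] in \<open>auto simp: block_alg_def corner_intros distrib_left distrib_right\<close>)

text \<open>
  The array \<open>Y\<close> is a positive element \<open>Z\<close> of \<open>M\<^sub>k(M)\<close>, and the entries of its square root in \<open>M\<^sub>k(M)\<close>
  are the required \<open>R l i\<close>. A column of an element of \<open>M\<^sub>k(M)\<close> is a tuple \<open>S\<close> from \<open>M\<close>, so these tuples
  suffice as tests of positivity.
\<close>

lemma gram_factorization:
  fixes k :: nat
  assumes M: "star_alg n M" and Y: "\<And>i j. i < k \<Longrightarrow> j < k \<Longrightarrow> Y i j \<in> M"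
    and nn: "\<And>S. (\<And>i. i < k \<Longrightarrow> S i \<in> M) \<Longrightarrow> 0 \<le> tr (\<Sum>i<k. \<Sum>j<k. (S i)\<^sup>\<dagger> * Y i j * S j)"
  shows "\<exists>R. (\<forall>l<k. \<forall>i<k. R l i \<in> M) \<and> (\<forall>i<k. \<forall>j<k. Y i j = (\<Sum>l<k. (R l i)\<^sup>\<dagger> * R l j))"
proof -
  note Md = star_algD[OF M]
  define Z where "Z = (\<Sum>i<k. \<Sum>j<k. blk n i * Y i j * (blk n j)\<^sup>\<dagger>)"
  have Zc: "Z \<in> corner (k * n)" unfolding Z_def by (rule array_corner)
  have ZY: "(blk n i)\<^sup>\<dagger> * Z * blk n j = Y i j" if ij: "i < k" "j < k" for i j
    unfolding Z_def by (rule compress_array[OF _ ij]) (use Y Md in blast)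
  have Zb: "Z \<in> block_alg k n M" using Zc ZY Y by (auto simp: block_alg_def)
  have nnZ: "0 \<le> tr (S\<^sup>\<dagger> * Z * S)" if S: "S \<in> block_alg k n M" for S
  proof -
    have Sc: "S \<in> corner (k * n)" using S by (simp add: block_alg_def)
    have "tr (S\<^sup>\<dagger> * Z * S) = tr (idm (k * n) * (S\<^sup>\<dagger> * Z * S))"
      using Sc Zc by (simp add: idm_times corner_times adj_corner)
    also have "\<dots> = (\<Sum>m<k. tr ((blk n m)\<^sup>\<dagger> * (S\<^sup>\<dagger> * Z * S) * blk n m))"
      unfolding sum_blk[symmetric] by (simp add: sum_distrib_right mult.assoc tr_comm[of "blk n _"])
    also have "\<dots> = (\<Sum>m<k. tr (\<Sum>i<k. \<Sum>j<k. ((blk n i)\<^sup>\<dagger> * S * blk n m)\<^sup>\<dagger> * Y i j * ((blk n j)\<^sup>\<dagger> * S * blk n m)))"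
    proof (intro sum.cong refl arg_cong[of _ _ tr])
      fix m assume "m \<in> {..<k}"
      have "(blk n m)\<^sup>\<dagger> * (S\<^sup>\<dagger> * Z * S) * blk n m =
          (\<Sum>i<k. \<Sum>j<k. (blk n m)\<^sup>\<dagger> * S\<^sup>\<dagger> * (blk n i * ((blk n i)\<^sup>\<dagger> * Z * blk n j) * (blk n j)\<^sup>\<dagger>) * S * blk n m)"
        by (subst blk_decompose[OF Zc]) (simp add: sum_distrib_left sum_distrib_right mult.assoc)
      also have "\<dots> = (\<Sum>i<k. \<Sum>j<k. (blk n m)\<^sup>\<dagger> * S\<^sup>\<dagger> * (blk n i * Y i j * (blk n j)\<^sup>\<dagger>) * S * blk n m)"
        by (intro sum.cong refl) (simp add: ZY)
      finally show "(blk n m)\<^sup>\<dagger> * (S\<^sup>\<dagger> * Z * S) * blk n m =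
          (\<Sum>i<k. \<Sum>j<k. ((blk n i)\<^sup>\<dagger> * S * blk n m)\<^sup>\<dagger> * Y i j * ((blk n j)\<^sup>\<dagger> * S * blk n m))"
        by (simp add: mult.assoc)
    qed
    also have "0 \<le> \<dots>"
      by (intro sum_nonneg nn) (use S in \<open>auto simp: block_alg_def\<close>)
    finally show ?thesis .
  qed
  obtain R where R: "R \<in> block_alg k n M" "pos R" "R * R = Z"
    using sqrt_in_star_alg[OF star_alg_block_alg[OF M] Zb nnZ] by blast
  have Rc: "R \<in> corner (k * n)" using R(1) by (simp add: block_alg_def)
  let ?R = "\<lambda>l i. (blk n l)\<^sup>\<dagger> * R * blk n i"
  have "Y i j = (\<Sum>l<k. (?R l i)\<^sup>\<dagger> * ?R l j)" if "i < k" "j < k" for i j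
    unfolding ZY[OF that, symmetric] R(3)[symmetric] blk_product[OF Rc]
    by (simp add: pos_herm[OF R(2)] mult.assoc)
  moreover have "?R l i \<in> M" if "l < k" "i < k" for l i using R(1) that by (auto simp: block_alg_def)
  ultimately show ?thesis by (intro exI[of _ ?R]) auto
qed

subsection \<open>Completely positive maps\<close>

text \<open>
  Complete positivity in kernel form: the matrices \<open>\<Phi> ((V i)\<^sup>\<dagger> * V j)\<close> are the entries of a positive
  block matrix, tested with the columns of arbitrary \<open>\<xi> i\<close>. The values of \<open>\<Phi>\<close> may lie outside \<open>M\<close>.
\<close>

definition cp :: "fmat set \<Rightarrow> (fmat \<Rightarrow> fmat) \<Rightarrow> bool" where
  "cp M \<Phi> \<longleftrightarrow> (\<forall>k::nat. \<forall>V \<xi>. (\<forall>i<k. V i \<in> M) \<longrightarrow> pos (\<Sum>i<k. \<Sum>j<k. (\<xi> i)\<^sup>\<dagger> * \<Phi> ((V i)\<^sup>\<dagger> * V j) * \<xi> j))"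

lemma cpD: "cp M \<Phi> \<Longrightarrow> (\<And>i. i < k \<Longrightarrow> V i \<in> M) \<Longrightarrow> pos (\<Sum>i<k. \<Sum>j<k. (\<xi> i)\<^sup>\<dagger> * \<Phi> ((V i)\<^sup>\<dagger> * V j) * \<xi> j)"
  for k :: nat
  by (auto simp: cp_def)

lemma gram_pos: "pos (\<Sum>i<k. \<Sum>j<k. (x i)\<^sup>\<dagger> * x j)" for k :: nat
proof -
  have "(\<Sum>i<k. \<Sum>j<k. (x i)\<^sup>\<dagger> * x j) = (\<Sum>i<k. x i)\<^sup>\<dagger> * (\<Sum>i<k. x i)" by (simp add: sum_product)
  then show ?thesis by (simp only: pos_adj_self)
qed

section \<open>The trace-preserving conditional expectation and the Casimir element of a star algebra\<close>

definition bilinear_on :: "fmat set \<Rightarrow> (fmat \<Rightarrow> fmat \<Rightarrow> fmat) \<Rightarrow> bool" where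
  "bilinear_on M F \<longleftrightarrow>
     (\<forall>A\<in>M. \<forall>A'\<in>M. \<forall>B\<in>M. F (A + A') B = F A B + F A' B) \<and> (\<forall>c. \<forall>A\<in>M. \<forall>B\<in>M. F (c *\<^sub>C A) B = c *\<^sub>C F A B) \<and>
     (\<forall>A\<in>M. \<forall>B\<in>M. \<forall>B'\<in>M. F A (B + B') = F A B + F A B') \<and> (\<forall>c. \<forall>A\<in>M. \<forall>B\<in>M. F A (c *\<^sub>C B) = c *\<^sub>C F A B)"

lemma entry_tr: "tr (munit j i * Y) = entry Y i j"
proof -
  obtain n where n: "munit j i \<in> corner n" "Y \<in> corner n" by (rule ex_corner2)
  have ij: "i < n" "j < n" using corner_entry[OF n(1), of j i] by (auto simp: entry_munit not_le[symmetric])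
  have "tr (munit j i * Y) = (\<Sum>a<n. \<Sum>b<n. if b = i then (if a = j then entry Y i j else 0) else 0)"
    unfolding tr_eq[OF corner_times[OF n]] entry_times[OF disjI1[OF n(1)]]
    by (intro sum.cong refl) (auto simp: entry_munit)
  then show ?thesis using ij by simp
qed

context
  fixes n :: nat and M :: "fmat set"
  assumes M: "star_alg n M"
begin

lemmas Md = star_algD[OF M]

lemmas P_in = hs_proj_exists(1)[OF Md(11) Md(1)]
  and P_id = hs_proj_id[OF Md(11) Md(1)]
  and P_add = hs_proj_add[OF Md(11) Md(1)]
  and P_cscale = hs_proj_cscale[OF Md(11) Md(1)]
  and P_tr = hs_proj_tr[OF Md(11) Md(1)]
  and P_sym = hs_proj_sym[OF Md(11) Md(1)]

lemma P_0: "hs_proj M 0 = 0" by (rule P_id) (rule Md)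

lemma P_diff: "hs_proj M (X - Y) = hs_proj M X - hs_proj M Y"
  using P_add[of X "(-1) *\<^sub>C Y"] P_cscale[of "-1" Y] by simp

lemma P_sum: "hs_proj M (sum f S) = (\<Sum>x\<in>S. hs_proj M (f x))"
  by (induction S rule: infinite_finite_induct) (auto simp: P_0 P_add)

lemma P_eqI: "Y \<in> M \<Longrightarrow> (\<And>Z. Z \<in> M \<Longrightarrow> tr (Z\<^sup>\<dagger> * X) = tr (Z\<^sup>\<dagger> * Y)) \<Longrightarrow> hs_proj M X = Y"
  by (rule hs_proj_eqI[OF Md(11) Md(1)]) (auto simp: right_diff_distrib)

text \<open>
  Multiplication by elements of \<open>M\<close> from either side has its Hilbert--Schmidt adjoint of the same kind,
  and so commutes with the projection onto \<open>M\<close>: the projection is a conditional expectation.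
\<close>

lemma P_bimodule: "A \<in> M \<Longrightarrow> B \<in> M \<Longrightarrow> hs_proj M (A * X * B) = A * hs_proj M X * B"
proof (rule P_eqI)
  fix Z assume *: "A \<in> M" "B \<in> M" "Z \<in> M"
  have "tr (Z\<^sup>\<dagger> * (A * X * B)) = tr ((A\<^sup>\<dagger> * Z * B\<^sup>\<dagger>)\<^sup>\<dagger> * X)" for X
    by (simp add: mult.assoc) (metis mult.assoc tr_comm)
  then show "tr (Z\<^sup>\<dagger> * (A * X * B)) = tr (Z\<^sup>\<dagger> * (A * hs_proj M X * B))"
    using * by (simp only: P_tr Md)
qed (intro Md P_in)

lemma P_left: "A \<in> M \<Longrightarrow> X \<in> corner n \<Longrightarrow> hs_proj M (A * X) = A * hs_proj M X"
  using P_bimodule[of A "idm n" X] P_in[of X] by (simp add: Md times_idm corner_times)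

lemma P_right: "A \<in> M \<Longrightarrow> X \<in> corner n \<Longrightarrow> hs_proj M (X * A) = hs_proj M X * A"
  using P_bimodule[of "idm n" A X] P_in[of X] by (simp add: Md idm_times corner_times)

text \<open>
  Positivity of the array may be tested with tuples from \<open>M\<close>, and against elements of \<open>M\<close> the trace
  does not see the projection.
\<close>

lemma P_gram:
  fixes k :: nat
  shows "\<exists>R. (\<forall>l<k. \<forall>i<k. R l i \<in> M) \<and> (\<forall>i<k. \<forall>j<k. hs_proj M ((V i)\<^sup>\<dagger> * V j) = (\<Sum>l<k. (R l i)\<^sup>\<dagger> * R l j))"
proof (rule gram_factorization[OF M])
  fix S assume S: "\<And>i. i < k \<Longrightarrow> S i \<in> M"
  have e: "tr ((S i)\<^sup>\<dagger> * hs_proj M W * S j) = tr ((S i)\<^sup>\<dagger> * W * S j)" if "i < k" "j < k" for i j W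
  proof -
    have "tr ((S i)\<^sup>\<dagger> * W * S j) = tr ((S i * (S j)\<^sup>\<dagger>)\<^sup>\<dagger> * W)" for W by (simp add: mult.assoc) (metis mult.assoc tr_comm)
    then show ?thesis using S that by (simp only: P_tr Md)
  qed
  have "tr (\<Sum>i<k. \<Sum>j<k. (S i)\<^sup>\<dagger> * hs_proj M ((V i)\<^sup>\<dagger> * V j) * S j) = tr (\<Sum>i<k. \<Sum>j<k. (V i * S i)\<^sup>\<dagger> * (V j * S j))"
    unfolding tr_sum by (intro sum.cong refl) (simp add: e, simp add: mult.assoc)
  also have "\<dots> = tr ((\<Sum>i<k. V i * S i)\<^sup>\<dagger> * (\<Sum>i<k. V i * S i))" unfolding adj_sum sum_product ..
  also have "0 \<le> \<dots>" by (rule tr_adj_self_nonneg)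
  finally show "0 \<le> tr (\<Sum>i<k. \<Sum>j<k. (S i)\<^sup>\<dagger> * hs_proj M ((V i)\<^sup>\<dagger> * V j) * S j)" .
qed (rule P_in)

lemma P_cp: "cp N (hs_proj M)"
  unfolding cp_def
proof (intro allI impI)
  fix k :: nat and V \<xi> :: "nat \<Rightarrow> fmat"
  obtain R where R: "\<And>i j. i < k \<Longrightarrow> j < k \<Longrightarrow> hs_proj M ((V i)\<^sup>\<dagger> * V j) = (\<Sum>l<k. (R l i)\<^sup>\<dagger> * R l j)"
    using P_gram[of k V] by blast
  have "(\<Sum>i<k. \<Sum>j<k. (\<xi> i)\<^sup>\<dagger> * hs_proj M ((V i)\<^sup>\<dagger> * V j) * \<xi> j) = (\<Sum>i<k. \<Sum>j<k. \<Sum>l<k. (R l i * \<xi> i)\<^sup>\<dagger> * (R l j * \<xi> j))"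
    by (intro sum.cong refl) (simp add: R sum_distrib_left sum_distrib_right mult.assoc)
  also have "\<dots> = (\<Sum>l<k. \<Sum>i<k. \<Sum>j<k. (R l i * \<xi> i)\<^sup>\<dagger> * (R l j * \<xi> j))"
    by (subst sum.swap, subst (2) sum.swap, subst sum.swap) (rule sum.cong[OF refl], rule sum.swap)
  also have "pos \<dots>" by (intro pos_sum gram_pos)
  finally show "pos (\<Sum>i<k. \<Sum>j<k. (\<xi> i)\<^sup>\<dagger> * hs_proj M ((V i)\<^sup>\<dagger> * V j) * \<xi> j)" .
qed

text \<open>
  The projections of the matrix units form a Parseval frame of \<open>M\<close>. Unlike an orthonormal basis it
  needs no choice.
\<close>

definition frame :: "nat \<times> nat \<Rightarrow> fmat" where "frame k = hs_proj M (munit (fst k) (snd k))"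
abbreviation "frame_idx \<equiv> {..<n} \<times> {..<n}"

lemma frame_in: "frame k \<in> M" by (simp add: frame_def P_in)

lemma frame_expand:
  assumes Y: "Y \<in> M"
  shows "Y = (\<Sum>k\<in>frame_idx. tr ((frame k)\<^sup>\<dagger> * Y) *\<^sub>C frame k)"
proof -
  have "Y = hs_proj M Y" using P_id[OF Y] by simp
  also have "\<dots> = hs_proj M (\<Sum>i<n. \<Sum>j<n. entry Y i j *\<^sub>C munit i j)" using munit_expand[OF Md(12)[OF Y]] by simp
  also have "\<dots> = (\<Sum>i<n. \<Sum>j<n. entry Y i j *\<^sub>C hs_proj M (munit i j))" by (simp add: P_sum P_cscale)
  also have "\<dots> = (\<Sum>i<n. \<Sum>j<n. tr ((frame (i, j))\<^sup>\<dagger> * Y) *\<^sub>C frame (i, j))"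
  proof (intro sum.cong refl)
    fix i j
    have "tr ((frame (i, j))\<^sup>\<dagger> * Y) = tr ((munit i j)\<^sup>\<dagger> * hs_proj M Y)" by (simp add: frame_def P_sym)
    then have "tr ((frame (i, j))\<^sup>\<dagger> * Y) = entry Y i j" by (simp add: P_id Y entry_tr)
    then show "entry Y i j *\<^sub>C hs_proj M (munit i j) = tr ((frame (i, j))\<^sup>\<dagger> * Y) *\<^sub>C frame (i, j)" by (simp add: frame_def)
  qed
  also have "\<dots> = (\<Sum>k\<in>frame_idx. tr ((frame k)\<^sup>\<dagger> * Y) *\<^sub>C frame k)" by (simp add: sum.cartesian_product)
  finally show ?thesis .
qed

lemma frame_expand_adj:
  assumes Y: "Y \<in> M"
  shows "Y = (\<Sum>k\<in>frame_idx. tr (frame k * Y) *\<^sub>C (frame k)\<^sup>\<dagger>)"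
proof -
  have "Y = (Y\<^sup>\<dagger>)\<^sup>\<dagger>" by simp
  also have "Y\<^sup>\<dagger> = (\<Sum>k\<in>frame_idx. tr ((frame k)\<^sup>\<dagger> * Y\<^sup>\<dagger>) *\<^sub>C frame k)" by (rule frame_expand) (rule Md(6)[OF Y])
  also have "(\<dots>)\<^sup>\<dagger> = (\<Sum>k\<in>frame_idx. cnj (tr ((Y * frame k)\<^sup>\<dagger>)) *\<^sub>C (frame k)\<^sup>\<dagger>)" by simp
  also have "\<dots> = (\<Sum>k\<in>frame_idx. tr (Y * frame k) *\<^sub>C (frame k)\<^sup>\<dagger>)" by (simp only: tr_simps complex_cnj_cnj)
  finally show ?thesis by (simp add: tr_comm[of Y])
qed

lemma bilinear_sum_left:
  assumes "bilinear_on M F" "\<And>x. x \<in> S \<Longrightarrow> f x \<in> M" "B \<in> M" "finite S"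
  shows "F (\<Sum>x\<in>S. c x *\<^sub>C f x) B = (\<Sum>x\<in>S. c x *\<^sub>C F (f x) B)"
  using assms(4,2)
proof (induction S)
  case empty
  have "F (0 *\<^sub>C 0) B = 0 *\<^sub>C F 0 B" using assms(1,3) Md(7) unfolding bilinear_on_def by blast
  then show ?case by simp
next
  case (insert a S)
  have "(\<Sum>x\<in>S. c x *\<^sub>C f x) \<in> M" "f a \<in> M" using insert by (auto intro!: Md)
  then show ?case using insert assms(1,3) Md(4) by (simp add: bilinear_on_def)
qed

lemma bilinear_sum_right:
  assumes "bilinear_on M F" "\<And>x. x \<in> S \<Longrightarrow> f x \<in> M" "B \<in> M" "finite S"
  shows "F B (\<Sum>x\<in>S. c x *\<^sub>C f x) = (\<Sum>x\<in>S. c x *\<^sub>C F B (f x))"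
  using assms(4,2)
proof (induction S)
  case empty
  have "F B (0 *\<^sub>C 0) = 0 *\<^sub>C F B 0" using assms(1,3) Md(7) unfolding bilinear_on_def by blast
  then show ?case by simp
next
  case (insert a S)
  have "(\<Sum>x\<in>S. c x *\<^sub>C f x) \<in> M" "f a \<in> M" using insert by (auto intro!: Md)
  then show ?case using insert assms(1,3) Md(4) by (simp add: bilinear_on_def)
qed

text \<open>
  The tensor \<open>\<Sum> frame k \<otimes> (frame k)\<^sup>\<dagger>\<close> is dual to the bilinear form \<open>tr (A * B)\<close>. A map acting on its first
  leg can therefore be moved to the second leg, where it acts by its transpose for this form. The
  bilinear map \<open>F\<close> stands for an arbitrary linear map on the tensor product.
\<close>

lemma casimir_swap:
  assumes F: "bilinear_on M F" and \<phi>: "\<And>A. A \<in> M \<Longrightarrow> \<phi> A \<in> M" and \<psi>: "\<And>A. A \<in> M \<Longrightarrow> \<psi> A \<in> M"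
    and transpose: "\<And>A B. A \<in> M \<Longrightarrow> B \<in> M \<Longrightarrow> tr (A * \<phi> B) = tr (B * \<psi> A)"
  shows "(\<Sum>k\<in>frame_idx. F (\<phi> (frame k)) ((frame k)\<^sup>\<dagger>)) = (\<Sum>k\<in>frame_idx. F (frame k) (\<psi> ((frame k)\<^sup>\<dagger>)))"
proof -
  have "(\<Sum>k\<in>frame_idx. F (\<phi> (frame k)) ((frame k)\<^sup>\<dagger>)) =
      (\<Sum>k\<in>frame_idx. F (\<Sum>l\<in>frame_idx. tr ((frame l)\<^sup>\<dagger> * \<phi> (frame k)) *\<^sub>C frame l) ((frame k)\<^sup>\<dagger>))"
    by (intro sum.cong refl arg_cong2[of _ _ _ _ F] frame_expand \<phi> frame_in)
  also have "\<dots> = (\<Sum>k\<in>frame_idx. \<Sum>l\<in>frame_idx. tr ((frame l)\<^sup>\<dagger> * \<phi> (frame k)) *\<^sub>C F (frame l) ((frame k)\<^sup>\<dagger>))"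
    by (intro sum.cong refl bilinear_sum_left[OF F] frame_in Md) auto
  also have "\<dots> = (\<Sum>l\<in>frame_idx. \<Sum>k\<in>frame_idx. tr ((frame l)\<^sup>\<dagger> * \<phi> (frame k)) *\<^sub>C F (frame l) ((frame k)\<^sup>\<dagger>))"
    by (rule sum.swap)
  also have "\<dots> = (\<Sum>l\<in>frame_idx. \<Sum>k\<in>frame_idx. tr (frame k * \<psi> ((frame l)\<^sup>\<dagger>)) *\<^sub>C F (frame l) ((frame k)\<^sup>\<dagger>))"
    by (intro sum.cong refl arg_cong2[of _ _ _ _ cscale] transpose frame_in Md)
  also have "\<dots> = (\<Sum>l\<in>frame_idx. F (frame l) (\<Sum>k\<in>frame_idx. tr (frame k * \<psi> ((frame l)\<^sup>\<dagger>)) *\<^sub>C (frame k)\<^sup>\<dagger>))"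
    by (intro sum.cong refl bilinear_sum_right[OF F, symmetric] frame_in Md) auto
  also have "\<dots> = (\<Sum>l\<in>frame_idx. F (frame l) (\<psi> ((frame l)\<^sup>\<dagger>)))"
    by (intro sum.cong refl arg_cong2[of _ _ _ _ F] frame_expand_adj[symmetric] \<psi> frame_in Md)
  finally show ?thesis .
qed

lemma casimir_left:
  assumes F: "bilinear_on M F" and X: "X \<in> M"
  shows "(\<Sum>k\<in>frame_idx. F (X * frame k) ((frame k)\<^sup>\<dagger>)) = (\<Sum>k\<in>frame_idx. F (frame k) ((frame k)\<^sup>\<dagger> * X))"
proof (rule casimir_swap[OF F])
  show "X * A \<in> M" "A * X \<in> M" if "A \<in> M" for A using that X by (auto intro: Md(5))
  show "tr (A * (X * B)) = tr (B * (A * X))" for A B by (metis mult.assoc tr_comm)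
qed

lemma casimir_right:
  assumes F: "bilinear_on M F" and X: "X \<in> M"
  shows "(\<Sum>k\<in>frame_idx. F (frame k * X) ((frame k)\<^sup>\<dagger>)) = (\<Sum>k\<in>frame_idx. F (frame k) (X * (frame k)\<^sup>\<dagger>))"
proof (rule casimir_swap[OF F])
  show "A * X \<in> M" "X * A \<in> M" if "A \<in> M" for A using that X by (auto intro: Md(5))
  show "tr (A * (B * X)) = tr (B * (X * A))" for A B by (metis mult.assoc tr_comm)
qed

definition casimir :: fmat where "casimir = (\<Sum>k\<in>frame_idx. frame k * (frame k)\<^sup>\<dagger>)"

text \<open>
  \<open>casimir\<close> is central by \<open>casimir_left\<close>, and it is injective because \<open>tr (X\<^sup>\<dagger> * casimir * X)\<close> is the sum of
  the square norms of all \<open>(frame k)\<^sup>\<dagger> * X\<close>, while the frame spans \<open>idm n\<close>.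
\<close>

lemma casimir_inverse:
  obtains D where "D \<in> M" "D\<^sup>\<dagger> = D" "D * casimir = idm n" "casimir * D = idm n" "\<And>X. X \<in> M \<Longrightarrow> X * D = D * X"
proof -
  have cM: "casimir \<in> M" unfolding casimir_def by (intro Md frame_in)
  have ch: "casimir\<^sup>\<dagger> = casimir" by (simp add: casimir_def)
  have central: "X * casimir = casimir * X" if X: "X \<in> M" for X
  proof -
    have "bilinear_on M (\<lambda>A B. A * B)" by (auto simp: bilinear_on_def distrib_left distrib_right)
    from casimir_left[OF this X] show ?thesis
      by (simp add: casimir_def sum_distrib_left sum_distrib_right mult.assoc)
  qed
  have "X = 0" if X: "X \<in> M" "casimir * X = 0" for X
  proof -
    have "tr (X\<^sup>\<dagger> * (casimir * X)) = (\<Sum>k\<in>frame_idx. tr (((frame k)\<^sup>\<dagger> * X)\<^sup>\<dagger> * ((frame k)\<^sup>\<dagger> * X)))"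
      by (simp add: casimir_def sum_distrib_left sum_distrib_right mult.assoc)
    then have z: "(\<Sum>k\<in>frame_idx. tr (((frame k)\<^sup>\<dagger> * X)\<^sup>\<dagger> * ((frame k)\<^sup>\<dagger> * X))) = 0" using X(2) by simp
    have "(frame k)\<^sup>\<dagger> * X = 0" if "k \<in> frame_idx" for k
    proof -
      have "tr (((frame k)\<^sup>\<dagger> * X)\<^sup>\<dagger> * ((frame k)\<^sup>\<dagger> * X)) = 0"
        using z that by (subst (asm) sum_nonneg_eq_0_iff) (auto simp only: tr_adj_self_nonneg finite_cartesian_product finite_lessThan)
      then show ?thesis by (simp only: tr_adj_self_eq_0)
    qed
    then have "(\<Sum>k\<in>frame_idx. tr (frame k * idm n) *\<^sub>C (frame k)\<^sup>\<dagger>) * X = 0" by (simp add: sum_distrib_right)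
    then have "idm n * X = 0" using frame_expand_adj[OF Md(2)] by simp
    then show "X = 0" using X(1) by (simp add: idm_times Md)
  qed
  then obtain D where D: "D \<in> M" "D * casimir = idm n" "casimir * D = idm n" "D\<^sup>\<dagger> = D"
    using inverse_in_star_alg[OF M cM ch] by blast
  have "X * D = D * X" if X: "X \<in> M" for X
  proof -
    have "X * D = D * casimir * X * D" using D(2) X by (simp add: idm_times Md)
    also have "\<dots> = D * X * (casimir * D)" by (metis central[OF X] mult.assoc)
    also have "\<dots> = D * X" using D(1,3) X by (simp add: mult.assoc times_idm Md)
    finally show ?thesis .
  qed
  then show thesis using that D by blast
qed

end

section \<open>Exponentials of linear maps on matrix spaces\<close>

definition nrm :: "nat \<Rightarrow> fmat \<Rightarrow> real" where "nrm n X = (\<Sum>i<n. \<Sum>j<n. cmod (entry X i j))"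

lemma nrm_nonneg [simp]: "0 \<le> nrm n X" by (simp add: nrm_def sum_nonneg)
lemma nrm_zero [simp]: "nrm n 0 = 0" by (simp add: nrm_def)
lemma nrm_add: "nrm n (X + Y) \<le> nrm n X + nrm n Y"
  unfolding nrm_def sum.distrib[symmetric] by (intro sum_mono) (simp add: norm_triangle_ineq)
lemma nrm_cscale: "nrm n (c *\<^sub>C X) = cmod c * nrm n X"
  by (simp add: nrm_def norm_mult sum_distrib_left)
lemma nrm_cscale_real: "0 \<le> r \<Longrightarrow> nrm n (of_real r *\<^sub>C X) = r * nrm n X"
  by (simp add: nrm_cscale)
lemma nrm_sum: "nrm n (sum f S) \<le> (\<Sum>x\<in>S. nrm n (f x))"
  by (induction S rule: infinite_finite_induct) (auto intro: order_trans[OF nrm_add])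
lemma entry_le_nrm: "i < n \<Longrightarrow> j < n \<Longrightarrow> cmod (entry X i j) \<le> nrm n X"
proof -
  assume ij: "i < n" "j < n"
  have "cmod (entry X i j) \<le> (\<Sum>j<n. cmod (entry X i j))" using ij by (intro member_le_sum) auto
  also have "\<dots> \<le> nrm n X" unfolding nrm_def using ij by (intro member_le_sum[of i]) (auto intro: sum_nonneg)
  finally show ?thesis .
qed

definition lin_on :: "fmat set \<Rightarrow> (fmat \<Rightarrow> fmat) \<Rightarrow> bool" where
  "lin_on M L \<longleftrightarrow> (\<forall>X\<in>M. L X \<in> M) \<and> (\<forall>X\<in>M. \<forall>Y\<in>M. L (X + Y) = L X + L Y) \<and> (\<forall>c. \<forall>X\<in>M. L (c *\<^sub>C X) = c *\<^sub>C L X)"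

lemma lin_onD:
  assumes "lin_on M L"
  shows "\<And>X. X \<in> M \<Longrightarrow> L X \<in> M" "\<And>X Y. X \<in> M \<Longrightarrow> Y \<in> M \<Longrightarrow> L (X + Y) = L X + L Y"
    "\<And>c X. X \<in> M \<Longrightarrow> L (c *\<^sub>C X) = c *\<^sub>C L X"
  using assms by (auto simp: lin_on_def)

context
  fixes M n L assumes V: "fmat.subspace M" "M \<subseteq> corner n" and L: "lin_on M L"
begin

lemma lin_zero: "L 0 = 0"
  using lin_onD(3)[OF L, of 0 0] V(1) by (simp add: fmat.subspace_0)

lemma lin_minus: "X \<in> M \<Longrightarrow> L (- X) = - L X"
  using lin_onD(3)[OF L, of X "-1"] by simp

lemma lin_diff: "X \<in> M \<Longrightarrow> Y \<in> M \<Longrightarrow> L (X - Y) = L X - L Y"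
  using lin_onD(2)[OF L, of X "- Y"] V(1) by (simp add: lin_minus fmat.subspace_neg)

lemma lin_sum: "(\<And>x. x \<in> S \<Longrightarrow> f x \<in> M) \<Longrightarrow> L (sum f S) = (\<Sum>x\<in>S. L (f x))"
proof (induction S rule: infinite_finite_induct)
  case (insert x S)
  then have "sum f S \<in> M" using V(1) by (intro fmat.subspace_sum) auto
  then show ?case using insert lin_onD(2)[OF L] by simp
qed (simp_all add: lin_zero)

lemma lin_pow: "X \<in> M \<Longrightarrow> (L ^^ k) X \<in> M"
  by (induction k) (auto intro: lin_onD[OF L])

lemma lin_on_pow: "lin_on M (L ^^ k)"
  unfolding lin_on_def
proof (intro conjI ballI allI)
  fix X Y c assume X: "X \<in> M"
  show "(L ^^ k) X \<in> M" by (rule lin_pow[OF X])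
  show "(L ^^ k) (c *\<^sub>C X) = c *\<^sub>C (L ^^ k) X"
    by (induction k) (auto simp: lin_onD(3)[OF L lin_pow[OF X]])
  assume Y: "Y \<in> M"
  show "(L ^^ k) (X + Y) = (L ^^ k) X + (L ^^ k) Y"
    by (induction k) (auto simp: lin_onD(2)[OF L lin_pow[OF X] lin_pow[OF Y]])
qed

lemma lin_bounded: "\<exists>C\<ge>0. \<forall>X\<in>M. nrm n (L X) \<le> C * nrm n X"
proof (intro exI conjI ballI)
  let ?C = "\<Sum>i<n. \<Sum>j<n. nrm n (L (hs_proj M (munit i j)))"
  show "0 \<le> ?C" by (intro sum_nonneg) auto
  fix X assume X: "X \<in> M"
  then have Xc: "X \<in> corner n" using V(2) by auto
  have pM: "hs_proj M Y \<in> M" for Y by (rule hs_proj_exists(1)[OF V])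
  have psum: "hs_proj M (sum f S) = (\<Sum>x\<in>S. hs_proj M (f x))" for f and S :: "nat set"
    by (induction S rule: infinite_finite_induct)
      (auto simp: hs_proj_add[OF V] hs_proj_id[OF V fmat.subspace_0[OF V(1)]])
  have "X = hs_proj M X" using hs_proj_id[OF V X] by simp
  also have "\<dots> = (\<Sum>i<n. \<Sum>j<n. entry X i j *\<^sub>C hs_proj M (munit i j))"
    by (subst munit_expand[OF Xc]) (simp add: psum hs_proj_cscale[OF V])
  finally have "L X = L (\<Sum>i<n. \<Sum>j<n. entry X i j *\<^sub>C hs_proj M (munit i j))" by simp
  also have "\<dots> = (\<Sum>i<n. \<Sum>j<n. entry X i j *\<^sub>C L (hs_proj M (munit i j)))"
    using pM V(1) by (simp add: lin_sum fmat.subspace_sum fmat.subspace_scale lin_onD(3)[OF L])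
  finally have e: "L X = (\<Sum>i<n. \<Sum>j<n. entry X i j *\<^sub>C L (hs_proj M (munit i j)))" .
  have "nrm n (L X) \<le> (\<Sum>i<n. \<Sum>j<n. nrm n (entry X i j *\<^sub>C L (hs_proj M (munit i j))))"
    unfolding e by (rule order_trans[OF nrm_sum]) (intro sum_mono nrm_sum)
  also have "\<dots> \<le> (\<Sum>i<n. \<Sum>j<n. nrm n X * nrm n (L (hs_proj M (munit i j))))"
    unfolding nrm_cscale by (intro sum_mono mult_right_mono entry_le_nrm) auto
  also have "\<dots> = ?C * nrm n X" by (simp add: sum_distrib_left mult.commute)
  finally show "nrm n (L X) \<le> ?C * nrm n X" .
qed

lemma pow_bound:
  assumes "0 \<le> C" "\<And>X. X \<in> M \<Longrightarrow> nrm n (L X) \<le> C * nrm n X" "X \<in> M"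
  shows "nrm n ((L ^^ k) X) \<le> C ^ k * nrm n X"
proof (induction k)
  case (Suc k)
  have "nrm n ((L ^^ Suc k) X) \<le> C * nrm n ((L ^^ k) X)" using assms(2)[OF lin_pow[OF assms(3)]] by simp
  also have "\<dots> \<le> C * (C ^ k * nrm n X)" using Suc assms(1) by (rule mult_left_mono)
  finally show ?case by (simp add: mult.assoc)
qed simp

end

lemma tr_entry_expand: "Z \<in> corner n \<Longrightarrow> tr (B * Z) = (\<Sum>i<n. \<Sum>j<n. tr (B * munit i j) * entry Z i j)"
  by (subst munit_expand, assumption) (simp add: sum_distrib_left mult.commute)

lemma tr_le_nrm:
  assumes "Z \<in> corner n"
  shows "cmod (tr (B * Z)) \<le> (\<Sum>i<n. \<Sum>j<n. cmod (tr (B * munit i j))) * nrm n Z"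
proof -
  have "cmod (tr (B * Z)) \<le> (\<Sum>i<n. \<Sum>j<n. cmod (tr (B * munit i j) * entry Z i j))"
    unfolding tr_entry_expand[OF assms] by (rule order_trans[OF norm_sum]) (intro sum_mono norm_sum)
  also have "\<dots> \<le> (\<Sum>i<n. \<Sum>j<n. cmod (tr (B * munit i j)) * nrm n Z)"
    unfolding norm_mult by (intro sum_mono mult_left_mono entry_le_nrm) auto
  finally show ?thesis by (simp only: sum_distrib_right)
qed

definition tcoef :: "real \<Rightarrow> nat \<Rightarrow> complex" where "tcoef t k = of_real t ^ k / fact k"

lemma tcoef_nonneg: "0 \<le> t \<Longrightarrow> 0 \<le> tcoef t k"
proof -
  assume "0 \<le> t"
  moreover have "tcoef t k = of_real (t ^ k / fact k)" by (simp add: tcoef_def)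
  ultimately show ?thesis by (simp add: less_eq_complex_def del: of_real_divide of_real_power)
qed

lemma tcoef_summable:
  assumes "\<And>k. cmod (a k) \<le> K * C ^ k"
  shows "summable (\<lambda>k. norm (tcoef t k * a k))" "(\<Sum>k. norm (tcoef t k * a k)) \<le> K * exp (\<bar>t\<bar> * C)"
proof -
  have s: "(\<lambda>k. K * ((\<bar>t\<bar> * C) ^ k /\<^sub>R fact k)) sums (K * exp (\<bar>t\<bar> * C))"
    by (intro sums_mult exp_converges)
  have b: "norm (tcoef t k * a k) \<le> K * ((\<bar>t\<bar> * C) ^ k /\<^sub>R fact k)" for k
  proof -
    have "norm (tcoef t k * a k) = \<bar>t\<bar> ^ k / fact k * cmod (a k)"
      by (simp add: tcoef_def norm_mult norm_divide norm_power)
    also have "\<dots> \<le> \<bar>t\<bar> ^ k / fact k * (K * C ^ k)" by (intro mult_left_mono assms) auto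
    finally show ?thesis by (simp add: power_mult_distrib divide_inverse mult_ac)
  qed
  show 1: "summable (\<lambda>k. norm (tcoef t k * a k))"
    by (rule summable_comparison_test'[OF sums_summable[OF s]]) (use b in auto)
  show "(\<Sum>k. norm (tcoef t k * a k)) \<le> K * exp (\<bar>t\<bar> * C)"
    using suminf_le[OF b 1 sums_summable[OF s]] sums_unique[OF s] by simp
qed

definition expo :: "nat \<Rightarrow> (fmat \<Rightarrow> fmat) \<Rightarrow> real \<Rightarrow> fmat \<Rightarrow> fmat" where
  "expo n L t X = (\<Sum>i<n. \<Sum>j<n. (\<Sum>k. tcoef t k * entry ((L ^^ k) X) i j) *\<^sub>C munit i j)"

lemma expo_corner: "expo n L t X \<in> corner n"
  unfolding expo_def by (intro corner_sum corner_cscale munit_corner) auto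

lemma expo_entry: "entry (expo n L t X) i j =
    (if i < n \<and> j < n then \<Sum>k. tcoef t k * entry ((L ^^ k) X) i j else 0)"
proof -
  have e: "c * (if i = a \<and> j = b then 1 else 0) = (if b = j then (if a = i then c else 0) else 0)" for a b and c :: complex
    by auto
  show ?thesis by (cases "j < n") (simp_all add: expo_def entry_munit e)
qed

text \<open>
  Convergence is used in this weak form throughout: a matrix is determined by its traces against
  all \<open>B\<close>, and the series of traces converges absolutely.
\<close>

lemma expo_sums:
  assumes V: "fmat.subspace M" "M \<subseteq> corner n" and L: "lin_on M L" and X: "X \<in> M"
  shows "(\<lambda>k. tcoef t k * tr (B * (L ^^ k) X)) sums tr (B * expo n L t X)"
proof -
  obtain C where C: "0 \<le> C" "\<And>X. X \<in> M \<Longrightarrow> nrm n (L X) \<le> C * nrm n X"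
    using lin_bounded[OF V L] by blast
  have s: "(\<lambda>k. tcoef t k * entry ((L ^^ k) X) i j) sums entry (expo n L t X) i j" if ij: "i < n" "j < n" for i j
  proof -
    have "cmod (entry ((L ^^ k) X) i j) \<le> nrm n X * C ^ k" for k
      using order_trans[OF entry_le_nrm[OF ij] pow_bound[OF V L C X, of k]] by (simp add: mult.commute)
    from tcoef_summable(1)[OF this] show ?thesis
      using ij by (simp add: expo_entry summable_sums summable_norm_cancel)
  qed
  have "(\<lambda>k. \<Sum>i<n. \<Sum>j<n. tr (B * munit i j) * (tcoef t k * entry ((L ^^ k) X) i j)) sums
      (\<Sum>i<n. \<Sum>j<n. tr (B * munit i j) * entry (expo n L t X) i j)"
    by (intro sums_sum sums_mult s) auto
  moreover have "(\<Sum>i<n. \<Sum>j<n. tr (B * munit i j) * (tcoef t k * entry ((L ^^ k) X) i j)) = tcoef t k * tr (B * (L ^^ k) X)" for k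
  proof -
    have c: "(L ^^ k) X \<in> corner n" using lin_pow[OF V L X] V(2) by auto
    show ?thesis
      unfolding tr_entry_expand[OF c] sum_distrib_left by (simp only: mult.left_commute[of "tcoef t k"])
  qed
  ultimately show ?thesis unfolding tr_entry_expand[OF expo_corner] by simp
qed

lemma tr_pow_bound:
  assumes V: "fmat.subspace M" "M \<subseteq> corner n" and L: "lin_on M L"
  shows "\<exists>K C. \<forall>B. \<forall>X\<in>M. \<forall>k. cmod (tr (B * (L ^^ k) X)) \<le> K B X * C ^ k"
proof -
  obtain C where C: "0 \<le> C" "\<And>X. X \<in> M \<Longrightarrow> nrm n (L X) \<le> C * nrm n X"
    using lin_bounded[OF V L] by blast
  let ?K = "\<lambda>B X. (\<Sum>i<n. \<Sum>j<n. cmod (tr (B * munit i j))) * nrm n X"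
  have "cmod (tr (B * (L ^^ k) X)) \<le> ?K B X * C ^ k" if X: "X \<in> M" for B X k
  proof -
    let ?T = "\<Sum>i<n. \<Sum>j<n. cmod (tr (B * munit i j))"
    have c: "(L ^^ k) X \<in> corner n" using lin_pow[OF V L X] V(2) by auto
    have "0 \<le> ?T" by (intro sum_nonneg) auto
    then have "cmod (tr (B * (L ^^ k) X)) \<le> ?T * (C ^ k * nrm n X)"
      by (rule order_trans[OF tr_le_nrm[OF c] mult_left_mono[OF pow_bound[OF V L C X], rotated]])
    also have "\<dots> = (?T * nrm n X) * C ^ k" by (simp only: mult_ac)
    finally show ?thesis .
  qed
  then show ?thesis by (intro exI[of _ ?K] exI[of _ C]) blast
qed

lemma fmat_eq_trI: "(\<And>B. tr (B * X) = tr (B * Y)) \<Longrightarrow> X = Y"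
  by (rule fmat_eqI) (metis entry_tr)

lemma expo_add:
  assumes V: "fmat.subspace M" "M \<subseteq> corner n" and L: "lin_on M L" and X: "X \<in> M" "Y \<in> M"
  shows "expo n L t (X + Y) = expo n L t X + expo n L t Y"
proof (rule fmat_eq_trI)
  fix B
  have XY: "X + Y \<in> M" using V(1) X by (rule fmat.subspace_add)
  note s = expo_sums[OF V L X(1), of t B] expo_sums[OF V L X(2), of t B] expo_sums[OF V L XY, of t B]
  have "(\<lambda>k. tcoef t k * tr (B * (L ^^ k) (X + Y))) = (\<lambda>k. tcoef t k * tr (B * (L ^^ k) X) + tcoef t k * tr (B * (L ^^ k) Y))"
    using lin_onD(2)[OF lin_on_pow[OF V L] X] by (auto simp: fun_eq_iff distrib_left)
  then show "tr (B * expo n L t (X + Y)) = tr (B * (expo n L t X + expo n L t Y))"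
    using sums_unique2[OF s(3)] sums_add[OF s(1,2)] by (simp add: distrib_left)
qed

lemma expo_cscale:
  assumes V: "fmat.subspace M" "M \<subseteq> corner n" and L: "lin_on M L" and X: "X \<in> M"
  shows "expo n L t (c *\<^sub>C X) = c *\<^sub>C expo n L t X"
proof (rule fmat_eq_trI)
  fix B
  have cX: "c *\<^sub>C X \<in> M" using V(1) X by (rule fmat.subspace_scale)
  note s = expo_sums[OF V L X, of t B] expo_sums[OF V L cX, of t B]
  have "(\<lambda>k. tcoef t k * tr (B * (L ^^ k) (c *\<^sub>C X))) = (\<lambda>k. c * (tcoef t k * tr (B * (L ^^ k) X)))"
    using lin_onD(3)[OF lin_on_pow[OF V L] X] by (auto simp: fun_eq_iff)
  then show "tr (B * expo n L t (c *\<^sub>C X)) = tr (B * c *\<^sub>C expo n L t X)"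
    using sums_unique2[OF s(2)] sums_mult[OF s(1), of c] by simp
qed

lemma expo_sum:
  assumes V: "fmat.subspace M" "M \<subseteq> corner n" and L: "lin_on M L" and X: "\<And>x. x \<in> S \<Longrightarrow> f x \<in> M"
  shows "expo n L t (sum f S) = (\<Sum>x\<in>S. expo n L t (f x))"
  using X
proof (induction S rule: infinite_finite_induct)
  case (infinite A)
  then show ?case using expo_cscale[OF V L, of 0 t 0] V(1) by (simp add: fmat.subspace_0)
next
  case empty
  then show ?case using expo_cscale[OF V L, of 0 t 0] V(1) by (simp add: fmat.subspace_0)
next
  case (insert x S)
  have "sum f S \<in> M" using insert V(1) by (intro fmat.subspace_sum) auto
  then show ?case using insert by (simp add: expo_add[OF V L])
qed

subsection \<open>First-order information at time zero\<close>

lemma null_limit: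
  fixes g :: "nat \<Rightarrow> complex"
  assumes "\<And>m. norm (g m) \<le> 1 / real (Suc m) * K"
  shows "g \<longlonglongrightarrow> 0"
proof (rule tendsto_0_le)
  show "(\<lambda>m. 1 / real (Suc m)) \<longlonglongrightarrow> 0" using LIMSEQ_inverse_real_of_nat by (simp add: inverse_eq_divide)
  show "\<forall>\<^sub>F m in sequentially. norm (g m) \<le> norm (1 / real (Suc m)) * K"
    using assms by (intro always_eventually) simp
qed

text \<open>
  The derivative at 0 along the sequence \<open>t = 1 / (m + 1)\<close>; the remainder of the exponential
  series after the linear term is of order \<open>t\<^sup>2\<close>.
\<close>

lemma first_coefficient_limit:
  assumes b: "\<And>k. cmod (a k) \<le> K * C ^ k" and s: "\<And>t. 0 < t \<Longrightarrow> (\<lambda>k. tcoef t k * a k) sums f t" and a0: "a 0 = 0"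
  shows "(\<lambda>m. f (1 / real (Suc m)) * of_nat (Suc m)) \<longlonglongrightarrow> a 1"
proof -
  have b': "cmod (a (Suc k)) \<le> (K * C) * C ^ k" for k using b[of "Suc k"] by (simp add: mult_ac)
  have est: "cmod (f t / of_real t - a 1) \<le> t * (\<bar>K\<bar> * exp \<bar>C\<bar>)" if t: "0 < t" "t \<le> 1" for t
  proof -
    have s2: "(\<lambda>k. tcoef t (k + 2) * a (k + 2)) sums (f t - (\<Sum>k<2. tcoef t k * a k))"
      by (rule sums_split_initial_segment[OF s[OF t(1)]])
    have e: "f t - (\<Sum>k<2. tcoef t k * a k) = f t - of_real t * a 1" by (simp add: numeral_2_eq_2 tcoef_def a0)
    have s3: "(\<lambda>k. t * t * (\<bar>K\<bar> * (\<bar>C\<bar> ^ (k + 2) /\<^sub>R fact (k + 2)))) sums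
        (t * t * (\<bar>K\<bar> * (exp \<bar>C\<bar> - (\<Sum>k<2. \<bar>C\<bar> ^ k /\<^sub>R fact k))))"
      by (intro sums_mult sums_split_initial_segment exp_converges)
    have bd: "norm (tcoef t (k + 2) * a (k + 2)) \<le> t * t * (\<bar>K\<bar> * (\<bar>C\<bar> ^ (k + 2) /\<^sub>R fact (k + 2)))" for k
    proof -
      have tk: "t ^ (k + 2) \<le> t * t"
      proof -
        have "t ^ k \<le> 1" using t by (simp add: power_le_one)
        then have "t ^ k * (t * t) \<le> 1 * (t * t)" using t by (intro mult_right_mono) auto
        then show ?thesis by (simp add: mult_ac)
      qed
      have ak: "cmod (a (k + 2)) \<le> \<bar>K\<bar> * \<bar>C\<bar> ^ (k + 2)"
        using order_trans[OF b[of "k + 2"] abs_ge_self] by (simp add: abs_mult power_abs)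
      have "norm (tcoef t (k + 2) * a (k + 2)) = t ^ (k + 2) / fact (k + 2) * cmod (a (k + 2))"
        using t unfolding tcoef_def by (simp only: norm_mult norm_divide norm_power norm_of_real norm_fact)
      also have "\<dots> \<le> (t * t) / fact (k + 2) * (\<bar>K\<bar> * \<bar>C\<bar> ^ (k + 2))"
        using t tk ak by (intro mult_mono divide_right_mono) auto
      finally show ?thesis by (simp only: divide_inverse real_scaleR_def mult_ac)
    qed
    have "norm (f t - of_real t * a 1) \<le> t * t * (\<bar>K\<bar> * (exp \<bar>C\<bar> - (\<Sum>k<2. \<bar>C\<bar> ^ k /\<^sub>R fact k)))"
      using norm_sums_le[OF s2[unfolded e] s3 bd] .
    also have "\<dots> \<le> t * t * (\<bar>K\<bar> * exp \<bar>C\<bar>)"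
      using t by (intro mult_left_mono) (auto simp: numeral_2_eq_2)
    finally have n: "norm (f t - of_real t * a 1) \<le> t * (t * (\<bar>K\<bar> * exp \<bar>C\<bar>))" by (simp add: mult.assoc)
    have "f t / of_real t - a 1 = (f t - of_real t * a 1) / of_real t" using t by (simp add: field_simps)
    then have "norm (f t / of_real t - a 1) = norm (f t - of_real t * a 1) / t" using t by (simp add: norm_divide)
    then show ?thesis using n t by (simp add: divide_le_eq mult_ac)
  qed
  have "(\<lambda>m. f (1 / real (Suc m)) * of_nat (Suc m) - a 1) \<longlonglongrightarrow> 0"
  proof (rule null_limit)
    fix m
    have "f (1 / real (Suc m)) / of_real (1 / real (Suc m)) = f (1 / real (Suc m)) * of_nat (Suc m)" by simp
    then show "norm (f (1 / real (Suc m)) * of_nat (Suc m) - a 1) \<le> 1 / real (Suc m) * (\<bar>K\<bar> * exp \<bar>C\<bar>)"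
      using est[of "1 / real (Suc m)"] by simp
  qed
  then show ?thesis by (simp add: LIM_zero_iff)
qed

lemma complex_limit_nonneg:
  fixes f :: "nat \<Rightarrow> complex"
  assumes "f \<longlonglongrightarrow> z" "\<And>m. 0 \<le> f m"
  shows "0 \<le> z"
proof -
  have "(\<lambda>m. Re (f m)) \<longlonglongrightarrow> Re z" "(\<lambda>m. Im (f m)) \<longlonglongrightarrow> Im z" using assms(1) by (auto intro: tendsto_intros)
  moreover have "Re (f m) \<ge> 0" "Im (f m) = 0" for m using assms(2)[of m] by (auto simp: less_eq_complex_def)
  ultimately show ?thesis
    using LIMSEQ_le_const[of "\<lambda>m. Re (f m)" "Re z" 0] LIMSEQ_unique[of "\<lambda>m. Im (f m)" "Im z" 0]
    by (auto simp: less_eq_complex_def)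
qed

lemma complex_suminf_nonneg:
  fixes f :: "nat \<Rightarrow> complex"
  assumes "f sums z" "\<And>m. 0 \<le> f m"
  shows "0 \<le> z"
  by (rule complex_limit_nonneg[of "\<lambda>n. \<Sum>k<n. f k"]) (use assms in \<open>auto simp: sums_def intro: sum_nonneg\<close>)

lemma first_coefficient_limit':
  assumes b: "\<And>k. cmod (a k) \<le> K * C ^ k" and s: "\<And>t. 0 < t \<Longrightarrow> (\<lambda>k. tcoef t k * a k) sums f t"
  shows "(\<lambda>m. (f (1 / real (Suc m)) - a 0) * of_nat (Suc m)) \<longlonglongrightarrow> a 1"
proof -
  let ?a = "a(0 := 0)"
  have "(\<lambda>m. (f (1 / real (Suc m)) - a 0) * of_nat (Suc m)) \<longlonglongrightarrow> ?a 1"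
  proof (rule first_coefficient_limit[where K = K and C = C and f = "\<lambda>t. f t - a 0"])
    show "cmod (?a k) \<le> K * C ^ k" for k using order_trans[OF norm_ge_zero b[of k]] b[of k] by auto
    fix t :: real assume t: "0 < t"
    have "(\<lambda>k. tcoef t k * a k - (if k = 0 then a 0 else 0)) sums (f t - a 0)"
      by (rule sums_diff[OF s[OF t] sums_single[of 0 "\<lambda>_. a 0"]])
    moreover have "(\<lambda>k. tcoef t k * a k - (if k = 0 then a 0 else 0)) = (\<lambda>k. tcoef t k * ?a k)"
      by (auto simp: fun_eq_iff tcoef_def)
    ultimately show "(\<lambda>k. tcoef t k * ?a k) sums (f t - a 0)" by simp
  qed simp
  then show ?thesis by simp
qed

lemma complex_limit_real:
  fixes f :: "nat \<Rightarrow> complex"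
  assumes "f \<longlonglongrightarrow> z" "\<And>m. f m \<in> \<real>"
  shows "z \<in> \<real>"
proof -
  have "(\<lambda>m. Im (f m)) \<longlonglongrightarrow> Im z" using assms(1) by (rule tendsto_Im)
  moreover have "(\<lambda>m. Im (f m)) = (\<lambda>m. 0)" using assms(2) by (auto simp: complex_is_Real_iff)
  ultimately show ?thesis using LIMSEQ_unique[of "\<lambda>m. Im (f m)" "Im z" 0] by (simp add: complex_is_Real_iff)
qed

subsection \<open>Exponentials of generators of completely positive semigroups\<close>

text \<open>
  Positivity of \<open>\<Phi>\<close> is known for Gram matrices over \<open>M\<close> only, so the positive array \<open>\<Theta> ((V i)\<^sup>\<dagger> * V j)\<close> has to
  be written as a sum of such matrices.
\<close>

lemma cp_compose:
  assumes M: "star_alg n M" and \<Phi>: "cp M \<Phi>" "lin_on M \<Phi>" and \<Theta>: "cp N \<Theta>" "\<And>X Y. X \<in> N \<Longrightarrow> Y \<in> N \<Longrightarrow> \<Theta> (X\<^sup>\<dagger> * Y) \<in> M"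
  shows "cp N (\<lambda>X. \<Phi> (\<Theta> X))"
  unfolding cp_def
proof (intro allI impI)
  note Md = star_algD[OF M]
  fix k :: nat and V \<xi> :: "nat \<Rightarrow> fmat" assume V: "\<forall>i<k. V i \<in> N"
  have "\<exists>R. (\<forall>l<k. \<forall>i<k. R l i \<in> M) \<and> (\<forall>i<k. \<forall>j<k. \<Theta> ((V i)\<^sup>\<dagger> * V j) = (\<Sum>l<k. (R l i)\<^sup>\<dagger> * R l j))"
  proof (rule gram_factorization[OF M])
    show "\<Theta> ((V i)\<^sup>\<dagger> * V j) \<in> M" if "i < k" "j < k" for i j
      using V that by (intro \<Theta>(2)) auto
    fix S :: "nat \<Rightarrow> fmat"
    obtain m where m: "(\<Sum>i<k. \<Sum>j<k. (S i)\<^sup>\<dagger> * \<Theta> ((V i)\<^sup>\<dagger> * V j) * S j) \<in> corner m" using ex_corner by blast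
    have "pos (\<Sum>i<k. \<Sum>j<k. (S i)\<^sup>\<dagger> * \<Theta> ((V i)\<^sup>\<dagger> * V j) * S j)" using V by (intro cpD[OF \<Theta>(1)]) auto
    from posD[OF this, of "idm m"] show "0 \<le> tr (\<Sum>i<k. \<Sum>j<k. (S i)\<^sup>\<dagger> * \<Theta> ((V i)\<^sup>\<dagger> * V j) * S j)"
      using idm_times[OF m] times_idm[OF m] by (simp only: adj_idm)
  qed
  then obtain R where R: "\<And>l i. l < k \<Longrightarrow> i < k \<Longrightarrow> R l i \<in> M"
    "\<And>i j. i < k \<Longrightarrow> j < k \<Longrightarrow> \<Theta> ((V i)\<^sup>\<dagger> * V j) = (\<Sum>l<k. (R l i)\<^sup>\<dagger> * R l j)" by blast
  have "(\<Sum>i<k. \<Sum>j<k. (\<xi> i)\<^sup>\<dagger> * \<Phi> (\<Theta> ((V i)\<^sup>\<dagger> * V j)) * \<xi> j) =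
      (\<Sum>i<k. \<Sum>j<k. \<Sum>l<k. (\<xi> i)\<^sup>\<dagger> * \<Phi> ((R l i)\<^sup>\<dagger> * R l j) * \<xi> j)"
  proof (intro sum.cong refl)
    fix i j assume ij: "i \<in> {..<k}" "j \<in> {..<k}"
    then have "\<Phi> (\<Theta> ((V i)\<^sup>\<dagger> * V j)) = (\<Sum>l<k. \<Phi> ((R l i)\<^sup>\<dagger> * R l j))"
      using lin_sum[OF Md(11,1) \<Phi>(2), of "{..<k}" "\<lambda>l. (R l i)\<^sup>\<dagger> * R l j"] R by (auto simp: Md)
    then show "(\<xi> i)\<^sup>\<dagger> * \<Phi> (\<Theta> ((V i)\<^sup>\<dagger> * V j)) * \<xi> j = (\<Sum>l<k. (\<xi> i)\<^sup>\<dagger> * \<Phi> ((R l i)\<^sup>\<dagger> * R l j) * \<xi> j)"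
      by (simp add: sum_distrib_left sum_distrib_right)
  qed
  also have "\<dots> = (\<Sum>i<k. \<Sum>l<k. \<Sum>j<k. (\<xi> i)\<^sup>\<dagger> * \<Phi> ((R l i)\<^sup>\<dagger> * R l j) * \<xi> j)"
    by (intro sum.cong refl sum.swap)
  also have "\<dots> = (\<Sum>l<k. \<Sum>i<k. \<Sum>j<k. (\<xi> i)\<^sup>\<dagger> * \<Phi> ((R l i)\<^sup>\<dagger> * R l j) * \<xi> j)"
    by (rule sum.swap)
  also have "pos \<dots>" by (intro pos_sum cpD[OF \<Phi>(1)]) (auto simp: R)
  finally show "pos (\<Sum>i<k. \<Sum>j<k. (\<xi> i)\<^sup>\<dagger> * \<Phi> (\<Theta> ((V i)\<^sup>\<dagger> * V j)) * \<xi> j)" .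
qed

lemma cp_id: "cp N (\<lambda>X. X)"
  unfolding cp_def
proof (intro allI impI)
  fix k :: nat and V \<xi> :: "nat \<Rightarrow> fmat"
  show "pos (\<Sum>i<k. \<Sum>j<k. (\<xi> i)\<^sup>\<dagger> * ((V i)\<^sup>\<dagger> * V j) * \<xi> j)"
    using gram_pos[of "\<lambda>i. V i * \<xi> i" k] by (simp add: mult.assoc)
qed

lemma cp_pow:
  assumes N: "star_alg n N" and "cp N \<Theta>" "lin_on N \<Theta>"
  shows "cp N (\<Theta> ^^ k)"
proof (induction k)
  case 0
  then show ?case using cp_id by (simp add: id_def)
next
  case (Suc k)
  have "(\<Theta> ^^ k) (X\<^sup>\<dagger> * Y) \<in> N" if "X \<in> N" "Y \<in> N" for X Y
    using that by (intro lin_pow[OF star_algD(11,1)[OF N] assms(3)] star_algD(5,6)[OF N])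
  from cp_compose[OF N assms(2,3) Suc this] show ?case by (simp add: comp_def)
qed

lemma shifted_pow:
  assumes V: "fmat.subspace M" "M \<subseteq> corner n" and T: "lin_on M \<Theta>" and X: "X \<in> M"
    and L: "\<And>X. X \<in> M \<Longrightarrow> L X = \<Theta> X + c *\<^sub>C X"
  shows "(L ^^ k) X = (\<Sum>i\<le>k. (of_nat (k choose i) * c ^ i) *\<^sub>C (\<Theta> ^^ (k - i)) X)"
proof (induction k)
  case (Suc k)
  have M: "(\<Theta> ^^ j) X \<in> M" for j by (rule lin_pow[OF V T X])
  have sM: "(\<Sum>i\<le>k. (of_nat (k choose i) * c ^ i) *\<^sub>C (\<Theta> ^^ (k - i)) X) \<in> M"
    using V(1) M by (intro fmat.subspace_sum fmat.subspace_scale) auto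
  have "(L ^^ Suc k) X = \<Theta> (\<Sum>i\<le>k. (of_nat (k choose i) * c ^ i) *\<^sub>C (\<Theta> ^^ (k - i)) X) +
      c *\<^sub>C (\<Sum>i\<le>k. (of_nat (k choose i) * c ^ i) *\<^sub>C (\<Theta> ^^ (k - i)) X)"
    by (simp add: Suc L[OF sM])
  also have "\<Theta> (\<Sum>i\<le>k. (of_nat (k choose i) * c ^ i) *\<^sub>C (\<Theta> ^^ (k - i)) X) =
      (\<Sum>i\<le>k. (of_nat (k choose i) * c ^ i) *\<^sub>C (\<Theta> ^^ Suc (k - i)) X)"
    using V(1) M by (simp add: lin_sum[OF V T] fmat.subspace_scale lin_onD(3)[OF T])
  also have "\<dots> = (\<Sum>i\<le>k. (of_nat (k choose i) * c ^ i) *\<^sub>C (\<Theta> ^^ (Suc k - i)) X)"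
    by (intro sum.cong refl) (simp add: Suc_diff_le)
  also have "\<dots> = (\<Sum>i\<le>Suc k. (of_nat (k choose i) * c ^ i) *\<^sub>C (\<Theta> ^^ (Suc k - i)) X)" by simp
  also have "\<dots> = (\<Theta> ^^ Suc k) X + (\<Sum>i\<le>k. (of_nat (k choose Suc i) * c ^ Suc i) *\<^sub>C (\<Theta> ^^ (k - i)) X)"
    by (subst sum.atMost_Suc_shift) simp
  also have "c *\<^sub>C (\<Sum>i\<le>k. (of_nat (k choose i) * c ^ i) *\<^sub>C (\<Theta> ^^ (k - i)) X) =
      (\<Sum>i\<le>k. (of_nat (k choose i) * c ^ Suc i) *\<^sub>C (\<Theta> ^^ (k - i)) X)"
    by (simp add: cscale_sum mult_ac)
  also have "(\<Theta> ^^ Suc k) X + (\<Sum>i\<le>k. (of_nat (k choose Suc i) * c ^ Suc i) *\<^sub>C (\<Theta> ^^ (k - i)) X) +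
      (\<Sum>i\<le>k. (of_nat (k choose i) * c ^ Suc i) *\<^sub>C (\<Theta> ^^ (k - i)) X) =
      (\<Theta> ^^ Suc k) X + (\<Sum>i\<le>k. (of_nat (Suc k choose Suc i) * c ^ Suc i) *\<^sub>C (\<Theta> ^^ (k - i)) X)"
  proof -
    have "of_nat (Suc k choose Suc i) = (of_nat (k choose Suc i) + of_nat (k choose i) :: complex)" for i by simp
    then show ?thesis by (simp only: add.assoc sum.distrib distrib_right cscale_add_left)
  qed
  also have "\<dots> = (\<Sum>i\<le>Suc k. (of_nat (Suc k choose i) * c ^ i) *\<^sub>C (\<Theta> ^^ (Suc k - i)) X)"
    by (subst sum.atMost_Suc_shift) simp
  finally show ?case .
qed simp

text \<open>
  A multiple of the identity commutes with \<open>\<Theta>\<close> and contributes the scalar factor \<open>exp (t c)\<close>, by the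
  Cauchy product of the two series.
\<close>

lemma shifted_expo:
  assumes V: "fmat.subspace M" "M \<subseteq> corner n" and T: "lin_on M \<Theta>" and X: "X \<in> M"
    and L: "\<And>X. X \<in> M \<Longrightarrow> L X = \<Theta> X + c *\<^sub>C X" and Ll: "lin_on M L"
  shows "tr (B * expo n L t X) = exp (of_real t * c) * tr (B * expo n \<Theta> t X)"
proof -
  obtain K C where "\<forall>B. \<forall>X\<in>M. \<forall>k. cmod (tr (B * (\<Theta> ^^ k) X)) \<le> K B X * C ^ k"
    using tr_pow_bound[OF V T] by blast
  then have KC: "cmod (tr (B * (\<Theta> ^^ k) X)) \<le> K B X * C ^ k" for k using X by blast
  have e: "exp (of_real t * c) = (\<Sum>k. tcoef t k * c ^ k)" "summable (\<lambda>k. norm (tcoef t k * c ^ k))"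
  proof -
    have e0: "tcoef t k * c ^ k = (of_real t * c) ^ k /\<^sub>R fact k" for k
      by (simp add: tcoef_def power_mult_distrib scaleR_conv_of_real divide_inverse mult_ac)
    show "exp (of_real t * c) = (\<Sum>k. tcoef t k * c ^ k)" by (simp only: e0 exp_def)
    show "summable (\<lambda>k. norm (tcoef t k * c ^ k))" unfolding e0 by (rule summable_norm_exp)
  qed
  have s: "tr (B * expo n \<Theta> t X) = (\<Sum>k. tcoef t k * tr (B * (\<Theta> ^^ k) X))"
    using expo_sums[OF V T X] by (rule sums_unique)
  have "(\<lambda>k. \<Sum>i\<le>k. (tcoef t i * c ^ i) * (tcoef t (k - i) * tr (B * (\<Theta> ^^ (k - i)) X))) sums
      (exp (of_real t * c) * tr (B * expo n \<Theta> t X))"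
    unfolding e(1) s by (rule Cauchy_product_sums[OF e(2) tcoef_summable(1)[OF KC]])
  moreover have "(\<Sum>i\<le>k. (tcoef t i * c ^ i) * (tcoef t (k - i) * tr (B * (\<Theta> ^^ (k - i)) X))) =
      tcoef t k * tr (B * (L ^^ k) X)" for k
  proof -
    have "tcoef t k * tr (B * (L ^^ k) X) =
        (\<Sum>i\<le>k. tcoef t k * (of_nat (k choose i) * c ^ i * tr (B * (\<Theta> ^^ (k - i)) X)))"
      by (subst shifted_pow[OF V T X L]) (simp_all add: sum_distrib_left)
    also have "\<dots> = (\<Sum>i\<le>k. (tcoef t i * c ^ i) * (tcoef t (k - i) * tr (B * (\<Theta> ^^ (k - i)) X)))"
    proof (intro sum.cong refl)
      fix i assume "i \<in> {..k}"
      then have i: "i \<le> k" by simp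
      have "of_real t ^ k = (of_real t ^ i * of_real t ^ (k - i) :: complex)" using i by (simp flip: power_add)
      then have "tcoef t k * of_nat (k choose i) = tcoef t i * tcoef t (k - i)"
        using i by (simp add: tcoef_def binomial_fact[OF i])
      then have "(tcoef t k * of_nat (k choose i)) * (c ^ i * tr (B * (\<Theta> ^^ (k - i)) X)) =
          (tcoef t i * tcoef t (k - i)) * (c ^ i * tr (B * (\<Theta> ^^ (k - i)) X))" by (rule arg_cong)
      then show "tcoef t k * (of_nat (k choose i) * c ^ i * tr (B * (\<Theta> ^^ (k - i)) X)) =
          (tcoef t i * c ^ i) * (tcoef t (k - i) * tr (B * (\<Theta> ^^ (k - i)) X))"
        by (simp only: mult_ac)
    qed
    finally show ?thesis by simp
  qed
  ultimately have "(\<lambda>k. tcoef t k * tr (B * (L ^^ k) X)) sums (exp (of_real t * c) * tr (B * expo n \<Theta> t X))" by simp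
  then show ?thesis using expo_sums[OF V Ll X, of t B] sums_unique2 by blast
qed

lemma tr_sandwich_expand:
  fixes k :: nat
  shows "tr (B\<^sup>\<dagger> * (\<Sum>i<k. \<Sum>j<k. (\<xi> i)\<^sup>\<dagger> * Y i j * \<xi> j) * B) = (\<Sum>i<k. \<Sum>j<k. tr (\<xi> j * B * B\<^sup>\<dagger> * (\<xi> i)\<^sup>\<dagger> * Y i j))"
proof -
  have e: "tr (B\<^sup>\<dagger> * ((\<xi> i)\<^sup>\<dagger> * Y i j * \<xi> j) * B) = tr (\<xi> j * B * B\<^sup>\<dagger> * (\<xi> i)\<^sup>\<dagger> * Y i j)" for i j
    by (metis mult.assoc tr_comm)
  show ?thesis by (simp only: sum_distrib_left sum_distrib_right tr_sum e)
qed

lemma expo_cp_of_cp: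
  assumes N: "star_alg n N" and T: "cp N \<Theta>" "lin_on N \<Theta>" and t: "0 \<le> t"
  shows "cp N (expo n \<Theta> t)"
  unfolding cp_def pos_def
proof (intro allI impI)
  note Nd = star_algD[OF N]
  fix k :: nat and V \<xi> :: "nat \<Rightarrow> fmat" and B assume V: "\<forall>i<k. V i \<in> N"
  have "(\<lambda>m. \<Sum>i<k. \<Sum>j<k. tcoef t m * tr (\<xi> j * B * B\<^sup>\<dagger> * (\<xi> i)\<^sup>\<dagger> * (\<Theta> ^^ m) ((V i)\<^sup>\<dagger> * V j))) sums
      (\<Sum>i<k. \<Sum>j<k. tr (\<xi> j * B * B\<^sup>\<dagger> * (\<xi> i)\<^sup>\<dagger> * expo n \<Theta> t ((V i)\<^sup>\<dagger> * V j)))"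
    by (intro sums_sum expo_sums[OF Nd(11,1) T(2)] Nd) (use V in auto)
  moreover have "0 \<le> (\<Sum>i<k. \<Sum>j<k. tcoef t m * tr (\<xi> j * B * B\<^sup>\<dagger> * (\<xi> i)\<^sup>\<dagger> * (\<Theta> ^^ m) ((V i)\<^sup>\<dagger> * V j)))" for m
  proof -
    have "pos (\<Sum>i<k. \<Sum>j<k. (\<xi> i)\<^sup>\<dagger> * (\<Theta> ^^ m) ((V i)\<^sup>\<dagger> * V j) * \<xi> j)"
      using V by (intro cpD[OF cp_pow[OF N T]]) auto
    from posD[OF this, of B] have "0 \<le> (\<Sum>i<k. \<Sum>j<k. tr (\<xi> j * B * B\<^sup>\<dagger> * (\<xi> i)\<^sup>\<dagger> * (\<Theta> ^^ m) ((V i)\<^sup>\<dagger> * V j)))"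
      by (simp only: tr_sandwich_expand)
    moreover have "0 \<le> tcoef t m" by (rule tcoef_nonneg[OF t])
    ultimately show ?thesis by (simp only: sum_distrib_left[symmetric] mult_nonneg_nonneg)
  qed
  ultimately show "0 \<le> tr (B\<^sup>\<dagger> * (\<Sum>i<k. \<Sum>j<k. (\<xi> i)\<^sup>\<dagger> * expo n \<Theta> t ((V i)\<^sup>\<dagger> * V j) * \<xi> j) * B)"
    unfolding tr_sandwich_expand by (rule complex_suminf_nonneg)
qed

text \<open>
  The exponential depends continuously on its generator: the \<open>k\<close>-th powers of \<open>L\<close> and of \<open>L + \<epsilon> R\<close>
  differ by at most \<open>\<epsilon> C2 (C + 1)\<^sup>k\<close> in norm, where \<open>C\<close> bounds both generators and \<open>C2\<close> bounds \<open>R\<close>.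
\<close>

lemma expo_perturb:
  assumes V: "fmat.subspace M" "M \<subseteq> corner n" and L: "lin_on M L" and R: "lin_on M R" and X: "X \<in> M"
  shows "(\<lambda>m. tr (B * expo n (\<lambda>Y. L Y + of_real (1 / real (Suc m)) *\<^sub>C R Y) t X)) \<longlonglongrightarrow> tr (B * expo n L t X)"
proof -
  obtain C1 where C1: "0 \<le> C1" "\<And>X. X \<in> M \<Longrightarrow> nrm n (L X) \<le> C1 * nrm n X" using lin_bounded[OF V L] by blast
  obtain C2 where C2: "0 \<le> C2" "\<And>X. X \<in> M \<Longrightarrow> nrm n (R X) \<le> C2 * nrm n X" using lin_bounded[OF V R] by blast
  define C where "C = C1 + C2"
  define A where "A m Y = L Y + of_real (1 / real (Suc m)) *\<^sub>C R Y" for m Y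
  have C0: "0 \<le> C" using C1 C2 by (simp add: C_def)
  have A: "lin_on M (A m)" for m
    using L R V(1) by (auto simp: lin_on_def A_def fmat.subspace_add fmat.subspace_scale algebra_simps)
  have Ab: "nrm n (A m Y) \<le> C * nrm n Y" if "Y \<in> M" for m Y
  proof -
    have "nrm n (A m Y) \<le> nrm n (L Y) + nrm n (of_real (1 / real (Suc m)) *\<^sub>C R Y)" unfolding A_def by (rule nrm_add)
    also have "\<dots> = nrm n (L Y) + 1 / real (Suc m) * nrm n (R Y)" by (subst nrm_cscale_real) auto
    also have "\<dots> \<le> C1 * nrm n Y + 1 * (C2 * nrm n Y)"
      by (intro add_mono mult_mono C1 C2 that) auto
    finally show ?thesis by (simp add: C_def algebra_simps)
  qed
  have Lb: "nrm n (L Y) \<le> C * nrm n Y" if "Y \<in> M" for Y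
    using C1(2)[OF that] C2(1) by (simp add: C_def algebra_simps add_increasing2)
  have d: "nrm n ((A m ^^ k) X - (L ^^ k) X) \<le> (1 / real (Suc m) * C2) * (C + 1) ^ k * nrm n X" for m k
  proof (induction k)
    case 0
    have "nrm n (X - X) = 0" by simp
    then show ?case using C2(1) by (simp add: zero_le_mult_iff)
  next
    case (Suc k)
    let ?d = "1 / real (Suc m) * C2" let ?A = "(A m ^^ k) X" let ?L = "(L ^^ k) X"
    have dn: "0 \<le> ?d" using C2(1) by simp
    have M: "?A \<in> M" "?L \<in> M" using lin_pow[OF V A X] lin_pow[OF V L X] by auto
    have "(A m ^^ Suc k) X - (L ^^ Suc k) X = A m (?A - ?L) + of_real (1 / real (Suc m)) *\<^sub>C R ?L"
      using lin_diff[OF V A M] by (simp add: A_def)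
    then have "nrm n ((A m ^^ Suc k) X - (L ^^ Suc k) X) \<le> nrm n (A m (?A - ?L)) + nrm n (of_real (1 / real (Suc m)) *\<^sub>C R ?L)"
      by (simp only: nrm_add)
    also have "\<dots> = nrm n (A m (?A - ?L)) + 1 / real (Suc m) * nrm n (R ?L)" by (subst nrm_cscale_real) auto
    also have "\<dots> \<le> C * nrm n (?A - ?L) + 1 / real (Suc m) * (C2 * nrm n ?L)"
      using M V(1) by (intro add_mono mult_left_mono Ab C2) (auto intro: fmat.subspace_diff)
    also have "\<dots> = C * nrm n (?A - ?L) + ?d * nrm n ?L" by simp
    also have "\<dots> \<le> C * (?d * (C + 1) ^ k * nrm n X) + ?d * ((C + 1) ^ k * nrm n X)"
    proof (intro add_mono mult_left_mono Suc C0 dn)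
      have "nrm n ?L \<le> C ^ k * nrm n X" by (rule pow_bound[OF V L C0 Lb X])
      also have "\<dots> \<le> (C + 1) ^ k * nrm n X" using C0 by (intro mult_right_mono power_mono) auto
      finally show "nrm n ?L \<le> (C + 1) ^ k * nrm n X" .
    qed
    also have "\<dots> = ?d * (C + 1) ^ Suc k * nrm n X" by (simp only: power_Suc) (simp only: algebra_simps)
    finally show ?case .
  qed
  let ?T = "\<Sum>i<n. \<Sum>j<n. cmod (tr (B * munit i j))"
  have td: "cmod (tr (B * ((A m ^^ k) X - (L ^^ k) X))) \<le> (1 / real (Suc m) * (?T * C2 * nrm n X)) * (C + 1) ^ k" for m k
  proof -
    let ?Z = "(A m ^^ k) X - (L ^^ k) X"
    have c: "?Z \<in> corner n" using lin_pow[OF V A[of m] X, of k] lin_pow[OF V L X, of k] V(2) by (intro corner_diff) auto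
    have "0 \<le> ?T" by (intro sum_nonneg) auto
    then have "cmod (tr (B * ?Z)) \<le> ?T * ((1 / real (Suc m) * C2) * (C + 1) ^ k * nrm n X)"
      by (rule order_trans[OF tr_le_nrm[OF c] mult_left_mono[OF d, rotated]])
    then show ?thesis by (simp only: mult_ac)
  qed
  have fin: "cmod (tr (B * expo n (A m) t X) - tr (B * expo n L t X)) \<le>
      1 / real (Suc m) * (?T * C2 * nrm n X * exp (\<bar>t\<bar> * (C + 1)))" for m
  proof -
    have "(\<lambda>k. tcoef t k * tr (B * (A m ^^ k) X) - tcoef t k * tr (B * (L ^^ k) X)) sums
        (tr (B * expo n (A m) t X) - tr (B * expo n L t X))"
      by (intro sums_diff expo_sums[OF V A X] expo_sums[OF V L X])
    then have s: "(\<lambda>k. tcoef t k * tr (B * ((A m ^^ k) X - (L ^^ k) X))) sums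
        (tr (B * expo n (A m) t X) - tr (B * expo n L t X))"
      by (simp add: right_diff_distrib)
    note ts = tcoef_summable[OF td[where m = m], of t]
    have "cmod (tr (B * expo n (A m) t X) - tr (B * expo n L t X)) \<le>
        (\<Sum>k. norm (tcoef t k * tr (B * ((A m ^^ k) X - (L ^^ k) X))))"
      unfolding sums_unique[OF s] by (rule summable_norm[OF ts(1)])
    also have "\<dots> \<le> (1 / real (Suc m) * (?T * C2 * nrm n X)) * exp (\<bar>t\<bar> * (C + 1))" by (rule ts(2))
    finally show ?thesis by (simp only: mult_ac)
  qed
  have "(\<lambda>m. tr (B * expo n (A m) t X) - tr (B * expo n L t X)) \<longlonglongrightarrow> 0"
    by (rule null_limit[OF fin])
  then show ?thesis unfolding A_def[abs_def] by (simp add: LIM_zero_iff)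
qed

text \<open>
  A multiple of the identity in the generator contributes a positive factor to the exponential, and
  arbitrarily small perturbations disappear in the limit. It is thus enough that the generator is
  completely positive up to these two kinds of terms.
\<close>

lemma expo_cp:
  assumes N: "star_alg n N" and L: "lin_on N L" and R: "lin_on N R"
    and c: "\<And>m::nat. \<exists>c::real. cp N (\<lambda>X. L X + of_real (1 / real (Suc m)) *\<^sub>C R X + of_real c *\<^sub>C X)"
    and t: "0 \<le> t"
  shows "cp N (expo n L t)"
  unfolding cp_def pos_def
proof (intro allI impI)
  note Nd = star_algD[OF N]
  fix k :: nat and V \<xi> :: "nat \<Rightarrow> fmat" and B assume V: "\<forall>i<k. V i \<in> N"
  define A where "A m Y = L Y + of_real (1 / real (Suc m)) *\<^sub>C R Y" for m Y
  have A: "lin_on N (A m)" for m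
    using L R by (auto simp: lin_on_def A_def Nd algebra_simps)
  have "(\<lambda>m. \<Sum>i<k. \<Sum>j<k. tr (\<xi> j * B * B\<^sup>\<dagger> * (\<xi> i)\<^sup>\<dagger> * expo n (A m) t ((V i)\<^sup>\<dagger> * V j))) \<longlonglongrightarrow>
      (\<Sum>i<k. \<Sum>j<k. tr (\<xi> j * B * B\<^sup>\<dagger> * (\<xi> i)\<^sup>\<dagger> * expo n L t ((V i)\<^sup>\<dagger> * V j)))"
    unfolding A_def[abs_def] by (intro tendsto_sum expo_perturb[OF Nd(11,1) L R] Nd) (use V in auto)
  moreover have "0 \<le> (\<Sum>i<k. \<Sum>j<k. tr (\<xi> j * B * B\<^sup>\<dagger> * (\<xi> i)\<^sup>\<dagger> * expo n (A m) t ((V i)\<^sup>\<dagger> * V j)))" for m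
  proof -
    obtain c where c: "cp N (\<lambda>X. A m X + of_real c *\<^sub>C X)" using c[of m] unfolding A_def by blast
    have T: "lin_on N (\<lambda>X. A m X + of_real c *\<^sub>C X)"
      using A[of m] by (auto simp: lin_on_def Nd algebra_simps)
    have AT: "A m X = (A m X + of_real c *\<^sub>C X) + (- of_real c) *\<^sub>C X" for X by (simp add: cscale_minus_left)
    have e: "tr (Z * expo n (A m) t ((V i)\<^sup>\<dagger> * V j)) =
        exp (of_real t * (- of_real c)) * tr (Z * expo n (\<lambda>X. A m X + of_real c *\<^sub>C X) t ((V i)\<^sup>\<dagger> * V j))"
      if "i < k" "j < k" for Z i j
      by (rule shifted_expo[where L = "A m" and \<Theta> = "\<lambda>X. A m X + of_real c *\<^sub>C X" and c = "- of_real c", OF Nd(11,1) T _ AT A]) (use V that in \<open>auto intro!: Nd\<close>)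
    have "pos (\<Sum>i<k. \<Sum>j<k. (\<xi> i)\<^sup>\<dagger> * expo n (\<lambda>X. A m X + of_real c *\<^sub>C X) t ((V i)\<^sup>\<dagger> * V j) * \<xi> j)"
      using V by (intro cpD[OF expo_cp_of_cp[OF N c T t]]) auto
    from posD[OF this, of B] have "0 \<le> (\<Sum>i<k. \<Sum>j<k. tr (\<xi> j * B * B\<^sup>\<dagger> * (\<xi> i)\<^sup>\<dagger> *
        expo n (\<lambda>X. A m X + of_real c *\<^sub>C X) t ((V i)\<^sup>\<dagger> * V j)))"
      by (simp only: tr_sandwich_expand)
    moreover have "exp (of_real t * (- of_real c)) = complex_of_real (exp (- t * c))" by (simp flip: exp_of_real)
    then have "0 \<le> exp (of_real t * (- of_real c) :: complex)" by (simp only:) (simp add: less_eq_complex_def)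
    ultimately have "0 \<le> exp (of_real t * (- of_real c)) * (\<Sum>i<k. \<Sum>j<k. tr (\<xi> j * B * B\<^sup>\<dagger> * (\<xi> i)\<^sup>\<dagger> *
        expo n (\<lambda>X. A m X + of_real c *\<^sub>C X) t ((V i)\<^sup>\<dagger> * V j)))" by (rule mult_nonneg_nonneg[rotated])
    also have "\<dots> = (\<Sum>i<k. \<Sum>j<k. tr (\<xi> j * B * B\<^sup>\<dagger> * (\<xi> i)\<^sup>\<dagger> * expo n (A m) t ((V i)\<^sup>\<dagger> * V j)))"
      unfolding sum_distrib_left by (intro sum.cong refl e[symmetric]) auto
    finally show ?thesis .
  qed
  ultimately show "0 \<le> tr (B\<^sup>\<dagger> * (\<Sum>i<k. \<Sum>j<k. (\<xi> i)\<^sup>\<dagger> * expo n L t ((V i)\<^sup>\<dagger> * V j) * \<xi> j) * B)"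
    unfolding tr_sandwich_expand by (rule complex_limit_nonneg)
qed

section \<open>Structure of GNS-symmetric generators\<close>

text \<open>
  A quantum Markov semigroup on \<open>M\<close>, with generator \<open>L\<close>, that is symmetric for the GNS inner product of
  the positive matrix \<open>s\<close> with inverse \<open>s'\<close>.
\<close>

locale gns_qms =
  fixes n :: nat and M :: "fmat set" and s s' :: fmat and L :: "fmat \<Rightarrow> fmat"
  assumes M: "star_alg n M" and sM: "s \<in> M" and spos: "pos s"
    and s'M: "s' \<in> M" and ss': "s * s' = idm n" and s's: "s' * s = idm n"
    and L: "lin_on M L" and cpL: "\<And>t. 0 \<le> t \<Longrightarrow> cp M (expo n L t)"
    and unital: "\<And>t. 0 \<le> t \<Longrightarrow> expo n L t (idm n) = idm n"
    and gns: "\<And>X Y. X \<in> M \<Longrightarrow> Y \<in> M \<Longrightarrow> tr (s * (L X)\<^sup>\<dagger> * Y) = tr (s * X\<^sup>\<dagger> * L Y)"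
begin

lemmas MD = star_algD[OF M]
lemmas LD = lin_onD[OF L]
lemmas L_diff = lin_diff[OF MD(11,1) L]

lemma s_herm: "s\<^sup>\<dagger> = s" by (rule pos_herm[OF spos])
lemma s_corner: "s \<in> corner n" and s'_corner: "s' \<in> corner n" using sM s'M MD by auto
lemma s'_herm: "s'\<^sup>\<dagger> = s'"
proof -
  have "s'\<^sup>\<dagger> = s'\<^sup>\<dagger> * (s * s')" using ss' s'_corner by (simp add: times_idm adj_corner)
  also have "\<dots> = (s * s')\<^sup>\<dagger> * s'" by (simp add: s_herm mult.assoc)
  also have "\<dots> = s'" using s'_corner by (simp add: ss' idm_times)
  finally show ?thesis .
qed

lemma idm_mult: "X \<in> M \<Longrightarrow> idm n * X = X" "X \<in> M \<Longrightarrow> X * idm n = X"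
  using MD(12) idm_times times_idm by auto
lemma cancel: "X \<in> M \<Longrightarrow> s * (s' * X) = X" "X \<in> M \<Longrightarrow> s' * (s * X) = X"
  by (simp_all add: ss' s's idm_mult flip: mult.assoc)

lemma faithful: assumes "D \<in> M" "tr (s * (D\<^sup>\<dagger> * D)) = 0" shows "D = 0"
proof -
  have "tr (D * s * D\<^sup>\<dagger>) = 0" using assms(2) by (metis mult.assoc tr_comm)
  then have "tr ((D\<^sup>\<dagger>)\<^sup>\<dagger> * s * D\<^sup>\<dagger>) = 0" by simp
  then have "s * D\<^sup>\<dagger> = 0" by (rule pos_mult_eq_0[OF spos])
  then have "s' * (s * D\<^sup>\<dagger>) = 0" by simp
  then have "D\<^sup>\<dagger> = 0" using cancel(2)[OF MD(6)[OF assms(1)]] by simp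
  then show ?thesis by (metis adj_simps(4,6))
qed

subsection \<open>First-order consequences of complete positivity\<close>

text \<open>
  Conditional complete positivity. The function \<open>t \<mapsto> \<Sum> (\<xi> i)\<^sup>\<dagger> * exp (t L) ((V i)\<^sup>\<dagger> * V j) * \<xi> j\<close> is positive for
  \<open>t \<ge> 0\<close> and, by the constraint on \<open>\<xi>\<close>, zero for \<open>t = 0\<close>; hence its derivative at 0 is positive.
\<close>

lemma cond_cp_nat:
  fixes k :: nat
  assumes V: "\<And>i. i < k \<Longrightarrow> V i \<in> M" and z: "(\<Sum>i<k. V i * \<xi> i) = 0"
  shows "pos (\<Sum>i<k. \<Sum>j<k. (\<xi> i)\<^sup>\<dagger> * L ((V i)\<^sup>\<dagger> * V j) * \<xi> j)"
  unfolding pos_def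
proof
  fix B
  obtain K C where KC: "\<And>B X k. X \<in> M \<Longrightarrow> cmod (tr (B * (L ^^ k) X)) \<le> K B X * C ^ k"
    using tr_pow_bound[OF MD(11,1) L] by blast
  define W where "W i j = \<xi> j * B * B\<^sup>\<dagger> * (\<xi> i)\<^sup>\<dagger>" for i j
  define a where "a m = (\<Sum>i<k. \<Sum>j<k. tr (W i j * (L ^^ m) ((V i)\<^sup>\<dagger> * V j)))" for m
  define f where "f t = (\<Sum>i<k. \<Sum>j<k. tr (W i j * expo n L t ((V i)\<^sup>\<dagger> * V j)))" for t
  have VV: "(V i)\<^sup>\<dagger> * V j \<in> M" if "i < k" "j < k" for i j using V that by (intro MD) auto
  have b: "cmod (a m) \<le> (\<Sum>i<k. \<Sum>j<k. K (W i j) ((V i)\<^sup>\<dagger> * V j)) * C ^ m" for m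
  proof -
    have "cmod (a m) \<le> (\<Sum>i<k. \<Sum>j<k. cmod (tr (W i j * (L ^^ m) ((V i)\<^sup>\<dagger> * V j))))"
      unfolding a_def by (rule order_trans[OF norm_sum]) (intro sum_mono norm_sum)
    also have "\<dots> \<le> (\<Sum>i<k. \<Sum>j<k. K (W i j) ((V i)\<^sup>\<dagger> * V j) * C ^ m)"
      by (intro sum_mono KC VV) auto
    finally show ?thesis by (simp only: sum_distrib_right)
  qed
  have fs: "(\<lambda>m. tcoef t m * a m) sums f t" for t
    unfolding a_def f_def sum_distrib_left by (intro sums_sum expo_sums[OF MD(11,1) L] VV) auto
  have a0: "a 0 = 0"
  proof -
    have "a 0 = tr (B\<^sup>\<dagger> * (\<Sum>i<k. \<Sum>j<k. (\<xi> i)\<^sup>\<dagger> * ((V i)\<^sup>\<dagger> * V j) * \<xi> j) * B)"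
      unfolding tr_sandwich_expand by (simp add: a_def W_def)
    also have "(\<Sum>i<k. \<Sum>j<k. (\<xi> i)\<^sup>\<dagger> * ((V i)\<^sup>\<dagger> * V j) * \<xi> j) = (\<Sum>i<k. V i * \<xi> i)\<^sup>\<dagger> * (\<Sum>i<k. V i * \<xi> i)"
      unfolding adj_sum sum_product by (simp add: mult.assoc)
    finally show ?thesis by (simp add: z)
  qed
  have fn: "0 \<le> f t" if "0 \<le> t" for t
    using posD[OF cpD[OF cpL[OF that], of k V \<xi>], of B] V by (simp only: tr_sandwich_expand f_def W_def)
  have "0 \<le> a 1"
  proof (rule complex_limit_nonneg[OF first_coefficient_limit'[OF b fs]])
    fix m show "0 \<le> (f (1 / real (Suc m)) - a 0) * of_nat (Suc m)"
      unfolding a0 diff_0_right using fn[of "1 / real (Suc m)"] by (intro mult_nonneg_nonneg) (auto simp: less_eq_complex_def)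
  qed
  then show "0 \<le> tr (B\<^sup>\<dagger> * (\<Sum>i<k. \<Sum>j<k. (\<xi> i)\<^sup>\<dagger> * L ((V i)\<^sup>\<dagger> * V j) * \<xi> j) * B)"
    unfolding tr_sandwich_expand by (simp add: a_def W_def)
qed

lemma cond_cp:
  fixes V \<xi> :: "'a \<Rightarrow> fmat"
  assumes J: "finite J" and V: "\<And>i. i \<in> J \<Longrightarrow> V i \<in> M" and z: "(\<Sum>i\<in>J. V i * \<xi> i) = 0"
  shows "pos (\<Sum>i\<in>J. \<Sum>j\<in>J. (\<xi> i)\<^sup>\<dagger> * L ((V i)\<^sup>\<dagger> * V j) * \<xi> j)"
proof -
  obtain h where h: "bij_betw h {..<card J} J"
    using ex_bij_betw_nat_finite[OF J] by (auto simp: atLeast0LessThan)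
  have e: "(\<Sum>i<card J. g (h i)) = (\<Sum>i\<in>J. g i)" for g :: "'a \<Rightarrow> fmat" by (rule sum.reindex_bij_betw[OF h])
  have "pos (\<Sum>i<card J. \<Sum>j<card J. (\<xi> (h i))\<^sup>\<dagger> * L ((V (h i))\<^sup>\<dagger> * V (h j)) * \<xi> (h j))"
  proof (rule cond_cp_nat)
    show "V (h i) \<in> M" if "i < card J" for i using V h that by (auto simp: bij_betw_def)
    show "(\<Sum>i<card J. V (h i) * \<xi> (h i)) = 0" using e[of "\<lambda>i. V i * \<xi> i"] z by simp
  qed
  also have "(\<Sum>i<card J. \<Sum>j<card J. (\<xi> (h i))\<^sup>\<dagger> * L ((V (h i))\<^sup>\<dagger> * V (h j)) * \<xi> (h j)) =
      (\<Sum>i\<in>J. \<Sum>j\<in>J. (\<xi> i)\<^sup>\<dagger> * L ((V i)\<^sup>\<dagger> * V j) * \<xi> j)"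
  proof -
    have "(\<Sum>j<card J. (\<xi> i)\<^sup>\<dagger> * L ((V i)\<^sup>\<dagger> * V (h j)) * \<xi> (h j)) = (\<Sum>j\<in>J. (\<xi> i)\<^sup>\<dagger> * L ((V i)\<^sup>\<dagger> * V j) * \<xi> j)" for i
      by (rule e)
    then show ?thesis using e[of "\<lambda>i. \<Sum>j\<in>J. (\<xi> i)\<^sup>\<dagger> * L ((V i)\<^sup>\<dagger> * V j) * \<xi> j"] by simp
  qed
  finally show ?thesis .
qed

lemma L_idm: "L (idm n) = 0"
proof (rule fmat_eq_trI)
  fix B
  obtain K C where KC: "\<And>B X k. X \<in> M \<Longrightarrow> cmod (tr (B * (L ^^ k) X)) \<le> K B X * C ^ k"
    using tr_pow_bound[OF MD(11,1) L] by blast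
  have "(\<lambda>m. (tr (B * expo n L (1 / real (Suc m)) (idm n)) - tr (B * (L ^^ 0) (idm n))) * of_nat (Suc m)) \<longlonglongrightarrow> tr (B * (L ^^ 1) (idm n))"
    by (rule first_coefficient_limit'[OF KC expo_sums[OF MD(11,1) L]]) (rule MD)+
  then have "(\<lambda>m::nat. 0) \<longlonglongrightarrow> tr (B * L (idm n))" by (simp add: unital)
  then show "tr (B * L (idm n)) = tr (B * 0)" by (simp add: LIMSEQ_const_iff)
qed

lemma L_square_herm:
  assumes V: "V \<in> M" shows "(L (V\<^sup>\<dagger> * V))\<^sup>\<dagger> = L (V\<^sup>\<dagger> * V)"
proof (rule herm_by_star_alg[OF star_alg_corner])
  have VV: "V\<^sup>\<dagger> * V \<in> M" using V by (intro MD)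
  show "L (V\<^sup>\<dagger> * V) \<in> corner n" using VV LD(1) MD by blast
  fix B
  obtain K C where KC: "\<And>B X k. X \<in> M \<Longrightarrow> cmod (tr (B * (L ^^ k) X)) \<le> K B X * C ^ k"
    using tr_pow_bound[OF MD(11,1) L] by blast
  let ?W = "B * B\<^sup>\<dagger>"
  have e: "tr (B\<^sup>\<dagger> * Y * B) = tr (?W * Y)" for Y by (metis mult.assoc tr_comm)
  have "(\<lambda>m. (tr (?W * expo n L (1 / real (Suc m)) (V\<^sup>\<dagger> * V)) - tr (?W * (L ^^ 0) (V\<^sup>\<dagger> * V))) * of_nat (Suc m)) \<longlonglongrightarrow> tr (?W * (L ^^ 1) (V\<^sup>\<dagger> * V))"
    by (rule first_coefficient_limit'[OF KC expo_sums[OF MD(11,1) L]]) (rule VV)+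
  moreover have "(tr (?W * expo n L (1 / real (Suc m)) (V\<^sup>\<dagger> * V)) - tr (?W * (L ^^ 0) (V\<^sup>\<dagger> * V))) * of_nat (Suc m) \<in> \<real>" for m
  proof (intro Reals_mult Reals_diff Reals_of_nat)
    have "pos (\<Sum>i<Suc 0. \<Sum>j<Suc 0. (idm n)\<^sup>\<dagger> * expo n L (1 / real (Suc m)) (V\<^sup>\<dagger> * V) * idm n)"
      by (rule cpD[OF cpL, of _ _ "\<lambda>_. V" "\<lambda>_. idm n"]) (use V in auto)
    then have "pos (expo n L (1 / real (Suc m)) (V\<^sup>\<dagger> * V))"
      using expo_corner[of n L] by (simp add: idm_times times_idm)
    from posD[OF this, of B] show "tr (?W * expo n L (1 / real (Suc m)) (V\<^sup>\<dagger> * V)) \<in> \<real>"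
      by (simp only: e nonneg_real)
    from posD[OF pos_adj_self[of V], of B] show "tr (?W * (L ^^ 0) (V\<^sup>\<dagger> * V)) \<in> \<real>"
      by (simp only: e nonneg_real funpow_0)
  qed
  ultimately have "tr (?W * (L ^^ 1) (V\<^sup>\<dagger> * V)) \<in> \<real>" by (rule complex_limit_real)
  then show "tr (B\<^sup>\<dagger> * L (V\<^sup>\<dagger> * V) * B) \<in> \<real>" by (simp add: e)
qed

text \<open>
  On the elements \<open>V\<^sup>\<dagger> * V\<close> the claim holds because \<open>L\<close> is a derivative of positive maps, and these
  elements span \<open>M\<close>.
\<close>

lemma L_adj:
  assumes X: "X \<in> M" shows "L (X\<^sup>\<dagger>) = (L X)\<^sup>\<dagger>"
proof -
  have h: "(L Y)\<^sup>\<dagger> = L Y" if Y: "Y \<in> M" "Y\<^sup>\<dagger> = Y" for Y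
  proof -
    define U W where "U = Y + idm n" and "W = Y - idm n"
    have UW: "U \<in> M" "W \<in> M" unfolding U_def W_def using Y MD by auto
    have "U\<^sup>\<dagger> * U - W\<^sup>\<dagger> * W = 4 *\<^sub>C Y"
    proof -
      have "U\<^sup>\<dagger> * U - W\<^sup>\<dagger> * W = Y + Y + (Y + Y)"
        by (simp add: U_def W_def algebra_simps Y(2) idm_mult Y(1))
      also have "\<dots> = 4 *\<^sub>C Y" by (rule fmat_eqI) simp
      finally show ?thesis .
    qed
    moreover have "U\<^sup>\<dagger> * U \<in> M" "W\<^sup>\<dagger> * W \<in> M" using UW by (auto intro: MD)
    ultimately have "4 *\<^sub>C L Y = L (U\<^sup>\<dagger> * U) - L (W\<^sup>\<dagger> * W)"
      using L_diff[of "U\<^sup>\<dagger> * U" "W\<^sup>\<dagger> * W"] LD(3)[OF Y(1), of 4] by simp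
    then have "(4 *\<^sub>C L Y)\<^sup>\<dagger> = 4 *\<^sub>C L Y" using L_square_herm UW by simp
    then have "(1/4) *\<^sub>C (4 *\<^sub>C (L Y)\<^sup>\<dagger>) = (1/4) *\<^sub>C (4 *\<^sub>C L Y)" by simp
    then show ?thesis by simp
  qed
  define H1 H2 where "H1 = (1/2) *\<^sub>C (X + X\<^sup>\<dagger>)" and "H2 = (- \<i> / 2) *\<^sub>C (X - X\<^sup>\<dagger>)"
  have H: "H1 \<in> M" "H2 \<in> M" "H1\<^sup>\<dagger> = H1" "H2\<^sup>\<dagger> = H2"
    unfolding H1_def H2_def using X by (auto intro!: MD simp: add.commute algebra_simps)
  have X1: "X = H1 + \<i> *\<^sub>C H2" and X2: "X\<^sup>\<dagger> = H1 - \<i> *\<^sub>C H2"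
    by (rule fmat_eqI; simp add: H1_def H2_def field_simps)+
  have "L (X\<^sup>\<dagger>) = L H1 - \<i> *\<^sub>C L H2" unfolding X2 using H by (simp add: L_diff LD MD)
  moreover have "L X = L H1 + \<i> *\<^sub>C L H2" using H by (subst X1) (simp add: LD MD)
  ultimately show ?thesis using h H by (simp add: cscale_minus_left)
qed

lemma gns_bilinear: "X \<in> M \<Longrightarrow> Y \<in> M \<Longrightarrow> tr (s * L X * Y) = tr (s * X * L Y)"
  using gns[of "X\<^sup>\<dagger>" Y] L_adj[of X] MD(6)[of X] by simp

text \<open>
  \<open>L\<close> commutes with the modular automorphism of \<open>s\<close>. It is symmetric for the bilinear form \<open>tr (s * X * Y)\<close>;
  exchanging the arguments of this form amounts to applying the automorphism to one of them, and
  using the symmetry before and after the exchange gives the claim.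
\<close>

lemma L_modular:
  assumes Y: "Y \<in> M" shows "L (s * Y * s') = s * L Y * s'"
proof -
  define Z where "Z = s * Y * s'"
  have Z: "Z \<in> M" unfolding Z_def using Y sM s'M by (intro MD)
  have sZ: "Z * s = s * Y" using Y by (simp add: Z_def mult.assoc s's MD times_idm)
  define D where "D = s * L Y * s' - L Z"
  have LM: "L Y \<in> M" "L Z \<in> M" using Y Z LD by auto
  have D: "D \<in> M" unfolding D_def using LM sM s'M by (intro MD)
  have "tr (s * X * D) = 0" if X: "X \<in> M" for X
  proof -
    have "tr (s * X * (s * L Y * s')) = tr (s' * (s * (X * s * L Y)))" by (metis mult.assoc tr_comm)
    also have "\<dots> = tr (X * s * L Y)" using X LM sM by (simp add: cancel MD)
    also have "\<dots> = tr (s * L Y * X)" by (metis mult.assoc tr_comm)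
    also have "\<dots> = tr (s * Y * L X)" by (rule gns_bilinear[OF Y X])
    also have "\<dots> = tr (s * L X * Z)" by (metis sZ mult.assoc tr_comm)
    also have "\<dots> = tr (s * X * L Z)" by (rule gns_bilinear[OF X Z])
    finally show ?thesis by (simp add: D_def right_diff_distrib)
  qed
  from this[OF MD(6)[OF D]] have "D = 0" using faithful[OF D] by (simp add: mult.assoc)
  then show ?thesis by (simp add: D_def Z_def)
qed

subsection \<open>Christensen--Evans form\<close>

definition casimir_inv :: fmat where
  "casimir_inv = (SOME D. D \<in> M \<and> D\<^sup>\<dagger> = D \<and> D * casimir n M = idm n \<and> casimir n M * D = idm n \<and> (\<forall>X\<in>M. X * D = D * X))"

lemma casimir_inv: "casimir_inv \<in> M" "casimir_inv\<^sup>\<dagger> = casimir_inv" "casimir n M * casimir_inv = idm n" "X \<in> M \<Longrightarrow> X * casimir_inv = casimir_inv * X"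
proof -
  obtain D where "D \<in> M" "D\<^sup>\<dagger> = D" "D * casimir n M = idm n" "casimir n M * D = idm n" "\<And>X. X \<in> M \<Longrightarrow> X * D = D * X"
    using casimir_inverse[OF M] by blast
  then have "\<exists>D. D \<in> M \<and> D\<^sup>\<dagger> = D \<and> D * casimir n M = idm n \<and> casimir n M * D = idm n \<and> (\<forall>X\<in>M. X * D = D * X)" by blast
  from someI_ex[OF this, folded casimir_inv_def]
  show "casimir_inv \<in> M" "casimir_inv\<^sup>\<dagger> = casimir_inv" "casimir n M * casimir_inv = idm n" "X \<in> M \<Longrightarrow> X * casimir_inv = casimir_inv * X" by auto
qed

abbreviation "z \<equiv> frame M"
abbreviation "F \<equiv> {..<n} \<times> {..<n}"

lemma zM [simp]: "z k \<in> M" "(z k)\<^sup>\<dagger> \<in> M" using frame_in[OF M] MD(6) by auto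

text \<open>
  The two elements below arise from the tensors \<open>\<Sum> z k \<otimes> (z k)\<^sup>\<dagger>\<close> when \<open>L\<close> is applied to one leg, and to
  the product of the inner legs of two copies. The identities that follow say how multiplication
  by \<open>X \<in> M\<close> moves through them.
\<close>

definition cas_L where "cas_L = (\<Sum>k\<in>F. L (z k) * (z k)\<^sup>\<dagger>)"
definition cas_L_cas where "cas_L_cas = (\<Sum>l\<in>F. \<Sum>k\<in>F. z l * L ((z l)\<^sup>\<dagger> * z k) * (z k)\<^sup>\<dagger>)"

lemma cas_LM: "cas_L \<in> M" and cas_L_casM: "cas_L_cas \<in> M"
  unfolding cas_L_def cas_L_cas_def by (intro MD LD(1) zM)+

lemma cas_L_adj: "cas_L\<^sup>\<dagger> = (\<Sum>k\<in>F. z k * L ((z k)\<^sup>\<dagger>))"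
  by (simp add: cas_L_def L_adj)

lemma cas_L_right: "X \<in> M \<Longrightarrow> (\<Sum>k\<in>F. L (X * z k) * (z k)\<^sup>\<dagger>) = cas_L * X"
  using casimir_left[OF M, of "\<lambda>A B. L A * B" X]
  by (simp add: bilinear_on_def LD algebra_simps cas_L_def sum_distrib_right)

lemma cas_L_left: "X \<in> M \<Longrightarrow> (\<Sum>k\<in>F. z k * L ((z k)\<^sup>\<dagger> * X)) = X * cas_L\<^sup>\<dagger>"
  using casimir_left[OF M, of "\<lambda>A B. A * L B" X]
  by (simp add: bilinear_on_def LD algebra_simps cas_L_adj sum_distrib_left)

lemma cas_L_cas_left: "X \<in> M \<Longrightarrow> (\<Sum>l\<in>F. \<Sum>k\<in>F. z l * L ((z l)\<^sup>\<dagger> * X * z k) * (z k)\<^sup>\<dagger>) = X * cas_L_cas"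
  using casimir_left[OF M, of "\<lambda>A B. \<Sum>k\<in>F. A * L (B * z k) * (z k)\<^sup>\<dagger>" X]
  by (simp add: bilinear_on_def LD MD distrib_left distrib_right sum.distrib cscale_sum cas_L_cas_def sum_distrib_left mult.assoc)

lemma cas_L_cas_right: "X \<in> M \<Longrightarrow> (\<Sum>l\<in>F. \<Sum>k\<in>F. z l * L ((z l)\<^sup>\<dagger> * X * z k) * (z k)\<^sup>\<dagger>) = cas_L_cas * X"
proof -
  assume X: "X \<in> M"
  have "bilinear_on M (\<lambda>A B. \<Sum>l\<in>F. z l * L ((z l)\<^sup>\<dagger> * A) * B)"
    by (simp add: bilinear_on_def LD MD distrib_left distrib_right sum.distrib cscale_sum)
  from casimir_left[OF M this X]
  have c: "(\<Sum>k\<in>F. \<Sum>l\<in>F. z l * L ((z l)\<^sup>\<dagger> * (X * z k)) * (z k)\<^sup>\<dagger>) =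
      (\<Sum>k\<in>F. \<Sum>l\<in>F. z l * L ((z l)\<^sup>\<dagger> * z k) * ((z k)\<^sup>\<dagger> * X))" .
  have "(\<Sum>l\<in>F. \<Sum>k\<in>F. z l * L ((z l)\<^sup>\<dagger> * X * z k) * (z k)\<^sup>\<dagger>) =
      (\<Sum>k\<in>F. \<Sum>l\<in>F. z l * L ((z l)\<^sup>\<dagger> * (X * z k)) * (z k)\<^sup>\<dagger>)"
    unfolding mult.assoc by (rule sum.swap)
  also note c
  also have "(\<Sum>k\<in>F. \<Sum>l\<in>F. z l * L ((z l)\<^sup>\<dagger> * z k) * ((z k)\<^sup>\<dagger> * X)) =
      (\<Sum>k\<in>F. \<Sum>l\<in>F. z l * L ((z l)\<^sup>\<dagger> * z k) * (z k)\<^sup>\<dagger>) * X"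
    by (simp only: sum_distrib_right mult.assoc)
  also have "(\<Sum>k\<in>F. \<Sum>l\<in>F. z l * L ((z l)\<^sup>\<dagger> * z k) * (z k)\<^sup>\<dagger>) = cas_L_cas"
    unfolding cas_L_cas_def by (rule sum.swap)
  finally show ?thesis .
qed

lemma cas_L_cas_central: "X \<in> M \<Longrightarrow> X * cas_L_cas = cas_L_cas * X"
  by (rule trans[OF cas_L_cas_left[symmetric] cas_L_cas_right])

definition central_part where "central_part = casimir_inv * cas_L_cas * casimir_inv"

lemma central_partM: "central_part \<in> M" unfolding central_part_def by (intro MD casimir_inv cas_L_casM)

lemma central_part_central: assumes X: "X \<in> M" shows "X * central_part = central_part * X"
proof -
  have "X * central_part = (X * casimir_inv) * cas_L_cas * casimir_inv" by (simp only: central_part_def mult.assoc)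
  also have "\<dots> = casimir_inv * (X * cas_L_cas) * casimir_inv" by (simp only: casimir_inv(4)[OF X] mult.assoc)
  also have "\<dots> = casimir_inv * cas_L_cas * (X * casimir_inv)" by (simp only: cas_L_cas_central[OF X] mult.assoc)
  also have "\<dots> = central_part * X" by (simp only: casimir_inv(4)[OF X] central_part_def mult.assoc)
  finally show ?thesis .
qed

text \<open>
  The completely positive part of \<open>L\<close>: the Christensen--Evans decomposition \<open>L X = Psi X + k * X + X * k\<^sup>\<dagger>\<close>
  up to a central term, with an explicit \<open>k = cas_L * casimir_inv\<close>. Because \<open>k\<close> comes from the canonical
  Casimir tensor, it inherits the invariance of \<open>L\<close> under the modular automorphism.
\<close>

definition Psi where "Psi X = L X - cas_L * casimir_inv * X - X * casimir_inv * cas_L\<^sup>\<dagger> + central_part * X"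

lemma Psi_M: "X \<in> M \<Longrightarrow> Psi X \<in> M"
  unfolding Psi_def by (intro MD LD casimir_inv cas_LM central_partM)

lemma Psi_lin: "lin_on M Psi"
  unfolding lin_on_def by (auto simp: Psi_M) (auto simp: Psi_def LD algebra_simps)

text \<open>
  Given elements \<open>X j\<close> with arbitrary coefficients \<open>\<eta> j\<close>, put \<open>u = \<Sum> X j * \<eta> j\<close> and adjoin the frame elements
  \<open>z l\<close> with coefficients \<open>- (z l)\<^sup>\<dagger> * casimir_inv * u\<close>. Then \<open>cond_cp\<close> applies, because \<open>\<Sum> z l * (z l)\<^sup>\<dagger>\<close> is the
  Casimir element. Of the four groups of terms, the one with only \<open>X\<close> is that of \<open>L\<close>; the Casimir
  identities turn the others into the correction terms of \<open>Psi\<close>.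
\<close>

lemma Psi_cp: "cp M Psi"
  unfolding cp_def
proof (intro allI impI)
  fix k :: nat and X \<eta> :: "nat \<Rightarrow> fmat" assume "\<forall>i<k. X i \<in> M"
  then have X: "\<And>i. i < k \<Longrightarrow> X i \<in> M" by blast
  define u where "u = (\<Sum>j<k. X j * \<eta> j)"
  have Xa: "\<And>i. i < k \<Longrightarrow> (X i)\<^sup>\<dagger> \<in> M" using X by (auto intro: MD(6))
  have iu: "idm n * u = u" using X by (simp add: u_def sum_distrib_left idm_mult flip: mult.assoc)
  (* The index set is the disjoint union of that of X and that of the frame. *)
  define V where "V i = (case i of Inl j \<Rightarrow> X j | Inr l \<Rightarrow> z l)" for i :: "nat + nat \<times> nat"
  define \<xi> where "\<xi> i = (case i of Inl j \<Rightarrow> \<eta> j | Inr l \<Rightarrow> - ((z l)\<^sup>\<dagger> * casimir_inv * u))" for i :: "nat + nat \<times> nat"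
  have "pos (\<Sum>i\<in>{..<k} <+> F. \<Sum>j\<in>{..<k} <+> F. (\<xi> i)\<^sup>\<dagger> * L ((V i)\<^sup>\<dagger> * V j) * \<xi> j)"
  proof (rule cond_cp)
    show "V i \<in> M" if "i \<in> {..<k} <+> F" for i using that X by (auto simp: V_def)
    have "(\<Sum>l\<in>F. z l * ((z l)\<^sup>\<dagger> * casimir_inv * u)) = casimir n M * casimir_inv * u"
      by (simp add: casimir_def[OF M] sum_distrib_right mult.assoc)
    also have "\<dots> = u" by (simp add: casimir_inv(3) iu)
    finally show "(\<Sum>i\<in>{..<k} <+> F. V i * \<xi> i) = 0"
      by (simp add: sum.Plus V_def \<xi>_def u_def sum_negf)
  qed auto
  also have "(\<Sum>i\<in>{..<k} <+> F. \<Sum>j\<in>{..<k} <+> F. (\<xi> i)\<^sup>\<dagger> * L ((V i)\<^sup>\<dagger> * V j) * \<xi> j) =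
      (\<Sum>i<k. \<Sum>j<k. (\<eta> i)\<^sup>\<dagger> * L ((X i)\<^sup>\<dagger> * X j) * \<eta> j)
      - (\<Sum>i<k. \<Sum>l\<in>F. (\<eta> i)\<^sup>\<dagger> * L ((X i)\<^sup>\<dagger> * z l) * ((z l)\<^sup>\<dagger> * casimir_inv * u))
      - (\<Sum>l\<in>F. \<Sum>j<k. (u\<^sup>\<dagger> * casimir_inv * z l) * L ((z l)\<^sup>\<dagger> * X j) * \<eta> j)
      + (\<Sum>l\<in>F. \<Sum>m\<in>F. (u\<^sup>\<dagger> * casimir_inv * z l) * L ((z l)\<^sup>\<dagger> * z m) * ((z m)\<^sup>\<dagger> * casimir_inv * u))"
    by (simp add: sum.Plus V_def \<xi>_def sum.distrib sum_negf sum_subtractf casimir_inv(2) mult.assoc)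
  also have "(\<Sum>i<k. \<Sum>l\<in>F. (\<eta> i)\<^sup>\<dagger> * L ((X i)\<^sup>\<dagger> * z l) * ((z l)\<^sup>\<dagger> * casimir_inv * u)) =
      (\<Sum>i<k. \<Sum>j<k. (\<eta> i)\<^sup>\<dagger> * (cas_L * casimir_inv * ((X i)\<^sup>\<dagger> * X j)) * \<eta> j)"
  proof (rule sum.cong[OF refl])
    fix i assume i: "i \<in> {..<k}"
    have "(\<Sum>l\<in>F. (\<eta> i)\<^sup>\<dagger> * L ((X i)\<^sup>\<dagger> * z l) * ((z l)\<^sup>\<dagger> * casimir_inv * u)) =
        (\<eta> i)\<^sup>\<dagger> * (\<Sum>l\<in>F. L ((X i)\<^sup>\<dagger> * z l) * (z l)\<^sup>\<dagger>) * casimir_inv * u"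
      by (simp add: sum_distrib_left sum_distrib_right mult.assoc)
    also have "\<dots> = (\<eta> i)\<^sup>\<dagger> * (cas_L * ((X i)\<^sup>\<dagger> * casimir_inv)) * u" using i by (simp add: cas_L_right Xa mult.assoc)
    also have "\<dots> = (\<eta> i)\<^sup>\<dagger> * (cas_L * (casimir_inv * (X i)\<^sup>\<dagger>)) * u" using i by (simp add: casimir_inv(4) Xa)
    finally show "(\<Sum>l\<in>F. (\<eta> i)\<^sup>\<dagger> * L ((X i)\<^sup>\<dagger> * z l) * ((z l)\<^sup>\<dagger> * casimir_inv * u)) =
        (\<Sum>j<k. (\<eta> i)\<^sup>\<dagger> * (cas_L * casimir_inv * ((X i)\<^sup>\<dagger> * X j)) * \<eta> j)"
      by (simp add: u_def sum_distrib_left mult.assoc)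
  qed
  also have "(\<Sum>l\<in>F. \<Sum>j<k. (u\<^sup>\<dagger> * casimir_inv * z l) * L ((z l)\<^sup>\<dagger> * X j) * \<eta> j) =
      (\<Sum>i<k. \<Sum>j<k. (\<eta> i)\<^sup>\<dagger> * (((X i)\<^sup>\<dagger> * X j) * casimir_inv * cas_L\<^sup>\<dagger>) * \<eta> j)"
  proof -
    have "(\<Sum>l\<in>F. \<Sum>j<k. (u\<^sup>\<dagger> * casimir_inv * z l) * L ((z l)\<^sup>\<dagger> * X j) * \<eta> j) =
        (\<Sum>j<k. \<Sum>l\<in>F. (u\<^sup>\<dagger> * casimir_inv * z l) * L ((z l)\<^sup>\<dagger> * X j) * \<eta> j)" by (rule sum.swap)
    also have "\<dots> = (\<Sum>j<k. u\<^sup>\<dagger> * casimir_inv * (\<Sum>l\<in>F. z l * L ((z l)\<^sup>\<dagger> * X j)) * \<eta> j)"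
      by (simp add: sum_distrib_left sum_distrib_right mult.assoc)
    also have "\<dots> = (\<Sum>j<k. u\<^sup>\<dagger> * ((casimir_inv * X j) * cas_L\<^sup>\<dagger>) * \<eta> j)" by (simp add: cas_L_left X mult.assoc)
    also have "\<dots> = (\<Sum>j<k. u\<^sup>\<dagger> * ((X j * casimir_inv) * cas_L\<^sup>\<dagger>) * \<eta> j)" by (simp add: casimir_inv(4) X)
    also have "\<dots> = (\<Sum>j<k. \<Sum>i<k. (\<eta> i)\<^sup>\<dagger> * (((X i)\<^sup>\<dagger> * X j) * casimir_inv * cas_L\<^sup>\<dagger>) * \<eta> j)"
      by (simp add: u_def sum_distrib_right mult.assoc)
    also have "\<dots> = (\<Sum>i<k. \<Sum>j<k. (\<eta> i)\<^sup>\<dagger> * (((X i)\<^sup>\<dagger> * X j) * casimir_inv * cas_L\<^sup>\<dagger>) * \<eta> j)"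
      by (rule sum.swap)
    finally show ?thesis .
  qed
  also have "(\<Sum>l\<in>F. \<Sum>m\<in>F. (u\<^sup>\<dagger> * casimir_inv * z l) * L ((z l)\<^sup>\<dagger> * z m) * ((z m)\<^sup>\<dagger> * casimir_inv * u)) =
      (\<Sum>i<k. \<Sum>j<k. (\<eta> i)\<^sup>\<dagger> * (central_part * ((X i)\<^sup>\<dagger> * X j)) * \<eta> j)"
  proof -
    have "(\<Sum>l\<in>F. \<Sum>m\<in>F. (u\<^sup>\<dagger> * casimir_inv * z l) * L ((z l)\<^sup>\<dagger> * z m) * ((z m)\<^sup>\<dagger> * casimir_inv * u)) = u\<^sup>\<dagger> * central_part * u"
      by (simp add: central_part_def cas_L_cas_def sum_distrib_left sum_distrib_right mult.assoc)
    also have "\<dots> = (\<Sum>i<k. \<Sum>j<k. (\<eta> i)\<^sup>\<dagger> * ((X i)\<^sup>\<dagger> * central_part) * (X j * \<eta> j))"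
      unfolding u_def adj_sum sum_distrib_right unfolding sum_distrib_left by (simp add: mult.assoc)
    also have "\<dots> = (\<Sum>i<k. \<Sum>j<k. (\<eta> i)\<^sup>\<dagger> * (central_part * ((X i)\<^sup>\<dagger> * X j)) * \<eta> j)"
    proof (intro sum.cong refl)
      fix i j assume "i \<in> {..<k}"
      then have "(X i)\<^sup>\<dagger> * central_part = central_part * (X i)\<^sup>\<dagger>" by (intro central_part_central Xa) simp
      then show "(\<eta> i)\<^sup>\<dagger> * ((X i)\<^sup>\<dagger> * central_part) * (X j * \<eta> j) = (\<eta> i)\<^sup>\<dagger> * (central_part * ((X i)\<^sup>\<dagger> * X j)) * \<eta> j"
        by (simp add: mult.assoc)
    qed
    finally show ?thesis .
  qed
  finally show "pos (\<Sum>i<k. \<Sum>j<k. (\<eta> i)\<^sup>\<dagger> * Psi ((X i)\<^sup>\<dagger> * X j) * \<eta> j)"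
    by (simp only: Psi_def distrib_left distrib_right left_diff_distrib right_diff_distrib sum.distrib sum_subtractf)
qed

subsection \<open>Modular covariance\<close>

text \<open>
  The Casimir tensor is invariant under the modular automorphism applied to both legs: \<open>casimir_left\<close> and
  \<open>casimir_right\<close> carry \<open>s\<close> and \<open>s'\<close> from one leg to the other.
\<close>

lemma cas_L_modular: "s * cas_L = cas_L * s"
proof -
  have m: "s * L (z k) = L (s * z k * s') * s" for k
    using L_modular[of "z k"] LD(1)[of "z k"] by (simp add: mult.assoc s's idm_mult)
  have "s * cas_L = (\<Sum>k\<in>F. L ((s * z k) * s') * (s * (z k)\<^sup>\<dagger>))"
    by (simp add: cas_L_def sum_distrib_left m flip: mult.assoc)
  also have "\<dots> = (\<Sum>k\<in>F. L (z k * s') * (s * ((z k)\<^sup>\<dagger> * s)))"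
    by (rule casimir_left[OF M, of "\<lambda>A B. L (A * s') * (s * B)" s])
      (auto simp: bilinear_on_def LD MD distrib_left distrib_right sM s'M)
  also have "\<dots> = (\<Sum>k\<in>F. L (z k * s') * (s * (z k)\<^sup>\<dagger>)) * s" by (simp add: sum_distrib_right mult.assoc)
  also have "(\<Sum>k\<in>F. L (z k * s') * (s * (z k)\<^sup>\<dagger>)) = (\<Sum>k\<in>F. L (z k) * (s * (s' * (z k)\<^sup>\<dagger>)))"
    by (rule casimir_right[OF M, of "\<lambda>A B. L A * (s * B)" s'])
      (auto simp: bilinear_on_def LD MD distrib_left distrib_right sM s'M)
  also have "\<dots> = cas_L" by (simp add: cas_L_def cancel)
  finally show ?thesis .
qed

lemma cas_L_adj_modular: "s * cas_L\<^sup>\<dagger> = cas_L\<^sup>\<dagger> * s"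
  using arg_cong[OF cas_L_modular, of adj] by (simp add: s_herm)

lemma Psi_modular:
  assumes Y: "Y \<in> M" shows "Psi (s * Y * s') = s * Psi Y * s'"
proof -
  have 1: "cas_L * casimir_inv * s = s * cas_L * casimir_inv" by (metis cas_L_modular casimir_inv(4) mult.assoc sM)
  have 3: "central_part * s = s * central_part" by (rule central_part_central[OF sM, symmetric])
  have c: "s' * (s * casimir_inv) = casimir_inv" using cancel(2)[OF casimir_inv(1)] .
  have 2: "s' * (casimir_inv * cas_L\<^sup>\<dagger>) = casimir_inv * cas_L\<^sup>\<dagger> * s'"
  proof -
    have "casimir_inv * cas_L\<^sup>\<dagger> * s' = s' * (s * (casimir_inv * cas_L\<^sup>\<dagger> * s'))" using cancel(2) casimir_inv cas_LM s'M MD by simp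
    also have "\<dots> = s' * (casimir_inv * cas_L\<^sup>\<dagger> * (s * s'))" by (metis cas_L_adj_modular casimir_inv(4) mult.assoc sM)
    also have "\<dots> = s' * (casimir_inv * cas_L\<^sup>\<dagger>)" using casimir_inv cas_LM MD by (simp add: ss' mult.assoc idm_mult)
    finally show ?thesis by simp
  qed
  have "cas_L * casimir_inv * (s * Y * s') = s * (cas_L * casimir_inv * Y) * s'" by (metis 1 mult.assoc)
  moreover have "s * Y * s' * casimir_inv * cas_L\<^sup>\<dagger> = s * (Y * casimir_inv * cas_L\<^sup>\<dagger>) * s'" by (metis 2 mult.assoc)
  moreover have "central_part * (s * Y * s') = s * (central_part * Y) * s'" by (metis 3 mult.assoc)
  ultimately show ?thesis
    by (simp only: Psi_def L_modular[OF Y] distrib_left distrib_right left_diff_distrib right_diff_distrib)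
qed

end

section \<open>Kraus operators adapted to the modular automorphism\<close>

lemma sum_divmod: "(\<Sum>p<n*n. f p) = (\<Sum>a<n. \<Sum>b<n. f (a * n + b))" for f :: "nat \<Rightarrow> 'b :: comm_monoid_add"
proof -
  have "(\<Sum>b<n. f (a * n + b)) = sum f {a * n..<a * n + n}" for a
  proof -
    have "(\<Sum>b<n. f (a * n + b)) = sum (\<lambda>b. f (b + a * n)) {0..<n}" by (simp add: lessThan_atLeast0 add.commute)
    also have "\<dots> = sum f {0 + a * n..<n + a * n}" by (rule sum.shift_bounds_nat_ivl[symmetric])
    finally show ?thesis by (simp add: add.commute)
  qed
  then show ?thesis by (simp add: sum.nat_group)
qed

lemma pos_tr: "pos A \<Longrightarrow> 0 \<le> tr A"
proof -
  assume "pos A"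
  obtain m where m: "A \<in> corner m" using ex_corner by blast
  show ?thesis using posD[OF \<open>pos A\<close>, of "idm m"] idm_times[OF m] times_idm[OF m] by (simp only: adj_idm)
qed

lemma entry_diag: "entry (\<Sum>p<N. d p *\<^sub>C munit p p) i j = (if i = j \<and> i < N then d i else 0)"
proof -
  have "d p * (if i = p \<and> j = p then 1 else 0) = (if p = i then (if i = j then d i else 0) else 0)" for p by auto
  then show ?thesis by (simp add: entry_munit)
qed

lemma entry_array: "entry (\<Sum>p<N. \<Sum>q<N. c p q *\<^sub>C munit p q) i j = (if i < N \<and> j < N then c i j else 0)"
proof -
  have e: "c p q * (if i = p \<and> j = q then 1 else 0) = (if q = j then (if p = i then c p q else 0) else 0)" for p q by auto
  show ?thesis by (cases "j < N") (simp_all add: entry_munit e)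
qed

text \<open>
  A kernel that connects only indices with equal \<open>d\<close> commutes with the diagonal matrix of \<open>d\<close>. So does
  its square root, taken in the commutant of that matrix.
\<close>

lemma kernel_factorization:
  fixes kap :: "nat \<Rightarrow> nat \<Rightarrow> complex" and d :: "nat \<Rightarrow> real"
  assumes nn: "\<And>y. 0 \<le> (\<Sum>p<N. \<Sum>q<N. cnj (y p) * y q * kap p q)"
    and kd: "\<And>p q. p < N \<Longrightarrow> q < N \<Longrightarrow> kap p q \<noteq> 0 \<Longrightarrow> d p = d q"
  shows "\<exists>S. (\<forall>p<N. \<forall>q<N. kap p q = (\<Sum>r<N. cnj (S r p) * S r q)) \<and>
    (\<forall>r<N. \<forall>p<N. S r p \<noteq> (0::complex) \<longrightarrow> d r = d p)"
proof -
  define A where "A = (\<Sum>p<N. \<Sum>q<N. kap p q *\<^sub>C munit p q)"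
  define D where "D = (\<Sum>p<N. of_real (d p) *\<^sub>C munit p p)"
  have Ae: "entry A p q = (if p < N \<and> q < N then kap p q else 0)" for p q unfolding A_def by (rule entry_array)
  have De: "entry D p q = (if p = q \<and> p < N then of_real (d p) else 0)" for p q unfolding D_def by (rule entry_diag)
  have Ac: "A \<in> corner N" and Dc: "D \<in> corner N" by (auto intro!: cornerI simp: Ae De)
  have XD: "entry (X * D) p q = entry X p q * of_real (d q)" if "X \<in> corner N" for X p q
  proof -
    have "entry (X * D) p q = (\<Sum>r<N. if r = q then entry X p q * of_real (d q) else 0)"
      unfolding entry_times[OF disjI2[OF Dc]] by (intro sum.cong refl) (auto simp: De)
    then show ?thesis using corner_entry[OF that, of p q] by auto
  qed
  have DX: "entry (D * X) p q = of_real (d p) * entry X p q" if "X \<in> corner N" for X p q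
  proof -
    have "entry (D * X) p q = (\<Sum>r<N. if r = p then of_real (d p) * entry X p q else 0)"
      unfolding entry_times[OF disjI1[OF Dc]] by (intro sum.cong refl) (auto simp: De)
    then show ?thesis using corner_entry[OF that, of p q] by auto
  qed
  define C where "C = {X \<in> corner N. \<forall>Y\<in>{D}. X * Y = Y * X}"
  have Cs: "star_alg N C" unfolding C_def
  proof (rule star_alg_commutant)
    have "D\<^sup>\<dagger> = D" by (simp add: D_def)
    then show "Y\<^sup>\<dagger> \<in> {D}" if "Y \<in> {D}" for Y using that by simp
  qed (use Dc in auto)
  have "A * D = D * A"
  proof (rule fmat_eqI)
    fix p q show "entry (A * D) p q = entry (D * A) p q"
    proof (cases "p < N \<and> q < N \<and> kap p q \<noteq> 0")
      case True
      then show ?thesis using kd[of p q] by (simp add: XD[OF Ac] DX[OF Ac] Ae)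
    next
      case False
      then show ?thesis by (auto simp: XD[OF Ac] DX[OF Ac] Ae)
    qed
  qed
  then have AC: "A \<in> C" using Ac by (simp add: C_def)
  have "0 \<le> tr (Y\<^sup>\<dagger> * A * Y)" if "Y \<in> C" for Y
  proof -
    have Yc: "Y \<in> corner N" using that by (simp add: C_def)
    have "tr (Y\<^sup>\<dagger> * A * Y) = (\<Sum>m<N. \<Sum>q<N. (\<Sum>p<N. cnj (entry Y p m) * kap p q) * entry Y q m)"
      unfolding tr_eq[OF corner_times[OF corner_times[OF adj_corner[OF Yc] Ac] Yc]] entry_times[OF disjI2[OF Yc]]
        entry_times[OF disjI2[OF Ac]]
      by (intro sum.cong refl arg_cong2[of _ _ _ _ times]) (auto simp: Ae)
    also have "\<dots> = (\<Sum>m<N. \<Sum>q<N. \<Sum>p<N. cnj (entry Y p m) * entry Y q m * kap p q)"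
      unfolding sum_distrib_right by (intro sum.cong refl) (simp only: mult_ac)
    also have "\<dots> = (\<Sum>m<N. \<Sum>p<N. \<Sum>q<N. cnj (entry Y p m) * entry Y q m * kap p q)"
      by (intro sum.cong refl sum.swap)
    also have "0 \<le> \<dots>" by (intro sum_nonneg nn)
    finally show ?thesis .
  qed
  then obtain R where R: "R \<in> C" "pos R" "R * R = A" using sqrt_in_star_alg[OF Cs AC] by blast
  have Rc: "R \<in> corner N" and RD: "R * D = D * R" using R(1) by (auto simp: C_def)
  have Rh: "entry R p q = cnj (entry R q p)" for p q using pos_herm[OF R(2)] by (metis entry_simps(6))
  have "kap p q = (\<Sum>r<N. cnj (entry R r p) * entry R r q)" if "p < N" "q < N" for p q
  proof -
    have "kap p q = entry (R * R) p q" using that by (simp add: R(3) Ae)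
    also have "\<dots> = (\<Sum>r<N. cnj (entry R r p) * entry R r q)"
      unfolding entry_times[OF disjI1[OF Rc]] by (simp only: Rh[of p])
    finally show ?thesis .
  qed
  moreover have "d r = d p" if "entry R r p \<noteq> 0" for r p
  proof -
    have "entry R r p * of_real (d p) = of_real (d r) * entry R r p" using RD XD[OF Rc] DX[OF Rc] by metis
    then have "entry R r p * (of_real (d p) - of_real (d r)) = 0" by (simp add: algebra_simps)
    then show ?thesis using that by simp
  qed
  ultimately show ?thesis by (intro exI[of _ "entry R"]) auto
qed

context gns_qms
begin

text \<open>
  Let \<open>w\<close> be an eigenbasis of \<open>s\<close> with eigenvalues \<open>l\<close>. The matrix units \<open>w a * (w b)\<^sup>\<dagger>\<close> are eigenvectors of the
  modular automorphism, with eigenvalues \<open>l a / l b\<close>. Since \<open>Psi \<circ> hs_proj M\<close> commutes with the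
  automorphism, its Choi kernel connects only pairs with the same quotient, and by
  \<open>kernel_factorization\<close> every Kraus operator can be built from matrix units with a single quotient.
\<close>

lemma kraus:
  "\<exists>N V r. (\<forall>q<N. 0 < r q \<and> V q \<in> corner n \<and> s * V q = complex_of_real (r q) *\<^sub>C (V q * s)) \<and>
     (\<forall>X\<in>M. Psi X = (\<Sum>q<N::nat. (V q)\<^sup>\<dagger> * X * V q))"
proof -
  obtain w l where w: "\<And>i. i < n \<Longrightarrow> w i \<in> corner n" "\<And>i. i < n \<Longrightarrow> w i * munit 0 0 = w i"
    "\<And>i. i < n \<Longrightarrow> s * w i = of_real (l i) *\<^sub>C w i"
    "\<And>i j. i < n \<Longrightarrow> j < n \<Longrightarrow> (w i)\<^sup>\<dagger> * w j = (if i = j then munit 0 0 else 0)"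
    "(\<Sum>i<n. w i * (w i)\<^sup>\<dagger>) = idm n"
    using herm_eigenbasis[OF s_corner s_herm] by blast
  have ws: "(w i)\<^sup>\<dagger> * s = of_real (l i) *\<^sub>C (w i)\<^sup>\<dagger>" if "i < n" for i
    using arg_cong[OF w(3)[OF that], of adj] by (simp add: s_herm)
  have l0: "0 < l i" if i: "i < n" for i
  proof -
    have "tr ((w i)\<^sup>\<dagger> * s * w i) = of_real (l i)" using i by (simp add: mult.assoc w tr_munit)
    then have "0 \<le> l i" using posD[OF spos, of "w i"] by (simp add: less_eq_complex_def)
    moreover have "l i \<noteq> 0"
    proof
      assume "l i = 0"
      then have "s' * (s * w i) = 0" using w(3)[OF i] by simp
      then have "w i = 0" using w(1)[OF i] by (simp add: s's idm_times flip: mult.assoc)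
      then have "munit 0 0 = 0" using w(4)[OF i i] by simp
      then show False using tr_munit[of 0 0] by simp
    qed
    ultimately show ?thesis by simp
  qed
  have inner: "(w a)\<^sup>\<dagger> * X * w c = tr ((w a)\<^sup>\<dagger> * X * w c) *\<^sub>C munit 0 0" if "a < n" "c < n" for a c X
    using column_inner[of "w a" "X * w c"] that by (simp add: w(2) mult.assoc)
  have sandwich: "(w b * (w a)\<^sup>\<dagger>) * X * (w c * (w d)\<^sup>\<dagger>) = tr ((w a)\<^sup>\<dagger> * X * w c) *\<^sub>C (w b * (w d)\<^sup>\<dagger>)"
    if "a < n" "c < n" "b < n" for a b c d X
  proof -
    have "(w b * (w a)\<^sup>\<dagger>) * X * (w c * (w d)\<^sup>\<dagger>) = w b * ((w a)\<^sup>\<dagger> * X * w c) * (w d)\<^sup>\<dagger>" by (simp only: mult.assoc)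
    also have "\<dots> = tr ((w a)\<^sup>\<dagger> * X * w c) *\<^sub>C ((w b * munit 0 0) * (w d)\<^sup>\<dagger>)"
      by (subst inner[OF that(1,2)]) simp
    finally show ?thesis using that by (simp add: w(2))
  qed
  have expand: "X = (\<Sum>a<n. \<Sum>c<n. tr ((w a)\<^sup>\<dagger> * X * w c) *\<^sub>C (w a * (w c)\<^sup>\<dagger>))" if X: "X \<in> corner n" for X
  proof -
    have "X = (\<Sum>a<n. w a * (w a)\<^sup>\<dagger>) * X * (\<Sum>c<n. w c * (w c)\<^sup>\<dagger>)" using X by (simp add: w(5) idm_times times_idm)
    also have "\<dots> = (\<Sum>a<n. \<Sum>c<n. (w a * (w a)\<^sup>\<dagger>) * X * (w c * (w c)\<^sup>\<dagger>))"
      by (simp only: sum_distrib_right sum_distrib_left) (rule sum.swap)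
    also have "\<dots> = (\<Sum>a<n. \<Sum>c<n. tr ((w a)\<^sup>\<dagger> * X * w c) *\<^sub>C (w a * (w c)\<^sup>\<dagger>))"
      by (intro sum.cong refl sandwich) auto
    finally show ?thesis .
  qed
  define \<Theta> where "\<Theta> X = Psi (hs_proj M X)" for X
  have \<Theta>M: "\<Theta> X \<in> M" for X unfolding \<Theta>_def by (intro Psi_M P_in[OF M])
  have \<Theta>c: "\<Theta> X \<in> corner n" for X using \<Theta>M MD by blast
  have \<Theta>cp: "cp UNIV \<Theta>"
    unfolding \<Theta>_def[abs_def] by (rule cp_compose[OF M Psi_cp Psi_lin P_cp[OF M]]) (rule P_in[OF M])
  have \<Theta>s: "\<Theta> (c *\<^sub>C X) = c *\<^sub>C \<Theta> X" for c X
    by (simp add: \<Theta>_def P_cscale[OF M] lin_onD(3)[OF Psi_lin P_in[OF M]])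
  have \<Theta>sum: "\<Theta> (sum f S) = (\<Sum>x\<in>S. \<Theta> (f x))" for f and S :: "nat set"
    unfolding \<Theta>_def P_sum[OF M] by (rule lin_sum[OF MD(11,1) Psi_lin]) (rule P_in[OF M])
  have \<Theta>mod: "\<Theta> (s * X * s') = s * \<Theta> X * s'" for X
    unfolding \<Theta>_def P_bimodule[OF M sM s'M] by (rule Psi_modular[OF P_in[OF M]])
  (* An index p < n * n stands for the pair (p div n, p mod n). *)
  define kap where "kap p q = tr ((w (p mod n))\<^sup>\<dagger> * \<Theta> (w (p div n) * (w (q div n))\<^sup>\<dagger>) * w (q mod n))" for p q
  define d where "d p = l (p div n) / l (p mod n)" for p
  have idx: "p div n < n" "p mod n < n" if "p < n * n" for p
  proof -
    have "0 < n" using that by (cases n) auto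
    then show "p div n < n" "p mod n < n" using that by (auto simp: less_mult_imp_div_less)
  qed
  have "\<exists>S. (\<forall>p<n*n. \<forall>q<n*n. kap p q = (\<Sum>r<n*n. cnj (S r p) * S r q)) \<and>
      (\<forall>r<n*n. \<forall>p<n*n. S r p \<noteq> (0::complex) \<longrightarrow> d r = d p)"
  proof (rule kernel_factorization)
    fix y :: "nat \<Rightarrow> complex"
    (* A scalar test vector y for the kernel is a tuple of test columns \<eta> a for complete positivity. *)
    define \<eta> where "\<eta> a = (\<Sum>b<n. y (a * n + b) *\<^sub>C w b)" for a
    have "pos (\<Sum>a<n. \<Sum>c<n. (\<eta> a)\<^sup>\<dagger> * \<Theta> (((w a)\<^sup>\<dagger>)\<^sup>\<dagger> * (w c)\<^sup>\<dagger>) * \<eta> c)" by (rule cpD[OF \<Theta>cp]) simp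
    then have "0 \<le> tr (\<Sum>a<n. \<Sum>c<n. (\<eta> a)\<^sup>\<dagger> * \<Theta> (w a * (w c)\<^sup>\<dagger>) * \<eta> c)" by (intro pos_tr) simp
    also have "\<dots> = (\<Sum>a<n. \<Sum>c<n. \<Sum>d<n. \<Sum>b<n. y (c * n + d) * (cnj (y (a * n + b)) * tr ((w b)\<^sup>\<dagger> * \<Theta> (w a * (w c)\<^sup>\<dagger>) * w d)))"
      by (simp add: \<eta>_def sum_distrib_left sum_distrib_right cscale_sum mult.assoc)
    also have "\<dots> = (\<Sum>a<n. \<Sum>c<n. \<Sum>d<n. \<Sum>b<n. cnj (y (a * n + b)) * y (c * n + d) * tr ((w b)\<^sup>\<dagger> * \<Theta> (w a * (w c)\<^sup>\<dagger>) * w d))"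
      by (intro sum.cong refl) (simp only: mult_ac)
    also have "\<dots> = (\<Sum>a<n. \<Sum>c<n. \<Sum>b<n. \<Sum>d<n. cnj (y (a * n + b)) * y (c * n + d) * tr ((w b)\<^sup>\<dagger> * \<Theta> (w a * (w c)\<^sup>\<dagger>) * w d))"
      by (intro sum.cong refl sum.swap)
    also have "\<dots> = (\<Sum>a<n. \<Sum>b<n. \<Sum>c<n. \<Sum>d<n. cnj (y (a * n + b)) * y (c * n + d) * tr ((w b)\<^sup>\<dagger> * \<Theta> (w a * (w c)\<^sup>\<dagger>) * w d))"
      by (intro sum.cong refl sum.swap)
    also have "\<dots> = (\<Sum>p<n*n. \<Sum>q<n*n. cnj (y p) * y q * kap p q)"
      unfolding sum_divmod by (intro sum.cong refl) (simp add: kap_def)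
    finally show "0 \<le> (\<Sum>p<n*n. \<Sum>q<n*n. cnj (y p) * y q * kap p q)" .
  next
    fix p q assume pq: "p < n * n" "q < n * n" "kap p q \<noteq> 0"
    let ?a = "p div n" and ?b = "p mod n" and ?c = "q div n" and ?d = "q mod n"
    have s'w: "(w i)\<^sup>\<dagger> * s' = of_real (1 / l i) *\<^sub>C (w i)\<^sup>\<dagger>" "s' * w i = of_real (1 / l i) *\<^sub>C w i" if i: "i < n" for i
    proof -
      have "w i = s' * (s * w i)" using w(1)[OF i] by (simp add: s's idm_times flip: mult.assoc)
      also have "\<dots> = of_real (l i) *\<^sub>C (s' * w i)" using w(3)[OF i] by simp
      finally have "of_real (1 / l i) *\<^sub>C w i = of_real (1 / l i) *\<^sub>C of_real (l i) *\<^sub>C (s' * w i)" by (rule arg_cong)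
      then show 1: "s' * w i = of_real (1 / l i) *\<^sub>C w i" using l0[OF i] by simp
      show "(w i)\<^sup>\<dagger> * s' = of_real (1 / l i) *\<^sub>C (w i)\<^sup>\<dagger>" using arg_cong[OF 1, of adj] by (simp add: s'_herm)
    qed
    have "s * (w ?a * (w ?c)\<^sup>\<dagger>) * s' = (s * w ?a) * ((w ?c)\<^sup>\<dagger> * s')" by (simp only: mult.assoc)
    also have "\<dots> = of_real (l ?a / l ?c) *\<^sub>C (w ?a * (w ?c)\<^sup>\<dagger>)"
      using idx pq by (simp add: w(3) s'w)
    finally have "\<Theta> (s * (w ?a * (w ?c)\<^sup>\<dagger>) * s') = of_real (l ?a / l ?c) *\<^sub>C \<Theta> (w ?a * (w ?c)\<^sup>\<dagger>)" by (simp only: \<Theta>s)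
    then have "tr ((w ?b)\<^sup>\<dagger> * (s * \<Theta> (w ?a * (w ?c)\<^sup>\<dagger>) * s') * w ?d) = of_real (l ?a / l ?c) * kap p q"
      by (simp only: \<Theta>mod) (simp add: kap_def)
    moreover have "(w ?b)\<^sup>\<dagger> * (s * \<Theta> (w ?a * (w ?c)\<^sup>\<dagger>) * s') * w ?d = ((w ?b)\<^sup>\<dagger> * s) * \<Theta> (w ?a * (w ?c)\<^sup>\<dagger>) * (s' * w ?d)"
      by (simp only: mult.assoc)
    moreover have "tr (((w ?b)\<^sup>\<dagger> * s) * \<Theta> (w ?a * (w ?c)\<^sup>\<dagger>) * (s' * w ?d)) = of_real (l ?b / l ?d) * kap p q"
      using idx pq by (simp add: ws s'w kap_def)
    ultimately have "complex_of_real (l ?a / l ?c) * kap p q = of_real (l ?b / l ?d) * kap p q" by simp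
    then have "complex_of_real (l ?a / l ?c) = of_real (l ?b / l ?d)" using pq(3) by (simp only: mult_cancel_right) simp
    then have "l ?a / l ?c = l ?b / l ?d" by (simp only: of_real_eq_iff)
    then show "d p = d q"
      using l0[of ?a] l0[of ?b] l0[of ?c] l0[of ?d] idx pq by (simp add: d_def field_simps)
  qed
  then obtain S where S: "\<And>p q. p < n * n \<Longrightarrow> q < n * n \<Longrightarrow> kap p q = (\<Sum>r<n*n. cnj (S r p) * S r q)"
    "\<And>r p. r < n * n \<Longrightarrow> p < n * n \<Longrightarrow> S r p \<noteq> (0::complex) \<Longrightarrow> d r = d p" by blast
  define V where "V q = (\<Sum>p<n*n. S q p *\<^sub>C (w (p div n) * (w (p mod n))\<^sup>\<dagger>))" for q
  have "0 < d q \<and> V q \<in> corner n \<and> s * V q = complex_of_real (d q) *\<^sub>C (V q * s)" if q: "q < n * n" for q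
  proof (intro conjI)
    show "0 < d q" unfolding d_def using l0 idx[OF q] by simp
    show "V q \<in> corner n" unfolding V_def using w(1) idx by (intro corner_sum corner_cscale corner_times adj_corner) auto
    have "s * V q = (\<Sum>p<n*n. S q p *\<^sub>C (of_real (l (p div n)) *\<^sub>C (w (p div n) * (w (p mod n))\<^sup>\<dagger>)))"
      unfolding V_def sum_distrib_left
      by (intro sum.cong refl) (use idx in \<open>simp add: w(3) flip: mult.assoc\<close>)
    also have "\<dots> = (\<Sum>p<n*n. of_real (d q) *\<^sub>C (S q p *\<^sub>C (of_real (l (p mod n)) *\<^sub>C (w (p div n) * (w (p mod n))\<^sup>\<dagger>))))"
    proof (intro sum.cong refl)
      fix p assume p: "p \<in> {..<n*n}"
      show "S q p *\<^sub>C (of_real (l (p div n)) *\<^sub>C (w (p div n) * (w (p mod n))\<^sup>\<dagger>)) =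
          of_real (d q) *\<^sub>C (S q p *\<^sub>C (of_real (l (p mod n)) *\<^sub>C (w (p div n) * (w (p mod n))\<^sup>\<dagger>)))"
      proof (cases "S q p = 0")
        case False
        then have "d q = l (p div n) / l (p mod n)" using S(2)[OF q, of p] p by (simp add: d_def)
        then have "l (p div n) = d q * l (p mod n)" using l0[of "p mod n"] idx[of p] p by simp
        then show ?thesis by (simp add: mult_ac)
      qed simp
    qed
    also have "\<dots> = of_real (d q) *\<^sub>C (V q * s)"
      unfolding V_def sum_distrib_right cscale_sum
      by (intro sum.cong refl) (use idx in \<open>simp add: ws mult.assoc\<close>)
    finally show "s * V q = complex_of_real (d q) *\<^sub>C (V q * s)" .
  qed
  moreover have "Psi X = (\<Sum>q<n*n. (V q)\<^sup>\<dagger> * X * V q)" if X: "X \<in> M" for X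
  proof -
    define x where "x a c = tr ((w a)\<^sup>\<dagger> * X * w c)" for a c
    have "(V q)\<^sup>\<dagger> * X * V q = (\<Sum>p<n*n. \<Sum>p'<n*n. (cnj (S q p) * S q p' * x (p div n) (p' div n)) *\<^sub>C (w (p mod n) * (w (p' mod n))\<^sup>\<dagger>))" for q
    proof -
      have "(V q)\<^sup>\<dagger> * X * V q = (\<Sum>p<n*n. \<Sum>p'<n*n. (cnj (S q p) * S q p') *\<^sub>C
          ((w (p mod n) * (w (p div n))\<^sup>\<dagger>) * X * (w (p' div n) * (w (p' mod n))\<^sup>\<dagger>)))"
        unfolding V_def adj_sum sum_distrib_right by (simp add: sum_distrib_left cscale_sum mult.commute)
      also have "\<dots> = (\<Sum>p<n*n. \<Sum>p'<n*n. (cnj (S q p) * S q p' * x (p div n) (p' div n)) *\<^sub>C (w (p mod n) * (w (p' mod n))\<^sup>\<dagger>))"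
        by (intro sum.cong refl) (use idx in \<open>simp add: sandwich x_def\<close>)
      finally show ?thesis .
    qed
    then have "(\<Sum>q<n*n. (V q)\<^sup>\<dagger> * X * V q) =
        (\<Sum>p<n*n. \<Sum>p'<n*n. \<Sum>q<n*n. (cnj (S q p) * S q p' * x (p div n) (p' div n)) *\<^sub>C (w (p mod n) * (w (p' mod n))\<^sup>\<dagger>))"
      by (simp only:) (subst sum.swap, intro sum.cong refl sum.swap)
    also have "\<dots> = (\<Sum>p<n*n. \<Sum>p'<n*n. (kap p p' * x (p div n) (p' div n)) *\<^sub>C (w (p mod n) * (w (p' mod n))\<^sup>\<dagger>))"
      by (intro sum.cong refl) (simp add: S(1) sum_distrib_right flip: cscale_sum_left)
    also have "\<dots> = (\<Sum>a<n. \<Sum>b<n. \<Sum>c<n. \<Sum>d<n. (tr ((w b)\<^sup>\<dagger> * \<Theta> (w a * (w c)\<^sup>\<dagger>) * w d) * x a c) *\<^sub>C (w b * (w d)\<^sup>\<dagger>))"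
      unfolding sum_divmod by (intro sum.cong refl) (simp add: kap_def)
    also have "\<dots> = (\<Sum>a<n. \<Sum>c<n. \<Sum>b<n. \<Sum>d<n. (tr ((w b)\<^sup>\<dagger> * \<Theta> (w a * (w c)\<^sup>\<dagger>) * w d) * x a c) *\<^sub>C (w b * (w d)\<^sup>\<dagger>))"
      by (intro sum.cong refl sum.swap)
    also have "\<dots> = (\<Sum>a<n. \<Sum>c<n. x a c *\<^sub>C \<Theta> (w a * (w c)\<^sup>\<dagger>))"
    proof (intro sum.cong refl)
      fix a c
      show "(\<Sum>b<n. \<Sum>d<n. (tr ((w b)\<^sup>\<dagger> * \<Theta> (w a * (w c)\<^sup>\<dagger>) * w d) * x a c) *\<^sub>C (w b * (w d)\<^sup>\<dagger>)) =
          x a c *\<^sub>C \<Theta> (w a * (w c)\<^sup>\<dagger>)"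
        by (subst (2) expand[OF \<Theta>c]) (simp add: cscale_sum mult.commute)
    qed
    also have "\<dots> = \<Theta> (\<Sum>a<n. \<Sum>c<n. x a c *\<^sub>C (w a * (w c)\<^sup>\<dagger>))" by (simp add: \<Theta>sum \<Theta>s)
    also have "\<dots> = \<Theta> X" using expand[OF MD(12)[OF X]] by (simp add: x_def)
    also have "\<dots> = Psi X" by (simp add: \<Theta>_def P_id[OF M X])
    finally show ?thesis by simp
  qed
  ultimately show ?thesis by (intro exI[of _ "n * n"] exI[of _ V] exI[of _ d]) blast
qed

text \<open>
  GNS symmetry yields a second expression \<open>L2\<close> for \<open>L\<close>, where \<open>V q\<close> is replaced by a multiple of its
  adjoint and \<open>k\<close> by \<open>k\<^sup>\<dagger>\<close>. In the sum of both expressions only the hermitian combination \<open>g = k + k\<^sup>\<dagger>\<close> survives,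
  and it is determined by \<open>L (idm n) = 0\<close>. This removes the Hamiltonian part of the generator.
\<close>

lemma symmetric_form:
  "\<exists>N V r. (\<forall>q<N. 0 < r q \<and> V q \<in> corner n \<and> s * V q = complex_of_real (r q) *\<^sub>C (V q * s)) \<and>
     (\<forall>X\<in>M. 2 *\<^sub>C L X = hs_proj M (\<Sum>q<N::nat. (V q)\<^sup>\<dagger> * X * V q + of_real (1 / r q) *\<^sub>C (V q * X * (V q)\<^sup>\<dagger>))
       - (1/2) *\<^sub>C (hs_proj M (\<Sum>q<N. (V q)\<^sup>\<dagger> * V q + of_real (1 / r q) *\<^sub>C (V q * (V q)\<^sup>\<dagger>)) * X
          + X * hs_proj M (\<Sum>q<N. (V q)\<^sup>\<dagger> * V q + of_real (1 / r q) *\<^sub>C (V q * (V q)\<^sup>\<dagger>))))"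
proof -
  obtain N :: nat and V r where V: "\<And>q. q < N \<Longrightarrow> 0 < r q" "\<And>q. q < N \<Longrightarrow> V q \<in> corner n"
    "\<And>q. q < N \<Longrightarrow> s * V q = complex_of_real (r q) *\<^sub>C (V q * s)"
    "\<And>X. X \<in> M \<Longrightarrow> Psi X = (\<Sum>q<N. (V q)\<^sup>\<dagger> * X * V q)"
    using kraus by blast
  define \<Psi>' where "\<Psi>' X = (\<Sum>q<N. of_real (1 / r q) *\<^sub>C (V q * X * (V q)\<^sup>\<dagger>))" for X
  have Vs: "s * (V q)\<^sup>\<dagger> = of_real (1 / r q) *\<^sub>C ((V q)\<^sup>\<dagger> * s)" if q: "q < N" for q
  proof -
    have "(V q)\<^sup>\<dagger> * s = of_real (r q) *\<^sub>C (s * (V q)\<^sup>\<dagger>)" using arg_cong[OF V(3)[OF q], of adj] by (simp add: s_herm)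
    then have "of_real (1 / r q) *\<^sub>C ((V q)\<^sup>\<dagger> * s) = of_real (1 / r q) *\<^sub>C of_real (r q) *\<^sub>C (s * (V q)\<^sup>\<dagger>)" by simp
    then show ?thesis using V(1)[OF q] by simp
  qed
  have adjoint: "tr (s * Psi X * Y) = tr (s * X * \<Psi>' Y)" if X: "X \<in> M" and Y: "Y \<in> M" for X Y
  proof -
    have "tr (s * Psi X * Y) = (\<Sum>q<N. tr (s * (V q)\<^sup>\<dagger> * X * V q * Y))"
      by (simp add: V(4)[OF X] sum_distrib_left sum_distrib_right mult.assoc)
    also have "\<dots> = (\<Sum>q<N. tr (of_real (1 / r q) *\<^sub>C (s * X * V q * Y * (V q)\<^sup>\<dagger>)))"
    proof (intro sum.cong refl)
      fix q assume "q \<in> {..<N}"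
      then have "s * (V q)\<^sup>\<dagger> * X * V q * Y = of_real (1 / r q) *\<^sub>C ((V q)\<^sup>\<dagger> * (s * X * V q * Y))" by (simp add: Vs mult.assoc)
      then show "tr (s * (V q)\<^sup>\<dagger> * X * V q * Y) = tr (of_real (1 / r q) *\<^sub>C (s * X * V q * Y * (V q)\<^sup>\<dagger>))"
        by (simp only: tr_simps) (simp only: tr_comm)
    qed
    also have "\<dots> = tr (s * X * \<Psi>' Y)"
      by (simp add: \<Psi>'_def sum_distrib_left mult.assoc)
    finally show ?thesis .
  qed
  define k where "k = cas_L * casimir_inv"
  have kM: "k \<in> M" "k\<^sup>\<dagger> \<in> M" unfolding k_def using MD(5) cas_LM casimir_inv(1) MD(6) by auto
  have ka: "casimir_inv * cas_L\<^sup>\<dagger> = k\<^sup>\<dagger>" by (simp add: k_def casimir_inv(2))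
  have ks: "k * s = s * k"
  proof -
    have "k * s = cas_L * (casimir_inv * s)" by (simp add: k_def mult.assoc)
    also have "\<dots> = cas_L * s * casimir_inv" using casimir_inv(4)[OF sM] by (simp add: mult.assoc)
    also have "\<dots> = s * k" by (simp add: k_def mult.assoc flip: cas_L_modular) 
    finally show ?thesis .
  qed
  have LPsi: "L X = Psi X + k * X + X * k\<^sup>\<dagger> - central_part * X" for X
    by (simp add: Psi_def k_def casimir_inv(2) mult.assoc)
  have L2: "L Y = hs_proj M (\<Psi>' Y) + Y * k + k\<^sup>\<dagger> * Y - central_part * Y" if Y: "Y \<in> M" for Y
  proof -
    define D where "D = hs_proj M (\<Psi>' Y) + Y * k + k\<^sup>\<dagger> * Y - central_part * Y - L Y"
    have DM: "D \<in> M" unfolding D_def using Y kM central_partM LD(1) P_in[OF M] by (intro MD)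
    have "tr (s * X * D) = 0" if X: "X \<in> M" for X
    proof -
      have 1: "tr (s * (k * X) * Y) = tr (s * X * (Y * k))"
        by (metis ks mult.assoc tr_comm)
      have 2: "tr (s * (X * k\<^sup>\<dagger>) * Y) = tr (s * X * (k\<^sup>\<dagger> * Y))" by (simp only: mult.assoc)
      have 3: "tr (s * (central_part * X) * Y) = tr (s * X * (central_part * Y))" by (simp only: central_part_central[OF X, symmetric] mult.assoc)
      have 4: "tr (s * X * hs_proj M (\<Psi>' Y)) = tr (s * X * \<Psi>' Y)"
        using P_tr[OF M MD(6)[OF MD(5)[OF sM X]], of "\<Psi>' Y"] by simp
      have "tr (s * L X * Y) = tr (s * X * \<Psi>' Y) + tr (s * (k * X) * Y) + tr (s * (X * k\<^sup>\<dagger>) * Y) - tr (s * (central_part * X) * Y)"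
        unfolding LPsi[of X] adjoint[OF X Y, symmetric]
        by (simp only: distrib_left distrib_right left_diff_distrib right_diff_distrib tr_simps)
      also have "\<dots> = tr (s * X * hs_proj M (\<Psi>' Y)) + tr (s * X * (Y * k)) + tr (s * X * (k\<^sup>\<dagger> * Y)) - tr (s * X * (central_part * Y))"
        by (simp only: 1 2 3 4)
      finally have "tr (s * X * L Y) = tr (s * X * hs_proj M (\<Psi>' Y)) + tr (s * X * (Y * k)) + tr (s * X * (k\<^sup>\<dagger> * Y)) - tr (s * X * (central_part * Y))"
        by (simp only: gns_bilinear[OF X Y])
      then show ?thesis unfolding D_def by (simp only: right_diff_distrib distrib_left tr_simps) simp
    qed
    from this[OF MD(6)[OF DM]] have "D = 0" using faithful[OF DM] by (simp only: mult.assoc)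
    then show ?thesis by (simp add: D_def)
  qed
  define \<Phi> where "\<Phi> X = hs_proj M (\<Sum>q<N. (V q)\<^sup>\<dagger> * X * V q + of_real (1 / r q) *\<^sub>C (V q * X * (V q)\<^sup>\<dagger>))" for X
  define g where "g = k + k\<^sup>\<dagger>"
  have gM: "g \<in> M" using kM MD by (simp add: g_def)
  have two: "2 *\<^sub>C Z = Z + Z" for Z by (rule fmat_eqI) simp
  have LL: "2 *\<^sub>C L X = \<Phi> X + g * X + X * g - 2 *\<^sub>C (central_part * X)" if X: "X \<in> M" for X
  proof -
    have "Psi X = hs_proj M (\<Sum>q<N. (V q)\<^sup>\<dagger> * X * V q)" using P_id[OF M Psi_M[OF X]] V(4)[OF X] by simp
    then have "\<Phi> X = Psi X + hs_proj M (\<Psi>' X)" by (simp add: \<Phi>_def \<Psi>'_def sum.distrib P_add[OF M])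
    moreover have "2 *\<^sub>C L X = (Psi X + k * X + X * k\<^sup>\<dagger> - central_part * X) + (hs_proj M (\<Psi>' X) + X * k + k\<^sup>\<dagger> * X - central_part * X)"
      using LPsi[of X] L2[OF X] two[of "L X"] by simp
    ultimately show ?thesis by (simp add: two g_def algebra_simps)
  qed
  have "0 = \<Phi> (idm n) + 2 *\<^sub>C g - 2 *\<^sub>C central_part"
    using LL[OF MD(2)] gM central_partM by (simp add: L_idm idm_mult two add.assoc del: cscale_simps)
  then have "(1/2) *\<^sub>C (\<Phi> (idm n) + 2 *\<^sub>C g - 2 *\<^sub>C central_part) = 0" by simp
  then have g: "g = central_part - (1/2) *\<^sub>C \<Phi> (idm n)" by (simp add: algebra_simps)
  have \<Phi>1: "hs_proj M (\<Sum>q<N. (V q)\<^sup>\<dagger> * V q + of_real (1 / r q) *\<^sub>C (V q * (V q)\<^sup>\<dagger>)) = \<Phi> (idm n)"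
    unfolding \<Phi>_def by (intro arg_cong[of _ _ "hs_proj M"] sum.cong refl) (use V(2) in \<open>simp add: times_idm adj_corner\<close>)
  have "2 *\<^sub>C L X = \<Phi> X - (1/2) *\<^sub>C (\<Phi> (idm n) * X + X * \<Phi> (idm n))" if X: "X \<in> M" for X
    unfolding LL[OF X] g using central_part_central[OF X] by (simp add: two algebra_simps)
  then show ?thesis using V \<Phi>1 unfolding \<Phi>_def[symmetric]
    by (intro exI[of _ N] exI[of _ V] exI[of _ r]) (auto simp: \<Phi>_def)
qed

end

subsection \<open>Closure properties of complete positivity\<close>

lemma cp_zero: "cp N (\<lambda>X. 0)"
  by (simp add: cp_def)

lemma cp_add:
  assumes "cp N \<Phi>" "cp N \<Psi>" shows "cp N (\<lambda>X. \<Phi> X + \<Psi> X)"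
  unfolding cp_def
proof (intro allI impI)
  fix k :: nat and V \<xi> :: "nat \<Rightarrow> fmat" assume "\<forall>i<k. V i \<in> N"
  then have "pos ((\<Sum>i<k. \<Sum>j<k. (\<xi> i)\<^sup>\<dagger> * \<Phi> ((V i)\<^sup>\<dagger> * V j) * \<xi> j) + (\<Sum>i<k. \<Sum>j<k. (\<xi> i)\<^sup>\<dagger> * \<Psi> ((V i)\<^sup>\<dagger> * V j) * \<xi> j))"
    by (intro pos_add cpD[OF assms(1)] cpD[OF assms(2)]) auto
  then show "pos (\<Sum>i<k. \<Sum>j<k. (\<xi> i)\<^sup>\<dagger> * (\<Phi> ((V i)\<^sup>\<dagger> * V j) + \<Psi> ((V i)\<^sup>\<dagger> * V j)) * \<xi> j)"
    by (simp only: distrib_left distrib_right sum.distrib)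
qed

lemma cp_sum: "(\<And>x. x \<in> S \<Longrightarrow> cp N (\<Phi> x)) \<Longrightarrow> cp N (\<lambda>X. \<Sum>x\<in>S. \<Phi> x X)"
proof (induction S rule: infinite_finite_induct)
  case (insert x S)
  then show ?case using cp_add[of N "\<Phi> x" "\<lambda>X. \<Sum>x\<in>S. \<Phi> x X"] by simp
qed (simp_all add: cp_zero)

lemma cp_scale:
  assumes "cp N \<Phi>" "0 \<le> c" shows "cp N (\<lambda>X. c *\<^sub>C \<Phi> X)"
  unfolding cp_def
proof (intro allI impI)
  fix k :: nat and V \<xi> :: "nat \<Rightarrow> fmat" assume "\<forall>i<k. V i \<in> N"
  then have "pos (c *\<^sub>C (\<Sum>i<k. \<Sum>j<k. (\<xi> i)\<^sup>\<dagger> * \<Phi> ((V i)\<^sup>\<dagger> * V j) * \<xi> j))"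
    by (intro pos_cscale assms(2) cpD[OF assms(1)]) auto
  then show "pos (\<Sum>i<k. \<Sum>j<k. (\<xi> i)\<^sup>\<dagger> * (c *\<^sub>C \<Phi> ((V i)\<^sup>\<dagger> * V j)) * \<xi> j)"
    by (simp only: cscale_sum cscale_mult)
qed

lemma cp_conj:
  assumes "cp N \<Phi>" shows "cp N (\<lambda>X. C * \<Phi> X * C\<^sup>\<dagger>)"
  unfolding cp_def
proof (intro allI impI)
  fix k :: nat and V \<xi> :: "nat \<Rightarrow> fmat" assume "\<forall>i<k. V i \<in> N"
  then have "pos (\<Sum>i<k. \<Sum>j<k. (C\<^sup>\<dagger> * \<xi> i)\<^sup>\<dagger> * \<Phi> ((V i)\<^sup>\<dagger> * V j) * (C\<^sup>\<dagger> * \<xi> j))"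
    by (intro cpD[OF assms]) auto
  then show "pos (\<Sum>i<k. \<Sum>j<k. (\<xi> i)\<^sup>\<dagger> * (C * \<Phi> ((V i)\<^sup>\<dagger> * V j) * C\<^sup>\<dagger>) * \<xi> j)"
    by (simp only: adj_times adj_simps mult.assoc)
qed

lemma cp_cong: "(\<And>X Y. X \<in> N \<Longrightarrow> Y \<in> N \<Longrightarrow> \<Phi> (X\<^sup>\<dagger> * Y) = \<Psi> (X\<^sup>\<dagger> * Y)) \<Longrightarrow> cp N \<Psi> \<Longrightarrow> cp N \<Phi>"
  unfolding cp_def by simp

lemma cp_precompose:
  assumes "cp UNIV \<Phi>" shows "cp N (\<lambda>X. \<Phi> (C\<^sup>\<dagger> * X * C))"
  unfolding cp_def
proof (intro allI impI)
  fix k :: nat and V \<xi> :: "nat \<Rightarrow> fmat"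
  have "pos (\<Sum>i<k. \<Sum>j<k. (\<xi> i)\<^sup>\<dagger> * \<Phi> ((V i * C)\<^sup>\<dagger> * (V j * C)) * \<xi> j)" by (intro cpD[OF assms]) auto
  then show "pos (\<Sum>i<k. \<Sum>j<k. (\<xi> i)\<^sup>\<dagger> * \<Phi> (C\<^sup>\<dagger> * ((V i)\<^sup>\<dagger> * V j) * C) * \<xi> j)"
    by (simp only: adj_times mult.assoc)
qed

section \<open>The lift\<close>

lemma blk_eqI:
  assumes "X \<in> corner (k * n)" "Y \<in> corner (k * n)"
    and "\<And>i j. i < k \<Longrightarrow> j < k \<Longrightarrow> (blk n i)\<^sup>\<dagger> * X * blk n j = (blk n i)\<^sup>\<dagger> * Y * blk n j"
  shows "X = Y"
  by (subst blk_decompose[OF assms(1)], subst blk_decompose[OF assms(2)]) (intro sum.cong refl, simp add: assms(3))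

text \<open>
  The outcome of \<open>symmetric_form\<close> for a density matrix \<open>s\<close>. The dissipative generator \<open>L\<close> is realized by a
  Hamiltonian on a space that has, besides the original \<open>\<complex>\<^sup>n\<close> as block 0, one further copy of \<open>\<complex>\<^sup>n\<close>
  for each \<open>V q\<close>.
\<close>

locale lift_data =
  fixes n N :: nat and M :: "fmat set" and s s' :: fmat and V :: "nat \<Rightarrow> fmat" and r :: "nat \<Rightarrow> real"
    and L :: "fmat \<Rightarrow> fmat"
  assumes M: "star_alg n M" and sM: "s \<in> M" and spos: "pos s" and trs: "tr s = 1"
    and s'M: "s' \<in> M" and ss': "s * s' = idm n" and s's: "s' * s = idm n"
    and r0: "\<And>q. q < N \<Longrightarrow> 0 < r q" and Vc: "\<And>q. q < N \<Longrightarrow> V q \<in> corner n"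
    and sV: "\<And>q. q < N \<Longrightarrow> s * V q = complex_of_real (r q) *\<^sub>C (V q * s)"
    and Lform: "\<And>X. X \<in> M \<Longrightarrow> 2 *\<^sub>C L X =
      hs_proj M (\<Sum>q<N. (V q)\<^sup>\<dagger> * X * V q + of_real (1 / r q) *\<^sub>C (V q * X * (V q)\<^sup>\<dagger>))
       - (1/2) *\<^sub>C (hs_proj M (\<Sum>q<N. (V q)\<^sup>\<dagger> * V q + of_real (1 / r q) *\<^sub>C (V q * (V q)\<^sup>\<dagger>)) * X
          + X * hs_proj M (\<Sum>q<N. (V q)\<^sup>\<dagger> * V q + of_real (1 / r q) *\<^sub>C (V q * (V q)\<^sup>\<dagger>)))"
begin

lemmas MD = star_algD[OF M]

definition "K = Suc N"
lemma K_simps [simp]: "0 < K" "Suc q < K \<longleftrightarrow> q < N" by (simp_all add: K_def)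
lemma sum_K: "(\<Sum>q<K. f q) = f 0 + (\<Sum>q<N. f (Suc q))" by (simp only: K_def sum.lessThan_Suc_shift)
definition "m = K * n"
abbreviation "T \<equiv> blk n"

lemma s_herm: "s\<^sup>\<dagger> = s" by (rule pos_herm[OF spos])
lemma idm_mult: "X \<in> M \<Longrightarrow> idm n * X = X" "X \<in> M \<Longrightarrow> X * idm n = X"
  using MD(12) idm_times times_idm by auto

text \<open>
  The weights of the blocks in the lifted state. The relation \<open>t (Suc q) = r q * t 0\<close> compensates
  \<open>s * V q = r q *\<^sub>C (V q * s)\<close>, so that a Hamiltonian with entries \<open>V q\<close> between the blocks \<open>0\<close> and \<open>Suc q\<close>
  commutes with the state.
\<close>

definition t :: "nat \<Rightarrow> real" where
  "t q = (case q of 0 \<Rightarrow> 1 | Suc p \<Rightarrow> r p) / (1 + (\<Sum>p<N. r p))"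

lemma rsum: "0 < 1 + (\<Sum>p<N. r p)" using r0 by (intro add_pos_nonneg sum_nonneg) (auto intro: less_imp_le)
lemma t0: "q < K \<Longrightarrow> 0 < t q"
  using rsum r0 by (cases q) (auto simp: t_def)
lemma t_sum: "(\<Sum>q<K. t q) = 1"
proof -
  have "(\<Sum>q<K. t q) = t 0 + (\<Sum>q<N. t (Suc q))" by (rule sum_K)
  also have "\<dots> = 1 / (1 + (\<Sum>p<N. r p)) + (\<Sum>p<N. r p) / (1 + (\<Sum>p<N. r p))" by (simp add: t_def flip: sum_divide_distrib)
  also have "\<dots> = (1 + (\<Sum>p<N. r p)) / (1 + (\<Sum>p<N. r p))" by (rule add_divide_distrib[symmetric])
  finally show ?thesis using rsum by simp
qed
lemma t_Suc: "t (Suc q) = r q * t 0" by (simp add: t_def)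

text \<open>
  The coupling constants; the identities \<open>h2\<close> are what the coefficients of the \<open>V q\<close> in \<open>L\<close> require.
\<close>

definition h :: "nat \<Rightarrow> real" where "h q = 1 / (2 * sqrt (t (Suc q)))"

lemma h2: assumes q: "q < N" shows "h q * h q * t (Suc q) = 1/4" "h q * h q * t 0 = 1 / (4 * r q)"
proof -
  have p: "0 < t (Suc q)" using t0 q by simp
  then have hh: "h q * h q = 1 / (4 * t (Suc q))" by (simp add: h_def field_simps)
  then show "h q * h q * t (Suc q) = 1/4" using p by simp
  have "0 < t 0" using t0 by simp
  then show "h q * h q * t 0 = 1 / (4 * r q)" using r0[OF q] by (simp add: hh t_Suc)
qed

text \<open>
  \<open>emb X\<close> is \<open>1 \<otimes> X\<close>, and \<open>red\<close> is the adjoint of \<open>emb\<close> for the KMS inner products. The composition \<open>Eh\<close> is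
  the conditional expectation onto \<open>1 \<otimes> M\<close>.
\<close>

definition emb :: "fmat \<Rightarrow> fmat" where "emb X = (\<Sum>q<K. T q * X * (T q)\<^sup>\<dagger>)"
definition red :: "fmat \<Rightarrow> fmat" where "red Z = hs_proj M (\<Sum>q<K. of_real (t q) *\<^sub>C ((T q)\<^sup>\<dagger> * Z * T q))"
definition Eh :: "fmat \<Rightarrow> fmat" where "Eh Z = emb (red Z)"
definition H :: fmat where
  "H = (\<Sum>q<N. of_real (h q) *\<^sub>C (T 0 * V q * (T (Suc q))\<^sup>\<dagger> + T (Suc q) * (V q)\<^sup>\<dagger> * (T 0)\<^sup>\<dagger>))"
definition LA :: "fmat \<Rightarrow> fmat" where "LA Z = \<i> *\<^sub>C (H * Z - Z * H)"
definition LS :: "fmat \<Rightarrow> fmat" where "LS Z = Eh Z - Z"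
definition diag :: "(nat \<Rightarrow> complex) \<Rightarrow> fmat \<Rightarrow> fmat" where "diag c X = (\<Sum>q<K. c q *\<^sub>C (T q * X * (T q)\<^sup>\<dagger>))"

lemma emb_diag: "emb X = diag (\<lambda>_. 1) X" by (simp add: emb_def diag_def)

lemma diag_corner: "diag c X \<in> corner m"
  unfolding diag_def m_def by (intro corner_sum corner_cscale blk_expand_corner) auto
lemma emb_corner: "emb X \<in> corner m" unfolding emb_diag by (rule diag_corner)

lemma T_diag: assumes "q < K" "X \<in> corner n" shows "(T q)\<^sup>\<dagger> * diag c X = c q *\<^sub>C (X * (T q)\<^sup>\<dagger>)"
proof -
  have "(T q)\<^sup>\<dagger> * diag c X = (\<Sum>p<K. c p *\<^sub>C (((T q)\<^sup>\<dagger> * T p) * X * (T p)\<^sup>\<dagger>))"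
    by (simp only: diag_def sum_distrib_left cscale_mult mult.assoc)
  also have "\<dots> = (\<Sum>p<K. if p = q then c q *\<^sub>C (X * (T q)\<^sup>\<dagger>) else 0)"
    by (intro sum.cong refl) (use assms in \<open>simp add: blk_adj_blk idm_times\<close>)
  finally show ?thesis using assms by simp
qed

lemma diag_adj: "(diag c X)\<^sup>\<dagger> = diag (\<lambda>q. cnj (c q)) (X\<^sup>\<dagger>)"
  by (simp add: diag_def mult.assoc)

lemma diag_T: assumes "q < K" "X \<in> corner n" shows "diag c X * T q = c q *\<^sub>C (T q * X)"
  using arg_cong[OF T_diag[OF assms(1) adj_corner[OF assms(2)], of "\<lambda>q. cnj (c q)"], of adj] by (simp add: diag_adj)

lemma diag_mult: assumes "X \<in> corner n" shows "diag c X * diag d Y = diag (\<lambda>q. c q * d q) (X * Y)"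
proof -
  have "diag c X * diag d Y = (\<Sum>q<K. d q *\<^sub>C ((diag c X * T q) * Y * (T q)\<^sup>\<dagger>))"
    by (subst (2) diag_def) (simp only: sum_distrib_left cscale_mult mult.assoc)
  also have "\<dots> = diag (\<lambda>q. c q * d q) (X * Y)" unfolding diag_def[of "\<lambda>q. c q * d q"]
  proof (intro sum.cong refl)
    fix q assume "q \<in> {..<K}"
    then show "d q *\<^sub>C (diag c X * T q * Y * (T q)\<^sup>\<dagger>) = (c q * d q) *\<^sub>C (T q * (X * Y) * (T q)\<^sup>\<dagger>)"
      using diag_T[of q X c] assms by (simp add: mult.assoc mult.commute)
  qed
  finally show ?thesis .
qed

lemma diag_idm: "diag (\<lambda>_. 1) (idm n) = idm m"
  unfolding diag_def m_def sum_blk[symmetric] by (simp add: blk_idm)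

lemma diag_pos: "pos X \<Longrightarrow> (\<And>q. q < K \<Longrightarrow> 0 \<le> c q) \<Longrightarrow> pos (diag c X)"
  unfolding diag_def by (intro pos_sum pos_cscale pos_conj') auto

lemma tr_diag: assumes "X \<in> corner n" shows "tr (diag c X) = (\<Sum>q<K. c q) * tr X"
proof -
  have "tr (T q * X * (T q)\<^sup>\<dagger>) = tr X" for q
  proof -
    have "tr (T q * X * (T q)\<^sup>\<dagger>) = tr ((T q)\<^sup>\<dagger> * T q * X)" by (rule tr_rotate)
    then show ?thesis by (simp add: blk_adj_blk idm_times assms)
  qed
  then show ?thesis by (simp add: diag_def sum_distrib_right)
qed

lemma tr_diag_mult: "tr (diag c X * Y) = tr (X * (\<Sum>q<K. c q *\<^sub>C ((T q)\<^sup>\<dagger> * Y * T q)))"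
proof -
  have "tr (T q * X * (T q)\<^sup>\<dagger> * Y) = tr (X * ((T q)\<^sup>\<dagger> * Y * T q))" for q
    by (metis mult.assoc tr_comm)
  then show ?thesis by (simp add: diag_def sum_distrib_left sum_distrib_right)
qed

lemma redM: "red Z \<in> M" unfolding red_def by (rule P_in[OF M])

lemma red_emb: assumes X: "X \<in> M" shows "red (emb X) = X"
proof -
  have "(T q)\<^sup>\<dagger> * emb X * T q = X" if "q < K" for q
    using that X by (simp add: emb_diag T_diag MD mult.assoc blk_adj_blk idm_mult)
  then have "(\<Sum>q<K. of_real (t q) *\<^sub>C ((T q)\<^sup>\<dagger> * emb X * T q)) = (\<Sum>q<K. of_real (t q) *\<^sub>C X)" by (intro sum.cong refl) simp
  also have "\<dots> = of_real (\<Sum>q<K. t q) *\<^sub>C X" unfolding of_real_sum by (rule cscale_sum_left[symmetric])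
  finally show ?thesis unfolding red_def t_sum by (simp add: P_id[OF M X])
qed

lemma red_add: "red (X + Y) = red X + red Y"
  unfolding red_def P_add[OF M, symmetric] by (simp add: distrib_left distrib_right sum.distrib)
lemma red_cscale: "red (c *\<^sub>C X) = c *\<^sub>C red X"
  unfolding red_def P_cscale[OF M, symmetric] by (simp add: cscale_sum mult.commute)
lemma emb_add: "emb (X + Y) = emb X + emb Y" by (simp add: emb_def distrib_left distrib_right sum.distrib)
lemma emb_cscale: "emb (c *\<^sub>C X) = c *\<^sub>C emb X" by (simp add: emb_def cscale_sum)
lemma emb_adj: "emb (X\<^sup>\<dagger>) = (emb X)\<^sup>\<dagger>" by (simp add: emb_diag diag_adj)
lemma emb_mult: "X \<in> corner n \<Longrightarrow> emb (X * Y) = emb X * emb Y" by (simp add: emb_diag diag_mult)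
lemma emb_idm: "emb (idm n) = idm m" by (simp add: emb_diag diag_idm)
lemma emb_0: "emb 0 = 0" by (simp add: emb_def)
lemma red_0: "red 0 = 0" using red_cscale[of 0 0] by simp

lemma Eh_corner: "Eh Z \<in> corner m" unfolding Eh_def by (rule emb_corner)
lemma Eh_emb: "X \<in> M \<Longrightarrow> Eh (emb X) = emb X" by (simp add: Eh_def red_emb)
lemma Eh_Eh: "Eh (Eh Z) = Eh Z" by (simp add: Eh_def red_emb redM)
lemma Eh_add: "Eh (X + Y) = Eh X + Eh Y" by (simp add: Eh_def red_add emb_add)
lemma Eh_cscale: "Eh (c *\<^sub>C X) = c *\<^sub>C Eh X" by (simp add: Eh_def red_cscale emb_cscale)
lemma Eh_diff: "Eh (X - Y) = Eh X - Eh Y"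
  using Eh_add[of X "(-1) *\<^sub>C Y"] Eh_cscale[of "-1" Y] by simp

subsection \<open>The Hamiltonian\<close>

lemma H_corner: "H \<in> corner m"
  unfolding H_def m_def by (intro corner_sum corner_cscale corner_add blk_expand_corner) auto
lemma H_adj: "H\<^sup>\<dagger> = H" by (simp add: H_def mult.assoc add.commute)

lemma TH: assumes "q < K" "p < K"
  shows "(T q)\<^sup>\<dagger> * H * T p = (case q of 0 \<Rightarrow> (case p of 0 \<Rightarrow> 0 | Suc b \<Rightarrow> of_real (h b) *\<^sub>C V b)
    | Suc a \<Rightarrow> (case p of 0 \<Rightarrow> of_real (h a) *\<^sub>C (V a)\<^sup>\<dagger> | Suc b \<Rightarrow> 0))"
proof -
  have "(T q)\<^sup>\<dagger> * H * T p = (\<Sum>a<N. of_real (h a) *\<^sub>C ((T q)\<^sup>\<dagger> * T 0 * V a * ((T (Suc a))\<^sup>\<dagger> * T p) + (T q)\<^sup>\<dagger> * T (Suc a) * (V a)\<^sup>\<dagger> * ((T 0)\<^sup>\<dagger> * T p)))"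
    by (simp add: H_def sum_distrib_left sum_distrib_right mult.assoc distrib_left distrib_right)
  also have "\<dots> = (\<Sum>a<N. if q = 0 \<and> p = Suc a then of_real (h a) *\<^sub>C V a else if p = 0 \<and> q = Suc a then of_real (h a) *\<^sub>C (V a)\<^sup>\<dagger> else 0)"
    by (intro sum.cong refl) (use Vc in \<open>auto simp: blk_adj_blk idm_times times_idm adj_corner\<close>)
  also have "\<dots> = (case q of 0 \<Rightarrow> (case p of 0 \<Rightarrow> 0 | Suc b \<Rightarrow> of_real (h b) *\<^sub>C V b)
    | Suc a \<Rightarrow> (case p of 0 \<Rightarrow> of_real (h a) *\<^sub>C (V a)\<^sup>\<dagger> | Suc b \<Rightarrow> 0))"
    using assms by (cases q; cases p) (simp_all cong: if_cong)
  finally show ?thesis .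
qed

lemma s_corner: "s \<in> corner n" using sM MD by auto

definition sg :: fmat where "sg = diag (\<lambda>q. of_real (t q)) s"

lemma H_sg: "H * sg = sg * H"
proof (rule blk_eqI[of _ K n])
  show "H * sg \<in> corner (K * n)" "sg * H \<in> corner (K * n)"
    using H_corner diag_corner by (auto simp: sg_def m_def intro!: corner_times)
  fix q p assume qp: "q < K" "p < K"
  have 1: "(T q)\<^sup>\<dagger> * (H * sg) * T p = of_real (t p) *\<^sub>C (((T q)\<^sup>\<dagger> * H * T p) * s)"
    using diag_T[OF qp(2) s_corner, of "\<lambda>q. of_real (t q)"] by (simp add: sg_def mult.assoc)
  have "(T q)\<^sup>\<dagger> * (sg * H) * T p = ((T q)\<^sup>\<dagger> * sg) * (H * T p)" by (simp only: mult.assoc)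
  also have "\<dots> = of_real (t q) *\<^sub>C (s * ((T q)\<^sup>\<dagger> * H * T p))"
    using T_diag[OF qp(1) s_corner, of "\<lambda>q. of_real (t q)"] by (simp add: sg_def mult.assoc)
  finally have 2: "(T q)\<^sup>\<dagger> * (sg * H) * T p = of_real (t q) *\<^sub>C (s * ((T q)\<^sup>\<dagger> * H * T p))" .
  have Vs: "(V a)\<^sup>\<dagger> * s = of_real (r a) *\<^sub>C (s * (V a)\<^sup>\<dagger>)" if "a < N" for a
    using arg_cong[OF sV[OF that], of adj] by (simp add: s_herm)
  show "(T q)\<^sup>\<dagger> * (H * sg) * T p = (T q)\<^sup>\<dagger> * (sg * H) * T p"
    unfolding 1 2 TH[OF qp] using qp by (auto split: nat.splits simp: sV Vs t_Suc mult_ac)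
qed

definition rs :: fmat where "rs = (SOME R. R \<in> M \<and> pos R \<and> R * R = s)"

lemma rs: "rs \<in> M" "pos rs" "rs * rs = s"
proof -
  have "\<exists>R. R \<in> M \<and> pos R \<and> R * R = s" using sqrt_in_star_alg[OF M sM] posD[OF spos] by metis
  from someI_ex[OF this, folded rs_def] show "rs \<in> M" "pos rs" "rs * rs = s" by auto
qed
lemma rs_corner: "rs \<in> corner n" using rs MD by auto
lemma rs_herm: "rs\<^sup>\<dagger> = rs" by (rule pos_herm[OF rs(2)])

definition rh :: fmat where "rh = diag (\<lambda>q. of_real (sqrt (t q))) rs"

lemma rh_pos: "pos rh" unfolding rh_def by (rule diag_pos[OF rs(2)]) (auto simp: less_eq_complex_def less_imp_le[OF t0])
lemma rh_herm: "rh\<^sup>\<dagger> = rh" by (rule pos_herm[OF rh_pos])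
lemma rh_corner: "rh \<in> corner m" unfolding rh_def by (rule diag_corner)
lemma rh_sq: "rh * rh = sg"
proof -
  have e: "complex_of_real (sqrt (t q)) * complex_of_real (sqrt (t q)) = of_real (t q)" if "q < K" for q
    using t0[OF that] by (simp flip: of_real_mult)
  show ?thesis unfolding rh_def sg_def diag_mult[OF rs_corner] rs(3) unfolding diag_def
    by (intro sum.cong refl) (simp add: e)
qed

lemma rh_inverse: "\<exists>ri\<in>corner m. rh * ri = idm m \<and> ri * rh = idm m"
proof (intro bexI conjI)
  let ?ri = "diag (\<lambda>q. of_real (1 / sqrt (t q))) (rs * s')" and ?rl = "diag (\<lambda>q. of_real (1 / sqrt (t q))) (s' * rs)"
  have c: "s' * rs \<in> corner n" "rs * s' \<in> corner n" using rs(1) s'M MD by auto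
  have e: "complex_of_real (sqrt (t q)) * complex_of_real (1 / sqrt (t q)) = 1" "complex_of_real (1 / sqrt (t q)) * complex_of_real (sqrt (t q)) = 1" if "q < K" for q
    using t0[OF that] by (simp_all flip: of_real_mult)
  have d: "diag c X = diag (\<lambda>_. 1) X" if "\<And>q. q < K \<Longrightarrow> c q = 1" for c X
    unfolding diag_def using that by (intro sum.cong refl) auto
  show 1: "rh * ?ri = idm m"
  proof -
    have "rh * ?ri = diag (\<lambda>_. 1) (rs * (rs * s'))" unfolding rh_def diag_mult[OF rs_corner] by (rule d[OF e(1)])
    then show ?thesis by (simp add: rs(3) ss' diag_idm flip: mult.assoc)
  qed
  have 2: "?rl * rh = idm m"
  proof -
    have "?rl * rh = diag (\<lambda>_. 1) ((s' * rs) * rs)" unfolding rh_def diag_mult[OF c(1)] by (rule d[OF e(2)])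
    then show ?thesis by (simp add: rs(3) s's diag_idm mult.assoc)
  qed
  have "?ri = ?rl * rh * ?ri" by (simp only: 2 idm_times diag_corner)
  also have "\<dots> = ?rl" by (simp only: mult.assoc 1 times_idm diag_corner)
  finally show "?ri * rh = idm m" using 2 by simp
qed (rule diag_corner)

text \<open>
  The state has a positive square root in the commutant of \<open>H\<close>, and positive square roots are unique.
\<close>

lemma H_rh: "H * rh = rh * H"
proof -
  define C where "C = {X \<in> corner m. \<forall>Y\<in>{H}. X * Y = Y * X}"
  have Cs: "star_alg m C" unfolding C_def
    by (rule star_alg_commutant) (use H_corner H_adj in auto)
  have sgC: "sg \<in> C" using H_sg diag_corner by (auto simp: C_def sg_def)
  have "pos sg" unfolding rh_sq[symmetric] using pos_adj_self[of rh] by (simp add: rh_herm)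
  then obtain R where R: "R \<in> C" "pos R" "R * R = sg" using sqrt_in_star_alg[OF Cs sgC] posD by metis
  have "R = rh" by (rule pos_sqrt_unique[OF R(2) rh_pos]) (simp add: R(3) rh_sq)
  then show ?thesis using R(1) by (simp add: C_def)
qed

subsection \<open>KMS geometry\<close>

definition kms :: "fmat \<Rightarrow> fmat \<Rightarrow> complex" where "kms X Y = tr (rh * X\<^sup>\<dagger> * rh * Y)"

lemma kms_simps:
  "kms X (Y + Z) = kms X Y + kms X Z" "kms X (Y - Z) = kms X Y - kms X Z" "kms X (c *\<^sub>C Y) = c * kms X Y"
  "kms (X + Z) Y = kms X Y + kms Z Y" "kms (X - Z) Y = kms X Y - kms Z Y" "kms (c *\<^sub>C X) Y = cnj c * kms X Y"
  "kms X 0 = 0" "kms 0 X = 0" "kms X (- Y) = - kms X Y" "kms (- X) Y = - kms X Y"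
  by (simp_all add: kms_def distrib_left distrib_right left_diff_distrib right_diff_distrib)

lemma kms_cnj: "cnj (kms X Y) = kms Y X"
proof -
  have "cnj (kms X Y) = tr ((rh * X\<^sup>\<dagger> * rh * Y)\<^sup>\<dagger>)" by (simp only: kms_def tr_simps)
  also have "\<dots> = tr (Y\<^sup>\<dagger> * rh * X * rh)" by (simp add: rh_herm mult.assoc)
  also have "\<dots> = kms Y X" unfolding kms_def by (metis mult.assoc tr_comm)
  finally show ?thesis .
qed

lemma kms_definite: "0 \<le> kms X X" "X \<in> corner m \<Longrightarrow> kms X X = 0 \<Longrightarrow> X = 0"
proof -
  obtain q where q: "q \<in> corner m" "pos q" "q * q = rh" using sqrt_in_star_alg[OF star_alg_corner rh_corner] posD[OF rh_pos] by metis
  have qh: "q\<^sup>\<dagger> = q" by (rule pos_herm[OF q(2)])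
  have e: "kms X X = tr ((q * X * q)\<^sup>\<dagger> * (q * X * q))"
  proof -
    have "kms X X = tr (q * (q * X\<^sup>\<dagger> * q * q * X))" by (simp add: kms_def mult.assoc flip: q(3))
    also have "\<dots> = tr (q * X\<^sup>\<dagger> * q * q * X * q)" by (rule tr_comm)
    finally show ?thesis by (simp add: qh mult.assoc)
  qed
  then show "0 \<le> kms X X" by (simp only: tr_adj_self_nonneg)
  assume X: "X \<in> corner m" "kms X X = 0"
  then have z: "q * X * q = 0" using e by (simp only: tr_adj_self_eq_0)
  obtain ri where ri: "rh * ri = idm m" "ri * rh = idm m" using rh_inverse by blast
  have "X = (ri * rh) * X * (rh * ri)" using X(1) by (simp add: ri idm_times times_idm)
  also have "\<dots> = ri * q * (q * X * q) * q * ri" by (simp add: mult.assoc flip: q(3))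
  finally show "X = 0" by (simp add: z)
qed

lemma kms_nondeg: "D \<in> corner m \<Longrightarrow> (\<And>X. X \<in> corner m \<Longrightarrow> kms X D = 0) \<Longrightarrow> D = 0"
  using kms_definite(2) by blast

lemma kms_emb: assumes X: "X \<in> M" shows "kms (emb X) Y = tr (rs * X\<^sup>\<dagger> * rs * red Y)"
proof -
  have e: "complex_of_real (sqrt (t q)) * complex_of_real (sqrt (t q)) = of_real (t q)" if "q < K" for q
    using t0[OF that] by (simp flip: of_real_mult)
  have Xc: "X\<^sup>\<dagger> \<in> corner n" by (rule MD(12)[OF MD(6)[OF X]])
  have "rh * (emb X)\<^sup>\<dagger> * rh = diag (\<lambda>q. of_real (sqrt (t q)) * of_real (sqrt (t q))) (rs * X\<^sup>\<dagger> * rs)"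
    by (simp add: rh_def emb_diag diag_adj diag_mult rs_corner Xc corner_times)
  also have "\<dots> = diag (\<lambda>q. of_real (t q)) (rs * X\<^sup>\<dagger> * rs)"
    unfolding diag_def by (intro sum.cong refl) (simp add: e)
  finally have "kms (emb X) Y = tr (rs * X\<^sup>\<dagger> * rs * (\<Sum>q<K. of_real (t q) *\<^sub>C ((T q)\<^sup>\<dagger> * Y * T q)))"
    unfolding kms_def by (simp only: tr_diag_mult)
  also have "\<dots> = tr ((rs * X * rs)\<^sup>\<dagger> * (\<Sum>q<K. of_real (t q) *\<^sub>C ((T q)\<^sup>\<dagger> * Y * T q)))" by (simp add: rs_herm mult.assoc)
  also have "\<dots> = tr ((rs * X * rs)\<^sup>\<dagger> * red Y)" unfolding red_def by (rule P_tr[OF M, symmetric]) (intro MD rs X)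
  finally show ?thesis by (simp add: rs_herm mult.assoc)
qed

lemma Eh_sym: "kms (Eh X) Y = kms X (Eh Y)"
proof -
  have "kms X (Eh Y) = cnj (kms (emb (red Y)) X)" by (simp add: kms_cnj Eh_def)
  also have "\<dots> = tr ((rs * (red Y)\<^sup>\<dagger> * rs * red X)\<^sup>\<dagger>)" by (simp only: kms_emb[OF redM] tr_simps)
  also have "\<dots> = tr ((red X)\<^sup>\<dagger> * rs * red Y * rs)" by (simp add: rs_herm mult.assoc)
  also have "\<dots> = tr (rs * (red X)\<^sup>\<dagger> * rs * red Y)" by (metis mult.assoc tr_comm)
  finally show ?thesis by (simp add: kms_emb[OF redM] Eh_def)
qed

lemma LS_sym: "kms (LS X) Y = kms X (LS Y)" by (simp add: LS_def kms_simps Eh_sym)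

text \<open>
  \<open>H\<close> commutes with the square root of the state.
\<close>

lemma LA_antisym: "kms (LA X) Y = - kms X (LA Y)"
proof -
  have 1: "tr (rh * (X\<^sup>\<dagger> * H) * rh * Y) = tr (rh * X\<^sup>\<dagger> * rh * (H * Y))" by (simp only: mult.assoc) (simp only: H_rh flip: mult.assoc)
  have "tr (rh * (H * X\<^sup>\<dagger>) * rh * Y) = tr ((rh * H) * X\<^sup>\<dagger> * rh * Y)" by (simp only: mult.assoc)
  also have "\<dots> = tr (H * (rh * X\<^sup>\<dagger> * rh * Y))" by (simp only: H_rh[symmetric] mult.assoc)
  also have "\<dots> = tr (rh * X\<^sup>\<dagger> * rh * (Y * H))" by (subst tr_comm) (simp only: mult.assoc)
  finally have 2: "tr (rh * (H * X\<^sup>\<dagger>) * rh * Y) = tr (rh * X\<^sup>\<dagger> * rh * (Y * H))" .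
  have "kms (LA X) Y = - \<i> * (tr (rh * (X\<^sup>\<dagger> * H) * rh * Y) - tr (rh * (H * X\<^sup>\<dagger>) * rh * Y))"
    by (simp add: kms_def LA_def H_adj right_diff_distrib left_diff_distrib)
  also have "\<dots> = - \<i> * (tr (rh * X\<^sup>\<dagger> * rh * (H * Y)) - tr (rh * X\<^sup>\<dagger> * rh * (Y * H)))" by (simp only: 1 2)
  also have "\<dots> = - kms X (LA Y)"
    by (simp add: kms_def LA_def right_diff_distrib)
  finally show ?thesis .
qed

lemma LA_corner: "Z \<in> corner m \<Longrightarrow> LA Z \<in> corner m"
  unfolding LA_def by (intro corner_intros H_corner)
lemma LS_corner: "Z \<in> corner m \<Longrightarrow> LS Z \<in> corner m"
  unfolding LS_def by (intro corner_diff Eh_corner)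
lemma LA_lin: "lin_on (corner m) LA"
  unfolding lin_on_def by (auto simp: LA_corner) (auto simp: LA_def algebra_simps)
lemma LS_lin: "lin_on (corner m) LS"
  unfolding lin_on_def by (auto simp: LS_corner) (auto simp: LS_def Eh_add Eh_cscale)

subsection \<open>The collapsed generator\<close>

text \<open>
  The diagonal blocks of the commutator with \<open>emb X\<close> vanish because those of \<open>H\<close> do.
\<close>

lemma red_LA_emb: assumes X: "X \<in> M" shows "red (LA (emb X)) = 0"
proof -
  have Xc: "X \<in> corner n" using X MD by auto
  have "(T q)\<^sup>\<dagger> * LA (emb X) * T q = 0" if q: "q < K" for q
  proof -
    have 1: "(T q)\<^sup>\<dagger> * emb X = X * (T q)\<^sup>\<dagger>" "emb X * T q = T q * X"
      using T_diag[OF q Xc, of "\<lambda>_. 1"] diag_T[OF q Xc, of "\<lambda>_. 1"] by (simp_all add: emb_diag)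
    have 2: "(T q)\<^sup>\<dagger> * H * T q = 0" unfolding TH[OF q q] by (auto split: nat.splits)
    have "(T q)\<^sup>\<dagger> * (H * emb X - emb X * H) * T q = (T q)\<^sup>\<dagger> * H * (emb X * T q) - ((T q)\<^sup>\<dagger> * emb X) * H * T q"
      by (simp only: left_diff_distrib right_diff_distrib mult.assoc)
    also have "\<dots> = ((T q)\<^sup>\<dagger> * H * T q) * X - X * ((T q)\<^sup>\<dagger> * H * T q)" by (simp only: 1 mult.assoc)
    finally have 3: "(T q)\<^sup>\<dagger> * (H * emb X - emb X * H) * T q = 0" by (simp add: 2)
    show ?thesis unfolding LA_def cscale_mult 3 by simp
  qed
  then have "(\<Sum>q<K. of_real (t q) *\<^sub>C ((T q)\<^sup>\<dagger> * LA (emb X) * T q)) = 0" by (intro sum.neutral) simp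
  then show ?thesis by (simp add: red_def P_0[OF M])
qed

lemma Eh_LA_Eh: "Eh (LA (Eh Z)) = 0"
  by (simp add: Eh_def red_LA_emb[OF redM] emb_0)

text \<open>
  The average of the diagonal blocks of \<open>H * emb X * H\<close> in the weights of the state. Block 0 passes
  through every \<open>V q\<close> and contributes the terms \<open>V q * X * (V q)\<^sup>\<dagger>\<close>; block \<open>Suc q\<close> passes through block 0 and
  contributes \<open>(V q)\<^sup>\<dagger> * X * V q\<close>.
\<close>

definition U where "U X = (\<Sum>q<K. of_real (t q) *\<^sub>C ((T q)\<^sup>\<dagger> * (H * emb X * H) * T q))"

lemma U_eq:
  assumes Xc: "X \<in> corner n"
  shows "U X = (1/4) *\<^sub>C (\<Sum>q<N. (V q)\<^sup>\<dagger> * X * V q + of_real (1 / r q) *\<^sub>C (V q * X * (V q)\<^sup>\<dagger>))"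
proof -
  have e: "(T q)\<^sup>\<dagger> * (H * emb X * H) * T q = (\<Sum>p<K. ((T q)\<^sup>\<dagger> * H * T p) * X * ((T p)\<^sup>\<dagger> * H * T q))" for q
    by (simp add: emb_def sum_distrib_left sum_distrib_right mult.assoc)
  have 0: "(T 0)\<^sup>\<dagger> * (H * emb X * H) * T 0 = (\<Sum>p<N. of_real (h p * h p) *\<^sub>C (V p * X * (V p)\<^sup>\<dagger>))"
    unfolding e sum_K by (simp add: TH)
  have S: "(T (Suc q))\<^sup>\<dagger> * (H * emb X * H) * T (Suc q) = of_real (h q * h q) *\<^sub>C ((V q)\<^sup>\<dagger> * X * V q)" if "q < N" for q
    unfolding e sum_K using that by (simp add: TH)
  have "U X = of_real (t 0) *\<^sub>C (\<Sum>p<N. of_real (h p * h p) *\<^sub>C (V p * X * (V p)\<^sup>\<dagger>)) +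
      (\<Sum>q<N. of_real (t (Suc q)) *\<^sub>C (of_real (h q * h q) *\<^sub>C ((V q)\<^sup>\<dagger> * X * V q)))"
    unfolding U_def sum_K 0 using S by simp
  also have "\<dots> = (\<Sum>q<N. of_real (h q * h q * t 0) *\<^sub>C (V q * X * (V q)\<^sup>\<dagger>)) + (\<Sum>q<N. of_real (h q * h q * t (Suc q)) *\<^sub>C ((V q)\<^sup>\<dagger> * X * V q))"
    by (simp add: cscale_sum mult_ac)
  also have "\<dots> = (\<Sum>q<N. of_real (1 / (4 * r q)) *\<^sub>C (V q * X * (V q)\<^sup>\<dagger>)) + (\<Sum>q<N. of_real (1/4) *\<^sub>C ((V q)\<^sup>\<dagger> * X * V q))"
    by (intro arg_cong2[of _ _ _ _ plus] sum.cong refl) (simp_all only: h2 lessThan_iff)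
  finally show ?thesis by (simp add: cscale_sum sum.distrib add.commute)
qed

text \<open>
  Here the double commutator \<open>2 H X H - H\<^sup>2 X - X H\<^sup>2\<close> produces the generator: averaging its first term
  gives the completely positive part, and averaging \<open>H\<^sup>2\<close> gives the value of that part at the identity.
\<close>

lemma red_LA_LA_emb:
  assumes X: "X \<in> M" shows "red (LA (LA (emb X))) = L X"
proof -
  have Xc: "X \<in> corner n" using X MD by auto
  define W where "W = U (idm n)"
  define \<Phi> where "\<Phi> X = hs_proj M (\<Sum>q<N. (V q)\<^sup>\<dagger> * X * V q + of_real (1 / r q) *\<^sub>C (V q * X * (V q)\<^sup>\<dagger>))" for X
  have Wc: "W \<in> corner n" unfolding W_def U_def by (intro corner_sum corner_cscale blk_compress_corner)
  have one: "(\<Sum>q<N. (V q)\<^sup>\<dagger> * V q + of_real (1 / r q) *\<^sub>C (V q * (V q)\<^sup>\<dagger>)) =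
      (\<Sum>q<N. (V q)\<^sup>\<dagger> * idm n * V q + of_real (1 / r q) *\<^sub>C (V q * idm n * (V q)\<^sup>\<dagger>))"
    by (intro sum.cong refl) (use Vc in \<open>simp add: times_idm adj_corner\<close>)
  have PU: "hs_proj M (U Y) = (1/4) *\<^sub>C \<Phi> Y" if "Y \<in> corner n" for Y
    unfolding U_eq[OF that] P_cscale[OF M] \<Phi>_def ..
  have HH: "H * emb (idm n) * H = H * H" using H_corner by (simp add: emb_idm times_idm)
  have q1: "(T q)\<^sup>\<dagger> * LA (LA (emb X)) * T q =
      2 *\<^sub>C ((T q)\<^sup>\<dagger> * (H * emb X * H) * T q) - ((T q)\<^sup>\<dagger> * (H * H) * T q) * X - X * ((T q)\<^sup>\<dagger> * (H * H) * T q)" if q: "q < K" for q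
  proof -
    have 1: "(T q)\<^sup>\<dagger> * emb X = X * (T q)\<^sup>\<dagger>" "emb X * T q = T q * X"
      using T_diag[OF q Xc, of "\<lambda>_. 1"] diag_T[OF q Xc, of "\<lambda>_. 1"] by (simp_all add: emb_diag)
    have "LA (LA (emb X)) = (H * emb X * H + H * emb X * H) - H * H * emb X - emb X * (H * H)"
      by (simp add: LA_def algebra_simps)
    then have "(T q)\<^sup>\<dagger> * LA (LA (emb X)) * T q = ((T q)\<^sup>\<dagger> * (H * emb X * H) * T q + (T q)\<^sup>\<dagger> * (H * emb X * H) * T q)
        - (T q)\<^sup>\<dagger> * (H * H) * (emb X * T q) - ((T q)\<^sup>\<dagger> * emb X) * (H * H) * T q"
      by (simp only: distrib_left distrib_right left_diff_distrib right_diff_distrib mult.assoc)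
    moreover have "2 *\<^sub>C Z = Z + Z" for Z by (rule fmat_eqI) simp
    ultimately show ?thesis by (simp only: 1 mult.assoc)
  qed
  have "(\<Sum>q<K. of_real (t q) *\<^sub>C ((T q)\<^sup>\<dagger> * LA (LA (emb X)) * T q)) =
      (\<Sum>q<K. of_real (t q) *\<^sub>C (2 *\<^sub>C ((T q)\<^sup>\<dagger> * (H * emb X * H) * T q) - ((T q)\<^sup>\<dagger> * (H * H) * T q) * X - X * ((T q)\<^sup>\<dagger> * (H * H) * T q)))"
    by (intro sum.cong refl) (simp only: q1 lessThan_iff)
  also have "\<dots> = 2 *\<^sub>C U X - W * X - X * W"
    unfolding U_def W_def HH by (simp add: sum_subtractf sum_distrib_left sum_distrib_right cscale_sum mult.commute)
  finally have "red (LA (LA (emb X))) = 2 *\<^sub>C hs_proj M (U X) - hs_proj M W * X - X * hs_proj M W"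
    unfolding red_def by (simp add: P_diff[OF M] P_cscale[OF M] P_left[OF M X Wc] P_right[OF M X Wc])
  also have "\<dots> = (1/2) *\<^sub>C \<Phi> X - (1/4) *\<^sub>C (\<Phi> (idm n) * X + X * \<Phi> (idm n))"
    unfolding W_def PU[OF Xc] PU[OF idm_corner] by (simp add: algebra_simps)
  also have "\<dots> = (1/2) *\<^sub>C (2 *\<^sub>C L X)"
    unfolding Lform[OF X] one \<Phi>_def[symmetric] by (simp only: cscale_simps) simp
  finally show ?thesis by simp
qed

subsection \<open>Complete positivity of the lifted semigroups\<close>

lemma Eh_cp: "cp (corner m) Eh"
proof (rule cp_cong)
  have "cp UNIV (hs_proj M)" by (rule P_cp[OF M])
  show "cp (corner m) (\<lambda>X. \<Sum>q<K. T q * (\<Sum>p<K. of_real (t p) *\<^sub>C hs_proj M ((T p)\<^sup>\<dagger> * X * T p)) * (T q)\<^sup>\<dagger>)"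
    by (intro cp_sum cp_conj cp_scale cp_precompose P_cp[OF M]) (auto simp: less_eq_complex_def less_imp_le[OF t0])
  fix X Y
  show "Eh (X\<^sup>\<dagger> * Y) = (\<Sum>q<K. T q * (\<Sum>p<K. of_real (t p) *\<^sub>C hs_proj M ((T p)\<^sup>\<dagger> * (X\<^sup>\<dagger> * Y) * T p)) * (T q)\<^sup>\<dagger>)"
    by (simp only: Eh_def emb_def red_def P_sum[OF M] P_cscale[OF M])
qed

text \<open>
  For \<open>\<epsilon> = 1 / (k + 1)\<close> the term \<open>\<epsilon> H Z H\<close> completes a square:
  \<open>\<epsilon>\<inverse> (1 + \<i> \<epsilon> H) Z (1 + \<i> \<epsilon> H)\<^sup>\<dagger> = \<epsilon>\<inverse> Z + LA Z + \<epsilon> H Z H\<close>. Up to this small term and a multiple of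
  the identity, the generator is thus completely positive, and \<open>expo_cp\<close> applies.
\<close>

lemma lift_cp:
  assumes g: "0 < \<gamma>" and u: "0 \<le> u"
  shows "cp (corner m) (expo m (\<lambda>Z. LA Z + of_real \<gamma> *\<^sub>C LS Z) u)"
proof (rule expo_cp[OF star_alg_corner _ _ _ u])
  show "lin_on (corner m) (\<lambda>Z. LA Z + of_real \<gamma> *\<^sub>C LS Z)"
    using LA_lin LS_lin by (auto simp: lin_on_def corner_intros algebra_simps)
  show "lin_on (corner m) (\<lambda>Z. H * Z * H)"
    using H_corner by (auto simp: lin_on_def corner_intros algebra_simps)
  fix k :: nat
  let ?e = "1 / real (Suc k)" let ?C = "idm m + (\<i> * of_real ?e) *\<^sub>C H"
  show "\<exists>c::real. cp (corner m) (\<lambda>Z. LA Z + of_real \<gamma> *\<^sub>C LS Z + of_real ?e *\<^sub>C (H * Z * H) + of_real c *\<^sub>C Z)"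
  proof (rule exI, rule cp_cong)
    show "cp (corner m) (\<lambda>Z. of_real (real (Suc k)) *\<^sub>C (?C * Z * ?C\<^sup>\<dagger>) + of_real \<gamma> *\<^sub>C Eh Z)"
      by (intro cp_add cp_scale cp_conj cp_id Eh_cp) (use g in \<open>auto simp: less_eq_complex_def\<close>)
    fix X Y assume XY: "X \<in> corner m" "Y \<in> corner m"
    define Z where "Z = X\<^sup>\<dagger> * Y"
    have Z: "Z \<in> corner m" using XY by (simp add: Z_def corner_intros)
    have k0: "complex_of_real ?e * of_real (real (Suc k)) = 1" "complex_of_real (real (Suc k)) * of_real ?e = 1"
      unfolding of_real_mult[symmetric] by simp_all
    define a where "a = complex_of_real (real (Suc k))" define b where "b = complex_of_real ?e"
    have ab: "a * b = 1" "b * a = 1" "cnj b = b" using k0 by (simp_all add: a_def b_def mult.commute)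
    have "a *\<^sub>C ((idm m + (\<i> * b) *\<^sub>C H) * Z * (idm m + (\<i> * b) *\<^sub>C H)\<^sup>\<dagger>) = a *\<^sub>C Z + (a * b * \<i>) *\<^sub>C (H * Z - Z * H) + (a * b * b) *\<^sub>C (H * Z * H)"
      using idm_times[OF Z] times_idm[OF Z] times_idm[OF H_corner] idm_times[OF H_corner]
      by (simp add: H_adj ab(3) algebra_simps cscale_minus_left)
    then have e: "a *\<^sub>C ((idm m + (\<i> * b) *\<^sub>C H) * Z * (idm m + (\<i> * b) *\<^sub>C H)\<^sup>\<dagger>) = a *\<^sub>C Z + LA Z + b *\<^sub>C (H * Z * H)"
      by (simp only: ab mult_1 LA_def)
    have "LA Z + of_real \<gamma> *\<^sub>C LS Z + b *\<^sub>C (H * Z * H) + of_real (real (Suc k) + \<gamma>) *\<^sub>C Z =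
        (a *\<^sub>C Z + LA Z + b *\<^sub>C (H * Z * H)) + of_real \<gamma> *\<^sub>C Eh Z"
      by (simp add: LS_def a_def cscale_add_left algebra_simps)
    then show "LA (X\<^sup>\<dagger> * Y) + of_real \<gamma> *\<^sub>C LS (X\<^sup>\<dagger> * Y) + of_real ?e *\<^sub>C (H * (X\<^sup>\<dagger> * Y) * H) + of_real (real (Suc k) + \<gamma>) *\<^sub>C (X\<^sup>\<dagger> * Y) =
        of_real (real (Suc k)) *\<^sub>C (?C * (X\<^sup>\<dagger> * Y) * ?C\<^sup>\<dagger>) + of_real \<gamma> *\<^sub>C Eh (X\<^sup>\<dagger> * Y)"
      by (simp only: e[symmetric] a_def[symmetric] b_def[symmetric] Z_def[symmetric])
  qed
qed

lemma LA_idm: "LA (idm m) = 0" using H_corner by (simp add: LA_def idm_times times_idm)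
lemma LS_idm: "LS (idm m) = 0" using Eh_emb[OF MD(2)] by (simp add: LS_def emb_idm)

lemma LS_fixed: "LS Z = 0 \<longleftrightarrow> (\<exists>X\<in>M. Z = emb X)"
  using Eh_emb redM by (auto simp: LS_def Eh_def) (metis)

text \<open>
  \<open>kms Z (LA Z)\<close> is imaginary, so pairing the equation with \<open>Z\<close> leaves \<open>kms Z (LS Z) = 0\<close>; as \<open>- LS\<close> is an
  orthogonal projection, this means \<open>LS Z = 0\<close>.
\<close>

lemma lift_fixed:
  assumes g: "0 < \<gamma>" and Z: "Z \<in> corner m" "LA Z + of_real \<gamma> *\<^sub>C LS Z = 0"
  shows "LS Z = 0" "LA Z = 0"
proof -
  have "kms Z (LA Z) + of_real \<gamma> * kms Z (LS Z) = 0" using arg_cong[OF Z(2), of "kms Z"] by (simp add: kms_simps)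
  moreover have "Re (kms Z (LA Z)) = 0"
  proof -
    have "kms Z (LA Z) = - cnj (kms Z (LA Z))" using LA_antisym[of Z Z] kms_cnj[of Z "LA Z"] by simp
    then have "Re (kms Z (LA Z)) = - Re (kms Z (LA Z))" by (metis cnj.simps(1) uminus_complex.simps(1))
    then show ?thesis by simp
  qed
  ultimately have "\<gamma> * Re (kms Z (LS Z)) = 0"
    by (metis Re_complex_of_real Im_complex_of_real plus_complex.simps(1) times_complex.simps(1) zero_complex.simps(1) add_0 diff_zero mult_zero_left)
  then have re: "Re (kms Z (LS Z)) = 0" using g by simp
  have "kms (LS Z) (LS Z) = - kms Z (LS Z)"
  proof -
    have "LS (LS Z) = - LS Z" by (simp add: LS_def Eh_diff Eh_Eh)
    then show ?thesis by (simp add: LS_sym kms_simps)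
  qed
  then have "Re (kms (LS Z) (LS Z)) = 0" using re by simp
  then have "kms (LS Z) (LS Z) = 0" using kms_definite(1)[of "LS Z"] by (simp add: less_eq_complex_def complex_eq_iff)
  then show 1: "LS Z = 0" using kms_definite(2) LS_corner Z(1) by blast
  show "LA Z = 0" using Z(2) 1 by simp
qed

end

section \<open>Translation to matrices of a fixed size\<close>

definition of_mat :: "complex mat \<Rightarrow> fmat" where
  "of_mat A = (\<Sum>i<dim_row A. \<Sum>j<dim_row A. A $$ (i, j) *\<^sub>C munit i j)"
definition to_mat :: "nat \<Rightarrow> fmat \<Rightarrow> complex mat" where
  "to_mat n X = mat n n (\<lambda>(i, j). entry X i j)"

lemma of_mat_entry: "A \<in> carrier_mat n n \<Longrightarrow> entry (of_mat A) i j = (if i < n \<and> j < n then A $$ (i, j) else 0)"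
  unfolding of_mat_def by (subst entry_array) auto

lemma of_mat_corner: "A \<in> carrier_mat n n \<Longrightarrow> of_mat A \<in> corner n"
  by (rule cornerI) (auto simp: of_mat_entry)

lemma to_mat_carrier [simp]: "to_mat n X \<in> carrier_mat n n" by (simp add: to_mat_def)

lemma to_mat_index: "i < n \<Longrightarrow> j < n \<Longrightarrow> to_mat n X $$ (i, j) = entry X i j" by (simp add: to_mat_def)

lemma to_of: "A \<in> carrier_mat n n \<Longrightarrow> to_mat n (of_mat A) = A"
  by (rule eq_matI) (auto simp: to_mat_def of_mat_entry)

lemma of_to: "X \<in> corner n \<Longrightarrow> of_mat (to_mat n X) = X"
proof (rule fmat_eqI)
  fix i j assume "X \<in> corner n"
  then show "entry (of_mat (to_mat n X)) i j = entry X i j"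
    using corner_entry[of X n i j] by (auto simp: of_mat_entry[OF to_mat_carrier] to_mat_index)
qed

lemma of_mat_inj: "A \<in> carrier_mat n n \<Longrightarrow> B \<in> carrier_mat n n \<Longrightarrow> of_mat A = of_mat B \<Longrightarrow> A = B"
  by (metis to_of)

lemma of_mat_add: "A \<in> carrier_mat n n \<Longrightarrow> B \<in> carrier_mat n n \<Longrightarrow> of_mat (A + B) = of_mat A + of_mat B"
  by (rule fmat_eqI) (auto simp: of_mat_entry[where n = n])
lemma of_mat_minus: "A \<in> carrier_mat n n \<Longrightarrow> B \<in> carrier_mat n n \<Longrightarrow> of_mat (A - B) = of_mat A - of_mat B"
  by (rule fmat_eqI) (auto simp: of_mat_entry[where n = n] minus_carrier_mat)
lemma of_mat_smult: "A \<in> carrier_mat n n \<Longrightarrow> of_mat (c \<cdot>\<^sub>m A) = c *\<^sub>C of_mat A"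
  by (rule fmat_eqI) (auto simp: of_mat_entry[where n = n])
lemma of_mat_mult:
  assumes "A \<in> carrier_mat n n" "B \<in> carrier_mat n n" shows "of_mat (A * B) = of_mat A * of_mat B"
proof (rule fmat_eqI)
  fix i j
  have c: "of_mat A \<in> corner n" "of_mat B \<in> corner n" "of_mat A * of_mat B \<in> corner n"
    using assms of_mat_corner corner_times by blast+
  show "entry (of_mat (A * B)) i j = entry (of_mat A * of_mat B) i j"
  proof (cases "i < n \<and> j < n")
    case True
    have "entry (of_mat A * of_mat B) i j = (\<Sum>k<n. A $$ (i, k) * B $$ (k, j))"
      unfolding entry_times[OF disjI1[OF c(1)]] using True assms by (intro sum.cong refl) (auto simp: of_mat_entry)
    then show ?thesis using True assms
      by (simp add: of_mat_entry[where n = n] scalar_prod_def lessThan_atLeast0)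
  next
    case False
    then show ?thesis using corner_entry[OF c(3), of i j] assms by (auto simp: of_mat_entry[where n = n])
  qed
qed
lemma mat_adjoint_carrier: "A \<in> carrier_mat n n \<Longrightarrow> mat_adjoint A \<in> carrier_mat n n"
  unfolding mat_adjoint_def by (simp add: mat_of_rows_def)
lemma mat_adjoint_index: "A \<in> carrier_mat n n \<Longrightarrow> i < n \<Longrightarrow> j < n \<Longrightarrow> mat_adjoint A $$ (i, j) = cnj (A $$ (j, i))"
  unfolding mat_adjoint_def by (simp add: mat_of_rows_def)
lemma of_mat_adjoint: "A \<in> carrier_mat n n \<Longrightarrow> of_mat (mat_adjoint A) = (of_mat A)\<^sup>\<dagger>"
  by (rule fmat_eqI) (auto simp: of_mat_entry[where n = n] mat_adjoint_carrier mat_adjoint_index)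
lemma of_mat_one: "of_mat (1\<^sub>m n) = idm n"
  by (rule fmat_eqI) (auto simp: of_mat_entry[where n = n] entry_idm)
lemma of_mat_zero: "of_mat (0\<^sub>m n n) = 0"
  by (rule fmat_eqI) (auto simp: of_mat_entry[where n = n])

lemma to_mat_0: "to_mat n 0 = 0\<^sub>m n n" by (rule eq_matI) (auto simp: to_mat_def)
lemma to_mat_idm: "to_mat n (idm n) = 1\<^sub>m n" by (rule eq_matI) (auto simp: to_mat_def entry_idm)
lemma to_mat_add: "to_mat n (X + Y) = to_mat n X + to_mat n Y" by (rule eq_matI) (auto simp: to_mat_def)
lemma to_mat_cscale: "to_mat n (c *\<^sub>C X) = c \<cdot>\<^sub>m to_mat n X" by (rule eq_matI) (auto simp: to_mat_def)
lemma to_mat_uminus: "to_mat n (- X) = - to_mat n X" by (rule eq_matI) (auto simp: to_mat_def)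
lemma to_mat_mult: "X \<in> corner n \<Longrightarrow> Y \<in> corner n \<Longrightarrow> to_mat n (X * Y) = to_mat n X * to_mat n Y"
  by (rule of_mat_inj[of _ n]) (auto simp: of_mat_mult[where n = n] of_to corner_times intro!: mult_carrier_mat[of _ n n])
lemma to_mat_adj: "X \<in> corner n \<Longrightarrow> to_mat n (X\<^sup>\<dagger>) = mat_adjoint (to_mat n X)"
  by (rule of_mat_inj[of _ n]) (auto simp: of_mat_adjoint[where n = n] of_to adj_corner mat_adjoint_carrier)

lemma mtrace_of_mat: "A \<in> carrier_mat n n \<Longrightarrow> mtrace A = tr (of_mat A)"
  by (auto simp: mtrace_def tr_eq[OF of_mat_corner] of_mat_entry)

lemma entry_times_col:
  assumes "\<And>k. n \<le> k \<Longrightarrow> entry A i k = 0 \<or> entry B k j = 0"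
  shows "entry (A * B) i j = (\<Sum>k<n. entry A i k * entry B k j)"
proof -
  obtain m where m: "A \<in> corner m" using ex_corner by blast
  have "entry (A * B) i j = (\<Sum>k<m. entry A i k * entry B k j)" by (rule entry_times) (use m in simp)
  also have "\<dots> = (\<Sum>k<max m n. entry A i k * entry B k j)"
    by (rule sum.mono_neutral_left) (use corner_entry[OF m] in auto)
  also have "\<dots> = (\<Sum>k<n. entry A i k * entry B k j)"
    by (rule sum.mono_neutral_right) (use assms in auto)
  finally show ?thesis .
qed

lemma quadratic_form:
  assumes A: "A \<in> carrier_mat n n" and v: "v \<in> carrier_vec n"
  shows "(A *\<^sub>v v) \<bullet>c v = (\<Sum>i<n. (\<Sum>j<n. A $$ (i, j) * v $ j) * cnj (v $ i))"
  using assms by (simp add: scalar_prod_def lessThan_atLeast0)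

lemma psd_iff_pos: "psd n A \<longleftrightarrow> A \<in> carrier_mat n n \<and> pos (of_mat A)"
proof (cases "A \<in> carrier_mat n n")
  case A: True
  have Ac: "of_mat A \<in> corner n" using of_mat_corner[OF A] .
  have e: "entry (B\<^sup>\<dagger> * of_mat A * B) k k = (\<Sum>i<n. (\<Sum>j<n. A $$ (i, j) * entry B j k) * cnj (entry B i k))" for B k
  proof -
    have AB: "entry (of_mat A * B) i k = (if i < n then \<Sum>j<n. A $$ (i, j) * entry B j k else 0)" for i
    proof -
      have "entry (of_mat A * B) i k = (\<Sum>j<n. entry (of_mat A) i j * entry B j k)" by (rule entry_times) (use Ac in simp)
      then show ?thesis using of_mat_entry[OF A] by auto
    qed
    have "entry (B\<^sup>\<dagger> * (of_mat A * B)) k k = (\<Sum>i<n. entry (B\<^sup>\<dagger>) k i * entry (of_mat A * B) i k)"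
      by (rule entry_times_col) (simp add: AB)
    then show ?thesis by (simp add: mult.assoc AB mult.commute)
  qed
  have "(\<forall>v \<in> carrier_vec n. 0 \<le> (A *\<^sub>v v) \<bullet>c v) \<longleftrightarrow> pos (of_mat A)"
  proof
    assume *: "\<forall>v \<in> carrier_vec n. 0 \<le> (A *\<^sub>v v) \<bullet>c v"
    show "pos (of_mat A)" unfolding pos_def
    proof
      fix B
      have "0 \<le> entry (B\<^sup>\<dagger> * of_mat A * B) k k" for k
        using bspec[OF *, of "vec n (\<lambda>i. entry B i k)"] by (simp add: quadratic_form[OF A] e)
      then show "0 \<le> tr (B\<^sup>\<dagger> * of_mat A * B)" unfolding tr_def by (intro sum_nonneg) auto
    qed
  next
    assume *: "pos (of_mat A)"
    show "\<forall>v \<in> carrier_vec n. 0 \<le> (A *\<^sub>v v) \<bullet>c v"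
    proof
      fix v :: "complex vec" assume v: "v \<in> carrier_vec n"
      define B where "B = (\<Sum>i<n. v $ i *\<^sub>C munit i 0)"
      have Be: "entry B i k = (if i < n \<and> k = 0 then v $ i else 0)" for i k
      proof -
        have "v $ a * (if i = a \<and> k = 0 then 1 else 0) = (if a = i then (if k = 0 then v $ i else 0) else 0)" for a by auto
        then show ?thesis by (simp add: B_def entry_munit)
      qed
      obtain m where m: "B\<^sup>\<dagger> * of_mat A * B \<in> corner (Suc m)" using ex_corner corner_mono[of _ _ "Suc _"] by (metis le_SucI order_refl)
      have "tr (B\<^sup>\<dagger> * of_mat A * B) = (\<Sum>k<Suc m. if k = 0 then (\<Sum>i<n. (\<Sum>j<n. A $$ (i, j) * v $ j) * cnj (v $ i)) else 0)"
        unfolding tr_eq[OF m] e by (intro sum.cong refl) (auto simp: Be)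
      then have "tr (B\<^sup>\<dagger> * of_mat A * B) = (A *\<^sub>v v) \<bullet>c v" by (simp add: quadratic_form[OF A v])
      then show "0 \<le> (A *\<^sub>v v) \<bullet>c v" using posD[OF *, of B] by simp
    qed
  qed
  then show ?thesis using A by (simp add: psd_def)
qed (simp add: psd_def)

lemma msqrt_eq:
  assumes "R \<in> corner n" "pos R" shows "msqrt n (to_mat n (R * R)) = to_mat n R"
  unfolding msqrt_def
proof (rule the_equality)
  show "psd n (to_mat n R) \<and> to_mat n R * to_mat n R = to_mat n (R * R)"
    using assms by (simp add: psd_iff_pos of_to to_mat_mult)
  fix B assume B: "psd n B \<and> B * B = to_mat n (R * R)"
  then have Bc: "B \<in> carrier_mat n n" and Bp: "pos (of_mat B)" by (auto simp: psd_iff_pos)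
  have "of_mat B * of_mat B = R * R"
    using B Bc assms by (metis of_mat_mult of_to corner_times)
  then have "of_mat B = R" by (rule pos_sqrt_unique[OF Bp assms(2)])
  then show "B = to_mat n R" using to_of[OF Bc] by simp
qed

lemma vna_star_alg: "von_neumann_algebra n M \<Longrightarrow> star_alg n (of_mat ` M)"
proof -
  assume M: "von_neumann_algebra n M"
  then have c: "A \<in> carrier_mat n n" if "A \<in> M" for A using that by (auto simp: von_neumann_algebra_def)
  show ?thesis unfolding star_alg_def
  proof (intro conjI ballI allI)
    show "of_mat ` M \<subseteq> corner n" using c of_mat_corner by auto
    show "idm n \<in> of_mat ` M" using M by (metis von_neumann_algebra_def image_eqI of_mat_one)
    fix X assume "X \<in> of_mat ` M" then obtain A where A: "A \<in> M" "X = of_mat A" by auto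
    show "c *\<^sub>C X \<in> of_mat ` M" for c
      using A M c[OF A(1)] by (auto simp: von_neumann_algebra_def simp flip: of_mat_smult)
    show "X\<^sup>\<dagger> \<in> of_mat ` M" using A M c[OF A(1)] by (auto simp: von_neumann_algebra_def simp flip: of_mat_adjoint)
    fix Y assume "Y \<in> of_mat ` M" then obtain B where B: "B \<in> M" "Y = of_mat B" by auto
    show "X + Y \<in> of_mat ` M" "X * Y \<in> of_mat ` M"
      using A B M c[OF A(1)] c[OF B(1)] by (auto simp: von_neumann_algebra_def simp flip: of_mat_add of_mat_mult)
  qed
qed

lemma star_alg_vna: "star_alg n N \<Longrightarrow> von_neumann_algebra n (to_mat n ` N)"
proof -
  assume N: "star_alg n N"
  note Nd = star_algD[OF N]
  show ?thesis unfolding von_neumann_algebra_def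
  proof (intro conjI ballI allI)
    show "to_mat n ` N \<subseteq> carrier_mat n n" by auto
    show "1\<^sub>m n \<in> to_mat n ` N" using Nd(2) by (metis image_eqI to_mat_idm)
    fix A assume "A \<in> to_mat n ` N" then obtain X where X: "X \<in> N" "A = to_mat n X" by auto
    show "c \<cdot>\<^sub>m A \<in> to_mat n ` N" for c using X Nd(4) by (auto simp flip: to_mat_cscale)
    show "mat_adjoint A \<in> to_mat n ` N" using X Nd(6,12) by (auto simp flip: to_mat_adj)
    fix B assume "B \<in> to_mat n ` N" then obtain Y where Y: "Y \<in> N" "B = to_mat n Y" by auto
    show "A + B \<in> to_mat n ` N" "A * B \<in> to_mat n ` N"
      using X Y Nd(3,5,12) by (auto simp flip: to_mat_add to_mat_mult)
  qed
qed

lemma full_rank_iff: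
  assumes A: "(A :: complex mat) \<in> carrier_mat n n"
  shows "vec_space.rank n A = n \<longleftrightarrow> (\<exists>B\<in>corner n. of_mat A * B = idm n \<and> B * of_mat A = idm n)"
proof
  assume "vec_space.rank n A = n"
  then have "det A \<noteq> 0" using vec_space.det_rank_iff[OF A] by simp
  from det_non_zero_imp_unit[OF A this, of "()"]
  obtain B where B: "B \<in> carrier_mat n n" "A * B = 1\<^sub>m n" "B * A = 1\<^sub>m n"
    by (auto simp: Units_def ring_mat_simps)
  then show "\<exists>B\<in>corner n. of_mat A * B = idm n \<and> B * of_mat A = idm n"
    using A by (metis of_mat_mult of_mat_one of_mat_corner)
next
  assume "\<exists>B\<in>corner n. of_mat A * B = idm n \<and> B * of_mat A = idm n"
  then obtain B where B: "B \<in> corner n" "of_mat A * B = idm n" by blast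
  have "A * to_mat n B = 1\<^sub>m n"
    by (rule of_mat_inj[of _ n]) (use A B in \<open>auto simp: of_mat_mult[where n = n] of_to of_mat_one\<close>)
  then have "det A * det (to_mat n B) = 1" using det_mult[OF A, of "to_mat n B"] by simp
  then have "det A \<noteq> 0" by auto
  then show "vec_space.rank n A = n" using vec_space.det_rank_iff[OF A] by simp
qed

subsection \<open>Semigroups\<close>

lemma semigroup_exp_eq:
  assumes M: "M \<subseteq> carrier_mat n n" "\<And>A. A \<in> M \<Longrightarrow> L A \<in> M" and A: "A \<in> M"
    and l: "\<And>A. A \<in> M \<Longrightarrow> l (of_mat A) = of_mat (L A)"
  shows "semigroup_exp n L t A = to_mat n (expo n l t (of_mat A))"
proof -
  have LM: "(L ^^ k) A \<in> M" for k by (induction k) (auto simp: A M)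
  have lk: "(l ^^ k) (of_mat A) = of_mat ((L ^^ k) A)" for k
    by (induction k) (auto simp: l LM)
  show ?thesis
  proof (rule eq_matI)
    fix i j assume "i < dim_row (to_mat n (expo n l t (of_mat A)))" "j < dim_col (to_mat n (expo n l t (of_mat A)))"
    then have ij: "i < n" "j < n" by (auto simp: to_mat_def)
    have "(L ^^ k) A \<in> carrier_mat n n" for k using LM M(1) by blast
    then show "semigroup_exp n L t A $$ (i, j) = to_mat n (expo n l t (of_mat A)) $$ (i, j)"
      using ij by (simp add: semigroup_exp_def to_mat_index expo_entry lk of_mat_entry[where n = n] tcoef_def)
  qed (auto simp: semigroup_exp_def to_mat_def)
qed

subsection \<open>Complete positivity\<close>

lemma blk_entry: assumes "a < n" "b < n" shows "entry ((blk n i)\<^sup>\<dagger> * W * blk n j) a b = entry W (i * n + a) (j * n + b)"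
proof -
  have 1: "blk n j * munit b a = munit (j * n + b) a" if "b < n" for j b a
  proof -
    have "blk n j * munit b a = (\<Sum>c<n. if c = b then munit (j * n + b) a else 0)"
      unfolding blk_def sum_distrib_right by (intro sum.cong refl) auto
    then show ?thesis using that by simp
  qed
  have 2: "munit c a * (blk n i)\<^sup>\<dagger> = munit c (i * n + a)" if "a < n" for c
    using arg_cong[OF 1[OF that, of i c], of adj] by simp
  have "entry ((blk n i)\<^sup>\<dagger> * W * blk n j) a b = tr (munit b a * ((blk n i)\<^sup>\<dagger> * W * blk n j))" by (simp add: entry_tr)
  also have "\<dots> = tr ((blk n j * munit b a * (blk n i)\<^sup>\<dagger>) * W)" by (metis mult.assoc tr_comm)
  also have "\<dots> = tr (munit (j * n + b) (i * n + a) * W)" using assms by (simp only: 1 2)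
  finally show ?thesis by (simp add: entry_tr)
qed

lemma block_to_mat: "i < k \<Longrightarrow> j < k \<Longrightarrow> block n (to_mat (k * n) W) i j = to_mat n ((blk n i)\<^sup>\<dagger> * W * blk n j)"
proof (rule eq_matI)
  fix a b assume ij: "i < k" "j < k" and "a < dim_row (to_mat n ((blk n i)\<^sup>\<dagger> * W * blk n j))" "b < dim_col (to_mat n ((blk n i)\<^sup>\<dagger> * W * blk n j))"
  then have ab: "a < n" "b < n" by (auto simp: to_mat_def)
  have "i * n + a < k * n" "j * n + b < k * n" using ij ab
    by (metis add.commute add_less_cancel_left less_le_trans mult_Suc mult_le_mono1 Suc_leI)+
  then show "block n (to_mat (k * n) W) i j $$ (a, b) = to_mat n ((blk n i)\<^sup>\<dagger> * W * blk n j) $$ (a, b)"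
    using ab by (simp add: block_def to_mat_index blk_entry)
qed (auto simp: block_def to_mat_def)

lemma amplification_eq:
  assumes "\<And>i j. i < k \<Longrightarrow> j < k \<Longrightarrow> \<Phi> (block n Z i j) = to_mat n (Y i j)" "\<And>i j. i < k \<Longrightarrow> j < k \<Longrightarrow> Y i j \<in> corner n"
  shows "amplification k n \<Phi> Z = to_mat (k * n) (\<Sum>i<k. \<Sum>j<k. blk n i * Y i j * (blk n j)\<^sup>\<dagger>)"
proof (rule eq_matI)
  let ?W = "\<Sum>i<k. \<Sum>j<k. blk n i * Y i j * (blk n j)\<^sup>\<dagger>"
  fix p q assume "p < dim_row (to_mat (k * n) ?W)" "q < dim_col (to_mat (k * n) ?W)"
  then have pq: "p < k * n" "q < k * n" by (auto simp: to_mat_def)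
  then have n: "0 < n" by (cases n) auto
  have d: "p div n < k" "q div n < k" "p mod n < n" "q mod n < n" using pq n by (auto simp: less_mult_imp_div_less)
  have "entry (Y (p div n) (q div n)) (p mod n) (q mod n) = entry ((blk n (p div n))\<^sup>\<dagger> * ?W * blk n (q div n)) (p mod n) (q mod n)"
    by (subst compress_array[OF assms(2) d(1,2)]) auto
  also have "\<dots> = entry ?W p q" by (subst blk_entry[OF d(3,4)]) simp
  finally show "amplification k n \<Phi> Z $$ (p, q) = to_mat (k * n) ?W $$ (p, q)"
    using pq d by (simp add: amplification_def to_mat_index assms(1))
qed (auto simp: amplification_def to_mat_def)

text \<open>
  The array \<open>\<phi> ((V i)\<^sup>\<dagger> * V j)\<close> is the amplification of the positive block matrix \<open>W\<close> with entries
  \<open>(V i)\<^sup>\<dagger> * V j\<close>.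
\<close>

lemma cp_of_completely_positive:
  assumes M: "star_alg n (of_mat ` M)" "M \<subseteq> carrier_mat n n" and CP: "completely_positive n M \<Phi>"
    and \<phi>: "\<And>A. A \<in> M \<Longrightarrow> \<Phi> A = to_mat n (\<phi> (of_mat A))" "\<And>A. A \<in> M \<Longrightarrow> \<phi> (of_mat A) \<in> corner n"
  shows "cp (of_mat ` M) \<phi>"
  unfolding cp_def
proof (intro allI impI)
  fix k :: nat and V \<xi> :: "nat \<Rightarrow> fmat" assume V: "\<forall>i<k. V i \<in> of_mat ` M"
  note Md = star_algD[OF M(1)]
  have VV: "(V i)\<^sup>\<dagger> * V j \<in> of_mat ` M" if "i < k" "j < k" for i j using V that by (intro Md) auto
  have VVc: "(V i)\<^sup>\<dagger> * V j \<in> corner n" if "i < k" "j < k" for i j using VV[OF that] Md by blast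
  have VVM: "to_mat n ((V i)\<^sup>\<dagger> * V j) \<in> M" if "i < k" "j < k" for i j
  proof -
    from VV[OF that] obtain A where A: "A \<in> M" "(V i)\<^sup>\<dagger> * V j = of_mat A" by auto
    then show ?thesis using M(2) by (auto simp: to_of)
  qed
  define W where "W = (\<Sum>i<k. \<Sum>j<k. blk n i * ((V i)\<^sup>\<dagger> * V j) * (blk n j)\<^sup>\<dagger>)"
  have Wc: "W \<in> corner (k * n)" unfolding W_def by (rule array_corner)
  have bW: "block n (to_mat (k * n) W) i j = to_mat n ((V i)\<^sup>\<dagger> * V j)" if "i < k" "j < k" for i j
    using that unfolding block_to_mat[OF that] W_def by (subst compress_array[OF VVc]) auto
  have "pos W"
  proof -
    have "W = (\<Sum>i<k. \<Sum>j<k. (V i * (blk n i)\<^sup>\<dagger>)\<^sup>\<dagger> * (V j * (blk n j)\<^sup>\<dagger>))" unfolding W_def by (simp add: mult.assoc)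
    then show ?thesis by (simp only: gram_pos)
  qed
  then have "psd (k * n) (to_mat (k * n) W)" by (simp add: psd_iff_pos of_to Wc)
  moreover have "to_mat (k * n) W \<in> block_matrices k n M" by (auto simp: block_matrices_def bW VVM)
  ultimately have "psd (k * n) (amplification k n \<Phi> (to_mat (k * n) W))" using CP by (auto simp: completely_positive_def)
  moreover have \<phi>c: "\<phi> ((V i)\<^sup>\<dagger> * V j) \<in> corner n" if "i < k" "j < k" for i j using VV[OF that] \<phi>(2) by auto
  have "amplification k n \<Phi> (to_mat (k * n) W) = to_mat (k * n) (\<Sum>i<k. \<Sum>j<k. blk n i * \<phi> ((V i)\<^sup>\<dagger> * V j) * (blk n j)\<^sup>\<dagger>)"
    by (rule amplification_eq) (use \<phi>(1) VVM bW \<phi>c VVc in \<open>auto simp: of_to\<close>)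
  ultimately have p: "pos (\<Sum>i<k. \<Sum>j<k. blk n i * \<phi> ((V i)\<^sup>\<dagger> * V j) * (blk n j)\<^sup>\<dagger>)"
    by (simp add: psd_iff_pos of_to array_corner)
  define x where "x = (\<Sum>i<k. blk n i * \<xi> i)"
  have x: "(blk n j)\<^sup>\<dagger> * x = idm n * \<xi> j" if "j < k" for j
  proof -
    have "(blk n j)\<^sup>\<dagger> * x = (\<Sum>i<k. ((blk n j)\<^sup>\<dagger> * blk n i) * \<xi> i)" by (simp add: x_def sum_distrib_left mult.assoc)
    also have "\<dots> = (\<Sum>i<k. if i = j then idm n * \<xi> j else 0)" by (intro sum.cong refl) (auto simp: blk_adj_blk)
    finally show ?thesis using that by simp
  qed
  have "x\<^sup>\<dagger> * (\<Sum>i<k. \<Sum>j<k. blk n i * \<phi> ((V i)\<^sup>\<dagger> * V j) * (blk n j)\<^sup>\<dagger>) * x =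
      (\<Sum>i<k. \<Sum>j<k. ((blk n i)\<^sup>\<dagger> * x)\<^sup>\<dagger> * \<phi> ((V i)\<^sup>\<dagger> * V j) * ((blk n j)\<^sup>\<dagger> * x))"
    by (simp add: sum_distrib_left sum_distrib_right mult.assoc)
  also have "\<dots> = (\<Sum>i<k. \<Sum>j<k. (\<xi> i)\<^sup>\<dagger> * \<phi> ((V i)\<^sup>\<dagger> * V j) * \<xi> j)"
  proof (intro sum.cong refl)
    fix i j assume "i \<in> {..<k}" "j \<in> {..<k}"
    then have ij: "i < k" "j < k" by auto
    have "((blk n i)\<^sup>\<dagger> * x)\<^sup>\<dagger> * \<phi> ((V i)\<^sup>\<dagger> * V j) * ((blk n j)\<^sup>\<dagger> * x) = (\<xi> i)\<^sup>\<dagger> * (idm n * \<phi> ((V i)\<^sup>\<dagger> * V j) * idm n) * \<xi> j"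
      unfolding x[OF ij(1)] x[OF ij(2)] by (simp add: mult.assoc)
    then show "((blk n i)\<^sup>\<dagger> * x)\<^sup>\<dagger> * \<phi> ((V i)\<^sup>\<dagger> * V j) * ((blk n j)\<^sup>\<dagger> * x) = (\<xi> i)\<^sup>\<dagger> * \<phi> ((V i)\<^sup>\<dagger> * V j) * \<xi> j"
      using \<phi>c[OF ij] by (simp only: corner_iff)
  qed
  finally show "pos (\<Sum>i<k. \<Sum>j<k. (\<xi> i)\<^sup>\<dagger> * \<phi> ((V i)\<^sup>\<dagger> * V j) * \<xi> j)" using pos_conj[OF p, of x] by simp
qed

text \<open>
  A positive element \<open>W\<close> of \<open>M\<^sub>k(M)\<close> is the square of a positive \<open>R\<close> in \<open>M\<^sub>k(M)\<close>, and \<open>R * R\<close> is a sum of Gram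
  matrices over \<open>M\<close>, one for each row of \<open>R\<close>.
\<close>

lemma completely_positive_of_cp:
  assumes M: "star_alg n (of_mat ` M)" "M \<subseteq> carrier_mat n n" and CP: "cp (of_mat ` M) \<phi>"
    and add: "\<And>(f :: nat \<Rightarrow> fmat) S. finite S \<Longrightarrow> (\<And>x. x \<in> S \<Longrightarrow> f x \<in> of_mat ` M) \<Longrightarrow> \<phi> (sum f S) = (\<Sum>x\<in>S. \<phi> (f x))"
    and \<phi>: "\<And>A. A \<in> M \<Longrightarrow> \<Phi> A = to_mat n (\<phi> (of_mat A))" "\<And>A. A \<in> M \<Longrightarrow> \<phi> (of_mat A) \<in> corner n"
  shows "completely_positive n M \<Phi>"
  unfolding completely_positive_def
proof (intro allI ballI impI)
  note Md = star_algD[OF M(1)]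
  fix k Z assume Z: "Z \<in> block_matrices k n M" "psd (k * n) Z"
  define W where "W = of_mat Z"
  have Zc: "Z \<in> carrier_mat (k * n) (k * n)" using Z by (simp add: block_matrices_def)
  have Wc: "W \<in> corner (k * n)" unfolding W_def using Zc by (rule of_mat_corner)
  have ZW: "Z = to_mat (k * n) W" unfolding W_def using to_of[OF Zc] by simp
  have bM: "block n Z i j \<in> M" if "i < k" "j < k" for i j using Z that by (auto simp: block_matrices_def)
  have b: "of_mat (block n Z i j) = (blk n i)\<^sup>\<dagger> * W * blk n j" if "i < k" "j < k" for i j
    unfolding ZW block_to_mat[OF that] by (rule of_to) (rule blk_compress_corner)
  have WB: "W \<in> block_alg k n (of_mat ` M)" using Wc b bM by (force simp: block_alg_def simp flip: b)
  have "pos W" using Z(2) by (simp add: psd_iff_pos W_def)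
  then obtain R where R: "R \<in> block_alg k n (of_mat ` M)" "pos R" "R * R = W"
    using sqrt_in_star_alg[OF star_alg_block_alg[OF M(1)] WB] posD by metis
  define Q where "Q l i = (blk n l)\<^sup>\<dagger> * R * blk n i" for l i
  have QM: "Q l i \<in> of_mat ` M" if "l < k" "i < k" for l i using R(1) that by (auto simp: Q_def block_alg_def)
  have WQ: "(blk n i)\<^sup>\<dagger> * W * blk n j = (\<Sum>l<k. (Q l i)\<^sup>\<dagger> * Q l j)" for i j
    unfolding R(3)[symmetric] using R(1) by (subst blk_product) (auto simp: block_alg_def Q_def pos_herm[OF R(2)] mult.assoc)
  let ?Y = "\<lambda>i j. \<phi> ((blk n i)\<^sup>\<dagger> * W * blk n j)"
  have Yc: "?Y i j \<in> corner n" if "i < k" "j < k" for i j using \<phi>(2)[OF bM[OF that]] by (simp add: b that)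
  have "amplification k n \<Phi> Z = to_mat (k * n) (\<Sum>i<k. \<Sum>j<k. blk n i * ?Y i j * (blk n j)\<^sup>\<dagger>)"
    by (rule amplification_eq) (use \<phi>(1) bM b Yc in auto)
  moreover have "pos (\<Sum>i<k. \<Sum>j<k. blk n i * ?Y i j * (blk n j)\<^sup>\<dagger>)"
  proof -
    have "?Y i j = (\<Sum>l<k. \<phi> ((Q l i)\<^sup>\<dagger> * Q l j))" if "i < k" "j < k" for i j
      unfolding WQ by (rule add) (use QM that Md in auto)
    then have "(\<Sum>i<k. \<Sum>j<k. blk n i * ?Y i j * (blk n j)\<^sup>\<dagger>) = (\<Sum>i<k. \<Sum>j<k. \<Sum>l<k. blk n i * \<phi> ((Q l i)\<^sup>\<dagger> * Q l j) * (blk n j)\<^sup>\<dagger>)"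
      by (intro sum.cong refl) (simp add: sum_distrib_left sum_distrib_right)
    also have "\<dots> = (\<Sum>i<k. \<Sum>l<k. \<Sum>j<k. blk n i * \<phi> ((Q l i)\<^sup>\<dagger> * Q l j) * (blk n j)\<^sup>\<dagger>)" by (intro sum.cong refl sum.swap)
    also have "\<dots> = (\<Sum>l<k. \<Sum>i<k. \<Sum>j<k. blk n i * \<phi> ((Q l i)\<^sup>\<dagger> * Q l j) * (blk n j)\<^sup>\<dagger>)" by (rule sum.swap)
    also have "pos \<dots>"
    proof (rule pos_sum)
      fix l assume l: "l \<in> {..<k}"
      have "pos (\<Sum>i<k. \<Sum>j<k. ((blk n i)\<^sup>\<dagger>)\<^sup>\<dagger> * \<phi> ((Q l i)\<^sup>\<dagger> * Q l j) * (blk n j)\<^sup>\<dagger>)" by (rule cpD[OF CP]) (use QM l in auto)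
      then show "pos (\<Sum>i<k. \<Sum>j<k. blk n i * \<phi> ((Q l i)\<^sup>\<dagger> * Q l j) * (blk n j)\<^sup>\<dagger>)" by simp
    qed
    finally show ?thesis .
  qed
  ultimately show "psd (k * n) (amplification k n \<Phi> Z)" by (simp add: psd_iff_pos of_to array_corner)
qed

subsection \<open>Dimension\<close>

text \<open>
  A basis of \<open>V\<close> stays independent when some \<open>w \<in> W - V\<close> is added to it, and independent subsets of \<open>W\<close>
  are no larger than generating ones.
\<close>

lemma mat_dim_strict_mono:
  assumes V: "fmat.subspace V" and W: "fmat.subspace W" "W \<subseteq> corner n" and VW: "V \<subset> W"
  shows "mat_dim n (to_mat n ` V) < mat_dim n (to_mat n ` W)"
proof -
  let ?R = "class_ring :: complex ring" and ?N = "\<lambda>U. module_mat TYPE(complex) n n\<lparr>carrier := to_mat n ` U\<rparr>"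
  have vs: "vectorspace ?R (?N U)" if U: "fmat.subspace U" "U \<subseteq> corner n" for U
  proof -
    interpret X: vectorspace ?R "module_mat TYPE(complex) n n" by (rule matrix_vs)
    show ?thesis
    proof (rule X.subspace_is_vs, rule VectorSpace.subspace.intro)
      show "vectorspace ?R (module_mat TYPE(complex) n n)" by (rule matrix_vs)
      show "submodule ?R (to_mat n ` U) (module_mat TYPE(complex) n n)"
        by (rule submodule.intro)
          (use X.module_axioms U in \<open>auto simp: matrix_vs_simps fmat.subspace_def simp flip: to_mat_add to_mat_cscale to_mat_0\<close>)
    qed
  qed
  have lc: "of_mat (LinearCombinations.module.lincomb (?N U) a A) = (\<Sum>v\<in>A. a v *\<^sub>C of_mat v)"
    if U: "fmat.subspace U" "U \<subseteq> corner n" and A: "finite A" "A \<subseteq> to_mat n ` U" for U a A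
  proof -
    interpret X: vectorspace ?R "?N U" by (rule vs[OF U])
    have cl: "c \<cdot>\<^sub>m B \<in> to_mat n ` U" if "B \<in> to_mat n ` U" for c B
      using that U by (auto simp: fmat.subspace_def simp flip: to_mat_cscale)
    show ?thesis using A
    proof (induction A)
      case empty
      then show ?case by (simp add: X.lincomb_def matrix_vs_simps of_mat_zero)
    next
      case (insert x A)
      have xc: "x \<in> carrier_mat n n" using insert by auto
      have lA: "X.lincomb a A \<in> carrier (?N U)" by (rule X.lincomb_closed) (use insert in \<open>auto simp: class_ring_simps\<close>)
      then have lc: "X.lincomb a A \<in> carrier_mat n n" by auto
      have "X.lincomb a (insert x A) = a x \<cdot>\<^sub>m x + X.lincomb a A"
        unfolding X.lincomb_def
        by (subst X.finsum_insert) (use insert cl in \<open>auto simp: matrix_vs_simps\<close>)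
      then show ?case using insert xc lc by (simp add: of_mat_add[where n = n] of_mat_smult[where n = n])
    qed
  qed
  have Vc: "V \<subseteq> corner n" using VW W by auto
  interpret XV: vectorspace ?R "?N V" by (rule vs[OF V Vc])
  interpret XW: vectorspace ?R "?N W" by (rule vs[OF W])
  have basis: "\<exists>B. finite B \<and> fmat.independent B \<and> B \<subseteq> U \<and> U \<subseteq> fmat.span B" if "U \<subseteq> corner n" for U
  proof -
    obtain B where "B \<subseteq> U" "fmat.independent B" "U \<subseteq> fmat.span B" using fmat.maximal_independent_subset[of U] by blast
    then show ?thesis using corner_independent(1)[of B n] that by blast
  qed
  have gen: "finite (to_mat n ` B) \<and> to_mat n ` B \<subseteq> carrier (?N U) \<and> LinearCombinations.module.span ?R (?N U) (to_mat n ` B) = carrier (?N U)"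
    if U: "fmat.subspace U" "U \<subseteq> corner n" and B: "finite B" "B \<subseteq> U" "U \<subseteq> fmat.span B" for U B
  proof (intro conjI)
    interpret X: vectorspace ?R "?N U" by (rule vs[OF U])
    show fin: "finite (to_mat n ` B)" and sub: "to_mat n ` B \<subseteq> carrier (?N U)" using B by auto
    show "LinearCombinations.module.span ?R (?N U) (to_mat n ` B) = carrier (?N U)"
    proof
      show "LinearCombinations.module.span ?R (?N U) (to_mat n ` B) \<subseteq> carrier (?N U)" using X.span_is_subset2[OF sub] by simp
      show "carrier (?N U) \<subseteq> LinearCombinations.module.span ?R (?N U) (to_mat n ` B)"
      proof
        fix A assume "A \<in> carrier (?N U)"
        then obtain Y where Y: "Y \<in> U" "A = to_mat n Y" by auto
        then have "Y \<in> fmat.span B" using B(3) by auto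
        then obtain u where u: "Y = (\<Sum>v\<in>B. u v *\<^sub>C v)" using fmat.span_finite[OF B(1)] by auto
        let ?a = "\<lambda>Z. u (of_mat Z)"
        have inj: "inj_on (to_mat n) B" using B(2) U(2) by (intro inj_onI) (metis of_to subsetD)
        have "of_mat (X.lincomb ?a (to_mat n ` B)) = (\<Sum>v\<in>to_mat n ` B. ?a v *\<^sub>C of_mat v)" by (rule lc[OF U fin]) (use sub in simp)
        also have "\<dots> = (\<Sum>v\<in>B. u v *\<^sub>C v)"
          unfolding sum.reindex[OF inj] by (intro sum.cong refl) (use B(2) U(2) in \<open>auto simp: of_to subset_iff\<close>)
        finally have e: "of_mat (X.lincomb ?a (to_mat n ` B)) = Y" using u by simp
        have "X.lincomb ?a (to_mat n ` B) \<in> carrier (?N U)" by (rule X.lincomb_closed) (use sub in \<open>auto simp: class_ring_simps\<close>)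
        then have "X.lincomb ?a (to_mat n ` B) \<in> carrier_mat n n" by auto
        then have "A = X.lincomb ?a (to_mat n ` B)" using e Y(2) to_of by metis
        then show "A \<in> LinearCombinations.module.span ?R (?N U) (to_mat n ` B)"
          unfolding X.span_def using fin by (auto simp: class_ring_simps)
      qed
    qed
  qed
  obtain b where b: "finite b" "fmat.independent b" "b \<subseteq> V" "V \<subseteq> fmat.span b" using basis[OF Vc] by blast
  obtain c where c: "finite c" "fmat.independent c" "c \<subseteq> W" "W \<subseteq> fmat.span c" using basis[OF W(2)] by blast
  have "XV.dim \<le> card (to_mat n ` b)"
    by (rule XV.gen_ge_dim) (use gen[OF V Vc b(1,3,4)] in auto)
  also have "\<dots> \<le> card b" using b(1) by (rule card_image_le)
  finally have 1: "XV.dim \<le> card b" .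
  have "\<exists>A. finite A \<and> card A = XW.dim \<and> A \<subseteq> carrier (?N W) \<and> XW.gen_set A"
    unfolding XW.dim_def by (rule LeastI[of "\<lambda>d. \<exists>A. finite A \<and> card A = d \<and> A \<subseteq> carrier (?N W) \<and> XW.gen_set A" "card (to_mat n ` c)"])
      (use gen[OF W c(1,3,4)] in auto)
  then obtain A where A: "finite A" "card A = XW.dim" "A \<subseteq> carrier (?N W)" "XW.gen_set A" by blast
  have WA: "W \<subseteq> fmat.span (of_mat ` A)"
  proof
    fix Y assume Y: "Y \<in> W"
    then have "to_mat n Y \<in> XW.span A" using A(4) by auto
    then obtain a A' where a: "to_mat n Y = XW.lincomb a A'" "finite A'" "A' \<subseteq> A" unfolding XW.span_def by auto
    have "Y = of_mat (to_mat n Y)" using Y W(2) by (auto simp: of_to)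
    also have "\<dots> = (\<Sum>v\<in>A'. a v *\<^sub>C of_mat v)" unfolding a(1) by (rule lc[OF W a(2)]) (use a(3) A(3) in auto)
    finally have e: "Y = (\<Sum>v\<in>A'. a v *\<^sub>C of_mat v)" .
    show "Y \<in> fmat.span (of_mat ` A)" unfolding e
      by (intro fmat.span_sum fmat.span_scale fmat.span_base) (use a(3) in auto)
  qed
  obtain w where w: "w \<in> W" "w \<notin> V" using VW by auto
  have "fmat.span b \<subseteq> V" using b(3) V by (rule fmat.span_minimal)
  then have ws: "w \<notin> fmat.span b" using w by auto
  then have ind: "fmat.independent (insert w b)" using b(2) by (simp add: fmat.independent_insert)
  have "finite (insert w b) \<and> card (insert w b) \<le> card (of_mat ` A)"
    by (rule fmat.independent_span_bound) (use A(1) ind w(1) b(3) VW WA in auto)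
  moreover have "w \<notin> b" using ws fmat.span_base by auto
  ultimately have "Suc (card b) \<le> card (of_mat ` A)" using b(1) by simp
  also have "\<dots> \<le> XW.dim" using A(2) card_image_le[OF A(1)] by metis
  finally show ?thesis unfolding mat_dim_def using 1 by simp
qed

section \<open>Verification of the conditions for a second-order lift\<close>

lemma ker_subspace: "lin_on (corner m) l \<Longrightarrow> fmat.subspace {Z \<in> corner m. l Z = 0}"
  using lin_zero[OF star_algD(11,1)[OF star_alg_corner]]
  by (auto simp: fmat.subspace_def corner_intros lin_on_def)

lemma to_mat_eq_0: "X \<in> corner m \<Longrightarrow> to_mat m X = 0\<^sub>m m m \<longleftrightarrow> X = 0"
  by (metis of_to of_mat_zero to_mat_0)

lemma fixed_space_eq:
  assumes "\<And>A. A \<in> carrier_mat m m \<Longrightarrow> L A = to_mat m (l (of_mat A))" "\<And>Z. Z \<in> corner m \<Longrightarrow> l Z \<in> corner m"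
  shows "fixed_space m (carrier_mat m m) L = to_mat m ` {Z \<in> corner m. l Z = 0}"
proof (intro equalityI subsetI)
  fix A assume "A \<in> fixed_space m (carrier_mat m m) L"
  then have A: "A \<in> carrier_mat m m" "L A = 0\<^sub>m m m" by (auto simp: fixed_space_def)
  have "of_mat A \<in> corner m" using A(1) by (rule of_mat_corner)
  then have "of_mat A \<in> {Z \<in> corner m. l Z = 0}" using A assms to_mat_eq_0 by auto
  then show "A \<in> to_mat m ` {Z \<in> corner m. l Z = 0}" using to_of[OF A(1)] by (metis image_eqI)
next
  fix A assume "A \<in> to_mat m ` {Z \<in> corner m. l Z = 0}"
  then obtain Z where Z: "Z \<in> corner m" "l Z = 0" "A = to_mat m Z" by auto
  then show "A \<in> fixed_space m (carrier_mat m m) L" using assms(1)[of A] by (simp add: fixed_space_def of_to to_mat_0)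
qed

lemma of_mat_image_carrier: "of_mat ` carrier_mat m m = corner m"
proof (intro equalityI subsetI)
  fix X assume "X \<in> corner m"
  then show "X \<in> of_mat ` carrier_mat m m" using of_to to_mat_carrier by (metis image_eqI)
qed (auto intro: of_mat_corner)

lemma expo_fixed: assumes "X \<in> corner m" "l X = 0" "l 0 = 0" shows "expo m l u X = X"
proof (rule fmat_eqI)
  fix i j
  have "(l ^^ k) X = (if k = 0 then X else 0)" for k by (induction k) (auto simp: assms)
  then have "(\<lambda>k. tcoef u k * entry ((l ^^ k) X) i j) = (\<lambda>k. if k = 0 then entry X i j else 0)" by (auto simp: tcoef_def)
  then have "(\<Sum>k. tcoef u k * entry ((l ^^ k) X) i j) = entry X i j"
    using sums_unique[OF sums_single[of 0 "\<lambda>_. entry X i j"]] by simp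
  then show "entry (expo m l u X) i j = entry X i j" using corner_entry[OF assms(1), of i j] by (auto simp: expo_entry)
qed

locale lift_qms = lift_data +
  assumes L: "lin_on M L" and cpL: "\<And>u. 0 \<le> u \<Longrightarrow> cp M (expo n L u)"
    and unital: "\<And>u. 0 \<le> u \<Longrightarrow> expo n L u (idm n) = idm n"
    and nontrivial: "\<exists>X\<in>M. L X \<noteq> 0"
begin

abbreviation C :: "complex mat set" where "C \<equiv> carrier_mat m m"
definition "rho = to_mat m sg"
definition "LAm A = to_mat m (LA (of_mat A))"
definition "LSm A = to_mat m (LS (of_mat A))"
definition "lc Z = Eh (LA (LA (Eh Z)))"
abbreviation "Lc \<equiv> L_col m C rho LAm LSm"
abbreviation "F \<equiv> fixed_space m C LSm"

lemma of_C_corner: "A \<in> C \<Longrightarrow> of_mat A \<in> corner m" by (rule of_mat_corner)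
lemma LAm_to: "Z \<in> corner m \<Longrightarrow> LAm (to_mat m Z) = to_mat m (LA Z)" by (simp add: LAm_def of_to)
lemma LAm_C [simp]: "LAm A \<in> C" and LSm_C [simp]: "LSm A \<in> C" by (simp_all add: LAm_def LSm_def)
lemma of_LAm: "A \<in> C \<Longrightarrow> of_mat (LAm A) = LA (of_mat A)" by (simp add: LAm_def of_to LA_corner of_C_corner)
lemma of_LSm: "A \<in> C \<Longrightarrow> of_mat (LSm A) = LS (of_mat A)" by (simp add: LSm_def of_to LS_corner of_C_corner)

lemma emb_L: "X \<in> M \<Longrightarrow> lc (emb X) = emb (L X)"
  by (simp add: lc_def Eh_emb) (simp add: Eh_def red_LA_LA_emb)

lemma LM: "X \<in> M \<Longrightarrow> L X \<in> M" using L by (simp add: lin_on_def)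
lemma M_corner: "X \<in> M \<Longrightarrow> X \<in> corner n" using MD by blast

lemma lc_corner: "lc Z \<in> corner m" by (simp add: lc_def Eh_corner)
lemma lc_lin: "lin_on (corner m) lc"
  unfolding lin_on_def
proof (intro conjI ballI allI)
  fix X Y c assume X: "X \<in> corner m"
  show "lc X \<in> corner m" by (rule lc_corner)
  show "lc (c *\<^sub>C X) = c *\<^sub>C lc X"
    by (simp add: lc_def Eh_cscale lin_onD(3)[OF LA_lin] Eh_corner LA_corner)
  assume Y: "Y \<in> corner m"
  show "lc (X + Y) = lc X + lc Y"
    by (simp add: lc_def Eh_add lin_onD(2)[OF LA_lin] Eh_corner LA_corner)
qed

lemma kms_inner_eq: assumes "A \<in> C" "B \<in> C" shows "kms_inner m rho A B = kms (of_mat A) (of_mat B)"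
proof -
  have "msqrt m rho = to_mat m rh" unfolding rho_def rh_sq[symmetric] by (rule msqrt_eq[OF rh_corner rh_pos])
  then have "kms_inner m rho A B = mtrace (to_mat m rh * mat_adjoint A * to_mat m rh * B)" by (simp add: kms_inner_def)
  also have "\<dots> = tr (of_mat (to_mat m rh * mat_adjoint A * to_mat m rh * B))"
    by (rule mtrace_of_mat[of _ m]) (intro mult_carrier_mat[of _ m m] to_mat_carrier mat_adjoint_carrier assms)
  also have "of_mat (to_mat m rh * mat_adjoint A * to_mat m rh * B) = rh * (of_mat A)\<^sup>\<dagger> * rh * of_mat B"
    using assms by (simp add: of_mat_mult[where n = m] of_mat_adjoint[where n = m] of_to rh_corner mat_adjoint_carrier
        mult_carrier_mat[where n = m])
  finally show ?thesis by (simp add: kms_def)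
qed

lemma rho_state: "rho \<in> full_rank_states m C"
  unfolding full_rank_states_def
proof (intro CollectI conjI)
  have c: "sg \<in> corner m" unfolding sg_def by (rule diag_corner)
  show "rho \<in> C" by (simp add: rho_def)
  have "pos sg" unfolding rh_sq[symmetric] using pos_adj_self[of rh] by (simp add: rh_herm)
  then show "psd m rho" by (simp add: rho_def psd_iff_pos of_to c)
  have "mtrace rho = tr sg" by (simp add: rho_def mtrace_of_mat[of _ m] of_to c)
  also have "\<dots> = of_real (\<Sum>q<K. t q) * tr s" unfolding sg_def tr_diag[OF s_corner] by simp
  finally show "mtrace rho = 1" by (simp add: t_sum trs)
  obtain ri where ri: "ri \<in> corner m" "rh * ri = idm m" "ri * rh = idm m" using rh_inverse by blast
  have "sg * (ri * ri) = rh * (rh * ri) * ri" by (simp add: mult.assoc flip: rh_sq)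
  then have 1: "sg * (ri * ri) = idm m" by (simp add: ri(2) times_idm rh_corner)
  have "(ri * ri) * sg = ri * (ri * rh) * rh" by (simp add: mult.assoc flip: rh_sq)
  then have 2: "(ri * ri) * sg = idm m" by (simp add: ri times_idm)
  show "vec_space.rank m rho = m"
    by (subst full_rank_iff) (use 1 2 ri(1) c in \<open>auto simp: rho_def of_to intro!: bexI[of _ "ri * ri"] corner_times\<close>)
qed

lemma F_eq: "F = to_mat m ` (emb ` M)"
proof -
  have "F = to_mat m ` {Z \<in> corner m. LS Z = 0}" by (rule fixed_space_eq) (simp_all add: LSm_def LS_corner)
  moreover have "{Z \<in> corner m. LS Z = 0} = emb ` M" using emb_corner by (auto simp: LS_fixed)
  ultimately show ?thesis by simp
qed

lemma of_F: "of_mat ` F = emb ` M"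
  unfolding F_eq image_image using emb_corner by (auto simp: of_to image_iff)

lemma F_C: "F \<subseteq> C" by (auto simp: fixed_space_def)

lemma lift_generator_eq: "A \<in> C \<Longrightarrow> lift_generator LAm LSm \<gamma> A = to_mat m (LA (of_mat A) + of_real \<gamma> *\<^sub>C LS (of_mat A))"
  by (simp add: lift_generator_def LAm_def LSm_def to_mat_add to_mat_cscale)

lemma generator_lin: "lin_on (corner m) (\<lambda>Z. LA Z + of_real \<gamma> *\<^sub>C LS Z)"
  using LA_lin LS_lin by (auto simp: lin_on_def corner_intros algebra_simps)

lemma linear_on_mat: "lin_on (corner m) l \<Longrightarrow> (\<And>A. A \<in> C \<Longrightarrow> Lm A = to_mat m (l (of_mat A))) \<Longrightarrow> linear_on C Lm"
  unfolding linear_on_def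
  by (auto simp: of_mat_add[where n = m] of_mat_smult[where n = m] lin_on_def of_C_corner to_mat_add to_mat_cscale)

lemma lift_qms_generator: assumes g: "0 < \<gamma>" shows "qms_generator m C (lift_generator LAm LSm \<gamma>)"
proof -
  let ?l = "\<lambda>Z. LA Z + of_real \<gamma> *\<^sub>C LS Z" let ?Lm = "lift_generator LAm LSm \<gamma>"
  have lin: "linear_on C ?Lm" by (rule linear_on_mat[OF generator_lin lift_generator_eq])
  have se: "semigroup_exp m ?Lm u A = to_mat m (expo m ?l u (of_mat A))" if "A \<in> C" for u A
  proof (rule semigroup_exp_eq[OF order_refl _ that])
    show "?Lm A \<in> C" if "A \<in> C" for A by (simp add: lift_generator_eq that)
    show "?l (of_mat A) = of_mat (?Lm A)" if "A \<in> C" for A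
      by (simp add: lift_generator_eq that of_to corner_intros LA_corner LS_corner of_C_corner)
  qed
  have sub: "fmat.subspace (corner m)" "corner m \<subseteq> corner m" by (rule star_algD(11)[OF star_alg_corner] order_refl)+
  show ?thesis unfolding qms_generator_def
  proof (intro conjI allI impI lin)
    fix u :: real assume u: "0 \<le> u"
    show "completely_positive m C (semigroup_exp m ?Lm u)"
    proof (rule completely_positive_of_cp[where \<phi> = "expo m ?l u"])
      show "star_alg m (of_mat ` C)" unfolding of_mat_image_carrier by (rule star_alg_corner)
      show "cp (of_mat ` C) (expo m ?l u)" unfolding of_mat_image_carrier by (rule lift_cp[OF g u])
      show "expo m ?l u (sum f S) = (\<Sum>x\<in>S. expo m ?l u (f x))" if "\<And>x. x \<in> S \<Longrightarrow> f x \<in> of_mat ` C" for f and S :: "nat set"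
        using that unfolding of_mat_image_carrier by (rule expo_sum[OF sub generator_lin])
    qed (auto simp: se expo_corner)
    have "?l (idm m) = 0" by (simp add: LA_idm LS_idm)
    moreover have "?l 0 = 0" by (rule lin_zero[OF sub generator_lin])
    ultimately have "expo m ?l u (idm m) = idm m" by (intro expo_fixed) auto
    then show "semigroup_exp m ?Lm u (1\<^sub>m m) = 1\<^sub>m m" by (simp add: se of_mat_one to_mat_idm)
  qed
qed

text \<open>
  By \<open>lift_fixed\<close>, an element in the kernel of the lifted generator is in the kernels of both its parts.
  If \<open>LA\<close> vanished on the whole kernel \<open>emb ` M\<close> of \<open>LS\<close>, then \<open>L X = red (LA (LA (emb X)))\<close> would vanish
  for all \<open>X\<close>.
\<close>

lemma dimension_drop:
  assumes g: "0 < \<gamma>" shows "mat_dim m (fixed_space m C (lift_generator LAm LSm \<gamma>)) < mat_dim m F"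
proof -
  let ?l = "\<lambda>Z. LA Z + of_real \<gamma> *\<^sub>C LS Z"
  have 1: "fixed_space m C (lift_generator LAm LSm \<gamma>) = to_mat m ` {Z \<in> corner m. ?l Z = 0}"
    by (rule fixed_space_eq) (simp_all add: lift_generator_eq LA_corner LS_corner corner_intros)
  have 2: "F = to_mat m ` {Z \<in> corner m. LS Z = 0}" by (rule fixed_space_eq) (simp_all add: LSm_def LS_corner)
  obtain X where X: "X \<in> M" "L X \<noteq> 0" using nontrivial by blast
  have "LA (emb X) \<noteq> 0"
  proof
    assume "LA (emb X) = 0"
    then have "L X = red (LA 0)" using red_LA_LA_emb[OF X(1)] by simp
    then show False using X(2) by (simp add: LA_def red_0)
  qed
  then have "?l (emb X) \<noteq> 0" using lift_fixed(2)[OF g emb_corner] by blast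
  moreover have "LS (emb X) = 0" using X(1) LS_fixed by blast
  ultimately have "{Z \<in> corner m. ?l Z = 0} \<subset> {Z \<in> corner m. LS Z = 0}"
    using lift_fixed(1)[OF g] emb_corner[of X] by blast
  then show ?thesis unfolding 1 2
    by (intro mat_dim_strict_mono ker_subspace generator_lin LS_lin) auto
qed

lemma kms_adjoint_eqI:
  assumes P: "\<And>A. A \<in> C \<Longrightarrow> \<Phi> A \<in> C" and Y: "Y \<in> C" and W: "W \<in> corner m"
    and k: "\<And>A. A \<in> C \<Longrightarrow> kms (of_mat (\<Phi> A)) (of_mat Y) = kms (of_mat A) W"
  shows "kms_adjoint m C rho \<Phi> Y = to_mat m W"
  unfolding kms_adjoint_def
proof (rule the_equality)
  show "to_mat m W \<in> C \<and> (\<forall>X\<in>C. kms_inner m rho (\<Phi> X) Y = kms_inner m rho X (to_mat m W))"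
    using assms by (simp add: kms_inner_eq of_to)
  fix W' assume W': "W' \<in> C \<and> (\<forall>X\<in>C. kms_inner m rho (\<Phi> X) Y = kms_inner m rho X W')"
  have "of_mat W' - W = 0"
  proof (rule kms_nondeg)
    show "of_mat W' - W \<in> corner m" using W' W by (simp add: corner_diff of_C_corner)
    fix X assume X: "X \<in> corner m"
    have "kms X (of_mat W') = kms_inner m rho (to_mat m X) W'" using W' X by (simp add: kms_inner_eq of_to)
    also have "\<dots> = kms_inner m rho (\<Phi> (to_mat m X)) Y" using W' by simp
    also have "\<dots> = kms X W" using P Y X by (simp add: kms_inner_eq k of_to)
    finally show "kms X (of_mat W' - W) = 0" by (simp add: kms_simps)
  qed
  then show "W' = to_mat m W" using W' to_of[of W' m] by simp
qed

lemma cond_exp_eq: assumes A: "A \<in> C" shows "cond_exp m C rho LSm A = to_mat m (Eh (of_mat A))"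
  unfolding cond_exp_def kms_projection_def
proof (rule the_equality)
  let ?a = "of_mat A"
  have ac: "?a \<in> corner m" by (rule of_C_corner[OF A])
  have orth: "kms (emb X) (?a - Eh ?a) = 0" if "X \<in> M" for X
    using Eh_sym[of "emb X" "?a - Eh ?a"] that by (simp add: Eh_emb Eh_diff Eh_Eh kms_simps)
  have ki: "kms_inner m rho (to_mat m (emb X)) (A - to_mat m Z) = kms (emb X) (?a - Z)" if "Z \<in> corner m" for X Z
    using A that by (simp add: kms_inner_eq minus_carrier_mat of_mat_minus[where n = m] of_to emb_corner)
  show "to_mat m (Eh ?a) \<in> F \<and> (\<forall>Z\<in>F. kms_inner m rho Z (A - to_mat m (Eh ?a)) = 0)"
    unfolding F_eq using redM[of ?a] by (auto simp: ki orth Eh_corner) (simp add: Eh_def)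
  fix Y assume Y: "Y \<in> F \<and> (\<forall>Z\<in>F. kms_inner m rho Z (A - Y) = 0)"
  then obtain X where X: "X \<in> M" "Y = to_mat m (emb X)" unfolding F_eq by auto
  have o2: "kms (emb Z) (?a - emb X) = 0" if "Z \<in> M" for Z
    using Y that unfolding F_eq X(2) by (simp add: ki emb_corner)
  define D where "D = X - red ?a"
  have DM: "D \<in> M" unfolding D_def using X(1) redM by (rule MD(9))
  have e: "emb D = emb X - Eh ?a" using emb_add[of X "(-1) *\<^sub>C red ?a"] emb_cscale[of "-1" "red ?a"] by (simp add: D_def Eh_def)
  have "kms (emb D) (emb D) = kms (emb D) (?a - Eh ?a) - kms (emb D) (?a - emb X)"
    by (subst (2) e) (simp add: kms_simps)
  then have "emb D = 0" using kms_definite(2)[OF emb_corner] orth[OF DM] o2[OF DM] by simp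
  then show "Y = to_mat m (Eh ?a)" using e X(2) by simp
qed

text \<open>
  \<open>- LS\<close> is the orthogonal projection onto the kernel of \<open>Eh\<close>, and hence its own pseudoinverse.
\<close>

lemma pseudoinverse_eq:
  assumes x: "x \<in> corner m" "Eh x = 0"
  shows "kms_pseudoinverse m C rho (\<lambda>Z. - LSm Z) (to_mat m x) = to_mat m x"
proof -
  have T: "- LSm A = to_mat m (- LS (of_mat A))" for A by (simp add: LSm_def to_mat_uminus)
  have fs: "fixed_space m C (\<lambda>Z. - LSm Z) = to_mat m ` (emb ` M)"
  proof -
    have "fixed_space m C (\<lambda>Z. - LSm Z) = to_mat m ` {Z \<in> corner m. - LS Z = 0}"
      by (rule fixed_space_eq) (simp_all add: T LS_corner corner_uminus)
    moreover have "{Z \<in> corner m. - LS Z = 0} = emb ` M" using emb_corner by (auto simp: LS_fixed)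
    ultimately show ?thesis by simp
  qed
  have k1: "kms_inner m rho (to_mat m (emb X)) Y = kms (emb X) (of_mat Y)" if "Y \<in> C" for X Y
    using that by (simp add: kms_inner_eq of_to emb_corner)
  have k2: "kms_inner m rho (- LSm Z) (to_mat m x - (- LSm Y)) = kms (- LS (of_mat Z)) (x + LS (of_mat Y))" if "Z \<in> C" "Y \<in> C" for Z Y
    unfolding T using that x by (simp add: kms_inner_eq minus_carrier_mat of_mat_minus[where n = m] of_to corner_uminus LS_corner of_C_corner)
  show ?thesis unfolding kms_pseudoinverse_def fs
  proof (rule the_equality)
    have "kms (emb X) x = 0" if "X \<in> M" for X
      using Eh_sym[of "emb X" x] that x by (simp add: Eh_emb kms_simps)
    moreover have "x + LS x = 0" using x by (simp add: LS_def)
    ultimately show "to_mat m x \<in> C \<and> (\<forall>Z\<in>to_mat m ` emb ` M. kms_inner m rho Z (to_mat m x) = 0) \<and>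
        (\<forall>Z\<in>C. kms_inner m rho (- LSm Z) (to_mat m x - (- LSm (to_mat m x))) = 0)"
      using x by (auto simp: k1 k2 of_to kms_simps)
    fix Y assume Y: "Y \<in> C \<and> (\<forall>Z\<in>to_mat m ` emb ` M. kms_inner m rho Z Y = 0) \<and>
        (\<forall>Z\<in>C. kms_inner m rho (- LSm Z) (to_mat m x - (- LSm Y)) = 0)"
    define y where "y = of_mat Y"
    have yc: "y \<in> corner m" and Yy: "Y = to_mat m y" using Y of_C_corner to_of by (auto simp: y_def)
    have "kms (emb X) y = 0" if "X \<in> M" for X using Y that k1 by (auto simp: y_def)
    then have "kms (Eh y) y = 0" by (simp add: Eh_def redM)
    then have "kms (Eh y) (Eh y) = 0" using Eh_sym[of "Eh y" y] by (simp add: Eh_Eh)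
    then have Ey: "Eh y = 0" by (rule kms_definite(2)[OF Eh_corner])
    define d where "d = x - y"
    have dc: "d \<in> corner m" and Ed: "Eh d = 0" using x yc Ey by (simp_all add: d_def corner_diff Eh_diff)
    have "kms_inner m rho (- LSm (to_mat m d)) (to_mat m x - (- LSm Y)) = 0" using Y by simp
    then have "kms (- LS d) (x + LS y) = 0" using Y by (simp add: k2 of_to dc y_def)
    then have "kms d d = 0" using Ed Ey by (simp add: LS_def d_def)
    then have "d = 0" by (rule kms_definite(2)[OF dc])
    then show "Y = to_mat m x" using Yy by (simp add: d_def)
  qed
qed

text \<open>
  By antisymmetry of \<open>LA\<close>, the adjoint of \<open>LA \<circ> Eh\<close> is \<open>- Eh \<circ> LA\<close>; the pseudoinverse acts as the identity
  on \<open>LA (Eh Z)\<close>.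
\<close>

lemma Lc_eq: assumes A: "A \<in> C" shows "Lc A = to_mat m (lc (of_mat A))"
proof -
  let ?LE = "LAm \<circ> cond_exp m C rho LSm"
  have LE: "?LE B = to_mat m (LA (Eh (of_mat B)))" if "B \<in> C" for B
    using that by (simp add: cond_exp_eq LAm_to Eh_corner)
  let ?x = "LA (Eh (of_mat A))"
  have xc: "?x \<in> corner m" by (intro LA_corner Eh_corner)
  have "kms_adjoint m C rho ?LE (to_mat m ?x) = to_mat m (- Eh (LA ?x))"
  proof (rule kms_adjoint_eqI)
    show "?LE B \<in> C" if "B \<in> C" for B using LE[OF that] by simp
    show "- Eh (LA ?x) \<in> corner m" by (intro corner_uminus Eh_corner)
    fix B assume B: "B \<in> C"
    have "kms (LA (Eh (of_mat B))) ?x = kms (of_mat B) (- Eh (LA ?x))"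
      by (simp add: LA_antisym Eh_sym kms_simps)
    then show "kms (of_mat (?LE B)) (of_mat (to_mat m ?x)) = kms (of_mat B) (- Eh (LA ?x))"
      unfolding LE[OF B] by (simp add: of_to LA_corner Eh_corner)
  qed simp
  then have "Lc A = - to_mat m (- Eh (LA ?x))"
    unfolding L_col_def Let_def LE[OF A] pseudoinverse_eq[OF xc Eh_LA_Eh] by simp
  then show ?thesis by (simp add: to_mat_uminus lc_def uminus_uminus_mat)
qed

lemma Lc_emb: "X \<in> M \<Longrightarrow> Lc (to_mat m (emb X)) = to_mat m (emb (L X))"
  by (simp add: Lc_eq of_to emb_corner emb_L)

lemma emb_star_alg: "star_alg m (emb ` M)"
  unfolding star_alg_def
proof (intro conjI ballI allI)
  show "emb ` M \<subseteq> corner m" using emb_corner by auto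
  show "idm m \<in> emb ` M" using emb_idm MD(2) by (metis image_eqI)
  fix X assume "X \<in> emb ` M" then obtain X' where X: "X = emb X'" "X' \<in> M" by auto
  show "c *\<^sub>C X \<in> emb ` M" for c using X MD(4) by (auto simp flip: emb_cscale)
  show "X\<^sup>\<dagger> \<in> emb ` M" using X MD(6) by (auto simp flip: emb_adj)
  fix Y assume "Y \<in> emb ` M" then obtain Y' where Y: "Y = emb Y'" "Y' \<in> M" by auto
  show "X + Y \<in> emb ` M" using X Y MD(3) by (auto simp flip: emb_add)
  have "X * Y = emb (X' * Y')" using X Y M_corner by (simp add: emb_mult)
  then show "X * Y \<in> emb ` M" by (rule image_eqI) (rule MD(5)[OF X(2) Y(2)])
qed

lemma F_vna: "von_neumann_algebra m F"
  unfolding F_eq by (rule star_alg_vna[OF emb_star_alg])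

lemma expo_emb: assumes X: "X \<in> M" shows "expo m lc u (emb X) = emb (expo n L u X)"
proof (rule fmat_eq_trI)
  fix B
  have sub: "fmat.subspace (corner m)" "corner m \<subseteq> corner m" by (rule star_algD(11)[OF star_alg_corner] order_refl)+
  have e: "tr (B * emb Y) = (\<Sum>q<K. tr (((T q)\<^sup>\<dagger> * B * T q) * Y))" for Y
  proof -
    have "tr (B * (T q * Y * (T q)\<^sup>\<dagger>)) = tr (((T q)\<^sup>\<dagger> * B * T q) * Y)" for q by (metis mult.assoc tr_comm)
    then show ?thesis by (simp add: emb_def sum_distrib_left)
  qed
  have pw: "(lc ^^ k) (emb X) = emb ((L ^^ k) X)" for k
    by (induction k) (simp_all add: emb_L lin_pow[OF MD(11,1) L X])
  have "(\<lambda>k. tcoef u k * tr (B * (lc ^^ k) (emb X))) sums tr (B * expo m lc u (emb X))"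
    by (rule expo_sums[OF sub lc_lin emb_corner])
  moreover have "(\<lambda>k. \<Sum>q<K. tcoef u k * tr (((T q)\<^sup>\<dagger> * B * T q) * (L ^^ k) X)) sums (\<Sum>q<K. tr (((T q)\<^sup>\<dagger> * B * T q) * expo n L u X))"
    by (intro sums_sum expo_sums[OF MD(11,1) L X])
  then have "(\<lambda>k. tcoef u k * tr (B * (lc ^^ k) (emb X))) sums tr (B * emb (expo n L u X))"
    by (simp only: pw e sum_distrib_left)
  ultimately show "tr (B * expo m lc u (emb X)) = tr (B * emb (expo n L u X))" by (rule sums_unique2)
qed

lemma semigroup_F: "X \<in> M \<Longrightarrow> semigroup_exp m Lc u (to_mat m (emb X)) = to_mat m (emb (expo n L u X))"
proof -
  assume X: "X \<in> M"
  have "semigroup_exp m Lc u (to_mat m (emb X)) = to_mat m (expo m lc u (of_mat (to_mat m (emb X))))"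
    by (rule semigroup_exp_eq[OF order_refl]) (auto simp: Lc_eq of_to lc_corner)
  then show ?thesis using X by (simp add: of_to emb_corner expo_emb)
qed

lemma F_qms: "qms_generator m F Lc"
  unfolding qms_generator_def
proof (intro conjI allI impI)
  show "linear_on F Lc" unfolding linear_on_def F_eq
    using lin_onD[OF L] MD(3,4)
    by (auto simp: Lc_emb emb_add emb_cscale to_mat_add to_mat_cscale simp flip: to_mat_add to_mat_cscale emb_add emb_cscale)
  fix u :: real assume u: "0 \<le> u"
  show "semigroup_exp m Lc u (1\<^sub>m m) = 1\<^sub>m m"
    using semigroup_F[OF MD(2), of u] by (simp add: unital u emb_idm to_mat_idm)
  have cp0: "cp M (\<lambda>X. emb (expo n L u X))" unfolding emb_def by (intro cp_sum cp_conj cpL u)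
  have cp1: "cp (emb ` M) (expo m lc u)"
    unfolding cp_def
  proof (intro allI impI)
    fix k :: nat and V \<xi> :: "nat \<Rightarrow> fmat" assume "\<forall>i<k. V i \<in> emb ` M"
    then have "\<forall>i. \<exists>X. i < k \<longrightarrow> X \<in> M \<and> V i = emb X" by auto
    then obtain X where X: "\<And>i. i < k \<Longrightarrow> X i \<in> M" "\<And>i. i < k \<Longrightarrow> V i = emb (X i)" by metis
    have e: "expo m lc u ((V i)\<^sup>\<dagger> * V j) = emb (expo n L u ((X i)\<^sup>\<dagger> * X j))" if "i < k" "j < k" for i j
    proof -
      have "(V i)\<^sup>\<dagger> * V j = emb ((X i)\<^sup>\<dagger> * X j)" using that X M_corner by (simp add: emb_mult emb_adj adj_corner)
      then show ?thesis using that X by (simp add: expo_emb MD)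
    qed
    have "pos (\<Sum>i<k. \<Sum>j<k. (\<xi> i)\<^sup>\<dagger> * emb (expo n L u ((X i)\<^sup>\<dagger> * X j)) * \<xi> j)" by (rule cpD[OF cp0]) (rule X)
    then show "pos (\<Sum>i<k. \<Sum>j<k. (\<xi> i)\<^sup>\<dagger> * expo m lc u ((V i)\<^sup>\<dagger> * V j) * \<xi> j)" by (simp add: e)
  qed
  have sub: "fmat.subspace (corner m)" "corner m \<subseteq> corner m" by (rule star_algD(11)[OF star_alg_corner] order_refl)+
  show "completely_positive m F (semigroup_exp m Lc u)"
  proof (rule completely_positive_of_cp[where \<phi> = "expo m lc u"])
    show "star_alg m (of_mat ` F)" unfolding of_F by (rule emb_star_alg)
    show "F \<subseteq> C" by (rule F_C)
    show "cp (of_mat ` F) (expo m lc u)" unfolding of_F by (rule cp1)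
    show "expo m lc u (sum f S) = (\<Sum>x\<in>S. expo m lc u (f x))" if f: "\<And>x. x \<in> S \<Longrightarrow> f x \<in> of_mat ` F" for f and S :: "nat set"
    proof (rule expo_sum[OF sub lc_lin])
      fix x assume "x \<in> S"
      then have "f x \<in> emb ` M" using f of_F by blast
      then show "f x \<in> corner m" using emb_corner by auto
    qed
    show "semigroup_exp m Lc u A = to_mat m (expo m lc u (of_mat A))" if "A \<in> F" for A
      using that unfolding F_eq by (auto simp: semigroup_F of_to emb_corner expo_emb)
  qed (rule expo_corner)
qed

text \<open>
  The state \<open>rho\<close> weights the blocks differently, and need not belong to the fixed algebra \<open>F\<close>. Its
  restriction to \<open>F\<close>, as a functional, is given by the density matrix \<open>rho_o\<close> in \<open>F\<close>.
\<close>

definition "rho_o = to_mat m (emb ((1 / of_nat K) *\<^sub>C s))"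

lemma K_neq_0: "K \<noteq> 0" using K_simps(1) by linarith

lemma emb_c: "emb (c *\<^sub>C X) = diag (\<lambda>_. c) X" by (simp add: emb_def diag_def)

lemma tr_emb: "X \<in> corner n \<Longrightarrow> tr (emb ((1 / of_nat K) *\<^sub>C X)) = tr X"
  unfolding emb_c by (simp add: tr_diag K_neq_0)

lemma rho_o_state: "rho_o \<in> full_rank_states m F"
  unfolding full_rank_states_def
proof (intro CollectI conjI)
  let ?r = "emb ((1 / of_nat K) *\<^sub>C s)"
  show "rho_o \<in> F" unfolding F_eq rho_o_def using sM by (auto intro!: imageI MD)
  have "pos ?r" unfolding emb_c by (rule diag_pos[OF spos]) (simp add: less_eq_complex_def)
  then show "psd m rho_o" by (simp add: rho_o_def psd_iff_pos of_to emb_corner)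
  show "mtrace rho_o = 1" by (simp add: rho_o_def mtrace_of_mat[of _ m] of_to emb_corner tr_emb s_corner trs del: cscale_simps)
  have s'c: "s' \<in> corner n" using s'M MD by blast
  have "?r * emb (of_nat K *\<^sub>C s') = idm m" "emb (of_nat K *\<^sub>C s') * ?r = idm m"
    using s_corner s'c by (simp_all add: K_neq_0 ss' s's emb_idm corner_cscale flip: emb_mult)
  then show "vec_space.rank m rho_o = m"
    by (subst full_rank_iff) (auto simp: rho_o_def of_to emb_corner intro!: bexI[of _ "emb (of_nat K *\<^sub>C s')"])
qed

lemma kms_emb_emb: "X \<in> M \<Longrightarrow> Y \<in> M \<Longrightarrow> kms (emb X) (emb Y) = tr (rs * X\<^sup>\<dagger> * rs * Y)"
  by (simp add: kms_emb red_emb)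

text \<open>
  Both sides equal the KMS inner product of \<open>X\<close> and \<open>Y\<close> with respect to \<open>s\<close>: the block weights of either
  state add up to 1.
\<close>

lemma kms_inner_o:
  assumes X: "X \<in> M" and Y: "Y \<in> M"
  shows "kms_inner m rho_o (to_mat m (emb X)) (to_mat m (emb Y)) = kms (emb X) (emb Y)"
proof -
  define c where "c = complex_of_real (sqrt (1 / real K))"
  have "complex_of_real (sqrt (1 / real K)) * complex_of_real (sqrt (1 / real K)) = of_real (1 / real K)"
    unfolding of_real_mult[symmetric] by (subst real_sqrt_mult_self) simp
  then have cc: "c * c = 1 / of_nat K" by (simp add: c_def)
  let ?R = "diag (\<lambda>_. c) rs"
  have Rp: "pos ?R" by (rule diag_pos[OF rs(2)]) (simp add: c_def less_eq_complex_def)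
  have RR: "?R * ?R = emb ((1 / of_nat K) *\<^sub>C s)" by (simp add: diag_mult rs_corner rs(3) cc emb_c del: cscale_simps)
  have sq: "msqrt m rho_o = to_mat m ?R" unfolding rho_o_def RR[symmetric] by (rule msqrt_eq[OF diag_corner Rp])
  have Xc: "X\<^sup>\<dagger> \<in> corner n" using MD(12)[OF MD(6)[OF X]] .
  have "kms_inner m rho_o (to_mat m (emb X)) (to_mat m (emb Y)) =
      mtrace (to_mat m ?R * mat_adjoint (to_mat m (emb X)) * to_mat m ?R * to_mat m (emb Y))" by (simp add: kms_inner_def sq)
  also have "\<dots> = mtrace (to_mat m (?R * (emb X)\<^sup>\<dagger> * ?R * emb Y))"
    by (simp add: to_mat_mult to_mat_adj diag_corner emb_corner corner_times adj_corner)
  also have "\<dots> = tr (?R * (emb X)\<^sup>\<dagger> * ?R * emb Y)"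
    by (simp add: mtrace_of_mat[of _ m] of_to diag_corner emb_corner corner_times adj_corner)
  also have "?R * (emb X)\<^sup>\<dagger> * ?R * emb Y = emb ((1 / of_nat K) *\<^sub>C (rs * X\<^sup>\<dagger> * rs * Y))"
    unfolding emb_c using Xc rs_corner M_corner[OF Y] by (simp add: emb_diag diag_adj diag_mult corner_times cc)
  also have "tr \<dots> = tr (rs * X\<^sup>\<dagger> * rs * Y)" by (rule tr_emb) (intro corner_times rs_corner Xc M_corner[OF Y])
  finally show ?thesis by (simp add: kms_emb_emb X Y)
qed

lemma lc_sym: "kms (lc X) Y = kms X (lc Y)"
  by (simp add: lc_def Eh_sym LA_antisym kms_simps)

lemma tr_s_L: assumes X: "X \<in> M" shows "tr (s * L X) = 0"
proof -
  have "tr (s * L X) = kms (emb (idm n)) (lc (emb X))"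
    using X kms_emb_emb[OF MD(2) LM[OF X]] by (simp add: emb_L times_idm rs_corner rs(3))
  also have "\<dots> = kms (lc (idm m)) (emb X)" by (simp add: lc_sym emb_idm)
  also have "lc (idm m) = 0" using Eh_emb[OF MD(2)] by (simp add: lc_def emb_idm LA_idm) (simp add: LA_def Eh_def red_0 emb_0)
  finally show ?thesis by (simp add: kms_simps)
qed

lemma tr_s_expo: assumes X: "X \<in> M" shows "tr (s * expo n L u X) = tr (s * X)"
proof -
  have "tr (s * (L ^^ k) X) = (if k = 0 then tr (s * X) else 0)" for k
    using tr_s_L lin_pow[OF MD(11,1) L X] by (cases k) auto
  then have "(\<lambda>k. tcoef u k * tr (s * (L ^^ k) X)) = (\<lambda>k. if k = 0 then tr (s * X) else 0)" by (auto simp: tcoef_def)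
  then show ?thesis
    using sums_unique2[OF expo_sums[OF MD(11,1) L X, of u s]] sums_single[of 0 "\<lambda>_. tr (s * X)"] by simp
qed

theorem lift: "second_order_lift_wrt m C rho LAm LSm"
  unfolding second_order_lift_wrt_def Let_def
proof (intro conjI allI impI ballI bexI[of _ rho_o] rho_state lift_qms_generator dimension_drop F_vna F_qms rho_o_state)
  have "to_mat m ` corner m = C"
  proof (intro equalityI subsetI)
    fix A assume "A \<in> C" then show "A \<in> to_mat m ` corner m" using to_of of_C_corner by (metis image_eqI)
  qed auto
  then show "von_neumann_algebra m C" using star_alg_vna[OF star_alg_corner, of m] by simp
  show "linear_on C LAm" by (rule linear_on_mat[OF LA_lin]) (simp add: LAm_def)
  show "linear_on C LSm" by (rule linear_on_mat[OF LS_lin]) (simp add: LSm_def)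
  show "LSm X = kms_adjoint m C rho LSm X" if "X \<in> C" for X
    unfolding LSm_def[of X]
    by (rule kms_adjoint_eqI[symmetric]) (simp_all add: that of_C_corner LS_corner of_LSm LS_sym)
  show "LAm X = - kms_adjoint m C rho LAm X" if "X \<in> C" for X
  proof -
    have "kms_adjoint m C rho LAm X = to_mat m (- LA (of_mat X))"
      by (rule kms_adjoint_eqI) (simp_all add: that of_C_corner LA_corner corner_uminus of_LAm LA_antisym kms_simps)
    then show ?thesis by (simp add: to_mat_uminus uminus_uminus_mat LAm_def)
  qed
  show "cond_exp m C rho LSm (LAm (cond_exp m C rho LSm X)) = 0\<^sub>m m m" if "X \<in> C" for X
    using that by (simp add: cond_exp_eq LAm_to Eh_corner of_to LA_corner Eh_LA_Eh to_mat_0)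
  show "mtrace (rho_o * semigroup_exp m Lc u X) = mtrace (rho_o * X)" if u: "0 \<le> u" and X: "X \<in> F" for u X
  proof -
    obtain Y where Y: "Y \<in> M" "X = to_mat m (emb Y)" using X unfolding F_eq by auto
    have e: "mtrace (rho_o * to_mat m (emb Z)) = tr (s * Z)" if "Z \<in> corner n" for Z
    proof -
      have "mtrace (rho_o * to_mat m (emb Z)) = tr (emb ((1 / of_nat K) *\<^sub>C s) * emb Z)"
        unfolding rho_o_def by (simp add: mtrace_of_mat[of _ m] of_to emb_corner corner_times del: cscale_simps flip: to_mat_mult)
      also have "\<dots> = tr (emb ((1 / of_nat K) *\<^sub>C (s * Z)))" using s_corner by (simp add: corner_cscale flip: emb_mult)
      finally show ?thesis by (simp only: tr_emb corner_times s_corner that)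
    qed
    show ?thesis unfolding Y(2) semigroup_F[OF Y(1)] by (simp add: e expo_corner M_corner Y(1) tr_s_expo)
  qed
  show "kms_detailed_balanced m F rho_o Lc"
  proof -
    have "kms (emb (L X)) (emb Y) = kms (emb X) (emb (L Y))" if "X \<in> M" "Y \<in> M" for X Y
      using lc_sym[of "emb X" "emb Y"] that by (simp add: emb_L)
    then show ?thesis unfolding kms_detailed_balanced_def F_eq by (auto simp: Lc_emb kms_inner_o LM)
  qed
  show "kms_inner m rho X (Lc Y) = kms_inner m rho_o X (Lc Y)" if "X \<in> F" "Y \<in> F" for X Y
    using that unfolding F_eq by (auto simp: Lc_emb kms_inner_o LM kms_inner_eq of_to emb_corner)
qed auto

text \<open>
  The isomorphism of the fixed algebra onto \<open>M\<close> reads off block 0.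
\<close>

theorem lift_of:
  assumes LO: "\<And>X. X \<in> M \<Longrightarrow> LO (to_mat n X) = to_mat n (L X)"
  shows "second_order_lift_of m C LAm LSm n (to_mat n ` M) LO"
proof -
  define io where "io A = to_mat n ((T 0)\<^sup>\<dagger> * of_mat A * T 0)" for A
  have io: "io (to_mat m (emb X)) = to_mat n X" if "X \<in> M" for X
  proof -
    have "(T 0)\<^sup>\<dagger> * emb X * T 0 = X"
      using M_corner[OF that] by (simp add: emb_diag T_diag mult.assoc blk_adj_blk times_idm)
    then show ?thesis by (simp add: io_def of_to emb_corner)
  qed
  have "star_isomorphism m F n (to_mat n ` M) io"
    unfolding star_isomorphism_def
  proof (intro conjI ballI allI)
    show "bij_betw io F (to_mat n ` M)"
    proof (rule bij_betwI')
      fix A B assume "A \<in> F" "B \<in> F"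
      then obtain X Y where "X \<in> M" "A = to_mat m (emb X)" "Y \<in> M" "B = to_mat m (emb Y)" unfolding F_eq by auto
      then show "io A = io B \<longleftrightarrow> A = B" using io M_corner by (metis of_to)
    next
      fix A assume "A \<in> F" then show "io A \<in> to_mat n ` M" unfolding F_eq by (auto simp: io)
    next
      fix B assume "B \<in> to_mat n ` M"
      then show "\<exists>A\<in>F. B = io A" unfolding F_eq by (auto simp: io)
    qed
    show "io (1\<^sub>m m) = 1\<^sub>m n" using io[OF MD(2)] by (simp add: emb_idm to_mat_idm)
    fix A assume "A \<in> F"
    then obtain X where X: "X \<in> M" "A = to_mat m (emb X)" unfolding F_eq by auto
    show "io (c \<cdot>\<^sub>m A) = c \<cdot>\<^sub>m io A" for c
      using io[OF MD(4)[OF X(1), of c]] io[OF X(1)] by (simp add: X(2) emb_cscale to_mat_cscale)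
    show "io (mat_adjoint A) = mat_adjoint (io A)"
      using io[OF MD(6)[OF X(1)]] io[OF X(1)] M_corner[OF X(1)] by (simp add: X(2) emb_adj to_mat_adj emb_corner)
    fix B assume "B \<in> F"
    then obtain Y where Y: "Y \<in> M" "B = to_mat m (emb Y)" unfolding F_eq by auto
    show "io (A + B) = io A + io B"
      using io[OF MD(3)[OF X(1) Y(1)]] io[OF X(1)] io[OF Y(1)] by (simp add: X(2) Y(2) emb_add to_mat_add)
    show "io (A * B) = io A * io B"
      using io[OF MD(5)[OF X(1) Y(1)]] io[OF X(1)] io[OF Y(1)] M_corner[OF X(1)] M_corner[OF Y(1)]
      by (simp add: X(2) Y(2) emb_mult to_mat_mult emb_corner)
  qed
  moreover have "\<forall>A\<in>F. io (Lc A) = LO (io A)" unfolding F_eq by (auto simp: Lc_emb io LM LO)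
  ultimately show ?thesis unfolding second_order_lift_of_def using lift by blast
qed

end

theorem proposition4p8:
  fixes n :: nat and M :: "complex mat set" and \<sigma> :: "complex mat"
    and LO :: "complex mat \<Rightarrow> complex mat"
  assumes "von_neumann_algebra n M"
    and "\<sigma> \<in> full_rank_states n M"
    and "qms_generator n M LO"
    and "gns_detailed_balanced M \<sigma> LO"
    and nontrivial: "\<exists>X\<in>M. LO X \<noteq> 0\<^sub>m n n"
  shows "\<exists>m Mh LA LS. second_order_lift_of m Mh LA LS n M LO"
proof -
  have MC: "M \<subseteq> carrier_mat n n" using assms(1) by (simp add: von_neumann_algebra_def)
  then have c: "A \<in> carrier_mat n n" if "A \<in> M" for A using that by blast
  define N where "N = of_mat ` M"
  have N: "star_alg n N" unfolding N_def by (rule vna_star_alg[OF assms(1)])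
  have toN: "to_mat n ` N = M"
    unfolding N_def image_image using to_of c by force
  have oN: "of_mat (to_mat n X) = X" if "X \<in> N" for X using that star_algD(12)[OF N] of_to by blast
  have tM: "to_mat n X \<in> M" if "X \<in> N" for X using that toN by blast
  define s where "s = of_mat \<sigma>"
  have sig: "\<sigma> \<in> M" "psd n \<sigma>" "mtrace \<sigma> = 1" "vec_space.rank n \<sigma> = n"
    using assms(2) by (auto simp: full_rank_states_def)
  have sN: "s \<in> N" using sig(1) by (simp add: s_def N_def)
  have spos: "pos s" using sig(2) by (simp add: psd_iff_pos s_def)
  have trs: "tr s = 1" using sig(3) mtrace_of_mat[OF c[OF sig(1)]] by (simp add: s_def)
  obtain b where b: "b * s = idm n" using full_rank_iff[OF c[OF sig(1)]] sig(4) unfolding s_def by blast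
  have inj: "X = 0" if X: "X \<in> N" "s * X = 0" for X
  proof -
    have "b * (s * X) = idm n * X" by (simp add: b flip: mult.assoc)
    then show ?thesis using X star_algD(12)[OF N X(1)] by (simp add: idm_times)
  qed
  obtain s' where s': "s' \<in> N" "s' * s = idm n" "s * s' = idm n"
    using inverse_in_star_alg[OF N sN pos_herm[OF spos] inj] by metis
  define l where "l X = of_mat (LO (to_mat n X))" for X
  have LOM: "LO A \<in> M" if "A \<in> M" for A using assms(3) that by (simp add: qms_generator_def linear_on_def)
  have l_of: "l (of_mat A) = of_mat (LO A)" if "A \<in> M" for A using that by (simp add: l_def to_of c)
  have lin: "lin_on N l"
    unfolding lin_on_def
  proof (intro conjI ballI allI)
    fix X d assume X: "X \<in> N"
    show "l X \<in> N" unfolding l_def N_def using LOM tM[OF X] by blast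
    show "l (d *\<^sub>C X) = d *\<^sub>C l X"
      using assms(3) tM[OF X] LOM[OF tM[OF X]] c by (simp add: l_def to_mat_cscale qms_generator_def linear_on_def of_mat_smult[where n = n])
    fix Y assume Y: "Y \<in> N"
    show "l (X + Y) = l X + l Y"
      using assms(3) tM[OF X] tM[OF Y] LOM[OF tM[OF X]] LOM[OF tM[OF Y]] c
      by (simp add: l_def to_mat_add qms_generator_def linear_on_def of_mat_add[where n = n])
  qed
  have se: "semigroup_exp n LO u A = to_mat n (expo n l u (of_mat A))" if "A \<in> M" for u A
    by (rule semigroup_exp_eq[OF MC]) (use LOM that l_of in auto)
  have cpl: "cp N (expo n l u)" if "0 \<le> u" for u
    unfolding N_def
    by (rule cp_of_completely_positive[OF N[unfolded N_def] MC, where \<Phi> = "semigroup_exp n LO u"])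
      (use assms(3) that se expo_corner in \<open>auto simp: qms_generator_def\<close>)
  have idM: "1\<^sub>m n \<in> M" using assms(1) by (simp add: von_neumann_algebra_def)
  have unital: "expo n l u (idm n) = idm n" if "0 \<le> u" for u
  proof -
    have "to_mat n (expo n l u (idm n)) = to_mat n (idm n)"
      using se[OF idM, of u] assms(3) that by (simp add: qms_generator_def of_mat_one to_mat_idm)
    then show ?thesis by (metis expo_corner idm_corner of_to)
  qed
  have gns: "tr (s * (l X)\<^sup>\<dagger> * Y) = tr (s * X\<^sup>\<dagger> * l Y)" if X: "X \<in> N" and Y: "Y \<in> N" for X Y
  proof -
    have e: "gns_inner \<sigma> A B = tr (s * (of_mat A)\<^sup>\<dagger> * of_mat B)" if "A \<in> M" "B \<in> M" for A B
    proof -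
      have AB: "A \<in> carrier_mat n n" "B \<in> carrier_mat n n" "\<sigma> \<in> carrier_mat n n" using that sig(1) c by auto
      have "gns_inner \<sigma> A B = tr (of_mat (\<sigma> * mat_adjoint A * B))" unfolding gns_inner_def
        by (rule mtrace_of_mat[of _ n]) (intro mult_carrier_mat[of _ n n] mat_adjoint_carrier AB)
      then show ?thesis using AB
        by (simp add: of_mat_mult[where n = n] of_mat_adjoint[where n = n] mat_adjoint_carrier mult_carrier_mat[where n = n] s_def)
    qed
    have "gns_inner \<sigma> (LO (to_mat n X)) (to_mat n Y) = gns_inner \<sigma> (to_mat n X) (LO (to_mat n Y))"
      using assms(4) tM X Y by (simp add: gns_detailed_balanced_def)
    then show ?thesis using X Y tM LOM by (simp add: e oN l_def)
  qed
  interpret G: gns_qms n N s s' l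
    by unfold_locales (use N sN spos s' lin cpl unital gns in auto)
  obtain k :: nat and V r where Vr: "\<forall>q<k. 0 < r q \<and> V q \<in> corner n \<and> s * V q = complex_of_real (r q) *\<^sub>C (V q * s)"
    "\<forall>X\<in>N. 2 *\<^sub>C l X = hs_proj N (\<Sum>q<k. (V q)\<^sup>\<dagger> * X * V q + of_real (1 / r q) *\<^sub>C (V q * X * (V q)\<^sup>\<dagger>))
       - (1/2) *\<^sub>C (hs_proj N (\<Sum>q<k. (V q)\<^sup>\<dagger> * V q + of_real (1 / r q) *\<^sub>C (V q * (V q)\<^sup>\<dagger>)) * X
          + X * hs_proj N (\<Sum>q<k. (V q)\<^sup>\<dagger> * V q + of_real (1 / r q) *\<^sub>C (V q * (V q)\<^sup>\<dagger>)))"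
    using G.symmetric_form by blast
  have nt: "\<exists>X\<in>N. l X \<noteq> 0"
  proof -
    obtain A where A: "A \<in> M" "LO A \<noteq> 0\<^sub>m n n" using nontrivial by blast
    have "of_mat (LO A) \<noteq> 0" using A LOM c of_mat_inj[of "LO A" n "0\<^sub>m n n"] by (auto simp: of_mat_zero)
    then show ?thesis using A(1) l_of[OF A(1)] unfolding N_def by (metis imageI)
  qed
  interpret Q: lift_qms n k N s s' V r l
    by unfold_locales (use N sN spos trs s' Vr lin cpl unital nt in \<open>blast+\<close>)
  have "LO (to_mat n X) = to_mat n (l X)" if "X \<in> N" for X
    using to_of[OF c[OF LOM[OF tM[OF that]]]] by (simp add: l_def)
  from Q.lift_of[OF this] show ?thesis unfolding toN by blast
qed

end
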